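(* Let $M$ be a closed topological manifold with non-vanishing Euler characteristic (for example $M=\mathbb S^2$), and let $\mathcal F$ be a dimension-one foliation on $M\times\mathbb L_+$. Then there is $\alpha\in\mathbb L_+$ such that the restriction of $\mathcal F$ to $M\times(\alpha,\omega_1)$ is the trivial product foliation by long rays, i.e. its leaves are the sets $\{x\}\times(\alpha,\omega_1)$, $x\in M$.
   Context: The closed long ray $\mathbb L_{\ge 0}$ is $\omega_1\times[0,1)$ with the order topology of the lexicographic order; the long ray is $\mathbb L_+=\mathbb L_{\ge0}\setminus\{0\}$. For $\alpha\in\mathbb L_+$, $(\alpha,\omega_1)=\{x\in\mathbb L_+:x>\alpha\}$. Manifold: a non-empty, connected, Hausdorff space in which every point has a neighbourhood homeomorphic to $\mathbb R^n$, for a fixed $n$; closed means compact (without boundary). Foliation: a foliation $\mathcal F$ of dimension $p$ on an $n$-manifold (not necessarily metrisable) is a maximal atlas $\{(U_i,\varphi_i)\}_{i\in I}$ such that all coordinate changes have the form $\varphi_j\varphi_i^{-1}(x,y)=(g_{i,j}(x,y),h_{i,j}(y))$ for $(x,y)\in\varphi_i(U_i\cap U_j)\subset\mathbb R^p\times\mathbb R^{n-p}$, where $h_{i,j}$ is an embedding of a relevant open subset of $\mathbb R^{n-p}$ into $\mathbb R^{n-p}$ (only continuity is required). Components of the sets $\varphi_i^{-1}(\mathbb R^p\times\{y\})$ are called plaques; they form a basis of the leaf topology, whose path components are the leaves. *)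

theory Defs
  imports "HOL-Analysis.Analysis" "HOL-Homology.Homology" "HOL-Library.Countable_Set_Type"
begin

section \<open>The long ray\<close>

text \<open>
  The successor cardinal of \<open>natLeq\<close> is a well-order of type \<open>\<omega>\<^sub>1\<close> on a subset of
  \<open>nat set\<close>; see the two lemmas below.
\<close>

definition omega1 :: "nat set rel" where
  "omega1 = cardSuc natLeq"

lemma Well_order_omega1: "Well_order omega1"
  unfolding omega1_def
  by (simp add: cardSuc_Card_order card_order_on_Card_order natLeq_Card_order)

lemma uncountable_Field_omega1: "uncountable (Field omega1)"
proof
  assume "countable (Field omega1)"
  then have "|Field omega1| \<le>o natLeq"
    by (simp add: countable_card_le_natLeq)
  moreover have "natLeq <o |Field omega1|"
    unfolding omega1_def
    by (metis cardSuc_Card_order cardSuc_greater card_of_Field_ordIso natLeq_Card_order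
        ordIso_symmetric ordLess_ordIso_trans)
  ultimately show False
    using not_ordLess_ordLeq by blast
qed

lemma countable_underS_omega1:
  assumes "a \<in> Field omega1"
  shows "countable (underS omega1 a)"
proof -
  have "|underS omega1 a| <o omega1"
    using assms unfolding omega1_def
    by (rule card_of_underS[OF cardSuc_Card_order[OF natLeq_Card_order]])
  then have "|underS omega1 a| \<le>o natLeq"
    unfolding omega1_def
    using cardSuc_ordLeq_ordLess[OF natLeq_Card_order card_of_Card_order] by blast
  then show ?thesis
    by (simp add: countable_card_le_natLeq)
qed

definition closed_long_ray :: "(nat set \<times> real) set" where
  "closed_long_ray = Field omega1 \<times> {0..<1}"

definition long_less :: "(nat set \<times> real) rel" where
  "long_less = (omega1 - Id) <*lex*> {(s, t). s < t}"

definition long_zero :: "nat set \<times> real" where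
  "long_zero = (wo_rel.minim omega1 (Field omega1), 0)"

definition order_topology_on :: "'a set \<Rightarrow> 'a rel \<Rightarrow> 'a topology" where
  "order_topology_on S r = topology_generated_by
     ({S} \<union> {{x \<in> S. (a, x) \<in> r} | a. a \<in> S} \<union> {{x \<in> S. (x, a) \<in> r} | a. a \<in> S})"

definition long_ray :: "(nat set \<times> real) topology" where
  "long_ray = subtopology (order_topology_on closed_long_ray long_less)
                          (closed_long_ray - {long_zero})"

definition long_tail :: "nat set \<times> real \<Rightarrow> (nat set \<times> real) set" where
  "long_tail \<alpha> = {x \<in> topspace long_ray. (\<alpha>, x) \<in> long_less}"

section \<open>Manifolds\<close>

text \<open>No second countability or paracompactness is required.\<close>

definition manifold :: "nat \<Rightarrow> 'a topology \<Rightarrow> bool" where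
  "manifold n X \<longleftrightarrow>
     topspace X \<noteq> {} \<and> connected_space X \<and> Hausdorff_space X \<and>
     (\<forall>x \<in> topspace X. \<exists>U. openin X U \<and> x \<in> U \<and>
        subtopology X U homeomorphic_space Euclidean_space n)"

definition closed_manifold :: "nat \<Rightarrow> 'a topology \<Rightarrow> bool" where
  "closed_manifold n X \<longleftrightarrow> manifold n X \<and> compact_space X"

section \<open>Euler characteristic\<close>

definition int_independent :: "('g, 'b) monoid_scheme \<Rightarrow> 'g set \<Rightarrow> bool" where
  "int_independent G B \<longleftrightarrow>
     (\<forall>c :: 'g \<Rightarrow> int. finprod G (\<lambda>b. b [^]\<^bsub>G\<^esub> c b) B = \<one>\<^bsub>G\<^esub> \<longrightarrow> (\<forall>b \<in> B. c b = 0))"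

text \<open>
  The rank of a (multiplicatively written) abelian group: the maximal number of elements
  that are linearly independent over the integers.  The supremum is over a bounded set
  whenever the group is finitely generated.
\<close>

definition abelian_rank :: "('g, 'b) monoid_scheme \<Rightarrow> nat" where
  "abelian_rank G = Sup {card B | B. finite B \<and> B \<subseteq> carrier G \<and> int_independent G B}"

definition betti_number :: "nat \<Rightarrow> 'a topology \<Rightarrow> nat" where
  "betti_number k X = abelian_rank (homology_group (int k) X)"

text \<open>
  Meaningful when the total singular homology is finitely generated, as it is for closed
  manifolds; then only finitely many Betti numbers are non-zero.
\<close>

definition euler_characteristic :: "'a topology \<Rightarrow> int" where
  "euler_characteristic X =
     (\<Sum>k | betti_number k X \<noteq> 0. (- 1) ^ k * int (betti_number k X))"

section \<open>Foliations\<close>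

text \<open>
  A chart is a pair \<open>(U, \<phi>)\<close>; only the values of \<open>\<phi>\<close> on \<open>U\<close> are relevant.  A chart domain
  need not be mapped onto the whole model space, so a slice of constant second coordinate
  may be disconnected.
\<close>

type_synonym 'a fchart = "'a set \<times> ('a \<Rightarrow> (nat \<Rightarrow> real) \<times> (nat \<Rightarrow> real))"

definition model_space :: "nat \<Rightarrow> nat \<Rightarrow> ((nat \<Rightarrow> real) \<times> (nat \<Rightarrow> real)) topology" where
  "model_space p n = prod_topology (Euclidean_space p) (Euclidean_space (n - p))"

definition is_chart :: "nat \<Rightarrow> nat \<Rightarrow> 'a topology \<Rightarrow> 'a fchart \<Rightarrow> bool" where
  "is_chart p n X = (\<lambda>(U, \<phi>).
     openin X U \<and> openin (model_space p n) (\<phi> ` U) \<and>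
     embedding_map (subtopology X U) (model_space p n) \<phi>)"

definition foliated_change :: "nat \<Rightarrow> nat \<Rightarrow> 'a fchart \<Rightarrow> 'a fchart \<Rightarrow> bool" where
  "foliated_change p n = (\<lambda>(U, \<phi>) (V, \<psi>).
     \<exists>g h. embedding_map (subtopology (Euclidean_space (n - p)) (snd ` \<phi> ` (U \<inter> V)))
                         (Euclidean_space (n - p)) h \<and>
           (\<forall>(x, y) \<in> \<phi> ` (U \<inter> V). \<psi> (inv_into U \<phi> (x, y)) = (g x y, h y)))"

definition foliated_atlas :: "nat \<Rightarrow> nat \<Rightarrow> 'a topology \<Rightarrow> 'a fchart set \<Rightarrow> bool" where
  "foliated_atlas p n X A \<longleftrightarrow>
     (\<forall>c \<in> A. is_chart p n X c) \<and>
     (\<Union>c \<in> A. fst c) = topspace X \<and>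
     (\<forall>c \<in> A. \<forall>d \<in> A. foliated_change p n c d)"

text \<open>
  \<open>foliation p n X A\<close>: \<open>A\<close> is a foliation of dimension \<open>p\<close> on the \<open>n\<close>-manifold \<open>X\<close>.
\<close>

definition foliation :: "nat \<Rightarrow> nat \<Rightarrow> 'a topology \<Rightarrow> 'a fchart set \<Rightarrow> bool" where
  "foliation p n X A \<longleftrightarrow> p \<le> n \<and> foliated_atlas p n X A \<and>
     (\<forall>B. foliated_atlas p n X B \<and> A \<subseteq> B \<longrightarrow> B = A)"

definition plaques :: "'a topology \<Rightarrow> 'a fchart set \<Rightarrow> 'a set set" where
  "plaques X A = (\<Union>(U, \<phi>) \<in> A. \<Union>y.
     connected_components_of (subtopology X {u \<in> U. snd (\<phi> u) = y}))"

definition leaf_topology :: "'a topology \<Rightarrow> 'a fchart set \<Rightarrow> 'a topology" where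
  "leaf_topology X A = topology_generated_by (plaques X A)"

definition leaves :: "'a topology \<Rightarrow> 'a fchart set \<Rightarrow> 'a set set" where
  "leaves X A = path_components_of (leaf_topology X A)"

text \<open>
  For an open set \<open>W\<close>; by maximality a foliation contains the restrictions of its charts to
  open subsets, so these charts do cover \<open>W\<close>.
\<close>

definition restrict_foliation :: "'a fchart set \<Rightarrow> 'a set \<Rightarrow> 'a fchart set" where
  "restrict_foliation A W = {(U, \<phi>) \<in> A. U \<subseteq> W}"

end

theory Submission
  imports Defs
begin

text \<open>
  Suppose first that no plaque leaves the level \<open>M \<times> {\<lambda>}\<close>. Then \<open>M\<close> itself is foliated by curves. Pushing
  points a small distance along plaques, in both directions because the foliation need not be
  orientable, is a two-valued map without fixed points close to the identity. On small simplices its two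
  branches induce a chain map that is homotopic to twice the identity and has trace zero, computed on
  flags of a nerve of \<open>M\<close>; by the Hopf trace formula the Euler characteristic vanishes.

  Hence plaques cross every level. A closing-off argument over a countable base of \<open>M\<close> yields a point from
  which single plaques reach every height. Two arcs in plaques that start at the same point in the same
  direction are nested, so these arcs exhaust a half-leaf. Its \<open>M\<close>-component is eventually constant, since
  otherwise it would oscillate infinitely often along one compact arc. So some \<open>{x} \<times> (\<delta>, \<omega>\<^sub>1)\<close> lies in a leaf.

  The set of such \<open>x\<close>, with \<open>\<delta>\<close> chosen uniformly by separability, is closed by continuity. It is open: by
  the same closing-off argument, plaques of nearby points stay above \<open>\<delta>\<close> and end on a vertical ray, which
  is open and closed in its leaf. As \<open>M\<close> is connected, every ray above \<open>\<delta>\<close> is vertical.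
\<close>

section \<open>Traces on free abelian groups\<close>

text \<open>A topological manifold need not carry a triangulation, so no simplicial fixed point
  theorem applies directly. Instead \<open>M\<close> is embedded in some
  \<open>coord_space d\<close> and covered by small closed cells of a grid; the flags of the nerve
  form a finite complex through which small singular cycles factor up to homology. Grid cells have
  multiplicity at most \<open>2 ^ d\<close> whatever their size, and this breaks a circle: the
  number of filling steps, hence every radius of the acyclic towers, must be known before the cover
  is chosen. There are two towers, because the displacement has to be small for the outer one, while
  the cover has to be fine compared with the least displacement.

  The two branches must be defined without reference to a chart or a direction. The distance to move
  is therefore measured by oscillations of finitely many functions along the arc as a point set, on
  which any two boxes agree.

  On the long ray the substitute for compactness is that countable sets are bounded: countably many
  failures can be collected below one height and, where arcs are nested, inside one arc of a single
  plaque.\<close>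

lemma frag_cmul_diff: "frag_cmul q (x - y) = frag_cmul q x - frag_cmul q y"
 by (rule poly_mapping_eqI) (simp add: lookup_minus right_diff_distrib)

lemma lookup_frag_extend:
 assumes "finite I" "Poly_Mapping.keys c \<subseteq> I"
 shows "Poly_Mapping.lookup (frag_extend f c) j
  = (\<Sum>i\<in>I. Poly_Mapping.lookup c i * Poly_Mapping.lookup (f i) j)"
proof -
 have "frag_extend f c = (\<Sum>i\<in>I. frag_cmul (Poly_Mapping.lookup c i) (f i))"
  unfolding frag_extend_def using assms
  by (intro sum.mono_neutral_left) (auto simp: in_keys_iff)
 thus ?thesis by (simp add: lookup_sum)
qed

lemma keys_frag_extendI:
 assumes "Poly_Mapping.keys c \<subseteq> A" "\<And>i. i \<in> A ==> Poly_Mapping.keys (f i) \<subseteq> B"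
 shows "Poly_Mapping.keys (frag_extend f c) \<subseteq> B"
 using keys_frag_extend[of f c] assms by blast

lemma keys_frag_sumI:
 assumes "\<And>i. i \<in> A ==> Poly_Mapping.keys (f i) \<subseteq> B"
 shows "Poly_Mapping.keys (\<Sum>i\<in>A. f i) \<subseteq> B"
 using assms by (induction A rule: infinite_finite_induct) (auto dest!: subsetD[OF keys_add])

lemma common_denominator:
 fixes g :: "'x => rat"
 assumes "finite S"
 shows "\<exists>q::int. q \<noteq> 0 \<and> (\<forall>x\<in>S. \<exists>n::int. of_int q * g x = of_int n)"
 using assms
proof (induction S)
 case empty
 show ?case by (rule exI[of _ 1]) auto
next
 case (insert x S)
 then obtain q :: int where q: "q \<noteq> 0" "\<forall>x\<in>S. \<exists>n::int. of_int q * g x = of_int n" by auto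
 obtain a b where ab: "quotient_of (g x) = (a,b)" by (cases "quotient_of (g x)")
 have b: "b > 0" using quotient_of_denom_pos[OF ab] .
 have gx: "g x = of_int a / of_int b" using quotient_of_div[OF ab] .
 show ?case
 proof (rule exI[of _ "q * b"], intro conjI ballI)
  show "q * b \<noteq> 0" using q b by simp
  fix y assume "y \<in> insert x S"
  then consider "y = x" | "y \<in> S" by auto
  thus "\<exists>n::int. of_int (q * b) * g y = of_int n"
  proof cases
   case 1 thus ?thesis using gx b by (intro exI[of _ "q * a"]) (simp add: field_simps)
  next
   case 2 then obtain n where n: "of_int q * g y = of_int n" using q by auto
   have "of_int (q * b) * g y = of_int b * (of_int q * g y)" by simp
   also have "\<dots> = of_int (b * n)" unfolding n by simp
   finally have "of_int (q * b) * g y = of_int (b * n)" .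
   thus ?thesis by blast
  qed
 qed
qed

text \<open>Over the rationals the linear map given by \<open>b\<close> has a right inverse
  \<open>g\<close> on its range, so \<open>b g b = b\<close>. Multiplying \<open>g\<close> by a
  common denominator \<open>q\<close> of its finitely many matrix entries gives an integral
  \<open>h\<close> with \<open>b h b = q b\<close>. With \<open>q = 1\<close> this would fail
  already for multiplication by 2.\<close>

lemma generalized_inverse:
 fixes b :: "'i => 'i \<Rightarrow>\<^sub>0 int"
 assumes fin: "finite I" and kb: "\<And>i. i \<in> I ==> Poly_Mapping.keys (b i) \<subseteq> I"
 shows "\<exists>(q::int) h. q \<noteq> 0 \<and> (\<forall>i. Poly_Mapping.keys (h i) \<subseteq> I) \<and>
  (\<forall>i\<in>I. frag_extend b (frag_extend h (b i)) = frag_cmul q (b i))"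
proof -
 let ?L = "Poly_Mapping.lookup"
 have kb0: "?L (b i) j = 0" if "i \<in> I" "j \<notin> I" for i j
  using kb[OF that(1)] that(2) by (meson in_keys_iff subsetD)
 define sc :: "rat => ('i \<Rightarrow>\<^sub>0 rat) => ('i \<Rightarrow>\<^sub>0 rat)" where "sc c x = Poly_Mapping.map ((*) c) x" for c x
 have Lsc: "?L (sc c x) i = c * ?L x i" for c x i
  by (simp add: sc_def map.rep_eq when_def)
 interpret vs: vector_space sc
  by unfold_locales (rule poly_mapping_eqI; simp add: Lsc lookup_add algebra_simps)+
 interpret vp: vector_space_pair sc sc ..
 define bq :: "'i => 'i \<Rightarrow>\<^sub>0 rat" where "bq i = (\<Sum>j\<in>I. Poly_Mapping.single j (of_int (?L (b i) j)))" for i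
 have Lbq: "?L (bq i) j = of_int (?L (b i) j)" if "i \<in> I" for i j
 proof -
  have "?L (bq i) j = (\<Sum>k\<in>I. if k = j then of_int (?L (b i) k) else 0)"
   by (simp add: bq_def lookup_sum lookup_single when_def)
  also have "\<dots> = of_int (?L (b i) j)"
   using kb0[OF that, of j] fin by simp
  finally show ?thesis .
 qed
 define B where "B v = (\<Sum>i\<in>I. sc (?L v i) (bq i))" for v
 have LB: "?L (B v) j = (\<Sum>i\<in>I. ?L v i * of_int (?L (b i) j))" for v j
  unfolding B_def by (simp add: lookup_sum Lsc Lbq)
 have "Vector_Spaces.linear sc sc B"
  unfolding Vector_Spaces.linear_iff using vs.vector_space_axioms
  by (intro conjI allI; (assumption)?) (rule poly_mapping_eqI; simp add: LB Lsc lookup_add algebra_simps sum.distrib sum_distrib_left)+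
 then obtain g where g: "Vector_Spaces.linear sc sc g" "\<And>v. v \<in> range B ==> B (g v) = v"
  using vp.linear_exists_right_inverse_on[OF _ vs.subspace_UNIV] by metis
 define e where "e i = Poly_Mapping.single i (1::rat)" for i :: 'i
 have Be: "B (e i) = bq i" if "i \<in> I" for i
  by (rule poly_mapping_eqI) (use fin that in \<open>auto simp: LB Lbq e_def lookup_single when_def if_distrib[of "\<lambda>x. x * _"] cong: if_cong\<close>)
 obtain q :: int where q: "q \<noteq> 0"
  "\<forall>p\<in>I\<times>I. \<exists>n::int. of_int q * ?L (g (e (fst p))) (snd p) = of_int n"
  using common_denominator[of "I \<times> I" "\<lambda>p. ?L (g (e (fst p))) (snd p)"] fin by blast
 from bchoice[OF q(2)] obtain N' where N': "\<forall>p\<in>I\<times>I. of_int q * ?L (g (e (fst p))) (snd p) = of_int (N' p)" by blast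
 define N where "N i j = N' (i, j)" for i j
 have N: "of_int q * ?L (g (e i)) j = of_int (N i j)" if "i \<in> I" "j \<in> I" for i j
  using bspec[OF N', of "(i, j)"] that by (simp add: N_def)
 define h where "h i = (\<Sum>j\<in>I. frag_cmul (N i j) (frag_of j))" for i
 have kh: "Poly_Mapping.keys (h i) \<subseteq> I" for i
  unfolding h_def by (intro keys_frag_sumI) auto
 have Lh: "?L (h i) j = N i j" if "j \<in> I" for i j
  using that fin by (simp add: h_def lookup_sum if_distrib[of "\<lambda>x. _ * x"] cong: if_cong)
 have gen: "bq i = (\<Sum>j\<in>I. sc (of_int (?L (b i) j)) (e j))" if "i \<in> I" for i
  by (rule poly_mapping_eqI) (use fin kb0[OF that] in \<open>auto simp: lookup_sum Lsc Lbq that e_def lookup_single when_def if_distrib[of "\<lambda>x. _ * x"] cong: if_cong\<close>)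
 have gb: "g (bq i) = (\<Sum>j\<in>I. sc (of_int (?L (b i) j)) (g (e j)))" if "i \<in> I" for i
  by (simp add: gen[OF that] vp.linear_sum[OF g(1)] vp.linear_scale[OF g(1)])
 have "frag_extend b (frag_extend h (b i)) = frag_cmul q (b i)" if i: "i \<in> I" for i
 proof (rule poly_mapping_eqI)
  fix l
  have "of_int (?L (frag_extend b (frag_extend h (b i))) l)
   = (\<Sum>k\<in>I. (\<Sum>j\<in>I. of_int (?L (b i) j) * of_int (?L (h j) k)) * (of_int (?L (b k) l) :: rat))"
   using kh kb[OF i]
   by (subst lookup_frag_extend[OF fin], intro keys_frag_extendI[OF kb[OF i]])
   (auto simp: lookup_frag_extend[OF fin kb[OF i]])
  also have "\<dots> = (\<Sum>k\<in>I. of_int q * ?L (g (bq i)) k * (of_int (?L (b k) l) :: rat))"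
  proof (rule sum.cong[OF refl])
   fix k assume k: "k \<in> I"
   have "(\<Sum>j\<in>I. of_int (?L (b i) j) * of_int (?L (h j) k)) = of_int q * ?L (g (bq i)) k"
   unfolding gb[OF i] by (auto simp: lookup_sum Lsc sum_distrib_left Lh[OF k] N[symmetric] k intro!: sum.cong)
   thus "(\<Sum>j\<in>I. of_int (?L (b i) j) * of_int (?L (h j) k)) * (of_int (?L (b k) l) :: rat) = of_int q * ?L (g (bq i)) k * of_int (?L (b k) l)" by simp
  qed
  also have "\<dots> = of_int q * ?L (B (g (bq i))) l"
   by (simp add: LB sum_distrib_left algebra_simps)
  also have "B (g (bq i)) = bq i" using g(2) Be[OF i] by (metis rangeI)
  finally have "of_int (?L (frag_extend b (frag_extend h (b i))) l) = (of_int (q * ?L (b i) l) :: rat)"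
   by (simp add: Lbq[OF i])
  thus "?L (frag_extend b (frag_extend h (b i))) l = ?L (frag_cmul q (b i)) l"
   using of_int_eq_iff by fastforce
 qed
 thus ?thesis using q kh by blast
qed

lemma frag_eq_sum:
 assumes "finite I" "Poly_Mapping.keys c \<subseteq> I"
 shows "frag_extend f c = (\<Sum>i\<in>I. frag_cmul (Poly_Mapping.lookup c i) (f i))"
  unfolding frag_extend_def using assms
  by (intro sum.mono_neutral_left) (auto simp: in_keys_iff)

text \<open>This is the symmetry of the trace of a product, with signs: an entry of \<open>b\<close>
  joins two degrees that differ by one, which turns equality into equality up to sign. Only the
  entries of \<open>A\<close> that raise the degree by one contribute, as the others meet a zero of
  \<open>b\<close>.\<close>

lemma supertrace_commutator:
 fixes A b :: "'i => 'i \<Rightarrow>\<^sub>0 int" and deg :: "'i => nat"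
 assumes fin: "finite I" and kA: "\<And>i. i \<in> I ==> Poly_Mapping.keys (A i) \<subseteq> I"
  and kb: "\<And>i. i \<in> I ==> Poly_Mapping.keys (b i) \<subseteq> {j \<in> I. deg i = Suc (deg j)}"
 shows "(\<Sum>i\<in>I. (-1) ^ deg i * Poly_Mapping.lookup (frag_extend b (A i)) i)
  = - (\<Sum>i\<in>I. (-1) ^ deg i * Poly_Mapping.lookup (frag_extend A (b i)) i)"
proof -
 let ?L = "Poly_Mapping.lookup"
 have kb': "Poly_Mapping.keys (b i) \<subseteq> I" if "i \<in> I" for i using kb[OF that] by auto
 have kb_deg: "deg j = Suc (deg i)" if "j \<in> I" "?L (b j) i \<noteq> 0" for i j
  using kb[OF that(1)] that(2) unfolding in_keys_iff[symmetric] by blast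
 have "(\<Sum>i\<in>I. (-1) ^ deg i * ?L (frag_extend b (A i)) i)
  = (\<Sum>i\<in>I. \<Sum>j\<in>I. (-1) ^ deg i * (?L (A i) j * ?L (b j) i))"
  by (simp add: lookup_frag_extend[OF fin kA] sum_distrib_left)
 also have "\<dots> = (\<Sum>i\<in>I. \<Sum>j\<in>I. - ((-1) ^ deg j * (?L (b j) i * ?L (A i) j)))"
 proof (intro sum.cong refl)
  fix i j assume "i \<in> I" "j \<in> I"
  thus "(-1) ^ deg i * (?L (A i) j * ?L (b j) i) = - ((-1) ^ deg j * (?L (b j) i * ?L (A i) j))"
   using kb_deg[of j i] by (cases "?L (b j) i = 0") auto
 qed
 also have "\<dots> = - (\<Sum>j\<in>I. \<Sum>i\<in>I. (-1) ^ deg j * (?L (b j) i * ?L (A i) j))"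
  by (subst sum.swap) (simp add: sum_negf)
 also have "\<dots> = - (\<Sum>i\<in>I. (-1) ^ deg i * ?L (frag_extend A (b i)) i)"
  by (simp add: lookup_frag_extend[OF fin kb'] sum_distrib_left)
 finally show ?thesis .
qed

text \<open>The complex on \<open>I\<close> is not assumed to have the homology counted by
  \<open>Z\<close>; it carries a chain map \<open>e\<close> that factors through that homology
  rationally. \<open>w\<close> realises the classes in \<open>Z\<close> by cycles of the complex,
  \<open>l\<close> reads off the rational coordinates of a cycle, and \<open>main\<close> says that
  on cycles \<open>e\<close> is \<open>w\<close> after \<open>l\<close> modulo boundaries. Since
  \<open>l\<close> after \<open>w\<close> is the identity, the supertrace of \<open>e\<close> counts
  \<open>Z\<close> with signs.\<close>

lemma Hopf_trace:
 fixes b e :: "'i => 'i \<Rightarrow>\<^sub>0 int" and deg :: "'i => nat"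
  and Z :: "nat => 'z set" and w :: "nat => 'z => 'i \<Rightarrow>\<^sub>0 int" and l :: "nat => 'z => ('i \<Rightarrow>\<^sub>0 int) => rat"
 defines "cyc \<equiv> \<lambda>I k x. Poly_Mapping.keys x \<subseteq> {i \<in> I. deg i = k} \<and> frag_extend b x = 0"
 assumes fin: "finite I"
  and kb: "\<And>i. i \<in> I ==> Poly_Mapping.keys (b i) \<subseteq> {j \<in> I. deg i = Suc (deg j)}"
  and ke: "\<And>i. i \<in> I ==> Poly_Mapping.keys (e i) \<subseteq> {j \<in> I. deg j = deg i}"
  and eb: "\<And>i. i \<in> I ==> frag_extend e (b i) = frag_extend b (e i)"
  and bb: "\<And>i. i \<in> I ==> frag_extend b (b i) = 0"
  and degK: "\<And>i. i \<in> I ==> deg i \<le> K"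
  and finZ: "\<And>k. finite (Z k)"
  and w: "\<And>k z. k \<le> K ==> z \<in> Z k ==> cyc I k (w k z)"
  and ladd: "\<And>k z x y. cyc I k x ==> cyc I k y ==> l k z (x + y) = l k z x + l k z y"
  and lcmul: "\<And>k z x n. cyc I k x ==> l k z (frag_cmul n x) = of_int n * l k z x"
  and lbd: "\<And>k z y. Poly_Mapping.keys y \<subseteq> {i \<in> I. deg i = Suc k} ==> l k z (frag_extend b y) = 0"
  and lw: "\<And>k z z'. k \<le> K ==> z \<in> Z k ==> z' \<in> Z k ==> l k z (w k z') = (if z = z' then 1 else 0)"
  and main: "\<And>k x. k \<le> K ==> cyc I k x ==> \<exists>n a y. n \<noteq> 0 \<and> (\<forall>z\<in>Z k. of_int (a z) = of_int n * l k z x)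
   \<and> Poly_Mapping.keys y \<subseteq> {i \<in> I. deg i = Suc k}
   \<and> frag_cmul n (frag_extend e x) = (\<Sum>z\<in>Z k. frag_cmul (a z) (w k z)) + frag_extend b y"
 shows "(\<Sum>i\<in>I. (-1) ^ deg i * Poly_Mapping.lookup (e i) i) = (\<Sum>k\<le>K. (-1) ^ k * int (card (Z k)))"
proof -
 let ?L = "Poly_Mapping.lookup" and ?k = "Poly_Mapping.keys"
 let ?str = "\<lambda>f. (\<Sum>i\<in>I. (-1) ^ deg i * ?L (f i) i)"
 note lin = frag_extend_add frag_extend_diff frag_extend_cmul frag_extend_minus frag_cmul_diff
 have kb': "?k (b i) \<subseteq> I" if "i \<in> I" for i using kb[OF that] by auto
 have ke': "?k (e i) \<subseteq> I" if "i \<in> I" for i using ke[OF that] by auto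
 have kb_deg: "j \<in> I \<and> deg i = Suc (deg j)" if "i \<in> I" "?L (b i) j \<noteq> 0" for i j
  using kb[OF that(1)] that(2) unfolding in_keys_iff[symmetric] by blast
 have deg_sub: "?k x \<subseteq> I" if "?k x \<subseteq> {i \<in> I. deg i = k}" for x :: "'i \<Rightarrow>\<^sub>0 int" and k using that by (rule subset_trans) (rule Collect_restrict)
 have gi: "\<exists>(q::int) h. q \<noteq> 0 \<and> (\<forall>i. ?k (h i) \<subseteq> I) \<and>
  (\<forall>i\<in>I. frag_extend b (frag_extend h (b i)) = frag_cmul q (b i))"
  by (rule generalized_inverse[OF fin]) (rule kb')
 obtain q h0 where qh: "(q::int) \<noteq> 0 \<and> (\<forall>i. ?k (h0 i) \<subseteq> I) \<and>
  (\<forall>i\<in>I. frag_extend b (frag_extend h0 (b i)) = frag_cmul q (b i))"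
  using gi by (elim exE) (rule that)
 have q: "q \<noteq> 0" and h0: "?k (h0 i) \<subseteq> I" for i using qh by simp_all
 have bhb0: "frag_extend b (frag_extend h0 (b i)) = frag_cmul q (b i)" if "i \<in> I" for i
  using qh that by simp
 \<comment> \<open>Only the part of \<open>h0\<close> that raises the degree by one is kept. As
   \<open>b\<close> is homogeneous, the other entries do not contribute to \<open>b h b\<close> in
   the degrees where \<open>b\<close> is nonzero.\<close>
 define h where "h i = (\<Sum>j\<in>{j\<in>I. deg j = Suc (deg i)}. frag_cmul (?L (h0 i) j) (frag_of j))" for i
 have kh: "?k (h i) \<subseteq> {j \<in> I. deg j = Suc (deg i)}" for i
  unfolding h_def by (intro keys_frag_sumI) auto
 have kh': "?k (h i) \<subseteq> I" for i using kh by blast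
 have Lh: "?L (h i) j = (if deg j = Suc (deg i) then ?L (h0 i) j else 0)" if "j \<in> I" for i j
  using that fin by (auto simp add: h_def lookup_sum if_distrib[of "\<lambda>x. _ * x"] cong: if_cong)
 have bhb: "frag_extend b (frag_extend h (b i)) = frag_cmul q (b i)" if i: "i \<in> I" for i
 proof (rule poly_mapping_eqI)
  fix m
  have ex: "?L (frag_extend b (frag_extend g (b i))) m = (\<Sum>k\<in>I. \<Sum>j\<in>I. ?L (b i) j * ?L (g j) k * ?L (b k) m)"
   if "\<And>i. ?k (g i) \<subseteq> I" for g
   by (subst lookup_frag_extend[OF fin keys_frag_extendI[OF kb'[OF i]]])
   (use that in \<open>auto simp: lookup_frag_extend[OF fin kb'[OF i]] sum_distrib_right\<close>)
  show "?L (frag_extend b (frag_extend h (b i))) m = ?L (frag_cmul q (b i)) m"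
  proof (cases "m \<in> I \<and> deg i = Suc (deg m)")
   case True
   have "?L (frag_extend b (frag_extend h (b i))) m = ?L (frag_extend b (frag_extend h0 (b i))) m"
   unfolding ex[OF kh'] ex[OF h0]
   proof (intro sum.cong refl)
   fix k j assume kj: "k \<in> I" "j \<in> I"
   show "?L (b i) j * ?L (h j) k * ?L (b k) m = ?L (b i) j * ?L (h0 j) k * ?L (b k) m"
   using kb_deg[OF i, of j] kb_deg[OF kj(1), of m] True Lh[OF kj(1)]
   by (cases "?L (b i) j = 0"; cases "?L (b k) m = 0") simp_all
   qed
   thus ?thesis using bhb0[OF i] by simp
  next
   case False
   have "?L (frag_extend b (frag_extend h (b i))) m = 0"
   unfolding ex[OF kh']
   proof (intro sum.neutral ballI)
   fix k j assume kj: "k \<in> I" "j \<in> I"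
   show "?L (b i) j * ?L (h j) k * ?L (b k) m = 0"
   using kb_deg[OF i, of j] kb_deg[OF kj(1), of m] False Lh[OF kj(1)]
   by (cases "?L (b i) j = 0"; cases "?L (b k) m = 0") auto
   qed
   thus ?thesis using kb_deg[OF i, of m] False by fastforce
  qed
 qed
 define p where "p i = frag_cmul q (frag_of i) - frag_extend b (h i) - frag_extend h (b i)" for i
 have px: "frag_extend p x = frag_cmul q x - frag_extend b (frag_extend h x) - frag_extend h (frag_extend b x)"
  if "?k x \<subseteq> I" for x using that
  by (induction x rule: frag_induction) (auto simp: p_def lin frag_cmul_diff)
 have bbx: "frag_extend b (frag_extend b x) = 0" if "?k x \<subseteq> I" for x using that
  by (induction x rule: frag_induction) (auto simp: lin bb)
 have bhbx: "frag_extend b (frag_extend h (frag_extend b x)) = frag_cmul q (frag_extend b x)" if "?k x \<subseteq> I" for x using that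
  by (induction x rule: frag_induction) (auto simp: lin bhb)
 have ebx: "frag_extend e (frag_extend b x) = frag_extend b (frag_extend e x)" if "?k x \<subseteq> I" for x using that
  by (induction x rule: frag_induction) (auto simp: lin eb)
 have kbx: "?k (frag_extend b x) \<subseteq> I" if "?k x \<subseteq> I" for x using keys_frag_extendI[OF that kb'] .
 have khx: "?k (frag_extend h x) \<subseteq> I" for x using keys_frag_extendI[OF subset_refl kh'] .
 have kex: "?k (frag_extend e x) \<subseteq> I" if "?k x \<subseteq> I" for x using keys_frag_extendI[OF that ke'] .
 have kp: "?k (p i) \<subseteq> {j \<in> I. deg j = deg i}" if "i \<in> I" for i
 proof -
  have "?k (frag_extend b (h i)) \<subseteq> {j \<in> I. deg j = deg i}"
   by (rule keys_frag_extendI[OF kh]) (use kb in force)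
  moreover have "?k (frag_extend h (b i)) \<subseteq> {j \<in> I. deg j = deg i}"
   by (rule keys_frag_extendI[OF kb[OF that]]) (use kh in fastforce)
  ultimately show ?thesis using that unfolding p_def
   by (intro subset_trans[OF keys_diff] Un_least) auto
 qed
 have kp': "?k (p i) \<subseteq> I" if "i \<in> I" for i using kp[OF that] by auto
 have pb: "frag_extend p (frag_extend b x) = 0" if "?k x \<subseteq> I" for x
  by (simp add: px kbx that bbx bhbx)
 have bp: "frag_extend b (frag_extend p x) = 0" if "?k x \<subseteq> I" for x
  by (simp add: px that lin bbx khx bhbx)
 have bp1: "frag_extend b (p i) = 0" if "i \<in> I" for i
  using bp[of "frag_of i"] that by simp
 \<comment> \<open>\<open>p = q - bh - hb\<close> vanishes on boundaries and has cycles as values, so that \<open>pep\<close> has the supertrace of \<open>q\<^sup>2 e\<close>.\<close>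
 have cycp: "cyc I (deg i) (p i)" if "i \<in> I" for i
  using kp[OF that] bp1[OF that] by (auto simp: cyc_def)
 have str_diff: "?str (\<lambda>i. f i - g i) = ?str f - ?str g" for f g :: "'i => 'i \<Rightarrow>\<^sub>0 int"
  by (simp add: lookup_minus right_diff_distrib sum_subtractf)
 have str_cmul: "?str (\<lambda>i. frag_cmul q (f i)) = q * ?str f" for f :: "'i => 'i \<Rightarrow>\<^sub>0 int"
  by (simp add: sum_distrib_left mult.left_commute)
 have str_cong: "?str f = ?str g" if "\<And>i. i \<in> I ==> f i = g i" for f g :: "'i => 'i \<Rightarrow>\<^sub>0 int"
  using that by (intro sum.cong) auto
 have com: "?str (\<lambda>i. frag_extend b (A i)) = - ?str (\<lambda>i. frag_extend A (b i))"
  if "\<And>i. i \<in> I ==> ?k (A i) \<subseteq> I" for A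
  by (rule supertrace_commutator[OF fin]) (use that kb in auto)
 \<comment> \<open>The supertraces of \<open>e b h\<close> and \<open>e h b\<close> cancel:
   \<open>e\<close> commutes with \<open>b\<close>, and moving \<open>b\<close> across the trace
   changes the sign.\<close>
 have str_ep: "?str (\<lambda>i. frag_extend e (p i)) = q * ?str e"
 proof -
  have "?str (\<lambda>i. frag_extend e (p i)) = q * ?str e - (?str (\<lambda>i. frag_extend b (frag_extend e (h i))) + ?str (\<lambda>i. frag_extend e (frag_extend h (b i))))"
  proof -
   have "?str (\<lambda>i. frag_extend e (p i)) = ?str (\<lambda>i. frag_cmul q (e i) - frag_extend b (frag_extend e (h i)) - frag_extend e (frag_extend h (b i)))"
   by (rule str_cong) (simp add: p_def frag_extend_diff frag_extend_cmul ebx kh')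
   thus ?thesis by (simp only: str_diff str_cmul)
  qed
  moreover have "frag_extend (\<lambda>j. frag_extend e (h j)) x = frag_extend e (frag_extend h x)" for x
   by (rule frag_induction[of x UNIV]) (auto simp: lin)
  ultimately show ?thesis
   using com[of "\<lambda>i. frag_extend e (h i)"] kex[OF kh'] by simp
 qed
 have pep: "frag_extend p (frag_extend e (p i)) = frag_cmul q (frag_extend e (p i)) - frag_extend b (frag_extend h (frag_extend e (p i)))" if "i \<in> I" for i
  using that by (simp add: px kex kp' bp1 ebx[symmetric])
 \<comment> \<open>Moving \<open>b\<close> around the trace puts it next to \<open>p\<close>, and
   \<open>p\<close> vanishes on boundaries.\<close>
 have "?str (\<lambda>i. frag_extend b (frag_extend h (frag_extend e (p i)))) = 0"
 proof -
  have "frag_extend (\<lambda>j. frag_extend h (frag_extend e (p j))) x = frag_extend h (frag_extend e (frag_extend p x))" for x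
   by (rule frag_induction[of x UNIV]) (auto simp: lin)
  moreover have "frag_extend p (b i) = 0" if "i \<in> I" for i
   using pb[of "frag_of i"] that by simp
  ultimately show ?thesis
   using com[of "\<lambda>i. frag_extend h (frag_extend e (p i))"] khx by simp
 qed
 hence str_pep: "?str (\<lambda>i. frag_extend p (frag_extend e (p i))) = q * q * ?str e"
  using str_ep by (simp only: str_cong[OF pep] str_diff str_cmul)
 \<comment> \<open>On a cycle, \<open>p\<close> is multiplication by \<open>q\<close> up to the
   boundary \<open>b h x\<close>, hence it multiplies the coordinates by \<open>q\<close>.\<close>
 have pw: "cyc I k (frag_extend p x) \<and> l k z (frag_extend p x) = of_int q * l k z x" if x: "cyc I k x" for k z x
 proof -
  have kx: "?k x \<subseteq> I" "?k x \<subseteq> {i \<in> I. deg i = k}" using x by (auto simp: cyc_def)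
  have "?k (frag_extend p x) \<subseteq> {i \<in> I. deg i = k}"
   by (rule keys_frag_extendI[OF kx(2)]) (use kp in auto)
  hence 1: "cyc I k (frag_extend p x)" using bp[OF kx(1)] by (auto simp: cyc_def)
  have kh1: "?k (frag_extend h x) \<subseteq> {i \<in> I. deg i = Suc k}"
   by (rule keys_frag_extendI[OF kx(2)]) (use kh in fastforce)
  have cb: "cyc I k (frag_extend b (frag_extend h x))"
   unfolding cyc_def
   by (intro conjI keys_frag_extendI[OF kh1] bbx khx) (use kb in force)
  have "l k z (frag_extend p x + frag_extend b (frag_extend h x)) = l k z (frag_extend p x)"
   using ladd[OF 1 cb] lbd[OF kh1] by simp
  moreover have "frag_extend p x + frag_extend b (frag_extend h x) = frag_cmul q x"
   using px[OF kx(1)] x by (simp add: cyc_def)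
  ultimately show ?thesis using 1 lcmul[OF x] by simp
 qed
 \<comment> \<open>\<open>main\<close> applies to the cycle \<open>p i\<close>. The outer
   \<open>p\<close> kills the boundary of \<open>y\<close>, and what remains is the diagonal entry
   of a product of two rectangular matrices, one made from \<open>l\<close> and one from
   \<open>w\<close>.\<close>
 have diag: "of_int (?L (frag_extend p (frag_extend e (p i))) i)
   = (\<Sum>z\<in>Z (deg i). l (deg i) z (p i) * of_int (?L (frag_extend p (w (deg i) z)) i))" if i: "i \<in> I" for i
 proof -
  obtain n a y where n: "n \<noteq> 0" and a: "\<forall>z\<in>Z (deg i). of_int (a z) = of_int n * l (deg i) z (p i)"
   and y: "?k y \<subseteq> {j \<in> I. deg j = Suc (deg i)}"
   and ny: "frag_cmul n (frag_extend e (p i)) = (\<Sum>z\<in>Z (deg i). frag_cmul (a z) (w (deg i) z)) + frag_extend b y"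
   using main[OF degK[OF i] cycp[OF i]] by (elim exE conjE) (rule that)
  have "frag_cmul n (frag_extend p (frag_extend e (p i))) = frag_extend p ((\<Sum>z\<in>Z (deg i). frag_cmul (a z) (w (deg i) z)) + frag_extend b y)"
   by (simp add: ny[symmetric] lin)
  also have "\<dots> = (\<Sum>z\<in>Z (deg i). frag_cmul (a z) (frag_extend p (w (deg i) z)))"
   using y by (simp add: lin pb[OF deg_sub[OF y]] frag_extend_sum[OF finZ] o_def)
  finally have "?L (frag_cmul n (frag_extend p (frag_extend e (p i)))) i = ?L (\<Sum>z\<in>Z (deg i). frag_cmul (a z) (frag_extend p (w (deg i) z))) i"
   by simp
  hence "n * ?L (frag_extend p (frag_extend e (p i))) i = (\<Sum>z\<in>Z (deg i). a z * ?L (frag_extend p (w (deg i) z)) i)"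
   by (simp add: lookup_sum)
  hence "of_int n * of_int (?L (frag_extend p (frag_extend e (p i))) i) = (\<Sum>z\<in>Z (deg i). of_int (a z) * (of_int (?L (frag_extend p (w (deg i) z)) i) :: rat))"
   by (metis (mono_tags, lifting) of_int_mult of_int_sum sum.cong)
  also have "\<dots> = of_int n * (\<Sum>z\<in>Z (deg i). l (deg i) z (p i) * of_int (?L (frag_extend p (w (deg i) z)) i))"
   using a by (simp add: sum_distrib_left algebra_simps)
  finally show ?thesis using n by simp
 qed
 have lsum: "l k z (\<Sum>i\<in>J. frag_cmul (v i) (p i)) = (\<Sum>i\<in>J. of_int (v i) * l k z (p i)) \<and> cyc I k (\<Sum>i\<in>J. frag_cmul (v i) (p i))"
  if "finite J" "J \<subseteq> {i\<in>I. deg i = k}" for J k z v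
  using that
 proof (induction J)
  case empty
  have "cyc I k 0" by (simp add: cyc_def)
  thus ?case using lcmul[of k 0 z 0] by simp
 next
  case (insert i J)
  have c: "cyc I k (frag_cmul (v i) (p i))" "cyc I k (p i)"
   using cycp[of i] insert.prems by (auto simp: cyc_def lin)
  have IH: "l k z (\<Sum>i\<in>J. frag_cmul (v i) (p i)) = (\<Sum>i\<in>J. of_int (v i) * l k z (p i))" "cyc I k (\<Sum>i\<in>J. frag_cmul (v i) (p i))"
   using insert by auto
  have "cyc I k (frag_cmul (v i) (p i) + (\<Sum>i\<in>J. frag_cmul (v i) (p i)))"
   using c(1) IH(2) keys_add[of "frag_cmul (v i) (p i)" "\<Sum>i\<in>J. frag_cmul (v i) (p i)"] unfolding cyc_def by (auto simp: lin)
  thus ?case using insert.hyps ladd[OF c(1) IH(2)] lcmul[OF c(2)] IH(1) by simp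
 qed
 \<comment> \<open>After exchanging the sums, each \<open>z\<close> contributes the coordinate at
   \<open>z\<close> of \<open>p\<close> applied twice to \<open>w k z\<close>, which is
   \<open>q * q\<close>.\<close>
 have blk: "(\<Sum>i\<in>{i\<in>I. deg i = k}. of_int (?L (frag_extend p (frag_extend e (p i))) i)) = (of_int (q * q) * of_nat (card (Z k)) :: rat)" if k: "k \<le> K" for k
 proof -
  have "(\<Sum>i\<in>{i\<in>I. deg i = k}. of_int (?L (frag_extend p (frag_extend e (p i))) i))
   = (\<Sum>i\<in>{i\<in>I. deg i = k}. \<Sum>z\<in>Z k. l k z (p i) * of_int (?L (frag_extend p (w k z)) i))"
   using diag by (intro sum.cong) auto
  also have "\<dots> = (\<Sum>z\<in>Z k. \<Sum>i\<in>{i\<in>I. deg i = k}. of_int (?L (frag_extend p (w k z)) i) * l k z (p i))"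
   by (subst sum.swap) (simp add: mult.commute)
  also have "\<dots> = (\<Sum>z\<in>Z k. of_int (q * q))"
  proof (rule sum.cong[OF refl])
   fix z assume z: "z \<in> Z k"
   let ?u = "frag_extend p (w k z)"
   have u: "cyc I k ?u" "l k z ?u = of_int q" using pw[OF w[OF k z], of z] lw[OF k z z] by auto
   have "(\<Sum>i\<in>{i\<in>I. deg i = k}. of_int (?L ?u i) * l k z (p i)) = l k z (\<Sum>i\<in>{i\<in>I. deg i = k}. frag_cmul (?L ?u i) (p i))"
   using lsum[of "{i\<in>I. deg i = k}" k] fin by simp
   also have "(\<Sum>i\<in>{i\<in>I. deg i = k}. frag_cmul (?L ?u i) (p i)) = frag_extend p ?u"
   using u(1) fin by (intro frag_eq_sum[symmetric]) (auto simp: cyc_def)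
   also have "l k z \<dots> = of_int (q * q)" using pw[OF u(1), of z] u(2) by simp
   finally show "(\<Sum>i\<in>{i\<in>I. deg i = k}. of_int (?L ?u i) * l k z (p i)) = of_int (q * q)" .
  qed
  finally show ?thesis by simp
 qed
 have "of_int (?str (\<lambda>i. frag_extend p (frag_extend e (p i))))
  = (\<Sum>k\<le>K. \<Sum>i\<in>{i\<in>I. deg i = k}. (-1) ^ deg i * (of_int (?L (frag_extend p (frag_extend e (p i))) i) :: rat))"
  using fin degK by (subst sum.group[of I "{..K}" deg]) auto
 also have "\<dots> = (\<Sum>k\<le>K. (-1) ^ k * (\<Sum>i\<in>{i\<in>I. deg i = k}. (of_int (?L (frag_extend p (frag_extend e (p i))) i) :: rat)))"
  by (simp add: sum_distrib_left)
 also have "\<dots> = of_int (q * q * (\<Sum>k\<le>K. (-1) ^ k * int (card (Z k))))"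
  by (simp add: blk sum_distrib_left algebra_simps)
 finally have "?str (\<lambda>i. frag_extend p (frag_extend e (p i))) = q * q * (\<Sum>k\<le>K. (-1) ^ k * int (card (Z k)))"
  using of_int_eq_iff by blast
 thus ?thesis using str_pep q by simp
qed

text \<open>Gaussian elimination of one coordinate at a time. The pivot row \<open>z0\<close> is
  combined with the others by cross-multiplication, so all coefficients stay integral.\<close>

lemma integer_dependence:
 fixes v :: "'z => 'i => int"
 assumes "finite I" "finite Z" "card I < card Z"
 shows "\<exists>a. (\<exists>z\<in>Z. a z \<noteq> 0) \<and> (\<forall>i\<in>I. (\<Sum>z\<in>Z. a z * v z i) = (0::int))"
 using assms
proof (induction I arbitrary: Z v)
 case empty
 then obtain z where "z \<in> Z" by fastforce
 thus ?case by (intro exI[of _ "\<lambda>_. 1"]) auto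
next
 case (insert i I)
 show ?case
 proof (cases "\<forall>z\<in>Z. v z i = 0")
  case True
  thus ?thesis using insert.IH[of Z v] insert by auto
 next
  case False
  then obtain z0 where z0: "z0 \<in> Z" "v z0 i \<noteq> 0" by auto
  define v' where "v' z j = v z0 i * v z j - v z i * v z0 j" for z j
  have "card I < card (Z - {z0})" using insert z0 by auto
  then obtain a where a: "\<exists>z\<in>Z - {z0}. a z \<noteq> 0" "\<forall>j\<in>I. (\<Sum>z\<in>Z - {z0}. a z * v' z j) = 0"
   using insert.IH[of "Z - {z0}" v'] insert.prems by auto
  define a' where "a' z = (if z = z0 then - (\<Sum>z\<in>Z - {z0}. a z * v z i) else v z0 i * a z)" for z
  have sum: "(\<Sum>z\<in>Z. a' z * v z j) = (\<Sum>z\<in>Z - {z0}. a z * v' z j)" for j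
  proof -
   have "(\<Sum>z\<in>Z. a' z * v z j) = a' z0 * v z0 j + (\<Sum>z\<in>Z - {z0}. a' z * v z j)"
   using z0 insert.prems by (simp add: sum.remove)
   also have "\<dots> = (\<Sum>z\<in>Z - {z0}. a z * v' z j)"
   by (simp add: a'_def v'_def sum_distrib_right sum_distrib_left sum_negf sum_subtractf algebra_simps)
   finally show ?thesis .
  qed
  have "(\<Sum>z\<in>Z - {z0}. a z * v' z i) = 0" by (simp add: v'_def)
  hence "\<forall>j\<in>insert i I. (\<Sum>z\<in>Z. a' z * v z j) = 0" using a(2) sum by auto
  moreover have "\<exists>z\<in>Z. a' z \<noteq> 0" using a(1) z0(2) by (auto simp: a'_def)
  ultimately show ?thesis by blast
 qed
qed

section \<open>Betti numbers through representing cycles\<close>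

definition homology_independent :: "nat => 'a topology => 'a chain set => bool" where
 "homology_independent k X Z \<longleftrightarrow> finite Z \<and> Z \<subseteq> singular_relcycle_set k X {} \<and>
  (\<forall>c :: 'a chain => int. singular_relboundary k X {} (\<Sum>z\<in>Z. frag_cmul (c z) z) --> (\<forall>z\<in>Z. c z = 0))"

lemma homology_class_hom:
 "homologous_rel_set k X {} \<in> hom (relcycle_group k X {}) (homology_group (int k) X)"
 using normal.r_coset_hom_Mod[OF normal_subgroup_singular_relboundary_relcycle, of k X "{}"]
 by (simp add: right_coset_singular_relboundary nontrivial_relative_homology_group)

lemma homology_class_mult:
 assumes "singular_relcycle k X {} x" "singular_relcycle k X {} y"
 shows "homologous_rel_set k X {} x \<otimes>\<^bsub>homology_group (int k) X\<^esub> homologous_rel_set k X {} y = homologous_rel_set k X {} (x + y)"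
 using hom_mult[OF homology_class_hom, of x k X y] assms by simp

lemma homologous_rel_set_eq_0:
 "homologous_rel_set k X {} z = \<one>\<^bsub>homology_group (int k) X\<^esub> \<longleftrightarrow> singular_relboundary k X {} z"
proof -
 have "singular_relboundary k X {} (- b) \<longleftrightarrow> singular_relboundary k X {} b" for b
  using singular_relboundary_minus[of k X "{}" b] singular_relboundary_minus[of k X "{}" "- b"] by auto
 hence "homologous_rel_set k X {} 0 = \<one>\<^bsub>homology_group (int k) X\<^esub>"
  by (simp add: one_relative_homology_group homologous_rel_def)
 thus ?thesis using homologous_rel_set_eq[of k X "{}" z 0] by (simp add: homologous_rel_def)
qed

lemma homology_class_int_pow:
 assumes "singular_relcycle k X {} z"
 shows "homologous_rel_set k X {} z [^]\<^bsub>homology_group (int k) X\<^esub> (n::int) = homologous_rel_set k X {} (frag_cmul n z)"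
proof -
 have "z [^]\<^bsub>relcycle_group k X {}\<^esub> n = frag_cmul n z"
  unfolding relcycle_group_def
  using assms group.int_pow_subgroup_generated[OF group_chain_group, of z k X "singular_relcycle_set k X {}" n]
  by (metis (mono_tags, lifting) carrier_relcycle_group chain_group_def int_pow_free_Abelian_group mem_Collect_eq relcycle_group_def singular_chain_def singular_relcycle)
 thus ?thesis
  using hom_int_pow[OF homology_class_hom, of z k X n] assms by simp
qed

lemma homology_class_finprod:
 assumes "finite Z" "Z \<subseteq> singular_relcycle_set k X {}"
 shows "finprod (homology_group (int k) X) (\<lambda>z. homologous_rel_set k X {} z [^]\<^bsub>homology_group (int k) X\<^esub> (c z :: int)) Z
  = homologous_rel_set k X {} (\<Sum>z\<in>Z. frag_cmul (c z) z)"
proof -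
 interpret comm_group "homology_group (int k) X" by (rule abelian_homology_group)
 have cl: "homologous_rel_set k X {} z \<in> carrier (homology_group (int k) X)" if "z \<in> singular_relcycle_set k X {}" for z
  using that by (auto simp: carrier_relative_homology_group)
 show ?thesis using assms
 proof (induction Z)
  case empty
  have "homologous_rel_set k X {} 0 = \<one>\<^bsub>homology_group (int k) X\<^esub>"
   by (simp only: homologous_rel_set_eq_0 singular_relboundary_0)
  thus ?case by (simp only: finprod_empty sum.empty)
 next
  case (insert z Z)
  have s: "singular_relcycle k X {} (\<Sum>z\<in>Z. frag_cmul (c z) z)"
   using insert.prems by (intro singular_relcycle_sum singular_relcycle_cmul) auto
  have z: "singular_relcycle k X {} (frag_cmul (c z) z)" using insert.prems by (intro singular_relcycle_cmul) auto
  have "finprod (homology_group (int k) X) (\<lambda>z. homologous_rel_set k X {} z [^]\<^bsub>homology_group (int k) X\<^esub> (c z :: int)) (insert z Z)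
   = homologous_rel_set k X {} z [^]\<^bsub>homology_group (int k) X\<^esub> c z \<otimes>\<^bsub>homology_group (int k) X\<^esub> homologous_rel_set k X {} (\<Sum>z\<in>Z. frag_cmul (c z) z)"
   using insert cl by (subst finprod_insert) auto
  also have "\<dots> = homologous_rel_set k X {} (\<Sum>z\<in>insert z Z. frag_cmul (c z) z)"
   using insert s z by (simp add: homology_class_int_pow homology_class_mult)
  finally show ?case .
 qed
qed

text \<open>\<open>abelian_rank\<close> is a supremum of natural numbers; \<open>bnd\<close> makes
  the set bounded, so that the supremum is attained. Choosing representatives translates independent
  sets of classes into independent sets of cycles of the same size, and back.\<close>

lemma betti_number_basis:
 assumes bnd: "\<And>Z. homology_independent k X Z ==> card Z \<le> N"
 obtains Z where "homology_independent k X Z" "card Z = betti_number k X"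
  "\<And>Z'. homology_independent k X Z' ==> card Z' \<le> card Z"
proof -
 let ?G = "homology_group (int k) X" and ?c = "homologous_rel_set k X {}"
 have A: "\<exists>Z. homology_independent k X Z \<and> card Z = card B"
  if "finite B" "B \<subseteq> carrier ?G" "int_independent ?G B" for B
 proof -
  have "\<forall>b\<in>B. \<exists>z. singular_relcycle k X {} z \<and> ?c z = b"
   using that(2) by (auto simp: carrier_relative_homology_group)
  then obtain r where r: "\<forall>b\<in>B. singular_relcycle k X {} (r b) \<and> ?c (r b) = b" by metis
  have inj: "inj_on r B" by (rule inj_on_inverseI[of _ ?c]) (use r in auto)
  have "homology_independent k X (r ` B)"
   unfolding homology_independent_def
  proof (intro conjI allI impI)
   fix c :: "'a chain => int" assume "singular_relboundary k X {} (\<Sum>z\<in>r ` B. frag_cmul (c z) z)"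
   hence "finprod ?G (\<lambda>z. ?c z [^]\<^bsub>?G\<^esub> c z) (r ` B) = \<one>\<^bsub>?G\<^esub>"
   using r that(1) homologous_rel_set_eq_0[of k X "\<Sum>z\<in>r ` B. frag_cmul (c z) z"]
   by (subst homology_class_finprod) (blast, blast, blast)
   moreover have "finprod ?G (\<lambda>z. ?c z [^]\<^bsub>?G\<^esub> c z) (r ` B) = finprod ?G (\<lambda>b. b [^]\<^bsub>?G\<^esub> c (r b)) B"
   proof -
   interpret comm_group ?G by (rule abelian_homology_group)
   have cl: "b \<in> carrier ?G" if "b \<in> B" for b using \<open>B \<subseteq> carrier ?G\<close> that by auto
   have "finprod ?G (\<lambda>z. ?c z [^]\<^bsub>?G\<^esub> c z) (r ` B) = finprod ?G (\<lambda>b. ?c (r b) [^]\<^bsub>?G\<^esub> c (r b)) B"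
   using r cl inj by (intro finprod_reindex) (auto simp: Pi_iff)
   also have "\<dots> = finprod ?G (\<lambda>b. b [^]\<^bsub>?G\<^esub> c (r b)) B"
   using r cl by (intro finprod_cong') (auto simp: Pi_iff)
   finally show ?thesis .
   qed
   ultimately have "\<forall>b\<in>B. c (r b) = 0"
   using that(3)[unfolded int_independent_def, THEN spec, of "\<lambda>b. c (r b)"] by simp
   thus "\<forall>z\<in>r ` B. c z = 0" by simp
  qed (use r that in auto)
  thus ?thesis using card_image[OF inj] by blast
 qed
 have B: "\<exists>B. finite B \<and> B \<subseteq> carrier ?G \<and> int_independent ?G B \<and> card B = card Z" if Z: "homology_independent k X Z" for Z
 proof -
  have fZ: "finite Z" "Z \<subseteq> singular_relcycle_set k X {}"
   and ind: "\<And>c :: 'a chain => int. singular_relboundary k X {} (\<Sum>z\<in>Z. frag_cmul (c z) z) ==> \<forall>z\<in>Z. c z = 0"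
   using Z by (auto simp: homology_independent_def)
  interpret comm_group ?G by (rule abelian_homology_group)
  have cl: "?c z \<in> carrier ?G" if "z \<in> Z" for z using fZ that by (auto simp: carrier_relative_homology_group)
  have inj: "inj_on ?c Z"
  proof (rule inj_onI, rule ccontr)
   fix x y assume xy: "x \<in> Z" "y \<in> Z" "?c x = ?c y" "x \<noteq> y"
   \<comment> \<open>The coefficients 1 and -1 turn an equality of the classes of \<open>x\<close>
     and \<open>y\<close> into a nontrivial relation between cycles of \<open>Z\<close>.\<close>
   let ?cc = "\<lambda>z. if z = x then 1 else if z = y then -1 else (0::int)"
   have "(\<Sum>z\<in>Z. frag_cmul (?cc z) z) = (\<Sum>z\<in>{x,y}. frag_cmul (?cc z) z)"
   using fZ xy by (intro sum.mono_neutral_right) auto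
   also have "\<dots> = x - y" using xy by simp
   finally have "singular_relboundary k X {} (\<Sum>z\<in>Z. frag_cmul (?cc z) z)"
   using xy(3) homologous_rel_set_eq[of k X "{}" x y] by (simp add: homologous_rel_def)
   from ind[OF this] xy show False by auto
  qed
  have "int_independent ?G (?c ` Z)"
   unfolding int_independent_def
  proof (intro allI impI)
   fix c :: "'a chain set => int" assume "finprod ?G (\<lambda>b. b [^]\<^bsub>?G\<^esub> c b) (?c ` Z) = \<one>\<^bsub>?G\<^esub>"
   moreover have "finprod ?G (\<lambda>b. b [^]\<^bsub>?G\<^esub> c b) (?c ` Z) = finprod ?G (\<lambda>z. ?c z [^]\<^bsub>?G\<^esub> c (?c z)) Z"
   using cl inj by (intro finprod_reindex) (auto simp: Pi_iff)
   ultimately have "singular_relboundary k X {} (\<Sum>z\<in>Z. frag_cmul (c (?c z)) z)"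
   using homology_class_finprod[OF fZ, of "\<lambda>z. c (?c z)"] homologous_rel_set_eq_0[of k X "\<Sum>z\<in>Z. frag_cmul (c (?c z)) z"] by (simp only:)
   from ind[OF this] show "\<forall>b\<in>?c ` Z. c b = 0" by auto
  qed
  thus ?thesis using fZ cl card_image[OF inj] by (intro exI[of _ "?c ` Z"]) auto
 qed
 define S where "S = {card B | B. finite B \<and> B \<subseteq> carrier ?G \<and> int_independent ?G B}"
 have S_le: "n \<le> N" if "n \<in> S" for n using that A bnd unfolding S_def by force
 hence fS: "finite S" by (meson finite_nat_set_iff_bounded_le)
 have "homology_independent k X {}" by (simp add: homology_independent_def)
 hence "S \<noteq> {}" using B[of "{}"] unfolding S_def by blast
 hence "Sup S \<in> S" "\<And>n. n \<in> S ==> n \<le> Sup S" using fS by (auto simp: Sup_nat_def)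
 moreover have "betti_number k X = Sup S" by (simp add: betti_number_def abelian_rank_def S_def)
 ultimately have "betti_number k X \<in> S" "\<And>n. n \<in> S ==> n \<le> betti_number k X" by auto
 moreover obtain Z where "homology_independent k X Z" "card Z = betti_number k X"
  using \<open>betti_number k X \<in> S\<close> A unfolding S_def by force
 moreover have "card Z' \<in> S" if "homology_independent k X Z'" for Z'
  using B[OF that] unfolding S_def by (metis (mono_tags, lifting) mem_Collect_eq)
 ultimately show thesis using that by metis
qed

text \<open>The functions \<open>l z\<close> are the rational dual basis of \<open>Z\<close> on
  homology, pulled back to cycles. The last clause keeps all chains integral: some nonzero multiple
  of a cycle is an integral combination of \<open>Z\<close> up to a boundary.\<close>

definition homology_coordinates :: "nat => 'a topology => 'a chain set => ('a chain => 'a chain => rat) => bool" where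
 "homology_coordinates k X Z l \<longleftrightarrow>
  (\<forall>z\<in>Z. \<forall>x y. singular_relcycle k X {} x --> singular_relcycle k X {} y --> l z (x + y) = l z x + l z y) \<and>
  (\<forall>z\<in>Z. \<forall>x n. singular_relcycle k X {} x --> l z (frag_cmul n x) = of_int n * l z x) \<and>
  (\<forall>z\<in>Z. \<forall>x. singular_relboundary k X {} x --> l z x = 0) \<and>
  (\<forall>z\<in>Z. \<forall>z'\<in>Z. l z z' = (if z = z' then 1 else 0)) \<and>
  (\<forall>x. singular_relcycle k X {} x --> (\<exists>n a. n \<noteq> 0 \<and> (\<forall>z\<in>Z. of_int (a z) = of_int n * l z x)
   \<and> singular_relboundary k X {} (frag_cmul n x - (\<Sum>z\<in>Z. frag_cmul (a z) z))))"

text \<open>By maximality every further cycle \<open>x\<close> satisfies a relation whose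
  coefficient \<open>n\<close> at \<open>x\<close> is nonzero, and the coordinates are the quotients
  \<open>a z / n\<close>. Independence of \<open>Z\<close> makes two relations for the same
  \<open>x\<close> proportional, so the quotients do not depend on the relation.\<close>

lemma homology_coordinates_exist:
 assumes Z: "homology_independent k X Z"
  and max: "\<And>Z'. homology_independent k X Z' ==> card Z' \<le> card Z"
 shows "\<exists>l. homology_coordinates k X Z l"
proof -
 have fZ: "finite Z" "Z \<subseteq> singular_relcycle_set k X {}"
   and ind: "\<And>c :: 'a chain => int. singular_relboundary k X {} (\<Sum>z\<in>Z. frag_cmul (c z) z) ==> \<forall>z\<in>Z. c z = 0"
   using Z by (auto simp: homology_independent_def)
 define rep where "rep x n a \<longleftrightarrow> n \<noteq> 0 \<and> singular_relboundary k X {} (frag_cmul n x - (\<Sum>z\<in>Z. frag_cmul (a z) z))" for x and n :: int and a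
 have ex: "\<exists>n a. rep x n a" if x: "singular_relcycle k X {} x" for x
 proof (cases "x \<in> Z")
  \<comment> \<open>Inserting an element of \<open>Z\<close> does not enlarge the set, so maximality
    says nothing here and the relation is given outright.\<close>
  case True
  have "(\<Sum>z\<in>Z. frag_cmul (if z = x then 1 else 0) z) = (\<Sum>z\<in>Z. if z = x then z else 0)"
   by (intro sum.cong) auto
  also have "\<dots> = x" using True fZ by simp
  finally show ?thesis unfolding rep_def
   by (intro exI[of _ 1] exI[of _ "\<lambda>z. if z = x then 1 else 0"]) simp
 next
  case False
  have "\<not> homology_independent k X (insert x Z)"
   using max[of "insert x Z"] False fZ by auto
  then obtain c where c: "singular_relboundary k X {} (\<Sum>z\<in>insert x Z. frag_cmul (c z) z)" "\<exists>z\<in>insert x Z. c z \<noteq> 0"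
   using fZ x unfolding homology_independent_def by auto
  have 1: "(\<Sum>z\<in>insert x Z. frag_cmul (c z) z) = frag_cmul (c x) x + (\<Sum>z\<in>Z. frag_cmul (c z) z)"
   using False fZ by simp
  have "c x \<noteq> 0"
  proof
   assume "c x = 0"
   hence "singular_relboundary k X {} (\<Sum>z\<in>Z. frag_cmul (c z) z)" using c(1) 1 by simp
   from ind[OF this] c(2) \<open>c x = 0\<close> show False by auto
  qed
  moreover have "(\<Sum>z\<in>Z. frag_cmul (- c z) z) = - (\<Sum>z\<in>Z. frag_cmul (c z) z)"
   by (simp add: sum_negf[symmetric])
  ultimately show ?thesis using c(1) unfolding rep_def 1
   by (intro exI[of _ "c x"] exI[of _ "\<lambda>z. - c z"]) simp
 qed
 have uniq: "n' * a z = n * a' z" if r: "rep x n a" "rep x n' a'" and z: "z \<in> Z" for x n a n' a' z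
 proof -
  have "singular_relboundary k X {} (frag_cmul n (frag_cmul n' x - (\<Sum>z\<in>Z. frag_cmul (a' z) z)) - frag_cmul n' (frag_cmul n x - (\<Sum>z\<in>Z. frag_cmul (a z) z)))"
   using r unfolding rep_def by (blast intro: singular_relboundary_diff[OF singular_relboundary_cmul singular_relboundary_cmul])
  moreover have "frag_cmul n (frag_cmul n' x - (\<Sum>z\<in>Z. frag_cmul (a' z) z)) - frag_cmul n' (frag_cmul n x - (\<Sum>z\<in>Z. frag_cmul (a z) z))
   = (\<Sum>z\<in>Z. frag_cmul (n' * a z - n * a' z) z)"
   by (rule poly_mapping_eqI) (simp add: lookup_minus lookup_sum algebra_simps sum_distrib_left sum_subtractf)
  ultimately show ?thesis using ind[of "\<lambda>z. n' * a z - n * a' z"] z by simp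
 qed
 define l :: "'a chain => 'a chain => rat" where
  "l z x = (let (n, a) = (SOME p. rep x (fst p) (snd p)) in of_int (a z) / of_int n)" for z x
 have l: "l z x = of_int (a z) / of_int n" if r: "rep x n a" and z: "z \<in> Z" for x n a z
 proof -
  obtain n' a' where na: "(SOME p. rep x (fst p) (snd p)) = (n', a')" by fastforce
  have "rep x n' a'" using someI[of "\<lambda>p. rep x (fst p) (snd p)" "(n, a)"] r na by simp
  from uniq[OF r this z] have "of_int n' * of_int (a z) = of_int n * (of_int (a' z) :: rat)"
   by (metis of_int_mult)
  moreover have "n \<noteq> 0" "n' \<noteq> 0" using r \<open>rep x n' a'\<close> by (auto simp: rep_def)
  ultimately show ?thesis by (simp add: l_def na field_simps)
 qed
 have add: "l z (x + y) = l z x + l z y" if xy: "singular_relcycle k X {} x" "singular_relcycle k X {} y" and z: "z \<in> Z" for z x y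
 proof -
  obtain n a m b where r: "rep x n a" "rep y m b" using ex[OF xy(1)] ex[OF xy(2)] by blast
  have "singular_relboundary k X {} (frag_cmul m (frag_cmul n x - (\<Sum>z\<in>Z. frag_cmul (a z) z)) + frag_cmul n (frag_cmul m y - (\<Sum>z\<in>Z. frag_cmul (b z) z)))"
   using r unfolding rep_def by (blast intro: singular_relboundary_add[OF singular_relboundary_cmul singular_relboundary_cmul])
  moreover have "frag_cmul m (frag_cmul n x - (\<Sum>z\<in>Z. frag_cmul (a z) z)) + frag_cmul n (frag_cmul m y - (\<Sum>z\<in>Z. frag_cmul (b z) z))
   = frag_cmul (n * m) (x + y) - (\<Sum>z\<in>Z. frag_cmul (m * a z + n * b z) z)"
   by (rule poly_mapping_eqI) (simp add: lookup_minus lookup_add lookup_sum algebra_simps sum_distrib_left sum.distrib)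
  ultimately have "rep (x + y) (n * m) (\<lambda>z. m * a z + n * b z)" using r by (simp add: rep_def)
  moreover have "n \<noteq> 0" "m \<noteq> 0" using r by (auto simp: rep_def)
  ultimately show ?thesis using l[OF r(1) z] l[OF r(2) z] l[OF _ z] by (simp add: field_simps)
 qed
 have cmul: "l z (frag_cmul q x) = of_int q * l z x" if x: "singular_relcycle k X {} x" and z: "z \<in> Z" for z x q
 proof -
  obtain n a where r: "rep x n a" using ex[OF x] by blast
  have "singular_relboundary k X {} (frag_cmul q (frag_cmul n x - (\<Sum>z\<in>Z. frag_cmul (a z) z)))"
   using r by (intro singular_relboundary_cmul) (auto simp: rep_def)
  moreover have "frag_cmul q (frag_cmul n x - (\<Sum>z\<in>Z. frag_cmul (a z) z)) = frag_cmul n (frag_cmul q x) - (\<Sum>z\<in>Z. frag_cmul (q * a z) z)"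
   by (rule poly_mapping_eqI) (simp add: lookup_minus lookup_sum algebra_simps sum_distrib_left)
  ultimately have "rep (frag_cmul q x) n (\<lambda>z. q * a z)" using r by (simp add: rep_def)
  from l[OF this z] l[OF r z] show ?thesis by simp
 qed
 have bd: "l z x = 0" if "singular_relboundary k X {} x" "z \<in> Z" for z x
  using l[of x 1 "\<lambda>_. 0" z] that by (simp add: rep_def)
 have delta: "l z z' = (if z = z' then 1 else 0)" if "z \<in> Z" "z' \<in> Z" for z z'
 proof -
  have "(\<Sum>z\<in>Z. frag_cmul (if z = z' then 1 else 0) z) = (\<Sum>z\<in>Z. if z = z' then z else 0)"
   by (intro sum.cong) auto
  also have "\<dots> = z'" using that fZ by simp
  finally have "rep z' 1 (\<lambda>z. if z = z' then 1 else 0)" by (simp add: rep_def)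
  from l[OF this that(1)] show ?thesis by simp
 qed
 have co: "\<exists>n a. n \<noteq> 0 \<and> (\<forall>z\<in>Z. of_int (a z) = of_int n * l z x)
   \<and> singular_relboundary k X {} (frag_cmul n x - (\<Sum>z\<in>Z. frag_cmul (a z) z))" if x: "singular_relcycle k X {} x" for x
 proof -
  obtain n a where r: "rep x n a" using ex[OF x] by blast
  thus ?thesis using l[OF r] by (intro exI[of _ n] exI[of _ a]) (auto simp: rep_def)
 qed
 show ?thesis unfolding homology_coordinates_def
  by (intro exI[of _ l] conjI allI impI ballI; rule add cmul bd delta co; assumption)
qed

lemma isomorphic_groups_int_independent:
 assumes "group_hom G H f" and f: "f \<in> iso G H" and "comm_group G" "comm_group H"
  and B: "finite B" "B \<subseteq> carrier G" "int_independent G B"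
 shows "int_independent H (f ` B)"
proof -
 interpret G: comm_group G by fact
 interpret H: comm_group H by fact
 interpret group_hom G H f by fact
 have inj: "inj_on f (carrier G)" using f by (auto simp: iso_def bij_betw_def)
 have injB: "inj_on f B" using inj B(2) by (rule inj_on_subset)
 have cl: "b [^]\<^bsub>G\<^esub> (n::int) \<in> carrier G" "f b [^]\<^bsub>H\<^esub> n \<in> carrier H" if "b \<in> B" for b n
  using that B(2) by (auto intro!: G.int_pow_closed H.int_pow_closed)
 show ?thesis unfolding int_independent_def
 proof (intro allI impI)
  fix c :: "_ => int" assume 0: "finprod H (\<lambda>b. b [^]\<^bsub>H\<^esub> c b) (f ` B) = \<one>\<^bsub>H\<^esub>"
  have prod: "f (finprod G (\<lambda>b. b [^]\<^bsub>G\<^esub> c (f b)) B') = finprod H (\<lambda>b. f b [^]\<^bsub>H\<^esub> c (f b)) B'" if "B' \<subseteq> B" "finite B'" for B'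
   using that(2,1)
  proof (induction B')
   case (insert b B')
   have b: "b \<in> carrier G" "b \<in> B" "B' \<subseteq> B" using insert.prems B by auto
   have "finprod G (\<lambda>b. b [^]\<^bsub>G\<^esub> c (f b)) B' \<in> carrier G"
   using cl b by (intro G.finprod_closed) auto
   moreover have "finprod G (\<lambda>b. b [^]\<^bsub>G\<^esub> c (f b)) (insert b B') = b [^]\<^bsub>G\<^esub> c (f b) \<otimes>\<^bsub>G\<^esub> finprod G (\<lambda>b. b [^]\<^bsub>G\<^esub> c (f b)) B'"
   using cl b insert.hyps by (intro G.finprod_insert) auto
   moreover have "finprod H (\<lambda>b. f b [^]\<^bsub>H\<^esub> c (f b)) (insert b B') = f b [^]\<^bsub>H\<^esub> c (f b) \<otimes>\<^bsub>H\<^esub> finprod H (\<lambda>b. f b [^]\<^bsub>H\<^esub> c (f b)) B'"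
   using cl b insert.hyps by (intro H.finprod_insert) auto
   ultimately show ?case using insert.IH[OF b(3)] b cl by (simp add: hom_int_pow)
  qed simp
  have "finprod H (\<lambda>b. b [^]\<^bsub>H\<^esub> c b) (f ` B) = finprod H (\<lambda>b. f b [^]\<^bsub>H\<^esub> c (f b)) B"
   using cl(2) injB by (intro H.finprod_reindex) (auto simp: Pi_iff)
  with 0 prod[OF order_refl B(1)] have "f (finprod G (\<lambda>b. b [^]\<^bsub>G\<^esub> c (f b)) B) = f \<one>\<^bsub>G\<^esub>" by simp
  hence "finprod G (\<lambda>b. b [^]\<^bsub>G\<^esub> c (f b)) B = \<one>\<^bsub>G\<^esub>"
   using cl(1) by (intro inj_onD[OF inj]) (auto intro!: G.finprod_closed)
  hence "\<forall>b\<in>B. c (f b) = 0" using B(3)[unfolded int_independent_def, THEN spec, of "\<lambda>b. c (f b)"] by simp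
  thus "\<forall>b\<in>f ` B. c b = 0" by simp
 qed
qed

lemma isomorphic_groups_abelian_rank:
 assumes "comm_group G" "comm_group H" "G \<cong> H"
 shows "abelian_rank G = abelian_rank H"
proof -
 have half: "{card B | B. finite B \<and> B \<subseteq> carrier G \<and> int_independent G B} \<subseteq> {card B | B. finite B \<and> B \<subseteq> carrier H \<and> int_independent H B}"
  if c: "comm_group G" "comm_group H" and i: "G \<cong> H" for G :: "('x,'y) monoid_scheme" and H :: "('z,'w) monoid_scheme"
 proof clarify
  fix B assume B: "finite B" "B \<subseteq> carrier G" "int_independent G B"
  obtain f where f: "f \<in> iso G H" using i by (auto simp: is_iso_def)
  have gh: "group_hom G H f" using c f by (auto simp: group_hom_def group_hom_axioms_def comm_group_def iso_def)
  have "inj_on f B" using f B(2) by (auto simp: iso_def bij_betw_def intro: inj_on_subset)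
  moreover have "f ` B \<subseteq> carrier H" using f B(2) by (auto simp: iso_def bij_betw_def)
  ultimately show "\<exists>Ba. card B = card Ba \<and> finite Ba \<and> Ba \<subseteq> carrier H \<and> int_independent H Ba"
   using isomorphic_groups_int_independent[OF gh f c B] B(1) card_image by (intro exI[of _ "f ` B"]) (auto simp: card_image)
 qed
 have "H \<cong> G" using assms by (simp add: group.iso_sym comm_group_def)
 thus ?thesis unfolding abelian_rank_def using half[OF assms] half[OF assms(2,1)] by (metis (no_types, lifting) subset_antisym)
qed

text \<open>This moves the hypothesis on \<open>M\<close> to a homeomorphic compact set of real
  sequences, where a metric is at hand.\<close>

lemma homeomorphic_space_euler_characteristic:
 assumes "X homeomorphic_space Y"
 shows "euler_characteristic X = euler_characteristic Y"
proof -
 have "betti_number k X = betti_number k Y" for k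
  unfolding betti_number_def
  by (intro isomorphic_groups_abelian_rank abelian_homology_group homeomorphic_space_imp_isomorphic_homology_groups assms)
 thus ?thesis by (simp add: euler_characteristic_def)
qed

section \<open>Nerves of covers\<close>

abbreviation fpre :: "'s => ('s list \<Rightarrow>\<^sub>0 int) => ('s list \<Rightarrow>\<^sub>0 int)" where
 "fpre x \<equiv> frag_extend (\<lambda>l. frag_of (x # l))"

text \<open>The alternating sum of deletions, by recursion on the first entry. A list of one entry
  is sent to the empty list, so this is the augmented boundary.\<close>

primrec flag_boundary :: "'s list => ('s list \<Rightarrow>\<^sub>0 int)" where
 "flag_boundary [] = 0"
| "flag_boundary (x # xs) = frag_of xs - fpre x (flag_boundary xs)"

lemma flag_boundary_fpre:
 "frag_extend flag_boundary (fpre x c) = c - fpre x (frag_extend flag_boundary c)"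
 by (rule frag_induction[of c UNIV]) (auto simp: frag_extend_diff)

lemma flag_boundary_boundary: "frag_extend flag_boundary (flag_boundary l) = 0"
 by (induction l) (auto simp: frag_extend_diff flag_boundary_fpre)

lemma keys_flag_boundary:
 "l' \<in> Poly_Mapping.keys (flag_boundary l) ==>
  Suc (length l') = length l \<and> set l' \<subseteq> set l \<and> (sorted_wrt P l --> sorted_wrt P l')"
proof (induction l arbitrary: l')
 case (Cons x xs)
 have "Poly_Mapping.keys (flag_boundary (x # xs)) \<subseteq> {xs} \<union> (\<Union>m\<in>Poly_Mapping.keys (flag_boundary xs). {x # m})"
  using keys_diff[of "frag_of xs" "fpre x (flag_boundary xs)"] keys_frag_extend[of "\<lambda>l. frag_of (x # l)" "flag_boundary xs"]
  by (auto simp: keys_frag_of)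
 then consider "l' = xs" | m where "m \<in> Poly_Mapping.keys (flag_boundary xs)" "l' = x # m"
  using Cons.prems by blast
 thus ?case
 proof cases
  case 2
  thus ?thesis using Cons.IH[OF 2(1)] by auto
 qed auto
qed simp

text \<open>The cone with apex \<open>s\<close> in normalised form: a list that already starts with
  \<open>s\<close> would become degenerate and is sent to 0.\<close>

definition flag_cone :: "'s => ('s list \<Rightarrow>\<^sub>0 int) => ('s list \<Rightarrow>\<^sub>0 int)" where
 "flag_cone s = frag_extend (\<lambda>l. if l \<noteq> [] \<and> hd l = s then 0 else frag_of (s # l))"

lemma flag_cone_fpre [simp]: "flag_cone s (fpre s c) = 0"
 unfolding flag_cone_def by (rule frag_induction[of c UNIV]) (auto simp: frag_extend_diff)

lemma flag_cone_eq_fpre: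
 assumes "\<And>l. l \<in> Poly_Mapping.keys c ==> l = [] \<or> hd l \<noteq> s"
 shows "flag_cone s c = fpre s c"
 unfolding flag_cone_def using assms by (intro frag_extend_eq) auto

lemma flag_cone_diff: "flag_cone s (a - b) = flag_cone s a - flag_cone s b"
 by (simp add: flag_cone_def frag_extend_diff)

lemma flag_cone_0 [simp]: "flag_cone s 0 = 0"
 by (simp add: flag_cone_def)

text \<open>The cone formula in augmented form. It survives the normalisation as long as
  \<open>s\<close> occurs at most at the head: a list with head \<open>s\<close> equals the cone
  over its own boundary, so both sides vanish.\<close>

lemma flag_boundary_cone:
 assumes "Poly_Mapping.keys c \<subseteq> {l. s \<notin> set (tl l)}"
 shows "frag_extend flag_boundary (flag_cone s c) = c - flag_cone s (frag_extend flag_boundary c)"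
 using assms
proof (induction c rule: frag_induction)
 case (one l)
 show ?case
 proof (cases l)
  case Nil
  thus ?thesis by (simp add: flag_cone_def)
 next
  case (Cons x xs)
  show ?thesis
  proof (cases "x = s")
   case True
   have "flag_cone s (frag_of xs) = frag_of (s # xs)"
   using one Cons by (cases xs) (auto simp: flag_cone_def)
   thus ?thesis using Cons True by (simp add: flag_cone_diff) (simp add: flag_cone_def)
  next
   case False
   have "flag_cone s (flag_boundary l) = fpre s (flag_boundary l)"
   proof (rule flag_cone_eq_fpre)
   fix l' assume "l' \<in> Poly_Mapping.keys (flag_boundary l)"
   hence "set l' \<subseteq> set l" using keys_flag_boundary by blast
   thus "l' = [] \<or> hd l' \<noteq> s"
   using one Cons False by (cases l') auto
   qed
   moreover have "flag_cone s (frag_of l) = frag_of (s # l)"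
   using Cons False by (simp add: flag_cone_def)
   ultimately show ?thesis by simp
  qed
 qed
qed (auto simp: flag_cone_diff frag_extend_diff)

text \<open>The natural map from singular simplices to the barycentric subdivision of the nerve. The
  apex \<open>sel k \<sigma>\<close> will be the set of all cover members that
  \<open>\<sigma>\<close> meets; taking all of them avoids a choice and makes the apex grow with the
  simplex.\<close>

primrec nerve_map :: "(nat => ((nat => real) => 'a) => 's) => nat => ((nat => real) => 'a) => ('s list \<Rightarrow>\<^sub>0 int)" where
 "nerve_map sel 0 \<sigma> = frag_of [sel 0 \<sigma>]"
| "nerve_map sel (Suc k) \<sigma> = flag_cone (sel (Suc k) \<sigma>) (frag_extend (nerve_map sel k) (chain_boundary (Suc k) (frag_of \<sigma>)))"

lemma keys_chain_boundary_of:
 "f \<in> Poly_Mapping.keys (chain_boundary (Suc k) (frag_of \<sigma>)) ==> \<exists>i\<le>Suc k. f = singular_face (Suc k) i \<sigma>"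
proof -
 assume f: "f \<in> Poly_Mapping.keys (chain_boundary (Suc k) (frag_of \<sigma>))"
 have "Poly_Mapping.keys (chain_boundary (Suc k) (frag_of \<sigma>)) \<subseteq> (\<Union>i\<in>{..Suc k}. Poly_Mapping.keys (frag_cmul ((-1) ^ i) (frag_of (singular_face (Suc k) i \<sigma>))))"
  unfolding chain_boundary_of using keys_sum by fastforce
 then obtain i where "i \<le> Suc k" "f \<in> Poly_Mapping.keys (frag_cmul ((-1) ^ i) (frag_of (singular_face (Suc k) i \<sigma>)))"
  using f by auto
 thus ?thesis by (auto simp: keys_frag_of)
qed

lemma singular_face_image:
 assumes "i \<le> Suc k"
 shows "singular_face (Suc k) i \<sigma> ` standard_simplex k \<subseteq> \<sigma> ` standard_simplex (Suc k)"
 using simplical_face_in_standard_simplex[of "Suc k" i] assms by (auto simp: singular_face_def)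

context
 fixes X :: "'a topology" and A :: "'i => 'a set" and I :: "'i set" and sel
 defines "sel \<equiv> \<lambda>k \<sigma>. {i \<in> I. A i \<inter> \<sigma> ` standard_simplex k \<noteq> {}}"
 assumes cover: "topspace X \<subseteq> (\<Union>i\<in>I. A i)"
begin

text \<open>A face meets no more members of the cover than its simplex, so \<open>sel\<close>
  decreases along faces; where it fails to decrease strictly, the normalised cone has removed the
  list.\<close>

lemma keys_nerve_map:
 assumes "singular_simplex k X \<sigma>" "l \<in> Poly_Mapping.keys (nerve_map sel k \<sigma>)"
 shows "length l = Suc k \<and> sorted_wrt (\<lambda>s t. t \<subset> s) l \<and> hd l \<subseteq> sel k \<sigma> \<and> {} \<notin> set l"
 using assms
proof (induction k arbitrary: \<sigma> l)
 have ne: "sel k \<sigma> \<noteq> {}" if \<sigma>: "singular_simplex k X \<sigma>" for k \<sigma>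
 proof -
  obtain v where "v \<in> standard_simplex k" using nonempty_standard_simplex by blast
  hence "\<sigma> v \<in> topspace X" using \<sigma> by (auto simp: singular_simplex_def continuous_map_def)
  then obtain i where "i \<in> I" "\<sigma> v \<in> A i" using cover by auto
  hence "i \<in> sel k \<sigma>" using \<open>v \<in> standard_simplex k\<close> unfolding sel_def by auto
  thus ?thesis by auto
 qed
 {
  case 0
  thus ?case using ne[of 0 \<sigma>] by (simp add: keys_frag_of)
 next
  case (Suc k)
  let ?s = "sel (Suc k) \<sigma>" and ?c = "frag_extend (nerve_map sel k) (chain_boundary (Suc k) (frag_of \<sigma>))"
  obtain m where m: "m \<in> Poly_Mapping.keys ?c" "l = ?s # m" "\<not> (m \<noteq> [] \<and> hd m = ?s)"
   using Suc.prems(2) keys_frag_extend[of "\<lambda>l. if l \<noteq> [] \<and> hd l = ?s then 0 else frag_of (?s # l)" ?c]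
   by (auto simp: flag_cone_def keys_frag_of split: if_splits)
  then obtain f where f: "f \<in> Poly_Mapping.keys (chain_boundary (Suc k) (frag_of \<sigma>))" "m \<in> Poly_Mapping.keys (nerve_map sel k f)"
   using keys_frag_extend[of "nerve_map sel k" "chain_boundary (Suc k) (frag_of \<sigma>)"] by blast
  obtain i where i: "i \<le> Suc k" "f = singular_face (Suc k) i \<sigma>" using keys_chain_boundary_of f(1) by metis
  have sf: "singular_simplex k X f" using i Suc.prems(1) singular_simplex_singular_face[of "Suc k" X \<sigma> i] by simp
  have IH: "length m = Suc k" "sorted_wrt (\<lambda>s t. t \<subset> s) m" "hd m \<subseteq> sel k f" "{} \<notin> set m"
   using Suc.IH[OF sf f(2)] by auto
  have "sel k f \<subseteq> ?s" using singular_face_image[OF i(1), of \<sigma>] i(2) by (auto simp: sel_def)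
  hence "hd m \<subset> ?s" using IH m(3) by (cases m) auto
  hence "\<forall>t\<in>set m. t \<subset> ?s" using IH(2) by (cases m) auto
  thus ?case using m(2) IH ne[OF Suc.prems(1)] by auto
 }
qed

text \<open>The cone formula leaves the boundary of the inner chain as error. It vanishes by
  induction and because the singular boundary squares to zero; for an edge it is the empty list
  minus itself.\<close>

lemma flag_boundary_nerve_map:
 "singular_simplex (Suc k) X \<sigma> ==>
  frag_extend flag_boundary (nerve_map sel (Suc k) \<sigma>) = frag_extend (nerve_map sel k) (chain_boundary (Suc k) (frag_of \<sigma>))"
proof (induction k arbitrary: \<sigma>)
 have key: "frag_extend flag_boundary (nerve_map sel (Suc k) \<sigma>) = frag_extend (nerve_map sel k) (chain_boundary (Suc k) (frag_of \<sigma>))"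
  if \<sigma>: "singular_simplex (Suc k) X \<sigma>"
   and z: "frag_extend flag_boundary (frag_extend (nerve_map sel k) (chain_boundary (Suc k) (frag_of \<sigma>)))
   \<in> {0, frag_of [] - frag_of []}" for k \<sigma>
 proof -
  let ?c = "frag_extend (nerve_map sel k) (chain_boundary (Suc k) (frag_of \<sigma>))"
  have "Poly_Mapping.keys ?c \<subseteq> {l. sel (Suc k) \<sigma> \<notin> set (tl l)}"
  proof
   fix m assume "m \<in> Poly_Mapping.keys ?c"
   then obtain f where f: "f \<in> Poly_Mapping.keys (chain_boundary (Suc k) (frag_of \<sigma>))" "m \<in> Poly_Mapping.keys (nerve_map sel k f)"
   using keys_frag_extend[of "nerve_map sel k" "chain_boundary (Suc k) (frag_of \<sigma>)"] by blast
   obtain i where i: "i \<le> Suc k" "f = singular_face (Suc k) i \<sigma>" using keys_chain_boundary_of f(1) by metis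
   have sf: "singular_simplex k X f" using i \<sigma> singular_simplex_singular_face[of "Suc k" X \<sigma> i] by simp
   have IH: "sorted_wrt (\<lambda>s t. t \<subset> s) m" "hd m \<subseteq> sel k f"
   using keys_nerve_map[OF sf f(2)] by auto
   have "sel k f \<subseteq> sel (Suc k) \<sigma>" using singular_face_image[OF i(1), of \<sigma>] i(2) by (auto simp: sel_def)
   thus "m \<in> {l. sel (Suc k) \<sigma> \<notin> set (tl l)}" using IH by (cases m) (auto dest!: bspec)
  qed
  from flag_boundary_cone[OF this] z show ?thesis by simp
 qed
 {
  case 0
  have "chain_boundary (Suc 0) (frag_of \<sigma>) = frag_of (singular_face (Suc 0) 0 \<sigma>) - frag_of (singular_face (Suc 0) (Suc 0) \<sigma>)"
   by (simp add: chain_boundary_of)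
  thus ?case using key[OF 0] by (simp add: frag_extend_diff)
 next
  case (Suc k)
  let ?b = "chain_boundary (Suc (Suc k)) (frag_of \<sigma>)"
  have sc: "singular_chain (Suc k) X ?b"
   using Suc.prems singular_chain_boundary[of "Suc (Suc k)" X "frag_of \<sigma>"] by (simp add: singular_chain_of)
  have "frag_extend flag_boundary (frag_extend (nerve_map sel (Suc k)) c) = frag_extend (nerve_map sel k) (chain_boundary (Suc k) c)"
   if "singular_chain (Suc k) X c" for c
   using that unfolding singular_chain_def
   by (induction c rule: frag_induction) (auto simp: frag_extend_diff chain_boundary_diff Suc.IH simp del: nerve_map.simps)
  from this[OF sc] have "frag_extend flag_boundary (frag_extend (nerve_map sel (Suc k)) ?b) = 0"
   using chain_boundary_boundary_alt[of "Suc k" X "frag_of \<sigma>"] Suc.prems by (simp add: singular_chain_of)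
  thus ?case by (intro key[OF Suc.prems]) simp
 }
qed

lemma flag_boundary_nerve_map_chain:
 "singular_chain (Suc k) X c ==>
  frag_extend flag_boundary (frag_extend (nerve_map sel (Suc k)) c) = frag_extend (nerve_map sel k) (chain_boundary (Suc k) c)"
 unfolding singular_chain_def
 by (induction c rule: frag_induction) (auto simp: frag_extend_diff chain_boundary_diff flag_boundary_nerve_map simp del: nerve_map.simps)

end

section \<open>Acyclic carriers, with metric balls as carriers\<close>

definition augment :: "('b \<Rightarrow>\<^sub>0 int) => (unit \<Rightarrow>\<^sub>0 int)" where
 "augment = frag_extend (\<lambda>_. frag_of ())"

lemma augment_simps [simp]:
 "augment 0 = 0" "augment (frag_of x) = frag_of ()" "augment (a + b) = augment a + augment b"
 "augment (a - b) = augment a - augment b" "augment (frag_cmul n a) = frag_cmul n (augment a)" "augment (- a) = - augment a"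
 by (simp_all add: augment_def frag_extend_add frag_extend_diff frag_extend_cmul frag_extend_minus)

text \<open>Local acyclicity in metric form, uniform over the centre. In degree 0 a vanishing
  coefficient sum replaces the cycle condition, so this concerns reduced homology.\<close>

definition acyclic_balls :: "'b::metric_space set => real => real => bool" where
 "acyclic_balls S r r' \<longleftrightarrow> (\<forall>x\<in>S. \<forall>k c. singular_chain k (top_of_set (S \<inter> ball x r)) c \<and>
  (if k = 0 then augment c = 0 else chain_boundary k c = 0) -->
  (\<exists>d. singular_chain (Suc k) (top_of_set (S \<inter> ball x r')) d \<and> chain_boundary (Suc k) d = c))"

lemma singular_chain_frag_extend:
 assumes "Poly_Mapping.keys c \<subseteq> A" "\<And>i. i \<in> A ==> singular_chain k X (f i)"
 shows "singular_chain k X (frag_extend f c)"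
 unfolding singular_chain_def
 using keys_frag_extend[of f c] assms unfolding singular_chain_def by blast

lemma chain_boundary_frag_extend:
 "chain_boundary k (frag_extend f c) = frag_extend (\<lambda>i. chain_boundary k (f i)) c"
 by (rule frag_induction[of c UNIV]) (auto simp: chain_boundary_diff frag_extend_diff)

lemma top_of_set_chain_mono:
 "singular_chain k (top_of_set U) c ==> U \<subseteq> V ==> singular_chain k (top_of_set V) c"
 by (rule singular_chain_mono)

text \<open>The chains \<open>H\<close> are built degree by degree: the prescribed boundary is a
  cycle by \<open>Qb\<close> and by the identity one degree below, and it lies in a ball where
  \<open>acy\<close> fills it. The factor 2 on the radius arises because the fillings over the faces
  of \<open>e\<close> live in balls around other centres. With \<open>c = 1\<close> this realises a
  complex by singular chains; with \<open>c = -1\<close> it yields a chain homotopy for the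
  difference \<open>Q\<close>.\<close>

theorem acyclic_carriers:
 fixes S :: "'b::metric_space set" and G :: "nat => 'e set" and bd :: "nat => 'e => ('e \<Rightarrow>\<^sub>0 int)"
  and Q :: "nat => 'e => 'b chain" and ctr :: "nat => 'e => 'b" and \<rho> :: "nat => real" and c :: int
 assumes ctr: "\<And>k e. k \<le> R ==> e \<in> G k ==> ctr k e \<in> S"
  and kbd: "\<And>k e. Suc k \<le> R ==> e \<in> G (Suc k) ==> Poly_Mapping.keys (bd (Suc k) e) \<subseteq> {e' \<in> G k. dist (ctr (Suc k) e) (ctr k e') \<le> \<rho> 0}"
  and bb: "\<And>k e. Suc (Suc k) \<le> R ==> e \<in> G (Suc (Suc k)) ==> frag_extend (bd (Suc k)) (bd (Suc (Suc k)) e) = 0"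
  and Qch: "\<And>k e. k \<le> R ==> e \<in> G k ==> singular_chain k (top_of_set (S \<inter> ball (ctr k e) (\<rho> 0))) (Q k e)"
  and Q0: "\<And>e. e \<in> G 0 ==> augment (Q 0 e) = 0"
  and Qb: "\<And>k e. Suc k \<le> R ==> e \<in> G (Suc k) ==> chain_boundary (Suc k) (Q (Suc k) e) + frag_cmul c (frag_extend (Q k) (bd (Suc k) e)) = 0"
  and acy: "\<And>k. k \<le> R ==> acyclic_balls S (2 * \<rho> k) (\<rho> (Suc k))"
  and \<rho>: "\<And>k. k \<le> R ==> 0 < \<rho> 0 \<and> \<rho> 0 \<le> \<rho> k"
 shows "\<exists>H. \<forall>k\<le>R. \<forall>e\<in>G k. singular_chain (Suc k) (top_of_set (S \<inter> ball (ctr k e) (\<rho> (Suc k)))) (H k e) \<and>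
  chain_boundary (Suc k) (H k e) = Q k e + (if k = 0 then 0 else frag_cmul c (frag_extend (H (k - 1)) (bd k e)))"
proof -
 define pick where "pick k x z = (SOME d. singular_chain (Suc k) (top_of_set (S \<inter> ball x (\<rho> (Suc k)))) d \<and> chain_boundary (Suc k) d = z)" for k x z
 have pick: "singular_chain (Suc k) (top_of_set (S \<inter> ball x (\<rho> (Suc k)))) (pick k x z) \<and> chain_boundary (Suc k) (pick k x z) = z"
  if "x \<in> S" "k \<le> R" "singular_chain k (top_of_set (S \<inter> ball x (2 * \<rho> k))) z" "if k = 0 then augment z = 0 else chain_boundary k z = 0" for x k z
  unfolding pick_def by (rule someI_ex) (use acy[OF that(2)] that in \<open>auto simp: acyclic_balls_def\<close>)
 define H where "H = rec_nat (\<lambda>e. pick 0 (ctr 0 e) (Q 0 e)) (\<lambda>k Hk e. pick (Suc k) (ctr (Suc k) e) (Q (Suc k) e + frag_cmul c (frag_extend Hk (bd (Suc k) e))))"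
 have H0: "H 0 e = pick 0 (ctr 0 e) (Q 0 e)" for e by (simp add: H_def)
 have HS: "H (Suc k) e = pick (Suc k) (ctr (Suc k) e) (Q (Suc k) e + frag_cmul c (frag_extend (H k) (bd (Suc k) e)))" for k e
  by (simp add: H_def)
 have Q2: "singular_chain k (top_of_set (S \<inter> ball (ctr k e) (2 * \<rho> k))) (Q k e)" if "k \<le> R" "e \<in> G k" for k e
  by (rule top_of_set_chain_mono[OF Qch[OF that]]) (use \<rho>[OF that(1)] in auto)
 have "\<forall>e\<in>G k. singular_chain (Suc k) (top_of_set (S \<inter> ball (ctr k e) (\<rho> (Suc k)))) (H k e) \<and>
  chain_boundary (Suc k) (H k e) = Q k e + (if k = 0 then 0 else frag_cmul c (frag_extend (H (k - 1)) (bd k e)))" if "k \<le> R" for k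
  using that
 proof (induction k)
  case 0
  show ?case using pick[OF ctr[OF 0] 0 Q2[OF 0]] Q0 by (auto simp: H0)
 next
  case (Suc k)
  hence kR: "k \<le> R" by simp
  note IH = Suc.IH[OF kR]
  show ?case
  proof
   fix e assume e: "e \<in> G (Suc k)"
   let ?z = "Q (Suc k) e + frag_cmul c (frag_extend (H k) (bd (Suc k) e))"
   have kb: "e' \<in> G k" "dist (ctr (Suc k) e) (ctr k e') \<le> \<rho> 0" if "e' \<in> Poly_Mapping.keys (bd (Suc k) e)" for e'
   using kbd[OF Suc.prems e] that by auto
   have hc: "singular_chain (Suc k) (top_of_set (S \<inter> ball (ctr (Suc k) e) (2 * \<rho> (Suc k)))) (H k e')"
   if e': "e' \<in> Poly_Mapping.keys (bd (Suc k) e)" for e'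
   proof (rule top_of_set_chain_mono)
   show "singular_chain (Suc k) (top_of_set (S \<inter> ball (ctr k e') (\<rho> (Suc k)))) (H k e')"
   using IH kb(1)[OF e'] by blast
   have "\<rho> 0 \<le> \<rho> (Suc k)" using \<rho>[OF Suc.prems] by simp
   thus "S \<inter> ball (ctr k e') (\<rho> (Suc k)) \<subseteq> S \<inter> ball (ctr (Suc k) e) (2 * \<rho> (Suc k))"
   using kb(2)[OF e'] dist_triangle[of "ctr (Suc k) e" _ "ctr k e'"] by (fastforce intro: order.strict_trans1)
   qed
   have "singular_chain (Suc k) (top_of_set (S \<inter> ball (ctr (Suc k) e) (2 * \<rho> (Suc k)))) ?z"
   by (intro singular_chain_add Q2 Suc.prems e singular_chain_cmul singular_chain_frag_extend[OF subset_refl]) (rule hc)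
   moreover have "chain_boundary (Suc k) ?z = 0"
   proof -
   have "frag_extend (\<lambda>e'. chain_boundary (Suc k) (H k e')) (bd (Suc k) e)
   = frag_extend (\<lambda>e'. Q k e' + (if k = 0 then 0 else frag_cmul c (frag_extend (H (k - 1)) (bd k e')))) (bd (Suc k) e)"
   using IH kb(1) by (intro frag_extend_eq) blast
   also have "\<dots> = frag_extend (Q k) (bd (Suc k) e) + (if k = 0 then 0 else frag_cmul c (frag_extend (H (k - 1)) (frag_extend (bd k) (bd (Suc k) e))))"
   by (rule frag_induction[of "bd (Suc k) e" UNIV]) (auto simp: frag_extend_diff frag_cmul_diff algebra_simps)
   also have "(if k = 0 then 0 else frag_cmul c (frag_extend (H (k - 1)) (frag_extend (bd k) (bd (Suc k) e)))) = 0"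
   using bb[of "k - 1" e] Suc.prems e by auto
   finally show ?thesis using Qb[OF Suc.prems e]
   by (simp add: chain_boundary_add chain_boundary_cmul chain_boundary_frag_extend)
   qed
   ultimately show "singular_chain (Suc (Suc k)) (top_of_set (S \<inter> ball (ctr (Suc k) e) (\<rho> (Suc (Suc k))))) (H (Suc k) e) \<and>
   chain_boundary (Suc (Suc k)) (H (Suc k) e) = Q (Suc k) e + (if Suc k = 0 then 0 else frag_cmul c (frag_extend (H (Suc k - 1)) (bd (Suc k) e)))"
   using pick[OF ctr[OF Suc.prems e] Suc.prems, of ?z] by (simp add: HS)
  qed
 qed
 thus ?thesis by blast
qed

section \<open>Locally Euclidean compact sets\<close>

text \<open>The metric on functions is a sum with weights \<open>(1/2)^n\<close>, whose total is
  2.\<close>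

lemma dist_fun_le:
 fixes x y :: "nat => 'b::metric_space"
 assumes "\<And>i. dist (x i) (y i) \<le> r"
 shows "dist x y \<le> 2 * r"
proof -
 have r: "0 \<le> r" using assms[of 0] zero_le_dist order_trans by blast
 have g: "(\<lambda>n. (1/2::real)^n * r) sums (2 * r)"
  using sums_mult2[OF geometric_sums[of "1/2::real"], of r] by simp
 have le: "(1/2::real)^n * min (dist (x (from_nat n)) (y (from_nat n))) 1 \<le> (1/2)^n * r" for n
  using assms[of "from_nat n"] by (intro mult_left_mono) auto
 have "summable (\<lambda>n. (1/2::real)^n * min (dist (x (from_nat n)) (y (from_nat n))) 1)"
  by (rule summable_comparison_test'[OF sums_summable[OF g], of 0]) (use le in auto)
 hence "dist x y \<le> suminf (\<lambda>n. (1/2::real)^n * r)"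
  unfolding dist_fun_def by (intro suminf_le le sums_summable[OF g])
 thus ?thesis using sums_unique[OF g] by simp
qed

abbreviation coord_space :: "nat => (nat => real) set" where
 "coord_space n \<equiv> {x. \<forall>i\<ge>n. x i = 0}"

lemma Euclidean_space_eq: "Euclidean_space n = top_of_set (coord_space n)"
 by (simp add: Euclidean_space_def euclidean_product_topology)

definition coord_cube :: "nat => (nat => real) => real => (nat => real) set" where
 "coord_cube n p r = {x \<in> coord_space n. \<forall>i<n. \<bar>x i - p i\<bar> < r}"

lemma openin_coord_cube: "openin (top_of_set (coord_space n)) (coord_cube n p r)"
proof -
 have "open {x :: nat => real. \<bar>x i - p i\<bar> < r}" for i
  by (intro open_Collect_less continuous_intros continuous_on_product_coordinates)
 hence "open (\<Inter>i\<in>{..<n}. {x :: nat => real. \<bar>x i - p i\<bar> < r})" by (intro open_INT) auto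
 moreover have "coord_cube n p r = coord_space n \<inter> (\<Inter>i\<in>{..<n}. {x :: nat => real. \<bar>x i - p i\<bar> < r})"
  by (auto simp: coord_cube_def)
 ultimately show ?thesis by (simp add: openin_open_Int)
qed

lemma coord_cube_inside:
 assumes W: "openin (top_of_set (coord_space n)) W" "p \<in> W"
 obtains r where "r > 0" "coord_cube n p r \<subseteq> W"
proof -
 obtain T where T: "open T" "W = coord_space n \<inter> T" using W(1) by (auto simp: openin_open)
 then obtain e where e: "e > 0" "ball p e \<subseteq> T" using W(2) by (meson IntD2 openE)
 have "coord_cube n p (e/3) \<subseteq> W"
 proof
  fix x assume x: "x \<in> coord_cube n p (e/3)"
  have "dist (x i) (p i) \<le> e/3" for i
   using x W(2) T(2) e(1) by (cases "i < n") (auto simp: coord_cube_def dist_real_def intro: less_imp_le)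
  hence "dist x p \<le> 2 * (e/3)" by (rule dist_fun_le)
  hence "x \<in> ball p e" using e(1) by (simp add: dist_commute)
  thus "x \<in> W" using e(2) T(2) x by (auto simp: coord_cube_def)
 qed
 thus thesis using that e(1) by (meson divide_pos_pos zero_less_numeral)
qed

lemma contractible_coord_cube:
 assumes "p \<in> coord_space n" shows "contractible_space (top_of_set (coord_cube n p r))"
proof (cases "r > 0")
 case True
 define h where "h = (\<lambda>z :: real \<times> (nat => real). \<lambda>i. (1 - fst z) * snd z i + fst z * p i)"
 have cont: "continuous_on ({0..1} \<times> coord_cube n p r) h"
  unfolding h_def
  by (rule continuous_on_coordinatewise_then_product)
   (intro continuous_intros continuous_on_compose2[OF continuous_on_product_coordinates continuous_on_snd[OF continuous_on_id]]; simp)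
 have in_cube: "h z \<in> coord_cube n p r" if z: "z \<in> {0..1} \<times> coord_cube n p r" for z
 proof -
  have "\<bar>h z i - p i\<bar> < r" if "i < n" for i
  proof -
   have "h z i - p i = (1 - fst z) * (snd z i - p i)" by (simp add: h_def algebra_simps)
   hence "\<bar>h z i - p i\<bar> = (1 - fst z) * \<bar>snd z i - p i\<bar>" using z by (auto simp: abs_mult)
   also have "\<dots> \<le> 1 * \<bar>snd z i - p i\<bar>" using z by (intro mult_right_mono) auto
   also have "\<dots> < r" using z that by (auto simp: coord_cube_def)
   finally show ?thesis .
  qed
  thus ?thesis using z assms by (auto simp: coord_cube_def h_def)
 qed
 have "homotopic_with (\<lambda>x. True) (top_of_set (coord_cube n p r)) (top_of_set (coord_cube n p r)) id (\<lambda>x. p)"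
  unfolding homotopic_with_def
  using cont in_cube by (intro exI[of _ h]) (auto simp: h_def prod_topology_subtopology_eu image_subset_iff Pi_iff)
 thus ?thesis unfolding contractible_space_def by blast
next
 case False
 show ?thesis
 proof (cases "n = 0")
  case True
  hence "coord_cube n p r = {\<lambda>_. 0}" by (auto simp: coord_cube_def)
  thus ?thesis by (simp add: contractible_space_subset_singleton)
 next
  case 2: False
  hence "coord_cube n p r = {}" using False by (auto simp: coord_cube_def)
  thus ?thesis by (simp add: contractible_space_empty)
 qed
qed

text \<open>A contraction makes \<open>c\<close> homologous to its image under a constant map. In
  positive degree that image is a cycle on a point, hence a boundary; in degree 0 it depends only on
  the coefficient sum of \<open>c\<close>.\<close>

lemma contractible_space_chain_bounds:
 assumes X: "contractible_space X" and c: "singular_chain k X c"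
  and cyc: "if k = 0 then augment c = 0 else chain_boundary k c = 0"
 shows "\<exists>d. singular_chain (Suc k) X d \<and> chain_boundary (Suc k) d = c"
proof (cases "topspace X = {}")
 case True
 hence "c = 0" using c by (simp add: singular_chain_empty)
 thus ?thesis by (intro exI[of _ 0]) simp
next
 case False
 obtain a where a: "homotopic_with (\<lambda>x. True) X X id (\<lambda>x. a)"
  using X by (auto simp: contractible_space_def)
 have ca: "continuous_map X X (\<lambda>x. a)" using homotopic_with_imp_continuous_maps[OF a] by simp
 have aX: "a \<in> topspace X" using ca False by (auto simp: continuous_map_def)
 have z: "singular_relcycle k X {} c"
  using c cyc by (cases "k = 0") (auto simp: singular_cycle chain_boundary_def)
 have "homotopic_with (\<lambda>h. h \<in> {} \<rightarrow> {}) X X id (\<lambda>x. a)" using a by simp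
 from homotopic_imp_homologous_rel_chain_maps[OF this z]
 have hr: "homologous_rel k X {} c (chain_map k (\<lambda>x. a) c)" using chain_map_ident[OF c] by simp
 have "singular_relboundary k X {} (chain_map k (\<lambda>x. a) c)"
 proof (cases "k = 0")
  case True
  have "chain_map 0 (\<lambda>x. a) c = frag_extend (\<lambda>_. frag_of (restrict (\<lambda>_. a) (standard_simplex 0))) (augment c)"
   by (rule frag_induction[of c UNIV]) (auto simp: chain_map_diff frag_extend_diff simplex_map_def o_def restrict_def)
  thus ?thesis using True cyc by simp
 next
  case k: False
  have "continuous_map X (subtopology X {a}) (\<lambda>x. a)" using ca by (simp add: continuous_map_in_subtopology aX Pi_iff)
  hence "singular_relcycle k (subtopology X {a}) {} (chain_map k (\<lambda>x. a) c)"
   by (rule singular_relcycle_chain_map[OF z]) auto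
  hence "singular_relboundary k (subtopology X {a}) {} (chain_map k (\<lambda>x. a) c)"
   using singular_boundary_eq_cycle_singleton[of "subtopology X {a}" a k] aX k by simp
  thus ?thesis using singular_boundary_mono[where T="{a}" and S="topspace X" and X=X] aX by auto
 qed
 with hr have "singular_relboundary k X {} c"
  using singular_relboundary_add unfolding homologous_rel_def by fastforce
 thus ?thesis by (auto simp: singular_boundary)
qed

definition locally_euclidean_set :: "nat => 'b::topological_space set => bool" where
 "locally_euclidean_set n S \<longleftrightarrow> (\<forall>x\<in>S. \<exists>U. openin (top_of_set S) U \<and> x \<in> U \<and> top_of_set U homeomorphic_space Euclidean_space n)"

lemma locally_euclidean_contractible_neighbourhood:
 fixes S :: "'b::metric_space set"
 assumes "locally_euclidean_set n S" "p \<in> S" "r > 0"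
 obtains V where "openin (top_of_set S) V" "p \<in> V" "V \<subseteq> ball p r" "contractible_space (top_of_set V)"
proof -
 obtain U where U: "openin (top_of_set S) U" "p \<in> U" "top_of_set U homeomorphic_space Euclidean_space n"
  using assms by (auto simp: locally_euclidean_set_def)
 then obtain f g where fg: "homeomorphic_maps (top_of_set U) (top_of_set (coord_space n)) f g"
  by (auto simp: homeomorphic_space_def Euclidean_space_eq)
 hence f: "homeomorphic_map (top_of_set U) (top_of_set (coord_space n)) f" and g: "homeomorphic_map (top_of_set (coord_space n)) (top_of_set U) g"
  and gf: "\<And>x. x \<in> U ==> g (f x) = x" and fg': "\<And>y. y \<in> coord_space n ==> f (g y) = y"
  using homeomorphic_maps_map[of "top_of_set U" "top_of_set (coord_space n)" f g] by auto
 have "openin (top_of_set U) (U \<inter> ball p r)" by (simp add: openin_open_Int)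
 hence W: "openin (top_of_set (coord_space n)) (f ` (U \<inter> ball p r))"
  using f homeomorphic_imp_open_map open_map_def by blast
 have pW: "f p \<in> f ` (U \<inter> ball p r)" using U(2) assms(3) by auto
 obtain e where e: "e > 0" "coord_cube n (f p) e \<subseteq> f ` (U \<inter> ball p r)" using coord_cube_inside[OF W pW] by blast
 let ?Q = "coord_cube n (f p) e" and ?V = "g ` coord_cube n (f p) e"
 have fp: "f p \<in> coord_space n" using W pW openin_imp_subset by blast
 have "openin (top_of_set U) ?V" using g openin_coord_cube homeomorphic_imp_open_map open_map_def by blast
 hence "openin (top_of_set S) ?V" using U(1) openin_trans by blast
 moreover have "f p \<in> ?Q" using e(1) fp by (auto simp: coord_cube_def)
 hence "p \<in> ?V" using gf[OF U(2)] by force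
 moreover have "?V \<subseteq> ball p r" using e(2) gf by fastforce
 moreover have "contractible_space (top_of_set ?V)"
 proof -
  have sub: "?Q \<subseteq> coord_space n" by (auto simp: coord_cube_def)
  have "?V \<subseteq> U" using e(2) gf by fastforce
  moreover have "homeomorphic_map (subtopology (top_of_set (coord_space n)) ?Q) (subtopology (top_of_set U) ?V) g"
  proof (rule homeomorphic_map_subtopologies_alt[OF g])
   fix y assume "y \<in> topspace (top_of_set (coord_space n))" "g y \<in> topspace (top_of_set U)"
   hence y: "f (g y) = y" using fg' by simp
   have "y \<in> ?Q" if "g y = g q" "q \<in> ?Q" for q
   using that y fg'[of q] sub by auto
   thus "(g y \<in> ?V) = (y \<in> ?Q)" by blast
  qed
  ultimately have "homeomorphic_map (top_of_set ?Q) (top_of_set ?V) g"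
   using sub by (simp add: subtopology_subtopology Int_absorb1)
  hence "top_of_set ?Q homeomorphic_space top_of_set ?V" by (rule homeomorphic_map_imp_homeomorphic_space)
  thus ?thesis using contractible_coord_cube[OF fp, of e] homeomorphic_space_contractibility by blast
 qed
 ultimately show thesis using that by blast
qed

text \<open>A Lebesgue number for a cover that is known only through the local existence of its
  members.\<close>

lemma compact_uniform_cover:
 fixes S :: "'b::metric_space set"
 assumes "compact S" and cov: "\<And>p. p \<in> S ==> \<exists>V. openin (top_of_set S) V \<and> p \<in> V \<and> P V"
 obtains \<delta> where "\<delta> > 0" "\<And>x. x \<in> S ==> \<exists>V. P V \<and> V \<subseteq> S \<and> S \<inter> ball x \<delta> \<subseteq> V"
proof (cases "S = {}")
 case True thus thesis using that[of 1] by auto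
next
 case False
 have "\<forall>p\<in>S. \<exists>T. open T \<and> p \<in> T \<and> P (S \<inter> T)"
  using cov unfolding openin_open by (metis IntD2)
 then obtain T where T: "\<And>p. p \<in> S ==> open (T p) \<and> p \<in> T p \<and> P (S \<inter> T p)" by metis
 have "S \<subseteq> \<Union>(T ` S)" "\<And>B. B \<in> T ` S ==> open B" using T by auto
 then obtain \<delta> where "\<delta> > 0" "\<forall>x\<in>S. \<exists>B\<in>T ` S. ball x \<delta> \<subseteq> B"
  using Heine_Borel_lemma[OF assms(1), of "T ` S"] by metis
 thus thesis using that[of \<delta>] T by (metis Int_lower1 Int_mono imageE order_refl)
qed

text \<open>The radius is a Lebesgue number of a cover by contractible open sets, each inside some
  ball of radius \<open>r'/2\<close>; such a set stays within \<open>r'\<close> of each of its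
  points.\<close>

lemma locally_euclidean_acyclic_balls:
 fixes S :: "'b::metric_space set"
 assumes "compact S" "locally_euclidean_set n S" "r' > 0"
 shows "\<exists>r>0. acyclic_balls S r r'"
proof -
 have cov: "\<exists>V. openin (top_of_set S) V \<and> p \<in> V \<and> contractible_space (top_of_set V) \<and> (\<exists>p. V \<subseteq> ball p (r'/2))"
  if "p \<in> S" for p
  using locally_euclidean_contractible_neighbourhood[OF assms(2) that, of "r'/2"] assms(3) by (metis half_gt_zero)
 obtain \<delta> where \<delta>: "\<delta> > 0" "\<And>x. x \<in> S ==> \<exists>V. (contractible_space (top_of_set V) \<and> (\<exists>p. V \<subseteq> ball p (r'/2))) \<and> V \<subseteq> S \<and> S \<inter> ball x \<delta> \<subseteq> V"
  using compact_uniform_cover[OF assms(1) cov] by blast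
 have "acyclic_balls S \<delta> r'"
  unfolding acyclic_balls_def
 proof (intro ballI allI impI, elim conjE)
  fix x k c assume x: "x \<in> S" and c: "singular_chain k (top_of_set (S \<inter> ball x \<delta>)) c" and cyc: "if k = 0 then augment c = 0 else chain_boundary k c = 0"
  obtain V p where V: "contractible_space (top_of_set V)" "V \<subseteq> ball p (r'/2)" "V \<subseteq> S" "S \<inter> ball x \<delta> \<subseteq> V"
   using \<delta>(2)[OF x] by blast
  have "singular_chain k (top_of_set V) c" using c V(4) by (rule top_of_set_chain_mono)
  then obtain d where d: "singular_chain (Suc k) (top_of_set V) d" "chain_boundary (Suc k) d = c"
   using contractible_space_chain_bounds[OF V(1) _ cyc] by blast
  have "x \<in> V" using x \<delta>(1) V(4) by auto
  have "V \<subseteq> ball x r'"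
  proof
   fix y assume "y \<in> V"
   hence "dist p x < r'/2" "dist p y < r'/2" using V(2) \<open>x \<in> V\<close> by auto
   thus "y \<in> ball x r'" using dist_triangle[of x y p] by (simp add: dist_commute)
  qed
  hence "V \<subseteq> S \<inter> ball x r'" using V(3) by auto
  thus "\<exists>d. singular_chain (Suc k) (top_of_set (S \<inter> ball x r')) d \<and> chain_boundary (Suc k) d = c"
   using d top_of_set_chain_mono by blast
 qed
 thus ?thesis using \<delta>(1) by blast
qed

text \<open>Radii are chosen from the top down, each as small as filling into the one above demands.
  The sequence \<open>\<tau>\<close> therefore decreases and is read backwards.\<close>

lemma acyclic_tower:
 fixes S :: "'b::metric_space set"
 assumes acy: "\<And>r'. r' > 0 ==> \<exists>r>0. acyclic_balls S r r'" and "\<epsilon> > 0"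
 shows "\<exists>\<rho>. \<rho> (Suc R) \<le> \<epsilon> \<and> 0 < \<rho> 0 \<and> (\<forall>k\<le>R. acyclic_balls S (2 * \<rho> k) (\<rho> (Suc k))) \<and> (\<forall>k\<le>Suc R. \<rho> 0 \<le> \<rho> k \<and> \<rho> k \<le> \<rho> (Suc R))"
proof -
 have mono: "acyclic_balls S r r'" if "acyclic_balls S s r'" "r \<le> s" for r s r'
  unfolding acyclic_balls_def
 proof (intro ballI allI impI, elim conjE)
  fix x k c assume x: "x \<in> S" and c: "singular_chain k (top_of_set (S \<inter> ball x r)) c" and cyc: "if k = 0 then augment c = 0 else chain_boundary k c = 0"
  have "singular_chain k (top_of_set (S \<inter> ball x s)) c" by (rule top_of_set_chain_mono[OF c]) (use that(2) in auto)
  thus "\<exists>d. singular_chain (Suc k) (top_of_set (S \<inter> ball x r')) d \<and> chain_boundary (Suc k) d = c"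
   using that(1) x cyc unfolding acyclic_balls_def by blast
 qed
 have step: "\<exists>s. 0 < s \<and> s \<le> t \<and> acyclic_balls S (2 * s) t" if t: "t > 0" for t
 proof -
  obtain r where "r > 0" "acyclic_balls S r t" using acy[OF t] by blast
  thus ?thesis using t mono[of r t "2 * min (r/2) t"] by (intro exI[of _ "min (r/2) t"]) auto
 qed
 define nx where "nx t = (SOME s. 0 < s \<and> s \<le> t \<and> acyclic_balls S (2 * s) t)" for t
 have nx: "0 < nx t \<and> nx t \<le> t \<and> acyclic_balls S (2 * nx t) t" if "t > 0" for t
  unfolding nx_def by (rule someI_ex) (rule step[OF that])
 define \<tau> where "\<tau> j = (nx ^^ j) \<epsilon>" for j
 have pos: "\<tau> j > 0" for j by (induction j) (use assms(2) nx in \<open>auto simp: \<tau>_def\<close>)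
 have anti: "\<tau> j \<le> \<tau> i" if "i \<le> j" for i j
  using that
 proof (induction j rule: dec_induct)
  case (step j)
  thus ?case using nx[OF pos[of j]] by (simp add: \<tau>_def)
 qed simp
 have \<tau>0: "\<tau> 0 = \<epsilon>" by (simp add: \<tau>_def)
 show ?thesis
 proof (intro exI[of _ "\<lambda>k. \<tau> (Suc R - k)"] conjI allI impI)
  fix k assume "k \<le> R"
  hence "Suc R - k = Suc (Suc R - Suc k)" by simp
  thus "acyclic_balls S (2 * \<tau> (Suc R - k)) (\<tau> (Suc R - Suc k))"
   using nx[OF pos[of "Suc R - Suc k"]] by (simp add: \<tau>_def)
 qed (use pos anti \<tau>0 in auto)
qed

text \<open>The cells of a cubical grid of side \<open>1 / N\<close>. In each of the
  \<open>d\<close> coordinates a point lies in at most two adjacent slabs, so the multiplicity bound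
  \<open>2 ^ d\<close> does not depend on the mesh.\<close>

lemma grid_cover:
 fixes S :: "(nat => real) set"
 assumes S: "compact S" "S \<subseteq> coord_space d" and "\<epsilon> > 0"
 obtains I :: "(nat => int) set" and A where "finite I" "\<And>i. i \<in> I ==> compact (A i) \<and> A i \<subseteq> S \<and> A i \<noteq> {}"
  "S = (\<Union>i\<in>I. A i)" "\<And>i x y. i \<in> I ==> x \<in> A i ==> y \<in> A i ==> dist x y < \<epsilon>"
  "\<And>x. card {i\<in>I. x \<in> A i} \<le> 2 ^ d"
proof -
 \<comment> \<open>\<open>dist_fun_le\<close> doubles the coordinatewise bound
   \<open>1 / N\<close>.\<close>
 obtain N :: nat where N: "N > 0" "2 / real N < \<epsilon>"
 proof -
  obtain m :: nat where m: "2 / \<epsilon> < real m" using reals_Archimedean2 by blast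
  moreover have "0 < 2 / \<epsilon>" using assms(3) by simp
  hence "real m > 0" using m by linarith
  ultimately have "2 / real m < \<epsilon>" using assms(3) by (simp add: field_simps)
  thus ?thesis using that[of m] \<open>real m > 0\<close> by auto
 qed
 have "\<exists>b. \<forall>x\<in>S. \<bar>x i\<bar> \<le> b" for i
 proof -
  have "compact ((\<lambda>x. x i) ` S)"
   by (rule compact_continuous_image[OF continuous_on_subset[OF continuous_on_product_coordinates subset_UNIV] S(1)])
  hence "bounded ((\<lambda>x. x i) ` S)" by (rule compact_imp_bounded)
  thus ?thesis unfolding bounded_iff by auto
 qed
 then obtain b where b: "\<And>i x. x \<in> S ==> \<bar>x i\<bar> \<le> b i" by metis
 define A where "A v = {x :: nat => real. x \<in> S \<and> (\<forall>i<d. real_of_int (v i) \<le> real N * x i \<and> real N * x i \<le> real_of_int (v i) + 1)}" for v :: "nat => int"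
 define J where "J = PiE {..<d} (\<lambda>i. {\<lfloor>- (real N * b i)\<rfloor>..\<lfloor>real N * b i\<rfloor>})"
 define I where "I = {v\<in>J. A v \<noteq> {}}"
 have "finite I" unfolding I_def J_def by (auto intro!: finite_subset[OF _ finite_PiE[of "{..<d}" "\<lambda>i. {\<lfloor>- (real N * b i)\<rfloor>..\<lfloor>real N * b i\<rfloor>}"]])
 moreover have "compact (A v) \<and> A v \<subseteq> S \<and> A v \<noteq> {}" if "v \<in> I" for v
 proof -
  have cl: "closed {x :: nat => real. real_of_int (v i) \<le> real N * x i \<and> real N * x i \<le> real_of_int (v i) + 1}" for i
   by (intro closed_Collect_conj closed_Collect_le continuous_intros continuous_on_product_coordinates)
  have "A v = S \<inter> (\<Inter>i\<in>{..<d}. {x :: nat => real. real_of_int (v i) \<le> real N * x i \<and> real N * x i \<le> real_of_int (v i) + 1})"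
   by (auto simp: A_def)
  moreover have "closed (\<Inter>i\<in>{..<d}. {x :: nat => real. real_of_int (v i) \<le> real N * x i \<and> real N * x i \<le> real_of_int (v i) + 1})"
   using cl by (intro closed_INT) auto
  ultimately have "compact (A v)" using S(1) by (simp add: compact_Int_closed)
  thus ?thesis using that by (auto simp: I_def A_def)
 qed
 moreover have "S = (\<Union>i\<in>I. A i)"
 proof
  show "S \<subseteq> (\<Union>i\<in>I. A i)"
  proof
   fix x assume x: "x \<in> S"
   define v where "v = restrict (\<lambda>i. \<lfloor>real N * x i\<rfloor>) {..<d}"
   have "x \<in> A v" using x by (auto simp: A_def v_def)
   moreover have "\<lfloor>- (real N * b i)\<rfloor> \<le> \<lfloor>real N * x i\<rfloor> \<and> \<lfloor>real N * x i\<rfloor> \<le> \<lfloor>real N * b i\<rfloor>" for i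
   proof -
   have "real N * \<bar>x i\<bar> \<le> real N * b i" using b[OF x] by (intro mult_left_mono) auto
   moreover have "\<bar>real N * x i\<bar> = real N * \<bar>x i\<bar>" by (simp add: abs_mult)
   ultimately show ?thesis by (intro conjI floor_mono) linarith+
   qed
   hence "v \<in> J" by (auto simp: J_def v_def)
   ultimately show "x \<in> (\<Union>i\<in>I. A i)" by (auto simp: I_def)
  qed
 qed (auto simp: A_def)
 moreover have "dist x y < \<epsilon>" if "v \<in> I" "x \<in> A v" "y \<in> A v" for v x y
 proof -
  have "dist (x i) (y i) \<le> 1 / N" for i
  proof (cases "i < d")
   case True
   hence "real_of_int (v i) \<le> real N * x i" "real N * x i \<le> real_of_int (v i) + 1" "real_of_int (v i) \<le> real N * y i" "real N * y i \<le> real_of_int (v i) + 1"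
   using that(2,3) by (auto simp: A_def)
   hence "\<bar>real N * x i - real N * y i\<bar> \<le> 1" by linarith
   moreover have "\<bar>real N * x i - real N * y i\<bar> = real N * dist (x i) (y i)"
   by (simp add: dist_real_def abs_mult right_diff_distrib[symmetric])
   ultimately show ?thesis using N(1) by (simp add: field_simps)
  next
   case False
   hence "x i = 0" "y i = 0" using that(2,3) S(2) by (auto simp: A_def)
   thus ?thesis by simp
  qed
  hence "dist x y \<le> 2 * (1 / N)" by (rule dist_fun_le)
  thus ?thesis using N by simp
 qed
 moreover have "card {v\<in>I. x \<in> A v} \<le> 2 ^ d" for x
 proof -
  have "{v\<in>I. x \<in> A v} \<subseteq> PiE {..<d} (\<lambda>i. {\<lfloor>real N * x i\<rfloor>, \<lfloor>real N * x i\<rfloor> - 1})"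
  proof
   fix v assume v: "v \<in> {v\<in>I. x \<in> A v}"
   have "v i = \<lfloor>real N * x i\<rfloor> \<or> v i = \<lfloor>real N * x i\<rfloor> - 1" if "i < d" for i
   proof -
   have "real_of_int (v i) \<le> real N * x i" "real N * x i \<le> real_of_int (v i) + 1" using v that by (auto simp: A_def)
   thus ?thesis by linarith
   qed
   moreover have "v \<in> extensional {..<d}" using v by (auto simp: I_def J_def PiE_def)
   ultimately show "v \<in> PiE {..<d} (\<lambda>i. {\<lfloor>real N * x i\<rfloor>, \<lfloor>real N * x i\<rfloor> - 1})" by (auto simp: PiE_def)
  qed
  hence "card {v\<in>I. x \<in> A v} \<le> card (PiE {..<d} (\<lambda>i. {\<lfloor>real N * x i\<rfloor>, \<lfloor>real N * x i\<rfloor> - 1}))"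
   by (intro card_mono finite_PiE) auto
  also have "\<dots> = (\<Prod>i\<in>{..<d}. 2)" by (subst card_PiE) (auto intro!: prod.cong simp: numeral_2_eq_2)
  finally show ?thesis by simp
 qed
 ultimately show thesis using that by blast
qed

text \<open>The usual embedding by finitely many charts: for each of them the coordinates multiplied
  by a bump function, together with the bump function itself. Where the bump does not vanish, these
  values recover the chart coordinates, which gives injectivity; compactness makes the map a
  homeomorphism onto its image.\<close>

lemma closed_manifold_embedding:
 assumes M: "closed_manifold n M"
 obtains f :: "'a => nat => real" and d where
  "homeomorphic_map M (top_of_set (f ` topspace M)) f" "compact (f ` topspace M)"
  "f ` topspace M \<subseteq> coord_space d" "locally_euclidean_set n (f ` topspace M)"
proof -
 have ne: "topspace M \<noteq> {}" and H: "Hausdorff_space M" and comp: "compact_space M"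
  and loc: "\<And>x. x \<in> topspace M ==> \<exists>U. openin M U \<and> x \<in> U \<and> subtopology M U homeomorphic_space Euclidean_space n"
  using M by (auto simp: closed_manifold_def manifold_def)
 have "\<forall>p\<in>topspace M. \<exists>U u v. openin M U \<and> p \<in> U \<and> homeomorphic_maps (subtopology M U) (top_of_set (coord_space n)) u v"
  using loc unfolding homeomorphic_space_def Euclidean_space_eq by blast
 from bchoice[OF this] obtain U where "\<forall>p\<in>topspace M. \<exists>u v. openin M (U p) \<and> p \<in> U p \<and> homeomorphic_maps (subtopology M (U p)) (top_of_set (coord_space n)) u v" by blast
 from bchoice[OF this] obtain u where "\<forall>p\<in>topspace M. \<exists>v. openin M (U p) \<and> p \<in> U p \<and> homeomorphic_maps (subtopology M (U p)) (top_of_set (coord_space n)) (u p) v" by blast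
 from bchoice[OF this] obtain v where Uuv: "\<forall>p\<in>topspace M. openin M (U p) \<and> p \<in> U p \<and> homeomorphic_maps (subtopology M (U p)) (top_of_set (coord_space n)) (u p) (v p)" by blast
 have U: "openin M (U p) \<and> p \<in> U p" and uv: "homeomorphic_maps (subtopology M (U p)) (top_of_set (coord_space n)) (u p) (v p)"
  if "p \<in> topspace M" for p using Uuv that by blast+
 have Usub: "U p \<subseteq> topspace M" if "p \<in> topspace M" for p using U[OF that] openin_subset by blast
 have tU: "topspace (subtopology M (U p)) = U p" if "p \<in> topspace M" for p using Usub[OF that] by (auto simp: topspace_subtopology)
 have cu: "continuous_map (subtopology M (U p)) euclidean (u p)" and cv: "continuous_map (top_of_set (coord_space n)) (subtopology M (U p)) (v p)"
  if p: "p \<in> topspace M" for p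
  using uv[OF p] unfolding homeomorphic_maps_def by (auto simp: continuous_map_in_subtopology)
 have vu: "v p (u p x) = x \<and> u p x \<in> coord_space n" if p: "p \<in> topspace M" and "x \<in> U p" for p x
 proof
  show "v p (u p x) = x" using uv[OF p] tU[OF p] that(2) unfolding homeomorphic_maps_def by simp
  have "u p \<in> U p \<rightarrow> coord_space n" using uv[OF p] tU[OF p] unfolding homeomorphic_maps_def continuous_map_def by simp
  thus "u p x \<in> coord_space n" using that(2) by blast
 qed
 have uv': "u p (v p y) = y \<and> v p y \<in> U p" if p: "p \<in> topspace M" and "y \<in> coord_space n" for p y
 proof
  show "u p (v p y) = y" using uv[OF p] that(2) unfolding homeomorphic_maps_def by simp
  have "v p \<in> coord_space n \<rightarrow> U p" using uv[OF p] tU[OF p] unfolding homeomorphic_maps_def continuous_map_def by simp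
  thus "v p y \<in> U p" using that(2) by blast
 qed
 \<comment> \<open>The image \<open>C p\<close> of a closed cube is compact, hence closed in the
   Hausdorff space \<open>M\<close>. Off \<open>C p\<close> the bump function is 0, so it extends
   continuously by 0.\<close>
 define C where "C p = v p ` {y \<in> coord_space n. \<forall>i<n. \<bar>y i - u p p i\<bar> \<le> 1}" for p
 define Ob where "Ob p = v p ` coord_cube n (u p p) 1" for p
 have clC: "closedin M (C p)" if p: "p \<in> topspace M" for p
 proof -
  have "compact (PiE UNIV (\<lambda>i. if i < n then cball (u p p i) 1 else {0 :: real}))"
   using compactin_PiE[of "\<lambda>_. euclideanreal" UNIV "\<lambda>i. if i < n then cball (u p p i) 1 else {0 :: real}"]
   by (auto simp: euclidean_product_topology)
  moreover have "{y \<in> coord_space n. \<forall>i<n. \<bar>y i - u p p i\<bar> \<le> 1} = PiE UNIV (\<lambda>i. if i < n then cball (u p p i) 1 else {0 :: real})"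
   by (auto simp: PiE_def Pi_iff dist_real_def abs_minus_commute split: if_splits)
  ultimately have "compactin (top_of_set (coord_space n)) {y \<in> coord_space n. \<forall>i<n. \<bar>y i - u p p i\<bar> \<le> 1}"
   by (auto simp: compactin_subtopology)
  hence "compactin (subtopology M (U p)) (C p)" unfolding C_def using cv[OF p] by (rule image_compactin)
  hence "compactin M (C p)" by (simp add: compactin_subtopology)
  thus ?thesis using H compactin_imp_closedin by blast
 qed
 have opO: "openin M (Ob p)" if p: "p \<in> topspace M" for p
 proof -
  have "homeomorphic_map (top_of_set (coord_space n)) (subtopology M (U p)) (v p)"
   using uv[OF p] homeomorphic_maps_map by blast
  hence "openin (subtopology M (U p)) (Ob p)" unfolding Ob_def using openin_coord_cube homeomorphic_imp_open_map open_map_def by blast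
  thus ?thesis using U[OF p] openin_trans_full by blast
 qed
 have OC: "Ob p \<subseteq> C p" for p unfolding Ob_def C_def coord_cube_def by (rule image_mono) (auto intro: less_imp_le)
 have CU: "C p \<subseteq> U p" if "p \<in> topspace M" for p using uv'[OF that] by (auto simp: C_def)
 have pO: "p \<in> Ob p" if p: "p \<in> topspace M" for p
 proof -
  have "u p p \<in> coord_cube n (u p p) 1" using vu[OF p, of p] U[OF p] by (auto simp: coord_cube_def)
  thus ?thesis unfolding Ob_def using vu[OF p, of p] U[OF p] by force
 qed
 define \<beta> where "\<beta> p y = (\<Prod>i<n. max 0 (1 - \<bar>y i - u p p i\<bar>))" for p and y :: "nat => real"
 have \<beta>_cont: "continuous_on UNIV (\<beta> p)" for p
  unfolding \<beta>_def by (intro continuous_intros continuous_on_product_coordinates)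
 have \<beta>_pos: "\<beta> p (u p x) \<noteq> 0 \<longleftrightarrow> x \<in> Ob p" if p: "p \<in> topspace M" and x: "x \<in> U p" for p x
 proof -
  have "\<beta> p (u p x) \<noteq> 0 \<longleftrightarrow> u p x \<in> coord_cube n (u p p) 1"
  proof -
   have "(max 0 (1 - \<bar>u p x i - u p p i\<bar>) \<noteq> 0) = (\<bar>u p x i - u p p i\<bar> < 1)" for i by linarith
   thus ?thesis using vu[OF p x] by (simp add: \<beta>_def coord_cube_def Ball_def)
  qed
  also have "\<dots> \<longleftrightarrow> x \<in> Ob p"
  proof
   assume "x \<in> Ob p"
   then obtain y where "x = v p y" "y \<in> coord_cube n (u p p) 1" by (auto simp: Ob_def)
   thus "u p x \<in> coord_cube n (u p p) 1" using uv'[OF p, of y] by (auto simp: coord_cube_def)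
  qed (use vu[OF p x] in \<open>force simp: Ob_def\<close>)
  finally show ?thesis .
 qed
 define \<gamma> where "\<gamma> p w x = (if x \<in> U p then \<beta> p (u p x) * w (u p x) else 0)" for p x and w :: "(nat => real) => real"
 have \<gamma>_cont: "continuous_map M euclideanreal (\<gamma> p w)" if p: "p \<in> topspace M" and w: "continuous_on UNIV w" for p w
 proof (rule pasting_lemma[of "{True, False}" M "\<lambda>b. if b then U p else topspace M - C p" _ "\<lambda>b x. if b then \<beta> p (u p x) * w (u p x) else 0"])
  show "openin M (if b then U p else topspace M - C p)" if "b \<in> {True, False}" for b
   using U[OF p] clC[OF p] by (auto simp: closedin_def)
  have "continuous_on UNIV (\<lambda>y. \<beta> p y * w y)" using \<beta>_cont w by (intro continuous_intros)
  hence "continuous_map euclidean euclideanreal (\<lambda>y. \<beta> p y * w y)" by simp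
  from continuous_map_compose[OF cu[OF p] this]
  show "continuous_map (subtopology M (if b then U p else topspace M - C p)) euclideanreal (\<lambda>x. if b then \<beta> p (u p x) * w (u p x) else 0)" if "b \<in> {True, False}" for b
   by (auto simp: o_def)
  have zero: "\<beta> p (u p x) = 0" if "x \<in> U p" "x \<notin> C p" for x using \<beta>_pos[OF p that(1)] OC that(2) by blast
  show "(if i then \<beta> p (u p x) * w (u p x) else 0) = (if j then \<beta> p (u p x) * w (u p x) else 0)"
   if "i \<in> {True, False}" "j \<in> {True, False}" "x \<in> topspace M \<inter> (if i then U p else topspace M - C p) \<inter> (if j then U p else topspace M - C p)" for i j x
   using that zero[of x] by (auto split: if_splits)
  show "\<exists>j. j \<in> {True, False} \<and> x \<in> (if j then U p else topspace M - C p) \<and> \<gamma> p w x = (if j then \<beta> p (u p x) * w (u p x) else 0)"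
   if "x \<in> topspace M" for x
   using that CU[OF p] by (cases "x \<in> U p") (auto simp: \<gamma>_def)
 qed
 obtain F where F: "finite F" "F \<subseteq> Ob ` topspace M" "topspace M \<subseteq> \<Union>F"
 proof -
  have "(\<forall>B\<in>Ob ` topspace M. openin M B) \<and> topspace M \<subseteq> \<Union>(Ob ` topspace M)" using opO pO by blast
  thus ?thesis using comp[unfolded compact_space_alt, THEN spec, of "Ob ` topspace M"] that by blast
 qed
 then obtain P where P: "finite P" "P \<subseteq> topspace M" "F = Ob ` P" by (meson finite_subset_image)
 obtain ps where ps: "set ps = P" using P(1) finite_list by blast
 \<comment> \<open>The factor with index \<open>n\<close> is 1, so that the bump function itself
   becomes one of the coordinates.\<close>
 define w where "w i = (\<lambda>y :: nat => real. if i < n then y i else 1)" for i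
 have w: "continuous_on UNIV (w i)" for i unfolding w_def by (cases "i < n") (auto intro: continuous_on_product_coordinates)
 define f where "f x m = (if m < length ps * Suc n then \<gamma> (ps ! (m div Suc n)) (w (m mod Suc n)) x else 0)" for x m
 have psM: "ps ! j \<in> topspace M" if "j < length ps" for j using that ps P(2) nth_mem by blast
 have fc: "continuous_map M euclidean f"
  unfolding euclidean_product_topology[symmetric] continuous_map_componentwise_UNIV
 proof
  fix m show "continuous_map M euclideanreal (\<lambda>x. f x m)"
  proof (cases "m < length ps * Suc n")
   case True
   hence "m div Suc n < length ps" by (simp add: less_mult_imp_div_less)
   thus ?thesis using True \<gamma>_cont[OF psM w] by (simp add: f_def)
  qed (simp add: f_def)
 qed
 have inj: "inj_on f (topspace M)"
 proof (rule inj_onI)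
  fix x y assume x: "x \<in> topspace M" and y: "y \<in> topspace M" and eq: "f x = f y"
  obtain p where "p \<in> P" "x \<in> Ob p" using F(3) P(3) x by blast
  then obtain j where j: "j < length ps" "x \<in> Ob (ps ! j)" using ps by (metis in_set_conv_nth)
  let ?p = "ps ! j"
  have p: "?p \<in> topspace M" using psM j(1) by blast
  have g: "\<gamma> ?p (w i) x = \<gamma> ?p (w i) y" if "i \<le> n" for i
  proof -
   have "j * Suc n + i < length ps * Suc n"
   proof -
   have "j * Suc n + i < Suc j * Suc n" using that by simp
   also have "\<dots> \<le> length ps * Suc n" using j(1) by (intro mult_le_mono1) auto
   finally show ?thesis .
   qed
   moreover have "(j * Suc n + i) div Suc n = j" "(j * Suc n + i) mod Suc n = i"
   using that div_mult_self1[of "Suc n" i j] mod_mult_self1[of i j "Suc n"] by (auto simp: add.commute simp del: mult_Suc_right)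
   ultimately show ?thesis using fun_cong[OF eq, of "j * Suc n + i"] by (simp only: f_def if_True)
  qed
  have xU: "x \<in> U ?p" using j(2) OC CU[OF p] by blast
  have nz: "\<beta> ?p (u ?p x) \<noteq> 0" using \<beta>_pos[OF p xU] j(2) by blast
  have g1: "\<gamma> ?p (w n) x = \<beta> ?p (u ?p x)" using xU by (simp add: \<gamma>_def w_def)
  have yU: "y \<in> U ?p" using g[of n] g1 nz by (auto simp: \<gamma>_def split: if_splits)
  have be: "\<beta> ?p (u ?p x) = \<beta> ?p (u ?p y)" using g[of n] g1 yU by (simp add: \<gamma>_def w_def)
  have "u ?p x = u ?p y"
  proof
   fix i show "u ?p x i = u ?p y i"
   proof (cases "i < n")
   case True
   thus ?thesis using g[of i] xU yU be nz by (simp add: \<gamma>_def w_def)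
   qed (use vu[OF p xU] vu[OF p yU] in auto)
  qed
  thus "x = y" using vu[OF p xU] vu[OF p yU] by metis
 qed
 let ?S = "f ` topspace M"
 have hom: "homeomorphic_map M (top_of_set ?S) f"
  by (rule continuous_imp_homeomorphic_map[OF _ comp])
   (use fc inj in \<open>auto simp: continuous_map_in_subtopology Hausdorff_space_subtopology\<close>)
 have "compact ?S" using image_compactin[OF _ fc, of "topspace M"] comp by (simp add: compact_space_def)
 moreover have "?S \<subseteq> coord_space (length ps * Suc n)" by (auto simp: f_def)
 moreover have "locally_euclidean_set n ?S"
  unfolding locally_euclidean_set_def
 proof
  fix s assume "s \<in> ?S"
  then obtain x where x: "x \<in> topspace M" "s = f x" by blast
  obtain V where V: "openin M V" "x \<in> V" "subtopology M V homeomorphic_space Euclidean_space n" using loc[OF x(1)] by blast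
  have VM: "V \<subseteq> topspace M" using V(1) openin_subset by blast
  have "openin (top_of_set ?S) (f ` V)" using hom V(1) homeomorphic_imp_open_map open_map_def by blast
  moreover have "homeomorphic_map (subtopology M V) (subtopology (top_of_set ?S) (f ` V)) f"
   using homeomorphic_map_subtopologies[OF hom, of V "f ` V"] VM by (simp add: Int_absorb1 image_mono)
  hence "homeomorphic_map (subtopology M V) (top_of_set (f ` V)) f"
   using VM by (simp add: subtopology_subtopology Int_absorb1 image_mono)
  hence "top_of_set (f ` V) homeomorphic_space subtopology M V"
   using homeomorphic_map_imp_homeomorphic_space homeomorphic_space_sym by blast
  hence "top_of_set (f ` V) homeomorphic_space Euclidean_space n" using V(3) homeomorphic_space_trans by blast
  ultimately show "\<exists>U. openin (top_of_set ?S) U \<and> s \<in> U \<and> top_of_set U homeomorphic_space Euclidean_space n"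
   using x(2) V(2) by blast
 qed
 ultimately show thesis using that[OF hom] by blast
qed

section \<open>Small simplices and iterated subdivision\<close>

definition small_simplex :: "'b::metric_space set => real => nat => ((nat => real) => 'b) => bool" where
 "small_simplex S r k \<sigma> \<longleftrightarrow> singular_simplex k (top_of_set S) \<sigma> \<and> (\<exists>x\<in>S. \<sigma> ` standard_simplex k \<subseteq> ball x r)"

abbreviation small_chain :: "'b::metric_space set => real => nat => 'b chain => bool" where
 "small_chain S r k c \<equiv> Poly_Mapping.keys c \<subseteq> Collect (small_simplex S r k)"

lemma small_imp_singular_chain: "small_chain S r k c ==> singular_chain k (top_of_set S) c"
 by (auto simp: singular_chain_def small_simplex_def)

lemma singular_chain_singular_subdivision_power:
 "singular_chain k X c ==> singular_chain k X ((singular_subdivision k ^^ j) c)"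
 by (induction j) (auto simp: singular_chain_singular_subdivision)

lemma chain_boundary_singular_subdivision_power:
 "singular_chain k X c ==> chain_boundary k ((singular_subdivision k ^^ j) c) = (singular_subdivision (k - 1) ^^ j) (chain_boundary k c)"
 by (induction j) (auto simp: chain_boundary_singular_subdivision[OF singular_chain_singular_subdivision_power])

lemma singular_subdivision_power_homologous:
 assumes "singular_relcycle k X {} c"
 shows "singular_relboundary k X {} ((singular_subdivision k ^^ j) c - c)"
proof -
 obtain h where h: "\<And>p. h p 0 = (0 :: 'a chain)" "\<And>p X c. singular_chain p X c ==> singular_chain (Suc p) X (h p c)"
   "\<And>p X c. singular_chain p X c ==> chain_boundary (Suc p) (h p c) + h (p - Suc 0) (chain_boundary p c) = (singular_subdivision p ^^ j) c - c"
  using chain_homotopic_iterated_singular_subdivision[of j] by metis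
 have "singular_chain k X c" "chain_boundary k c = 0" using assms by (auto simp: singular_cycle)
 thus ?thesis using h(2)[of k X c] h(3)[of k X c] h(1)[of "k - Suc 0"] by (auto simp: singular_boundary)
qed

lemma eventually_small_subdivision:
 assumes "singular_chain k (top_of_set S) c" "r > 0"
 shows "\<exists>n. \<forall>m\<ge>n. small_chain S r k ((singular_subdivision k ^^ m) c)"
proof -
 have op: "openin (top_of_set S) U" if "U \<in> (\<lambda>x. S \<inter> ball x r) ` S" for U using that by (auto simp: openin_open_Int)
 have cov: "topspace (top_of_set S) \<subseteq> \<Union>((\<lambda>x. S \<inter> ball x r) ` S)" using assms(2) by auto
 obtain n where n: "\<And>m f. n \<le> m ==> f \<in> Poly_Mapping.keys ((singular_subdivision k ^^ m) c) ==> \<exists>V\<in>(\<lambda>x. S \<inter> ball x r) ` S. f \<in> standard_simplex k \<rightarrow> V"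
  using sufficient_iterated_singular_subdivision_exists[OF op cov assms(1)] by blast
 have "small_simplex S r k f" if "n \<le> m" "f \<in> Poly_Mapping.keys ((singular_subdivision k ^^ m) c)" for m f
 proof -
  have "singular_simplex k (top_of_set S) f"
   using singular_chain_singular_subdivision_power[OF assms(1), of m] that(2) by (auto simp: singular_chain_def)
  thus ?thesis using n[OF that] by (fastforce simp: small_simplex_def)
 qed
 thus ?thesis by blast
qed

text \<open>Subdividing a given bounding chain makes it small but replaces its boundary by a
  subdivision of \<open>c\<close>; the homotopy \<open>h\<close> between subdivision and identity
  corrects this. As \<open>h\<close> works in every space at once, it keeps a simplex within its
  ball, so it is small on small chains.\<close>

lemma small_cycle_bounds_small:
 assumes c: "small_chain S r k c" and b: "singular_relboundary k (top_of_set S) {} c" and r: "r > 0"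
 shows "\<exists>w. small_chain S r (Suc k) w \<and> chain_boundary (Suc k) w = c"
proof -
 obtain w where w: "singular_chain (Suc k) (top_of_set S) w" "chain_boundary (Suc k) w = c"
  using b by (auto simp: singular_boundary)
 obtain n where n: "small_chain S r (Suc k) ((singular_subdivision (Suc k) ^^ n) w)"
  using eventually_small_subdivision[OF w(1) r] by blast
 obtain h where h: "\<And>p. h p 0 = (0 :: 'a chain)" "\<And>p c1 c2. h p (c1 - c2) = h p c1 - h p c2"
   "\<And>p X c. singular_chain p X c ==> singular_chain (Suc p) X (h p c)"
   "\<And>p X c. singular_chain p X c ==> chain_boundary (Suc p) (h p c) + h (p - Suc 0) (chain_boundary p c) = (singular_subdivision p ^^ n) c - c"
  using chain_homotopic_iterated_singular_subdivision[of n] by metis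
 have hs: "small_chain S r (Suc k) (h k c)"
  using c
 proof (induction c rule: frag_induction)
  case zero thus ?case by (simp add: h(1))
 next
  case (diff a b)
  thus ?case using keys_diff[of "h k a" "h k b"] by (auto simp: h(2))
 next
  case (one \<sigma>)
  then obtain x where s: "singular_simplex k (top_of_set S) \<sigma>" and x: "x \<in> S" "\<sigma> ` standard_simplex k \<subseteq> ball x r" by (auto simp: small_simplex_def)
  have "\<sigma> ` standard_simplex k \<subseteq> S" using s by (auto simp: singular_simplex_def continuous_map_def)
  hence "singular_simplex k (top_of_set (S \<inter> ball x r)) \<sigma>"
   using s x by (auto simp: singular_simplex_def continuous_map_in_subtopology)
  hence "singular_chain (Suc k) (top_of_set (S \<inter> ball x r)) (h k (frag_of \<sigma>))" by (intro h(3)) (simp add: singular_chain_of)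
  show ?case
  proof
   fix \<tau> assume "\<tau> \<in> Poly_Mapping.keys (h k (frag_of \<sigma>))"
   hence \<tau>: "singular_simplex (Suc k) (top_of_set (S \<inter> ball x r)) \<tau>"
   using \<open>singular_chain (Suc k) (top_of_set (S \<inter> ball x r)) (h k (frag_of \<sigma>))\<close> by (auto simp: singular_chain_def)
   hence "\<tau> ` standard_simplex (Suc k) \<subseteq> S \<inter> ball x r" by (auto simp: singular_simplex_def continuous_map_def)
   moreover have "singular_simplex (Suc k) (top_of_set S) \<tau>"
   using \<tau> by (auto simp: singular_simplex_def continuous_map_in_subtopology)
   ultimately show "\<tau> \<in> Collect (small_simplex S r (Suc k))" using x(1) by (auto simp: small_simplex_def)
  qed
 qed
 have ch: "singular_chain k (top_of_set S) c" using small_imp_singular_chain[OF c] .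
 have c0: "chain_boundary k c = 0" using chain_boundary_boundary_alt[OF w(1)] w(2) by simp
 have 1: "chain_boundary (Suc k) (h k c) = (singular_subdivision k ^^ n) c - c"
  using h(4)[OF ch] c0 h(1) by simp
 have 2: "chain_boundary (Suc k) ((singular_subdivision (Suc k) ^^ n) w) = (singular_subdivision k ^^ n) c"
  using chain_boundary_singular_subdivision_power[OF w(1), of n] w(2) by simp
 let ?w = "(singular_subdivision (Suc k) ^^ n) w - h k c"
 have "chain_boundary (Suc k) ?w = c" using 1 2 by (simp add: chain_boundary_diff)
 moreover have "small_chain S r (Suc k) ?w" using n hs keys_diff[of "(singular_subdivision (Suc k) ^^ n) w" "h k c"] by blast
 ultimately show ?thesis by blast
qed

text \<open>Over a small simplex a two-valued map splits into two continuous branches, so this is a sum of two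
 simplices, and the construction commutes with the boundary there.\<close>

definition lift_sum :: "'b::topological_space set => ('b => 'b set) => nat => ((nat => real) => 'b) => 'b chain" where
 "lift_sum S \<Phi> k \<sigma> = (\<Sum>\<tau>\<in>{\<tau>. singular_simplex k (top_of_set S) \<tau> \<and> (\<forall>t\<in>standard_simplex k. \<tau> t \<in> \<Phi> (\<sigma> t))}. frag_of \<tau>)"

text \<open>A lift \<open>\<tau>\<close> of \<open>\<sigma>\<close> agrees with one of the two
  branches at each point. The two sets of agreement are closed and disjoint, and the standard
  simplex is connected, so \<open>\<tau>\<close> is one of exactly two simplices.\<close>

lemma lift_sum_local:
 fixes S :: "'b::metric_space set"
 assumes W: "W \<subseteq> S" and f: "continuous_on W f" "f ` W \<subseteq> S" and g: "continuous_on W g" "g ` W \<subseteq> S"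
  and \<Phi>: "\<And>y. y \<in> W ==> \<Phi> y = {f y, g y} \<and> f y \<noteq> g y"
  and c: "singular_chain k (top_of_set W) c"
 shows "frag_extend (lift_sum S \<Phi> k) c = chain_map k f c + chain_map k g c"
proof -
 have single: "lift_sum S \<Phi> k \<sigma> = frag_of (simplex_map k f \<sigma>) + frag_of (simplex_map k g \<sigma>)"
  if \<sigma>: "singular_simplex k (top_of_set W) \<sigma>" for \<sigma>
 proof -
  have s: "continuous_on (standard_simplex k) \<sigma>" "\<sigma> ` standard_simplex k \<subseteq> W"
   using \<sigma> by (auto simp: singular_simplex_def continuous_map_in_subtopology euclidean_product_topology)
  have cf: "continuous_map (top_of_set W) (top_of_set S) f" "continuous_map (top_of_set W) (top_of_set S) g"
   using f g by auto
  have sf: "singular_simplex k (top_of_set S) (simplex_map k f \<sigma>)" "singular_simplex k (top_of_set S) (simplex_map k g \<sigma>)"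
   using singular_simplex_simplex_map[OF \<sigma> cf(1)] singular_simplex_simplex_map[OF \<sigma> cf(2)] by auto
  have ne: "simplex_map k f \<sigma> \<noteq> simplex_map k g \<sigma>"
  proof
   obtain t where t: "t \<in> standard_simplex k" using nonempty_standard_simplex by blast
   assume "simplex_map k f \<sigma> = simplex_map k g \<sigma>"
   from fun_cong[OF this, of t] have "f (\<sigma> t) = g (\<sigma> t)" using t by (simp add: simplex_map_def)
   thus False using \<Phi>[of "\<sigma> t"] s(2) t by blast
  qed
  have "{\<tau>. singular_simplex k (top_of_set S) \<tau> \<and> (\<forall>t\<in>standard_simplex k. \<tau> t \<in> \<Phi> (\<sigma> t))} = {simplex_map k f \<sigma>, simplex_map k g \<sigma>}"
  proof (intro equalityI subsetI)
   fix \<tau> assume "\<tau> \<in> {\<tau>. singular_simplex k (top_of_set S) \<tau> \<and> (\<forall>t\<in>standard_simplex k. \<tau> t \<in> \<Phi> (\<sigma> t))}"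
   hence \<tau>: "continuous_on (standard_simplex k) \<tau>" "\<tau> \<in> extensional (standard_simplex k)" "\<And>t. t \<in> standard_simplex k ==> \<tau> t = f (\<sigma> t) \<or> \<tau> t = g (\<sigma> t)"
   using s(2) \<Phi> by (auto simp: singular_simplex_def continuous_map_in_subtopology euclidean_product_topology, blast)
   have fs: "continuous_on (standard_simplex k) (\<lambda>t. f (\<sigma> t))" "continuous_on (standard_simplex k) (\<lambda>t. g (\<sigma> t))"
   using continuous_on_compose2[OF f(1) s(1,2)] continuous_on_compose2[OF g(1) s(1,2)] by auto
   define d where "d h t = dist (\<tau> t) (h (\<sigma> t))" for h :: "'b => 'b" and t
   let ?A = "\<lambda>h. {t \<in> standard_simplex k. d h t \<in> {0}}"
   have cl: "closedin (top_of_set (standard_simplex k)) (?A f)" "closedin (top_of_set (standard_simplex k)) (?A g)"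
   proof -
   have "continuous_on (standard_simplex k) (d f)" "continuous_on (standard_simplex k) (d g)"
   unfolding d_def by (intro continuous_on_dist \<tau>(1) fs)+
   moreover have "?A h = standard_simplex k \<inter> d h -` {0}" for h by auto
   ultimately show "closedin (top_of_set (standard_simplex k)) (?A f)" "closedin (top_of_set (standard_simplex k)) (?A g)"
   by (auto intro: continuous_closedin_preimage)
   qed
   have "?A f \<union> ?A g = standard_simplex k" using \<tau>(3) by (auto simp: d_def)
   moreover have "?A f \<inter> ?A g = {}" using \<Phi> s(2) by (auto simp: d_def) (metis image_subset_iff)
   moreover have "connected (standard_simplex k)"
   using connectedin_standard_simplex[of k] by (simp add: euclidean_product_topology)
   ultimately have "?A f = {} \<or> ?A g = {}"
   using cl unfolding connected_closedin_eq by blast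
   hence "(\<forall>t\<in>standard_simplex k. \<tau> t = f (\<sigma> t)) \<or> (\<forall>t\<in>standard_simplex k. \<tau> t = g (\<sigma> t))"
   using \<tau>(3) by (auto simp: d_def)
   thus "\<tau> \<in> {simplex_map k f \<sigma>, simplex_map k g \<sigma>}"
   using \<tau>(2) by (auto simp: simplex_map_def extensional_def fun_eq_iff)
  next
   fix \<tau> assume "\<tau> \<in> {simplex_map k f \<sigma>, simplex_map k g \<sigma>}"
   thus "\<tau> \<in> {\<tau>. singular_simplex k (top_of_set S) \<tau> \<and> (\<forall>t\<in>standard_simplex k. \<tau> t \<in> \<Phi> (\<sigma> t))}"
   using sf s(2) \<Phi> by (auto simp: simplex_map_def)
  qed
  thus ?thesis using ne by (simp add: lift_sum_def)
 qed
 show ?thesis using c unfolding singular_chain_def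
  by (induction c rule: frag_induction) (auto simp: single frag_extend_diff chain_map_diff)
qed

lemma singular_subdivision_power_extend:
 "(singular_subdivision k ^^ j) (frag_extend f c) = frag_extend (\<lambda>i. (singular_subdivision k ^^ j) (f i)) c"
 by (rule frag_induction[of c UNIV]) (auto simp: frag_extend_diff singular_subdivision_power_diff)

lemma singular_subdivision_power_cmul:
 "(singular_subdivision k ^^ j) (frag_cmul n c) = frag_cmul n ((singular_subdivision k ^^ j) c)"
proof -
 have "frag_cmul n c = frag_extend (\<lambda>_. c) (frag_cmul n (frag_of ()))" by (simp add: frag_extend_cmul)
 thus ?thesis by (simp only: singular_subdivision_power_extend) (simp add: frag_extend_cmul)
qed

lemma singular_subdivision_power_add:
 "(singular_subdivision k ^^ j) (a + b) = (singular_subdivision k ^^ j) a + (singular_subdivision k ^^ j) b"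
 using singular_subdivision_power_diff[where p=k and n=j and a=a and b="0 - b"] singular_subdivision_power_diff[where p=k and n=j and a=0 and b=b] by simp

lemma chain_boundary_extend_of:
 "frag_extend (\<lambda>\<sigma>. chain_boundary k (frag_of \<sigma>)) c = chain_boundary k c"
 using chain_boundary_frag_extend[of k frag_of c] frag_expansion[of c] by simp

text \<open>One number of subdivisions serves all the chains, since the maps built from their
  subdivisions have to be compatible with boundaries.\<close>

lemma eventually_small_subdivision_finite:
 assumes "finite F" "\<And>k c. (k, c) \<in> F ==> singular_chain k (top_of_set S) c" "r > 0"
 shows "\<exists>j. \<forall>(k, c)\<in>F. small_chain S r k ((singular_subdivision k ^^ j) c)"
proof -
 have "\<exists>n. \<forall>m\<ge>n. small_chain S r (fst p) ((singular_subdivision (fst p) ^^ m) (snd p))" if "p \<in> F" for p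
  using eventually_small_subdivision[of "fst p" S "snd p" r] assms(2)[of "fst p" "snd p"] that assms(3) by simp
 hence "\<forall>p\<in>F. \<exists>n. \<forall>m\<ge>n. small_chain S r (fst p) ((singular_subdivision (fst p) ^^ m) (snd p))" by blast
 from bchoice[OF this] obtain n where n: "\<forall>p\<in>F. \<forall>m\<ge>n p. small_chain S r (fst p) ((singular_subdivision (fst p) ^^ m) (snd p))" ..
 have "small_chain S r k ((singular_subdivision k ^^ (\<Sum>p\<in>F. n p)) c)" if "(k, c) \<in> F" for k c
  using n that member_le_sum[of "(k,c)" F n] assms(1) by fastforce
 thus ?thesis by blast
qed

text \<open>Near a point \<open>p\<close> only those members occur that contain \<open>p\<close>,
  because the others form a closed set; so \<open>p\<close> itself is the common point, and a
  Lebesgue number makes this uniform. For closed members, coming close enough together already means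
  intersecting.\<close>

lemma closed_cover_common_point:
 fixes S :: "'b::metric_space set"
 assumes "compact S" "finite I" "\<And>i. i \<in> I ==> compact (A i) \<and> A i \<subseteq> S"
 shows "\<exists>\<kappa>>0. \<forall>x\<in>S. \<exists>z\<in>S. \<forall>i\<in>I. A i \<inter> ball x \<kappa> \<noteq> {} --> z \<in> A i"
proof -
 have cov: "\<exists>V. openin (top_of_set S) V \<and> p \<in> V \<and> (\<exists>z\<in>S. \<forall>i\<in>I. A i \<inter> V \<noteq> {} --> z \<in> A i)" if p: "p \<in> S" for p
 proof -
  let ?C = "\<Union>i\<in>{i\<in>I. p \<notin> A i}. A i"
  have "compact ?C" using assms(2,3) by (intro compact_UN) auto
  hence "open (- ?C)" using compact_imp_closed open_Compl by blast
  hence "openin (top_of_set S) (S - ?C)" unfolding Diff_eq by (rule openin_open_Int)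
  thus ?thesis using p by (intro exI[of _ "S - ?C"]) blast
 qed
 obtain \<delta> where \<delta>: "\<delta> > 0" "\<And>x. x \<in> S ==> \<exists>V. (\<exists>z\<in>S. \<forall>i\<in>I. A i \<inter> V \<noteq> {} --> z \<in> A i) \<and> V \<subseteq> S \<and> S \<inter> ball x \<delta> \<subseteq> V"
  using compact_uniform_cover[OF assms(1) cov] by blast
 have "\<exists>z\<in>S. \<forall>i\<in>I. A i \<inter> ball x \<delta> \<noteq> {} --> z \<in> A i" if x: "x \<in> S" for x
 proof -
  obtain V z where V: "z \<in> S" "\<forall>i\<in>I. A i \<inter> V \<noteq> {} --> z \<in> A i" "S \<inter> ball x \<delta> \<subseteq> V" using \<delta>(2)[OF x] by blast
  have "A i \<inter> V \<noteq> {}" if "i \<in> I" "A i \<inter> ball x \<delta> \<noteq> {}" for i using V(3) assms(3)[OF that(1)] that(2) by blast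
  thus ?thesis using V(1,2) by blast
 qed
 thus ?thesis using \<delta>(1) by blast
qed

section \<open>The flag complex of a closed cover and its realisation\<close>

locale closed_nerve =
 fixes S :: "'b::metric_space set" and A :: "'i => 'b set" and I :: "'i set" and \<kappa> \<mu> :: real and N :: nat
 assumes finI: "finite I" and AS: "\<And>i. i \<in> I ==> A i \<subseteq> S" and cover: "S \<subseteq> (\<Union>i\<in>I. A i)"
  and common: "\<And>x. x \<in> S ==> \<exists>z\<in>S. \<forall>i\<in>I. A i \<inter> ball x \<kappa> \<noteq> {} --> z \<in> A i"
  and mesh: "\<And>i x y. i \<in> I ==> x \<in> A i ==> y \<in> A i ==> dist x y < \<mu>"
  and mult: "\<And>x. card {i\<in>I. x \<in> A i} \<le> N"
begin

definition "sel k \<sigma> = {i \<in> I. A i \<inter> \<sigma> ` standard_simplex k \<noteq> {}}"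

text \<open>The simplices of the barycentric subdivision of the nerve, with the largest index set
  first; a common point for the largest set serves all the others.\<close>

definition "flags = {l. l \<noteq> [] \<and> sorted_wrt (\<lambda>s t. t \<subset> s) l \<and> {} \<notin> set l \<and> hd l \<subseteq> I \<and> (\<exists>z\<in>S. \<forall>i\<in>hd l. z \<in> A i)}"

definition "pick l = (SOME z. z \<in> S \<and> (\<forall>i\<in>hd l. z \<in> A i))"

definition deg :: "'i set list => nat" where "deg l = length l - 1"

text \<open>The boundary without augmentation: \<open>flag_boundary\<close> would send a flag of
  length 1 to the empty list.\<close>

definition bdry :: "'i set list => ('i set list \<Rightarrow>\<^sub>0 int)" where
 "bdry l = (if length l \<ge> 2 then flag_boundary l else 0)"

abbreviation nmap :: "nat => 'b chain => ('i set list \<Rightarrow>\<^sub>0 int)" where "nmap k \<equiv> frag_extend (nerve_map sel k)"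

lemma sel_eq: "sel = (\<lambda>k \<sigma>. {i \<in> I. A i \<inter> \<sigma> ` standard_simplex k \<noteq> {}})"
 by (rule ext)+ (simp add: sel_def)

lemma topcover: "topspace (top_of_set S) \<subseteq> (\<Union>i\<in>I. A i)" using cover by simp

lemma pick: "l \<in> flags ==> pick l \<in> S \<and> (\<forall>i\<in>hd l. pick l \<in> A i)"
 unfolding pick_def by (rule someI_ex) (auto simp: flags_def)

lemma flags_hd: "l \<in> flags ==> s \<in> set l ==> s \<subseteq> hd l"
 unfolding flags_def by (cases l) auto

lemma hd_flag_nonempty: "l \<in> flags ==> \<exists>i. i \<in> hd l \<and> i \<in> I"
 unfolding flags_def by (cases l) auto

lemma subflag:
 assumes "l \<in> flags" "l' \<noteq> []" "set l' \<subseteq> set l" "sorted_wrt (\<lambda>s t. t \<subset> s) l'"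
 shows "l' \<in> flags" "dist (pick l) (pick l') < \<mu>"
proof -
 have h: "hd l' \<in> set l" using assms(2,3) by (cases l') auto
 hence h': "hd l' \<subseteq> hd l" using flags_hd[OF assms(1)] by blast
 show l': "l' \<in> flags" using assms h' unfolding flags_def by blast
 obtain i where i: "i \<in> hd l'" "i \<in> I" using hd_flag_nonempty[OF l'] by blast
 show "dist (pick l) (pick l') < \<mu>"
  by (rule mesh[OF i(2)]) (use i pick[OF assms(1)] pick[OF l'] h' in auto)
qed

text \<open>A flag loses at least one index per step, and its head indexes members through the point
  \<open>pick l\<close>; so the multiplicity bounds the length.\<close>

lemma flag_length: "l \<in> flags ==> length l \<le> N"
proof -
 assume l: "l \<in> flags"
 have "length l \<le> card (hd l)" if "sorted_wrt (\<lambda>s t. t \<subset> s) l" "l \<noteq> []" "finite (hd l)" "{} \<notin> set l" for l :: "'i set list"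
  using that
 proof (induction l)
  case (Cons a l)
  show ?case
  proof (cases l)
   case Nil thus ?thesis using Cons.prems by (simp add: Suc_leI card_gt_0_iff)
  next
   case (Cons b m)
   hence "b \<subset> a" using Cons.prems by simp
   hence "card b < card a" "finite b" using Cons.prems(3) by (auto simp: psubset_card_mono finite_subset psubset_imp_subset)
   thus ?thesis using Cons.IH Cons.prems Cons by simp
  qed
 qed simp
 moreover have "finite (hd l)" using l finI unfolding flags_def by (auto intro: finite_subset)
 ultimately have "length l \<le> card (hd l)" using l unfolding flags_def by blast
 also have "hd l \<subseteq> {i\<in>I. pick l \<in> A i}" using l pick[OF l] unfolding flags_def by auto
 hence "card (hd l) \<le> card {i\<in>I. pick l \<in> A i}" using finI by (intro card_mono) auto
 also have "\<dots> \<le> N" by (rule mult)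
 finally show ?thesis .
qed

lemma finite_flags: "finite flags"
proof (rule finite_subset)
 show "flags \<subseteq> {l. set l \<subseteq> Pow I \<and> length l \<le> N}"
 proof
  fix l assume l: "l \<in> flags"
  hence "hd l \<subseteq> I" by (simp add: flags_def)
  hence "set l \<subseteq> Pow I" using flags_hd[OF l] by blast
  thus "l \<in> {l. set l \<subseteq> Pow I \<and> length l \<le> N}" using flag_length[OF l] by simp
 qed
 show "finite {l. set l \<subseteq> Pow I \<and> length l \<le> N}" using finI by (intro finite_lists_length_le) auto
qed

lemma keys_bdry:
 assumes "l \<in> flags" "l' \<in> Poly_Mapping.keys (flag_boundary l)" "2 \<le> length l"
 shows "l' \<in> flags" "Suc (length l') = length l" "deg l = Suc (deg l')" "dist (pick l) (pick l') < \<mu>"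
proof -
 have k: "Suc (length l') = length l" "set l' \<subseteq> set l" "sorted_wrt (\<lambda>s t. t \<subset> s) l'"
  using keys_flag_boundary[OF assms(2)] assms(1) by (auto simp: flags_def)
 hence "l' \<noteq> []" using assms(3) by auto
 from subflag[OF assms(1) this k(2,3)] show "l' \<in> flags" "dist (pick l) (pick l') < \<mu>" by auto
 show "Suc (length l') = length l" by fact
 show "deg l = Suc (deg l')" using k(1) \<open>l' \<noteq> []\<close> by (cases l') (auto simp: deg_def)
qed

lemma keys_bdry': "l \<in> flags ==> Poly_Mapping.keys (bdry l) \<subseteq> {l' \<in> flags. deg l = Suc (deg l')}"
 using keys_bdry unfolding bdry_def by auto

text \<open>For flags of length 2 the boundary consists of vertices, on which \<open>bdry\<close> is
  0; from length 3 on, \<open>bdry\<close> and \<open>flag_boundary\<close> agree in both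
  applications.\<close>

lemma bdry_bdry: "l \<in> flags ==> frag_extend bdry (bdry l) = 0"
proof (cases "length l \<ge> 3")
 case True
 assume l: "l \<in> flags"
 have "frag_extend bdry (bdry l) = frag_extend flag_boundary (flag_boundary l)"
 proof -
  have "2 \<le> length l'" if "l' \<in> Poly_Mapping.keys (flag_boundary l)" for l'
   using keys_bdry(2)[OF l that] True by simp
  hence "frag_extend bdry (flag_boundary l) = frag_extend flag_boundary (flag_boundary l)"
   by (intro frag_extend_eq) (simp add: bdry_def)
  thus ?thesis using True by (simp add: bdry_def)
 qed
 thus ?thesis by (simp add: flag_boundary_boundary)
next
 case False
 assume l: "l \<in> flags"
 show ?thesis
 proof (cases "2 \<le> length l")
  case True
  have "\<not> 2 \<le> length l'" if "l' \<in> Poly_Mapping.keys (flag_boundary l)" for l'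
   using keys_bdry(2)[OF l that True] False by simp
  hence "frag_extend bdry (flag_boundary l) = 0"
   by (intro frag_extend_eq_0) (simp add: bdry_def)
  thus ?thesis using True by (simp add: bdry_def)
 qed (simp add: bdry_def)
qed

lemma deg_length: "l \<in> flags ==> length l = Suc (deg l)"
 by (cases l) (auto simp: flags_def deg_def)

text \<open>Smallness turns the lists produced by \<open>nerve_map\<close> into flags: all members
  met by a simplex inside a ball of radius \<open>\<kappa>\<close> have a common point.\<close>

lemma keys_nerve_map_small:
 assumes "small_simplex S \<kappa> k \<sigma>" "l \<in> Poly_Mapping.keys (nerve_map sel k \<sigma>)"
 shows "l \<in> flags" "deg l = k" "hd l \<subseteq> sel k \<sigma>"
proof -
 have s: "singular_simplex k (top_of_set S) \<sigma>" and "\<exists>x\<in>S. \<sigma> ` standard_simplex k \<subseteq> ball x \<kappa>" using assms(1) by (auto simp: small_simplex_def)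
 then obtain x where x: "x \<in> S" "\<sigma> ` standard_simplex k \<subseteq> ball x \<kappa>" by blast
 have kn: "length l = Suc k \<and> sorted_wrt (\<lambda>s t. t \<subset> s) l \<and> hd l \<subseteq> sel k \<sigma> \<and> {} \<notin> set l"
  using keys_nerve_map[OF topcover s, of l] assms(2) unfolding sel_eq by blast
 obtain z where z: "z \<in> S" "\<forall>i\<in>I. A i \<inter> ball x \<kappa> \<noteq> {} --> z \<in> A i" using common[OF x(1)] by blast
 have "z \<in> A i \<and> i \<in> I" if "i \<in> sel k \<sigma>" for i using that z(2) x(2) unfolding sel_def by blast
 thus "l \<in> flags" using kn z(1) unfolding flags_def by fastforce
 show "deg l = k" "hd l \<subseteq> sel k \<sigma>" using kn by (auto simp: deg_def)
qed

lemma keys_nmap_small: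
 "small_chain S \<kappa> k c ==> Poly_Mapping.keys (nmap k c) \<subseteq> {l \<in> flags. deg l = k}"
 by (rule keys_frag_extendI) (use keys_nerve_map_small in auto)

lemma bdry_nmap:
 assumes "small_chain S \<kappa> (Suc k) c"
 shows "frag_extend bdry (nmap (Suc k) c) = nmap k (chain_boundary (Suc k) c)"
proof -
 have "frag_extend bdry (nmap (Suc k) c) = frag_extend flag_boundary (nmap (Suc k) c)"
  using keys_nmap_small[OF assms] deg_length by (intro frag_extend_eq) (fastforce simp: bdry_def)
 also have "\<dots> = nmap k (chain_boundary (Suc k) c)"
  using flag_boundary_nerve_map_chain[OF topcover small_imp_singular_chain[OF assms]] unfolding sel_eq by blast
 finally show ?thesis .
qed

lemma bdry_nmap_cycle:
 assumes "small_chain S \<kappa> k c" "chain_boundary k c = 0"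
 shows "frag_extend bdry (nmap k c) = 0"
proof (cases k)
 case 0
 thus ?thesis using keys_nmap_small[OF assms(1)] deg_length
  by (intro frag_extend_eq_0) (fastforce simp: bdry_def)
next
 case (Suc j)
 thus ?thesis using bdry_nmap[where k=j and c=c] assms by simp
qed

lemma small_boundary:
 assumes "small_chain S \<kappa> (Suc k) c"
 shows "small_chain S \<kappa> k (chain_boundary (Suc k) c)"
proof -
 have "small_chain S \<kappa> k (frag_extend (\<lambda>\<sigma>. chain_boundary (Suc k) (frag_of \<sigma>)) c)"
 proof (rule keys_frag_extendI[OF assms])
  fix \<sigma> assume "\<sigma> \<in> Collect (small_simplex S \<kappa> (Suc k))"
  then obtain x where s: "singular_simplex (Suc k) (top_of_set S) \<sigma>" "x \<in> S" "\<sigma> ` standard_simplex (Suc k) \<subseteq> ball x \<kappa>"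
   by (auto simp: small_simplex_def)
  show "small_chain S \<kappa> k (chain_boundary (Suc k) (frag_of \<sigma>))"
  proof
   fix f assume "f \<in> Poly_Mapping.keys (chain_boundary (Suc k) (frag_of \<sigma>))"
   then obtain i where i: "i \<le> Suc k" "f = singular_face (Suc k) i \<sigma>" using keys_chain_boundary_of by metis
   thus "f \<in> Collect (small_simplex S \<kappa> k)"
   using singular_simplex_singular_face[OF s(1), of i] singular_face_image[OF i(1), of \<sigma>] s(2,3) by (auto simp: small_simplex_def)
  qed
 qed
 thus ?thesis by (simp add: chain_boundary_extend_of)
qed

definition "pt z = restrict (\<lambda>_. z) (standard_simplex 0)"

lemma singular_simplex_pt: "z \<in> U ==> singular_simplex 0 (top_of_set U) (pt z)"
 by (auto simp: singular_simplex_def pt_def continuous_map_in_subtopology intro: continuous_map_eq[of _ _ "\<lambda>_. z"])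

text \<open>Vertices go to the points \<open>pick l\<close>, and a longer flag is filled inside a
  ball around its own point. The filling degree \<open>k\<close> belongs to flags of length
  \<open>k + 2\<close>, since a flag of degree \<open>k + 1\<close> requires a chain with a given
  \<open>k\<close>-dimensional boundary.\<close>

lemma nerve_realization:
 assumes acy: "\<And>k. k \<le> R ==> acyclic_balls S (2 * \<rho> k) (\<rho> (Suc k))"
  and \<rho>: "0 < \<rho> 0" "\<And>k. k \<le> Suc R ==> \<rho> 0 \<le> \<rho> k \<and> \<rho> k \<le> \<rho> (Suc R)" and \<mu>: "\<mu> \<le> \<rho> 0" and N: "N \<le> R"
 obtains iota where
  "\<And>l. l \<in> flags ==> singular_chain (deg l) (top_of_set (S \<inter> ball (pick l) (\<rho> (Suc R)))) (iota l)"
  "\<And>l. l \<in> flags ==> chain_boundary (deg l) (iota l) = frag_extend iota (bdry l)"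
  "\<And>l. l \<in> flags ==> deg l = 0 ==> augment (iota l) = frag_of ()"
proof -
 let ?G = "\<lambda>k. {l \<in> flags. length l = k + 2}"
 let ?pt = "\<lambda>l. frag_of (pt (pick l))"
 \<comment> \<open>Only for edges is the boundary prescribed from outside, by the end points; in
   higher degrees the recursion supplies it, hence the value 0.\<close>
 let ?Q = "\<lambda>k l. if k = 0 then frag_extend ?pt (flag_boundary l) else 0"
 have "\<exists>H. \<forall>k\<le>R. \<forall>l\<in>?G k. singular_chain (Suc k) (top_of_set (S \<inter> ball (pick l) (\<rho> (Suc k)))) (H k l) \<and>
  chain_boundary (Suc k) (H k l) = ?Q k l + (if k = 0 then 0 else frag_cmul 1 (frag_extend (H (k - 1)) (flag_boundary l)))"
 proof (rule acyclic_carriers)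
  show "pick l \<in> S" if "l \<in> ?G k" for k l using pick that by auto
  show "Poly_Mapping.keys (flag_boundary l) \<subseteq> {l' \<in> ?G k. dist (pick l) (pick l') \<le> \<rho> 0}" if "l \<in> ?G (Suc k)" for k l
   using keys_bdry[of l] that \<mu> by fastforce
  show "frag_extend flag_boundary (flag_boundary l) = 0" for l :: "'i set list" by (rule flag_boundary_boundary)
  show "singular_chain k (top_of_set (S \<inter> ball (pick l) (\<rho> 0))) (?Q k l)" if l: "l \<in> ?G k" for k l
  proof (cases "k = 0")
   case True
   have "singular_chain 0 (top_of_set (S \<inter> ball (pick l) (\<rho> 0))) (frag_extend ?pt (flag_boundary l))"
   proof (rule singular_chain_frag_extend[OF subset_refl])
   fix l' assume "l' \<in> Poly_Mapping.keys (flag_boundary l)"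
   hence "l' \<in> flags" "dist (pick l) (pick l') < \<mu>" using keys_bdry[of l l'] l by auto
   thus "singular_chain 0 (top_of_set (S \<inter> ball (pick l) (\<rho> 0))) (?pt l')"
   using pick[of l'] \<mu> by (simp add: singular_chain_of singular_simplex_pt)
   qed
   thus ?thesis using True by simp
  qed simp
  show "augment (?Q 0 l) = 0" if l: "l \<in> ?G 0" for l
  proof -
   obtain a b where "l = [a, b]" using l by (auto simp: length_Suc_conv numeral_2_eq_2)
   thus ?thesis by (simp add: frag_extend_diff)
  qed
  show "chain_boundary (Suc k) (?Q (Suc k) l) + frag_cmul 1 (frag_extend (?Q k) (flag_boundary l)) = 0" if "l \<in> ?G (Suc k)" for k l
  proof (cases "k = 0")
   case True
   have "frag_extend (\<lambda>l. frag_extend ?pt (flag_boundary l)) c = frag_extend ?pt (frag_extend flag_boundary c)" for c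
   by (rule frag_induction[of c UNIV]) (auto simp: frag_extend_diff)
   thus ?thesis using True by (simp add: flag_boundary_boundary)
  qed (simp add: frag_extend_eq_0)
 qed (use acy \<rho> in auto)
 then obtain H where H: "\<And>k l. k \<le> R ==> l \<in> ?G k ==> singular_chain (Suc k) (top_of_set (S \<inter> ball (pick l) (\<rho> (Suc k)))) (H k l) \<and>
  chain_boundary (Suc k) (H k l) = ?Q k l + (if k = 0 then 0 else frag_cmul 1 (frag_extend (H (k - 1)) (flag_boundary l)))" by blast
 define iota where "iota l = (if length l = 1 then ?pt l else H (length l - 2) l)" for l
 have iS: "iota l = H k l \<and> l \<in> ?G k \<and> k \<le> R \<and> length l = k + 2" if "l \<in> flags" "deg l = Suc k" for l k
  using deg_length[OF that(1)] that flag_length[OF that(1)] N by (simp add: iota_def)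
 have i0: "iota l = ?pt l \<and> length l = 1" if "l \<in> flags" "deg l = 0" for l
  using deg_length[OF that(1)] that by (simp add: iota_def)
 show thesis
 proof (rule that[of iota])
  fix l assume l: "l \<in> flags"
  show "singular_chain (deg l) (top_of_set (S \<inter> ball (pick l) (\<rho> (Suc R)))) (iota l)"
  proof (cases "deg l")
   case 0
   have "0 < \<rho> (Suc R)" using \<rho>(1) \<rho>(2)[of "Suc R"] by simp
   thus ?thesis using 0 i0[OF l 0] pick[OF l] by (simp add: singular_chain_of singular_simplex_pt)
  next
   case (Suc k)
   have "singular_chain (Suc k) (top_of_set (S \<inter> ball (pick l) (\<rho> (Suc k)))) (iota l)" using iS[OF l Suc] H[of k l] by auto
   thus ?thesis unfolding Suc by (rule top_of_set_chain_mono) (use \<rho>(2)[of "Suc k"] iS[OF l Suc] in auto)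
  qed
  show "chain_boundary (deg l) (iota l) = frag_extend iota (bdry l)"
  proof (cases "deg l")
   case 0
   thus ?thesis using i0[OF l 0] by (simp add: bdry_def chain_boundary_def)
  next
   case (Suc k)
   note i = iS[OF l Suc]
   have kb: "l' \<in> flags \<and> deg l' = k" if "l' \<in> Poly_Mapping.keys (flag_boundary l)" for l'
   using keys_bdry[OF l that] i Suc by auto
   have "chain_boundary (Suc k) (iota l) = frag_extend iota (flag_boundary l)"
   proof (cases k)
   case 0
   have "frag_extend iota (flag_boundary l) = frag_extend ?pt (flag_boundary l)"
   using kb i0 0 by (intro frag_extend_eq) auto
   thus ?thesis using H[of k l] i 0 by simp
   next
   case (Suc j)
   have "frag_extend iota (flag_boundary l) = frag_extend (H j) (flag_boundary l)"
   using kb iS Suc by (intro frag_extend_eq) blast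
   thus ?thesis using H[of k l] i Suc by simp
   qed
   thus ?thesis using Suc i by (simp add: bdry_def)
  qed
  show "augment (iota l) = frag_of ()" if "deg l = 0" using i0[OF l that] by simp
 qed
qed

text \<open>Realisation after the nerve map is chain homotopic to the identity on small chains,
  again by acyclic carriers. In \<open>r + \<mu> + 2 * \<kappa>\<close> the terms are the size of
  \<open>iota l\<close> around \<open>pick l\<close>, the distance from \<open>pick l\<close> to the
  simplex, and the diameter of a small simplex.\<close>

lemma nerve_realization_homologous:
 assumes acy: "\<And>k. k \<le> R ==> acyclic_balls S (2 * \<rho> k) (\<rho> (Suc k))"
  and \<rho>: "0 < \<rho> 0" "\<And>k. k \<le> Suc R ==> \<rho> 0 \<le> \<rho> k" and r: "r + \<mu> + 2 * \<kappa> \<le> \<rho> 0" and pos: "0 < r" "0 < \<mu>" "0 < \<kappa>"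
  and iota1: "\<And>l. l \<in> flags ==> singular_chain (deg l) (top_of_set (S \<inter> ball (pick l) r)) (iota l)"
  and iota2: "\<And>l. l \<in> flags ==> chain_boundary (deg l) (iota l) = frag_extend iota (bdry l)"
  and iota3: "\<And>l. l \<in> flags ==> deg l = 0 ==> augment (iota l) = frag_of ()"
  and k: "k \<le> R" and c: "small_chain S \<kappa> k c" "chain_boundary k c = 0"
 shows "singular_relboundary k (top_of_set S) {} (frag_extend iota (nmap k c) - c)"
proof -
 let ?G = "\<lambda>k. Collect (small_simplex S \<kappa> k)"
 let ?Q = "\<lambda>k \<sigma>. frag_extend iota (nerve_map sel k \<sigma>) - frag_of \<sigma>"
 \<comment> \<open>Vertex number 0 of every standard simplex; its image is the centre of the ball
   that carries \<open>\<sigma>\<close>.\<close>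
 let ?v = "(\<lambda>j. if j = 0 then 1 else 0) :: nat => real"
 let ?ctr = "\<lambda>k \<sigma>. \<sigma> ?v"
 have v: "?v \<in> standard_simplex k" for k by simp
 have diam: "dist y z < 2 * \<kappa>" if "\<sigma> \<in> ?G k" "y \<in> \<sigma> ` standard_simplex k" "z \<in> \<sigma> ` standard_simplex k" for \<sigma> k y z
 proof -
  have "\<exists>x. \<sigma> ` standard_simplex k \<subseteq> ball x \<kappa>" using that(1) by (auto simp: small_simplex_def)
  then obtain x where "\<sigma> ` standard_simplex k \<subseteq> ball x \<kappa>" by blast
  hence "dist x y < \<kappa>" "dist x z < \<kappa>" using that by auto
  thus ?thesis using dist_triangle[of y z x] by (simp add: dist_commute)
 qed
 have imS: "\<sigma> ` standard_simplex k \<subseteq> S" if "\<sigma> \<in> ?G k" for \<sigma> k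
  using that by (auto simp: small_simplex_def singular_simplex_def continuous_map_def)
 have chS: "singular_chain k (top_of_set (S \<inter> ball (?ctr k \<sigma>) (\<rho> 0))) (?Q k \<sigma>)" if \<sigma>: "\<sigma> \<in> ?G k" for k \<sigma>
 proof (intro singular_chain_diff)
  show "singular_chain k (top_of_set (S \<inter> ball (?ctr k \<sigma>) (\<rho> 0))) (frag_extend iota (nerve_map sel k \<sigma>))"
  proof (rule singular_chain_frag_extend[OF subset_refl])
   fix l assume l: "l \<in> Poly_Mapping.keys (nerve_map sel k \<sigma>)"
   have lf: "l \<in> flags" "deg l = k" "hd l \<subseteq> sel k \<sigma>" using keys_nerve_map_small[OF _ l] \<sigma> by auto
   obtain i where i: "i \<in> hd l" "i \<in> I" using hd_flag_nonempty[OF lf(1)] by blast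
   obtain y where y: "y \<in> A i" "y \<in> \<sigma> ` standard_simplex k" using i lf(3) unfolding sel_def by blast
   have "dist y (pick l) < \<mu>" by (rule mesh[OF i(2) y(1)]) (use pick[OF lf(1)] i in auto)
   moreover have "dist (?ctr k \<sigma>) y < 2 * \<kappa>" by (rule diam[OF \<sigma>]) (use v y in auto)
   ultimately have d: "dist (?ctr k \<sigma>) (pick l) < \<mu> + 2 * \<kappa>" using dist_triangle[of "?ctr k \<sigma>" "pick l" y] by linarith
   have "ball (pick l) r \<subseteq> ball (?ctr k \<sigma>) (\<rho> 0)"
   proof
   fix z assume "z \<in> ball (pick l) r"
   thus "z \<in> ball (?ctr k \<sigma>) (\<rho> 0)" using d r dist_triangle[of "?ctr k \<sigma>" z "pick l"] by simp
   qed
   thus "singular_chain k (top_of_set (S \<inter> ball (?ctr k \<sigma>) (\<rho> 0))) (iota l)"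
   using iota1[OF lf(1)] lf(2) by (auto intro: top_of_set_chain_mono)
  qed
  have "\<sigma> ` standard_simplex k \<subseteq> ball (?ctr k \<sigma>) (\<rho> 0)"
  proof
   fix y assume "y \<in> \<sigma> ` standard_simplex k"
   hence "dist (?ctr k \<sigma>) y < 2 * \<kappa>" using diam[OF \<sigma>] v by blast
   thus "y \<in> ball (?ctr k \<sigma>) (\<rho> 0)" using r pos by simp
  qed
  thus "singular_chain k (top_of_set (S \<inter> ball (?ctr k \<sigma>) (\<rho> 0))) (frag_of \<sigma>)"
   using \<sigma> imS[OF \<sigma>] by (auto simp: singular_chain_of small_simplex_def singular_simplex_def continuous_map_in_subtopology)
 qed
 have ext: "frag_extend (?Q k) c = frag_extend iota (nmap k c) - c" for k c
  by (rule frag_induction[of c UNIV]) (auto simp: frag_extend_diff)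
 have "\<exists>H. \<forall>k\<le>R. \<forall>\<sigma>\<in>?G k. singular_chain (Suc k) (top_of_set (S \<inter> ball (?ctr k \<sigma>) (\<rho> (Suc k)))) (H k \<sigma>) \<and>
  chain_boundary (Suc k) (H k \<sigma>) = ?Q k \<sigma> + (if k = 0 then 0 else frag_cmul (-1) (frag_extend (H (k - 1)) (chain_boundary k (frag_of \<sigma>))))"
 proof (rule acyclic_carriers)
  show "?ctr k \<sigma> \<in> S" if "\<sigma> \<in> ?G k" for k \<sigma> using imS[OF that] v by blast
  show "Poly_Mapping.keys (chain_boundary (Suc k) (frag_of \<sigma>)) \<subseteq> {f \<in> ?G k. dist (?ctr (Suc k) \<sigma>) (?ctr k f) \<le> \<rho> 0}"
   if \<sigma>: "\<sigma> \<in> ?G (Suc k)" for k \<sigma>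
  proof
   fix f assume f: "f \<in> Poly_Mapping.keys (chain_boundary (Suc k) (frag_of \<sigma>))"
   have "small_chain S \<kappa> k (chain_boundary (Suc k) (frag_of \<sigma>))" by (rule small_boundary) (use \<sigma> in auto)
   hence 1: "f \<in> ?G k" using f by blast
   obtain i where i: "i \<le> Suc k" "f = singular_face (Suc k) i \<sigma>" using keys_chain_boundary_of f by metis
   have "?ctr k f \<in> \<sigma> ` standard_simplex (Suc k)" using singular_face_image[OF i(1), of \<sigma>] i(2) v[of k] by blast
   hence "dist (?ctr (Suc k) \<sigma>) (?ctr k f) < 2 * \<kappa>" using diam[OF \<sigma>] v[of "Suc k"] by blast
   thus "f \<in> {f \<in> ?G k. dist (?ctr (Suc k) \<sigma>) (?ctr k f) \<le> \<rho> 0}" using 1 r pos by simp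
  qed
  show "frag_extend (\<lambda>\<sigma>. chain_boundary (Suc k) (frag_of \<sigma>)) (chain_boundary (Suc (Suc k)) (frag_of \<sigma>)) = 0"
   if "\<sigma> \<in> ?G (Suc (Suc k))" for k \<sigma>
   unfolding chain_boundary_extend_of
   using that chain_boundary_boundary_alt[of "Suc k" "top_of_set S" "frag_of \<sigma>"] by (simp add: small_simplex_def singular_chain_of)
  show "singular_chain k (top_of_set (S \<inter> ball (?ctr k \<sigma>) (\<rho> 0))) (?Q k \<sigma>)" if "\<sigma> \<in> ?G k" for k \<sigma> by (rule chS[OF that])
  show "augment (?Q 0 \<sigma>) = 0" if \<sigma>: "\<sigma> \<in> ?G 0" for \<sigma>
  proof -
   have "[sel 0 \<sigma>] \<in> flags" "deg [sel 0 \<sigma>] = 0" using keys_nerve_map_small[of 0 \<sigma> "[sel 0 \<sigma>]"] \<sigma> by (auto simp: keys_frag_of)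
   thus ?thesis using iota3 by simp
  qed
  show "chain_boundary (Suc k) (?Q (Suc k) \<sigma>) + frag_cmul (-1) (frag_extend (?Q k) (chain_boundary (Suc k) (frag_of \<sigma>))) = 0"
   if \<sigma>: "\<sigma> \<in> ?G (Suc k)" for k \<sigma>
  proof -
   have sm: "small_chain S \<kappa> (Suc k) (frag_of \<sigma>)" using \<sigma> by auto
   have "chain_boundary (Suc k) (frag_extend iota (nmap (Suc k) (frag_of \<sigma>))) = frag_extend (\<lambda>l. frag_extend iota (bdry l)) (nmap (Suc k) (frag_of \<sigma>))"
   unfolding chain_boundary_frag_extend using keys_nmap_small[OF sm] iota2 by (intro frag_extend_eq) force
   also have "\<dots> = frag_extend iota (frag_extend bdry (nmap (Suc k) (frag_of \<sigma>)))"
   by (rule frag_induction[of "nmap (Suc k) (frag_of \<sigma>)" UNIV]) (auto simp: frag_extend_diff)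
   also have "\<dots> = frag_extend iota (nmap k (chain_boundary (Suc k) (frag_of \<sigma>)))" by (simp only: bdry_nmap[OF sm])
   finally have "chain_boundary (Suc k) (frag_extend iota (nerve_map sel (Suc k) \<sigma>)) = frag_extend iota (nmap k (chain_boundary (Suc k) (frag_of \<sigma>)))"
   by (simp only: frag_extend_of)
   thus ?thesis by (simp only: ext chain_boundary_diff) simp
  qed
 qed (use acy \<rho> in auto)
 then obtain H where H: "\<And>k \<sigma>. k \<le> R ==> \<sigma> \<in> ?G k ==> singular_chain (Suc k) (top_of_set (S \<inter> ball (?ctr k \<sigma>) (\<rho> (Suc k)))) (H k \<sigma>) \<and>
  chain_boundary (Suc k) (H k \<sigma>) = ?Q k \<sigma> + (if k = 0 then 0 else frag_cmul (-1) (frag_extend (H (k - 1)) (chain_boundary k (frag_of \<sigma>))))" by blast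
 have "singular_chain (Suc k) (top_of_set S) (frag_extend (H k) c)"
  using H[OF k] by (intro singular_chain_frag_extend[OF c(1)]) (auto intro: top_of_set_chain_mono)
 moreover have "chain_boundary (Suc k) (frag_extend (H k) c) = frag_extend iota (nmap k c) - c"
 proof -
  have "chain_boundary (Suc k) (frag_extend (H k) c) = frag_extend (\<lambda>\<sigma>. ?Q k \<sigma> - (if k = 0 then 0 else (frag_extend (H (k - 1)) (chain_boundary k (frag_of \<sigma>))))) c"
   unfolding chain_boundary_frag_extend using c(1) H[OF k] by (intro frag_extend_eq) auto
  also have "\<dots> = frag_extend (?Q k) c - (if k = 0 then 0 else frag_extend (H (k - 1)) (chain_boundary k c))"
   by (rule frag_induction[of c UNIV]) (auto simp: frag_extend_diff chain_boundary_diff)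
  finally show ?thesis using c(2) ext by simp
 qed
 ultimately show ?thesis by (auto simp: singular_boundary)
qed

end

section \<open>Two-valued displacements\<close>

lemma singular_relboundary_sum:
 "(\<And>i. i \<in> I ==> singular_relboundary p X S (f i)) ==> singular_relboundary p X S (sum f I)"
 by (induction I rule: infinite_finite_induct) (auto simp: singular_relboundary_add)

text \<open>Two continuous branches exist on each ball of the fixed radius \<open>\<delta>\<close>,
  but they may be exchanged along a loop, so only their unordered pair \<open>\<Phi>\<close> is
  global. The lower bound \<open>\<eta>\<close> excludes fixed points uniformly.\<close>

definition two_valued_displacement :: "'b::metric_space set => real => ('b => 'b set) => real => real => bool" where
 "two_valued_displacement S \<delta> \<Phi> \<eta> \<epsilon> \<longleftrightarrow> (\<forall>x\<in>S. \<exists>f g. continuous_on (S \<inter> ball x \<delta>) f \<and> f ` (S \<inter> ball x \<delta>) \<subseteq> S \<and>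
   continuous_on (S \<inter> ball x \<delta>) g \<and> g ` (S \<inter> ball x \<delta>) \<subseteq> S \<and>
   (\<forall>y\<in>S \<inter> ball x \<delta>. \<Phi> y = {f y, g y} \<and> f y \<noteq> g y \<and> \<eta> \<le> dist y (f y) \<and> dist y (f y) \<le> \<epsilon> \<and> \<eta> \<le> dist y (g y) \<and> dist y (g y) \<le> \<epsilon>))"

text \<open>Points move by at least \<open>\<eta>\<close>, so the image of a chain near
  \<open>z\<close> avoids a ball around \<open>z\<close>; this later makes the diagonal vanish. The
  doubled coefficient sum is what makes the induced map comparable with twice the identity.\<close>

lemma two_valued_displacement_chain_map:
 fixes S :: "'b::metric_space set"
 assumes \<Phi>: "two_valued_displacement S \<delta> \<Phi> \<eta> \<epsilon>"
  and z: "z \<in> S" and r: "r \<le> \<delta>" and c: "singular_chain k (top_of_set (S \<inter> ball z r)) c"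
 shows "singular_chain k (top_of_set (S \<inter> ball z (r + \<epsilon>) \<inter> {y. \<eta> - r \<le> dist z y})) (frag_extend (lift_sum S \<Phi> k) c)"
  and "chain_boundary k (frag_extend (lift_sum S \<Phi> k) c) = frag_extend (lift_sum S \<Phi> (k - 1)) (chain_boundary k c)"
  and "k = 0 ==> augment (frag_extend (lift_sum S \<Phi> k) c) = frag_cmul 2 (augment c)"
proof -
 let ?W = "S \<inter> ball z r"
 from bspec[OF \<Phi>[unfolded two_valued_displacement_def] z] obtain f g where
  fg: "continuous_on (S \<inter> ball z \<delta>) f \<and> f ` (S \<inter> ball z \<delta>) \<subseteq> S \<and> continuous_on (S \<inter> ball z \<delta>) g \<and> g ` (S \<inter> ball z \<delta>) \<subseteq> S \<and>
  (\<forall>y\<in>S \<inter> ball z \<delta>. \<Phi> y = {f y, g y} \<and> f y \<noteq> g y \<and> \<eta> \<le> dist y (f y) \<and> dist y (f y) \<le> \<epsilon> \<and> \<eta> \<le> dist y (g y) \<and> dist y (g y) \<le> \<epsilon>)"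
  by (elim exE) (rule that)
 hence P: "\<Phi> y = {f y, g y} \<and> f y \<noteq> g y \<and> \<eta> \<le> dist y (f y) \<and> dist y (f y) \<le> \<epsilon> \<and> \<eta> \<le> dist y (g y) \<and> dist y (g y) \<le> \<epsilon>"
  if "y \<in> S \<inter> ball z \<delta>" for y using that by blast
 have sub: "?W \<subseteq> S \<inter> ball z \<delta>" using r by auto
 have f: "continuous_on ?W f" "f ` ?W \<subseteq> S" and g: "continuous_on ?W g" "g ` ?W \<subseteq> S"
  using fg sub by (meson continuous_on_subset image_mono order_trans)+
 have eq: "frag_extend (lift_sum S \<Phi> j) b = chain_map j f b + chain_map j g b" if "singular_chain j (top_of_set ?W) b" for j b
  by (rule lift_sum_local[OF _ f g _ that]) (use P sub in auto)
 let ?V = "S \<inter> ball z (r + \<epsilon>) \<inter> {y. \<eta> - r \<le> dist z y}"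
 have into: "h ` ?W \<subseteq> ?V" if "h ` ?W \<subseteq> S" and h: "\<And>y. y \<in> ?W ==> \<eta> \<le> dist y (h y) \<and> dist y (h y) \<le> \<epsilon>" for h
 proof
  fix w assume "w \<in> h ` ?W"
  then obtain y where y: "y \<in> ?W" "w = h y" by blast
  have "dist z w \<le> dist z y + dist y w" by (rule dist_triangle)
  moreover have "dist y w \<le> dist z y + dist z w" using dist_triangle[of y w z] by (simp add: dist_commute)
  ultimately show "w \<in> ?V" using h[OF y(1)] y that(1) by auto
 qed
 have cm: "continuous_map (top_of_set ?W) (top_of_set ?V) f" "continuous_map (top_of_set ?W) (top_of_set ?V) g"
 proof -
  have "f ` ?W \<subseteq> ?V" by (rule into[OF f(2)]) (use P sub in blast)
  thus "continuous_map (top_of_set ?W) (top_of_set ?V) f" using f(1) by (simp add: continuous_map_in_subtopology image_subset_iff_funcset Pi_iff)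
  have "g ` ?W \<subseteq> ?V" by (rule into[OF g(2)]) (use P sub in blast)
  thus "continuous_map (top_of_set ?W) (top_of_set ?V) g" using g(1) by (simp add: continuous_map_in_subtopology image_subset_iff_funcset Pi_iff)
 qed
 show "singular_chain k (top_of_set ?V) (frag_extend (lift_sum S \<Phi> k) c)"
  unfolding eq[OF c] using cm c by (intro singular_chain_add singular_chain_chain_map)
 show "chain_boundary k (frag_extend (lift_sum S \<Phi> k) c) = frag_extend (lift_sum S \<Phi> (k - 1)) (chain_boundary k c)"
 proof (cases k)
  case 0 thus ?thesis by (simp add: chain_boundary_def)
 next
  case (Suc j)
  have "singular_chain j (top_of_set ?W) (chain_boundary k c)" using singular_chain_boundary[OF c] Suc by simp
  from eq[OF this] show ?thesis unfolding eq[OF c] using Suc chain_boundary_chain_map[OF c, where g=f] chain_boundary_chain_map[OF c, where g=g] by (simp add: chain_boundary_add)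
 qed
 have "augment (chain_map k h c) = augment c" for h :: "'b => 'b"
  by (rule frag_induction[of c UNIV]) (auto simp: chain_map_diff)
 thus "augment (frag_extend (lift_sum S \<Phi> k) c) = frag_cmul 2 (augment c)"
  unfolding eq[OF c] by (simp add: frag_cmul_distrib[of 1 1, simplified])
qed

text \<open>Let \<open>E\<close> be the endomorphism of the flag complex given by realisation,
  subdivision and nerve map, and \<open>G\<close> the same with the displacement inserted after the
  realisation. \<open>E\<close> factors the identity of the homology of \<open>S\<close>, so
  \<open>Hopf_trace\<close> computes its supertrace as the Euler characteristic; \<open>G\<close> is
  homotopic to \<open>2 E\<close> and has zero diagonal.\<close>

theorem Lefschetz_two_valued_displacement:
 fixes S :: "(nat => real) set"
 assumes S: "compact S" "S \<subseteq> coord_space d" "locally_euclidean_set n S"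
  and push: "\<And>\<epsilon>. \<epsilon> > 0 ==> \<exists>\<eta>>0. \<exists>\<delta>>0. \<exists>\<Phi>. two_valued_displacement S \<delta> \<Phi> \<eta> \<epsilon>"
 shows "euler_characteristic (top_of_set S) = 0"
proof (cases "finite {k. betti_number k (top_of_set S) \<noteq> 0}")
 \<comment> \<open>A sum over an infinite set is 0 by convention. In the other case only finitely
   many degrees matter.\<close>
 case False
 thus ?thesis by (simp add: euler_characteristic_def)
next
 case finb: True
 let ?X = "top_of_set S"
 obtain R0 where R0: "\<And>k. betti_number k ?X \<noteq> 0 ==> k \<le> R0" using finb unfolding finite_nat_set_iff_bounded_le by blast
 \<comment> \<open>\<open>R\<close> bounds the degrees with nonzero Betti number and also, for every
   grid, the length of flags; so the height of both towers is fixed before the cover.\<close>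
 define R where "R = max R0 (2 ^ d)"
 have acy: "\<exists>r>0. acyclic_balls S r r'" if "r' > 0" for r' using locally_euclidean_acyclic_balls[OF S(1,3) that] .
 obtain \<rho>' where \<rho>': "0 < \<rho>' 0" "\<And>k. k \<le> R ==> acyclic_balls S (2 * \<rho>' k) (\<rho>' (Suc k))" "\<And>k. k \<le> Suc R ==> \<rho>' 0 \<le> \<rho>' k"
  using acyclic_tower[OF acy, of 1 R] by auto
 \<comment> \<open>The smallest radius of the outer tower, which fills the difference between the
   displacement and twice the identity. A chain of size at most \<open>m/8\<close>, displaced by at
   most \<open>m/8\<close>, stays within it.\<close>
 define m where "m = \<rho>' 0"
 have m: "m > 0" using \<rho>'(1) by (simp add: m_def)
 then obtain \<eta> \<delta> \<Phi> where \<eta>: "\<eta> > 0" and \<delta>: "\<delta> > 0" and \<Phi>: "two_valued_displacement S \<delta> \<Phi> \<eta> (m/8)"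
  using push[of "m/8"] by auto
 \<comment> \<open>The inner tower bounds the size \<open>r\<close> of realised flags:
   \<open>m/8\<close> keeps them within reach of the outer tower, \<open>\<delta>\<close> puts each
   of them where both branches exist, and \<open>\<eta>/4\<close> makes them small compared with the
   displacement.\<close>
 have pos: "0 < min (m/8) (min \<delta> (\<eta>/4))" using m \<delta> \<eta> by simp
 obtain \<rho> where \<rho>: "\<rho> (Suc R) \<le> min (m/8) (min \<delta> (\<eta>/4))" "0 < \<rho> 0" "\<And>k. k \<le> R ==> acyclic_balls S (2 * \<rho> k) (\<rho> (Suc k))"
   "\<And>k. k \<le> Suc R ==> \<rho> 0 \<le> \<rho> k \<and> \<rho> k \<le> \<rho> (Suc R)"
  using acyclic_tower[OF acy pos, of R] by auto
 define r where "r = \<rho> (Suc R)"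
 have r: "0 < r" "r \<le> m/8" "r \<le> \<delta>" "r \<le> \<eta>/4" "\<rho> 0 \<le> r" using \<rho>(1,2) \<rho>(4)[of "Suc R"] by (auto simp: r_def)
 have "0 < \<rho> 0 / 4" using \<rho>(2) by simp
 then obtain I :: "(nat => int) set" and A where I: "finite I" "\<And>i. i \<in> I ==> compact (A i) \<and> A i \<subseteq> S \<and> A i \<noteq> {}"
  "S = (\<Union>i\<in>I. A i)" "\<And>i x y. i \<in> I ==> x \<in> A i ==> y \<in> A i ==> dist x y < \<rho> 0 / 4"
  "\<And>x. card {i\<in>I. x \<in> A i} \<le> 2 ^ d"
  using grid_cover[OF S(1,2)] by blast
 have "\<exists>\<kappa>>0. \<forall>x\<in>S. \<exists>z\<in>S. \<forall>i\<in>I. A i \<inter> ball x \<kappa> \<noteq> {} --> z \<in> A i"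
  by (rule closed_cover_common_point[OF S(1) I(1)]) (use I(2) in blast)
 then obtain \<kappa>0 where \<kappa>0: "\<kappa>0 > 0"
  "\<And>x. x \<in> S ==> \<exists>z\<in>S. \<forall>i\<in>I. A i \<inter> ball x \<kappa>0 \<noteq> {} --> z \<in> A i" by blast
 \<comment> \<open>The bound \<open>\<rho> 0 / 4\<close>, which is also the mesh, keeps
   \<open>r + \<mu> + 2 * \<kappa>\<close> below the outer radius \<open>m\<close>.\<close>
 define \<kappa> where "\<kappa> = min \<kappa>0 (\<rho> 0 / 4)"
 have \<kappa>: "\<kappa> > 0" "\<kappa> \<le> \<rho> 0 / 4" using \<kappa>0(1) \<rho>(2) by (auto simp: \<kappa>_def)
 interpret closed_nerve S A I \<kappa> "\<rho> 0 / 4" "2 ^ d"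
 proof
  show "\<exists>z\<in>S. \<forall>i\<in>I. A i \<inter> ball x \<kappa> \<noteq> {} --> z \<in> A i" if x: "x \<in> S" for x
  proof -
   obtain z where "z \<in> S" "\<forall>i\<in>I. A i \<inter> ball x \<kappa>0 \<noteq> {} --> z \<in> A i" using \<kappa>0(2)[OF x] by blast
   moreover have "ball x \<kappa> \<subseteq> ball x \<kappa>0" by (rule subset_ball) (simp add: \<kappa>_def)
   ultimately show ?thesis by blast
  qed
 qed (use I in auto)
 have degR: "deg l \<le> R" if "l \<in> flags" for l using flag_length[OF that] by (simp add: deg_def R_def)
 obtain iota where iota1: "\<And>l. l \<in> flags ==> singular_chain (deg l) (top_of_set (S \<inter> ball (pick l) r)) (iota l)"
  and iota2: "\<And>l. l \<in> flags ==> chain_boundary (deg l) (iota l) = frag_extend iota (bdry l)"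
  and iota3: "\<And>l. l \<in> flags ==> deg l = 0 ==> augment (iota l) = frag_of ()"
  unfolding r_def by (rule nerve_realization[of R \<rho>]) (use \<rho> in \<open>auto simp: R_def\<close>)
 have iotaS: "singular_chain (deg l) ?X (iota l)" if "l \<in> flags" for l
  using iota1[OF that] by (auto intro: top_of_set_chain_mono)
 have iotaN: "singular_chain k ?X (frag_extend iota x)" if "Poly_Mapping.keys x \<subseteq> {l \<in> flags. deg l = k}" for k x
  by (rule singular_chain_frag_extend[OF that]) (use iotaS in auto)
 have iota_bdry: "chain_boundary k (frag_extend iota x) = frag_extend iota (frag_extend bdry x)"
  if "Poly_Mapping.keys x \<subseteq> {l \<in> flags. deg l = k}" for k x
 proof -
  have "chain_boundary k (frag_extend iota x) = frag_extend (\<lambda>l. frag_extend iota (bdry l)) x"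
   unfolding chain_boundary_frag_extend using that iota2 by (intro frag_extend_eq) force
  also have "\<dots> = frag_extend iota (frag_extend bdry x)"
   by (rule frag_induction[of x UNIV]) (auto simp: frag_extend_diff)
  finally show ?thesis .
 qed
 have IP: "singular_relboundary k ?X {} (frag_extend iota (nmap k c) - c)"
  if "k \<le> R" "small_chain S \<kappa> k c" "chain_boundary k c = 0" for k c
  by (rule nerve_realization_homologous[of R \<rho>' r iota k c])
   (use \<rho>' iota1 iota2 iota3 r \<kappa> \<rho>(2) that in \<open>auto simp: m_def[symmetric]\<close>)
 define T where "T k = frag_extend (lift_sum S \<Phi> k)" for k
 define \<theta> where "\<theta> l = T (deg l) (iota l)" for l
 have pickS: "pick l \<in> S" if "l \<in> flags" for l using pick[OF that] by blast
 have \<theta>1: "singular_chain (deg l) (top_of_set (S \<inter> ball (pick l) (r + m/8) \<inter> {y. \<eta> - r \<le> dist (pick l) y})) (\<theta> l)"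
  and \<theta>2: "chain_boundary (deg l) (\<theta> l) = T (deg l - 1) (frag_extend iota (bdry l))"
  and \<theta>3: "deg l = 0 ==> augment (\<theta> l) = frag_cmul 2 (frag_of ())" if l: "l \<in> flags" for l
  using two_valued_displacement_chain_map[OF \<Phi> pickS[OF l] r(3) iota1[OF l]] iota2[OF l] iota3[OF l] unfolding \<theta>_def T_def by simp_all
 have T\<theta>: "T k (frag_extend iota x) = frag_extend \<theta> x" if "Poly_Mapping.keys x \<subseteq> {l \<in> flags. deg l = k}" for k x
 proof -
  have "frag_extend \<theta> x = frag_extend (\<lambda>l. T k (iota l)) x" using that by (intro frag_extend_eq) (auto simp: \<theta>_def)
  also have "\<dots> = T k (frag_extend iota x)"
   unfolding T_def by (rule frag_induction[of x UNIV]) (auto simp: frag_extend_diff)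
  finally show ?thesis by simp
 qed
 have kb: "Poly_Mapping.keys (bdry l) \<subseteq> {l' \<in> flags. deg l' = deg l - 1}" if "l \<in> flags" for l
  using keys_bdry'[OF that] by auto
 have \<theta>b: "chain_boundary (deg l) (\<theta> l) = frag_extend \<theta> (bdry l)" if l: "l \<in> flags" for l
  unfolding \<theta>2[OF l] by (rule T\<theta>[OF kb[OF l]])
 \<comment> \<open>Both the displaced realisation \<open>\<theta>\<close> and twice
   \<open>iota\<close> are carried by the outer balls and have the same augmentation, so acyclic
   carriers give a homotopy between them.\<close>
 have "\<exists>H. \<forall>k\<le>R. \<forall>l\<in>{l\<in>flags. deg l = k}. singular_chain (Suc k) (top_of_set (S \<inter> ball (pick l) (\<rho>' (Suc k)))) (H k l) \<and>
  chain_boundary (Suc k) (H k l) = (\<theta> l - frag_cmul 2 (iota l)) + (if k = 0 then 0 else frag_cmul (-1) (frag_extend (H (k - 1)) (bdry l)))"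
 proof (rule acyclic_carriers)
  show "pick l \<in> S" if "l \<in> {l\<in>flags. deg l = k}" for k l using pickS that by auto
  show "Poly_Mapping.keys (bdry l) \<subseteq> {l' \<in> {l\<in>flags. deg l = k}. dist (pick l) (pick l') \<le> \<rho>' 0}" if l: "l \<in> {l\<in>flags. deg l = Suc k}" for k l
  proof
   fix l' assume l': "l' \<in> Poly_Mapping.keys (bdry l)"
   have "dist (pick l) (pick l') < \<rho> 0 / 4" using keys_bdry(4)[of l l'] l l' by (auto simp: bdry_def split: if_splits)
   hence "dist (pick l) (pick l') \<le> \<rho>' 0" using r m \<rho>(2) by (simp add: m_def)
   thus "l' \<in> {l' \<in> {l\<in>flags. deg l = k}. dist (pick l) (pick l') \<le> \<rho>' 0}" using l l' kb[of l] by auto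
  qed
  show "frag_extend bdry (bdry l) = 0" if "l \<in> {l\<in>flags. deg l = Suc (Suc k)}" for k l using bdry_bdry that by auto
  show "singular_chain k (top_of_set (S \<inter> ball (pick l) (\<rho>' 0))) (\<theta> l - frag_cmul 2 (iota l))" if l: "l \<in> {l\<in>flags. deg l = k}" for k l
  proof -
   have le: "r + m/8 \<le> \<rho>' 0" using r m by (simp add: m_def)
   have "singular_chain k (top_of_set (S \<inter> ball (pick l) (\<rho>' 0))) (\<theta> l)"
   by (rule top_of_set_chain_mono) (use \<theta>1[of l] l le in auto)
   moreover have "singular_chain k (top_of_set (S \<inter> ball (pick l) (\<rho>' 0))) (iota l)"
   by (rule top_of_set_chain_mono) (use iota1[of l] l le m in auto)
   ultimately show ?thesis by (intro singular_chain_diff singular_chain_cmul)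
  qed
  show "augment (\<theta> l - frag_cmul 2 (iota l)) = 0" if "l \<in> {l\<in>flags. deg l = 0}" for l
   using \<theta>3 iota3 that by simp
  show "chain_boundary (Suc k) (\<theta> l - frag_cmul 2 (iota l)) + frag_cmul (-1) (frag_extend (\<lambda>l. \<theta> l - frag_cmul 2 (iota l)) (bdry l)) = 0"
   if l: "l \<in> {l\<in>flags. deg l = Suc k}" for k l
  proof -
   have "frag_extend (\<lambda>l. \<theta> l - frag_cmul 2 (iota l)) x = frag_extend \<theta> x - frag_cmul 2 (frag_extend iota x)" for x
   by (rule frag_induction[of x UNIV]) (auto simp: frag_extend_diff frag_cmul_diff)
   thus ?thesis using \<theta>b[of l] iota2[of l] l by (auto simp: chain_boundary_diff chain_boundary_cmul)
  qed
 qed (use \<rho>' in auto)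
 then obtain H0 where H0: "\<And>k l. k \<le> R ==> l \<in> {l\<in>flags. deg l = k} ==> singular_chain (Suc k) (top_of_set (S \<inter> ball (pick l) (\<rho>' (Suc k)))) (H0 k l) \<and>
  chain_boundary (Suc k) (H0 k l) = (\<theta> l - frag_cmul 2 (iota l)) + (if k = 0 then 0 else frag_cmul (-1) (frag_extend (H0 (k - 1)) (bdry l)))" by blast
 define H where "H l = H0 (deg l) l" for l
 have H1: "singular_chain (Suc (deg l)) ?X (H l)" if "l \<in> flags" for l
  using H0[OF degR[OF that], of l] that unfolding H_def by (auto intro: top_of_set_chain_mono)
 have H2: "chain_boundary (Suc (deg l)) (H l) = \<theta> l - frag_cmul 2 (iota l) - frag_extend H (bdry l)" if l: "l \<in> flags" for l
 proof (cases "deg l = 0")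
  case True
  hence "bdry l = 0" using deg_length[OF l] by (simp add: bdry_def)
  thus ?thesis using H0[OF degR[OF l], of l] l True by (simp add: H_def)
 next
  case False
  have "frag_extend H (bdry l) = frag_extend (H0 (deg l - 1)) (bdry l)"
   using kb[OF l] by (intro frag_extend_eq) (auto simp: H_def)
  thus ?thesis using H0[OF degR[OF l], of l] l False by (simp add: H_def)
 qed
 \<comment> \<open>The nerve image of a small cycle is a vector with one entry per flag. A relation
   between the images of too many cycles would, after realisation, become a relation modulo
   boundaries between the cycles themselves. Hence finite homology bases exist in all degrees up to
   \<open>R\<close>.\<close>
 have bound: "card Z \<le> card flags" if Z: "homology_independent k ?X Z" and k: "k \<le> R" for k Z
 proof (rule ccontr)
  assume "\<not> card Z \<le> card flags"
  hence lt: "card flags < card Z" by simp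
  have fZ: "finite Z" and cyc: "\<And>z. z \<in> Z ==> singular_relcycle k ?X {} z"
   and ind: "\<And>c. singular_relboundary k ?X {} (\<Sum>z\<in>Z. frag_cmul (c z) z) ==> \<forall>z\<in>Z. c z = 0"
   using Z by (auto simp: homology_independent_def)
  obtain j where j: "\<forall>(k, c)\<in>Pair k ` Z. small_chain S \<kappa> k ((singular_subdivision k ^^ j) c)"
   using eventually_small_subdivision_finite[of "Pair k ` Z" S \<kappa>] fZ cyc \<kappa>(1) by (force simp: singular_cycle)
  let ?s = "\<lambda>z. (singular_subdivision k ^^ j) z"
  obtain a where a: "\<exists>z\<in>Z. a z \<noteq> 0" "\<forall>l\<in>flags. (\<Sum>z\<in>Z. a z * Poly_Mapping.lookup (nmap k (?s z)) l) = 0"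
   using integer_dependence[OF finite_flags fZ lt, of "\<lambda>z. Poly_Mapping.lookup (nmap k (?s z))"] by blast
  let ?c = "\<Sum>z\<in>Z. frag_cmul (a z) (?s z)"
  have sm: "small_chain S \<kappa> k (?s z)" if "z \<in> Z" for z using j that by auto
  have smc: "small_chain S \<kappa> k ?c"
   by (rule keys_frag_sumI) (use sm keys_cmul in blast)
  have "nmap k ?c = 0"
  proof (rule poly_mapping_eqI)
   fix l
   have e: "nmap k ?c = (\<Sum>z\<in>Z. frag_cmul (a z) (nmap k (?s z)))"
   by (simp add: frag_extend_sum[OF fZ] frag_extend_cmul o_def)
   show "Poly_Mapping.lookup (nmap k ?c) l = Poly_Mapping.lookup 0 l"
   proof (cases "l \<in> flags")
   case True thus ?thesis unfolding e using a(2) by (simp add: lookup_sum)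
   next
   case False thus ?thesis using keys_nmap_small[OF smc] by (auto simp: in_keys_iff)
   qed
  qed
  moreover have s0: "chain_boundary k (?s z) = 0 \<and> singular_chain k ?X (?s z)" if "z \<in> Z" for z
   using cyc[OF that] chain_boundary_singular_subdivision_power[of k ?X z j] singular_chain_singular_subdivision_power[of k ?X z j]
   by (auto simp: singular_cycle)
  have "chain_boundary k ?c = 0" using s0 by (simp add: chain_boundary_sum chain_boundary_cmul)
  ultimately have "singular_relboundary k ?X {} (0 - ?c)" using IP[OF k smc] by simp
  moreover have "singular_relboundary k ?X {} (\<Sum>z\<in>Z. frag_cmul (a z) (?s z - z))"
   using singular_subdivision_power_homologous[OF cyc]
   by (intro singular_relboundary_sum singular_relboundary_cmul) auto
  ultimately have "singular_relboundary k ?X {} (- ((0 - ?c) + (\<Sum>z\<in>Z. frag_cmul (a z) (?s z - z))))"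
   unfolding singular_relboundary_minus by (rule singular_relboundary_add)
  moreover have "- ((0 - ?c) + (\<Sum>z\<in>Z. frag_cmul (a z) (?s z - z))) = (\<Sum>z\<in>Z. frag_cmul (a z) z)"
   by (simp add: frag_cmul_diff sum_subtractf)
  ultimately show False using ind[of a] a(1) by auto
 qed
 have "\<exists>Z l. homology_independent k ?X Z \<and> card Z = betti_number k ?X \<and> homology_coordinates k ?X Z l" if k: "k \<in> {..R}" for k
 proof -
  have k': "k \<le> R" using k by simp
  obtain Z where Z: "homology_independent k ?X Z" "card Z = betti_number k ?X" "\<And>Z'. homology_independent k ?X Z' ==> card Z' \<le> card Z"
   using betti_number_basis[OF bound[OF _ k']] by blast
  thus ?thesis using homology_coordinates_exist[OF Z(1,3)] by blast
 qed
 hence "\<forall>k\<in>{..R}. \<exists>Z l. homology_independent k ?X Z \<and> card Z = betti_number k ?X \<and> homology_coordinates k ?X Z l" by blast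
 from bchoice[OF this] obtain Z where "\<forall>k\<in>{..R}. \<exists>l. homology_independent k ?X (Z k) \<and> card (Z k) = betti_number k ?X \<and> homology_coordinates k ?X (Z k) l" ..
 from bchoice[OF this] obtain l where l: "\<forall>k\<in>{..R}. homology_independent k ?X (Z k) \<and> card (Z k) = betti_number k ?X \<and> homology_coordinates k ?X (Z k) (l k)" ..
 have ladd: "l k z (x + y) = l k z x + l k z y" if "k \<le> R" "z \<in> Z k" "singular_relcycle k ?X {} x" "singular_relcycle k ?X {} y" for k z x y
  using l that unfolding homology_coordinates_def by simp
 have lcmul: "l k z (frag_cmul n x) = of_int n * l k z x" if "k \<le> R" "z \<in> Z k" "singular_relcycle k ?X {} x" for k z x n
  using l that unfolding homology_coordinates_def by simp
 have lbd: "l k z x = 0" if "k \<le> R" "z \<in> Z k" "singular_relboundary k ?X {} x" for k z x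
  using l that unfolding homology_coordinates_def by simp
 have ldelta: "l k z z' = (if z = z' then 1 else 0)" if "k \<le> R" "z \<in> Z k" "z' \<in> Z k" for k z z'
  using l that unfolding homology_coordinates_def by simp
 have lrep: "\<exists>n a. n \<noteq> 0 \<and> (\<forall>z\<in>Z k. of_int (a z) = of_int n * l k z x) \<and> singular_relboundary k ?X {} (frag_cmul n x - (\<Sum>z\<in>Z k. frag_cmul (a z) z))"
  if "k \<le> R" "singular_relcycle k ?X {} x" for k x
  using l that unfolding homology_coordinates_def by simp
 have Zc: "singular_relcycle k ?X {} z" if "k \<le> R" "z \<in> Z k" for k z using l that by (auto simp: homology_independent_def)
 have Zf: "finite (Z k)" if "k \<le> R" for k using l that by (auto simp: homology_independent_def)
 \<comment> \<open>All chains whose nerve images are going to be compared; they are subdivided with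
   one common number \<open>J\<close>.\<close>
 define F where "F = (\<lambda>l. (deg l, iota l)) ` flags \<union> (\<lambda>l. (deg l, \<theta> l)) ` flags \<union> (\<lambda>l. (Suc (deg l), H l)) ` flags \<union> (\<Union>k\<in>{..R}. Pair k ` Z k)"
 have \<theta>S: "singular_chain (deg l) ?X (\<theta> l)" if "l \<in> flags" for l
  using \<theta>1[OF that] by (rule top_of_set_chain_mono) auto
 have "finite F" unfolding F_def using finite_flags Zf by auto
 moreover have "singular_chain k ?X c" if "(k, c) \<in> F" for k c
  using that iotaS \<theta>S H1 Zc unfolding F_def by (auto simp: singular_cycle)
 ultimately obtain J where J: "\<forall>(k, c)\<in>F. small_chain S \<kappa> k ((singular_subdivision k ^^ J) c)"
  using eventually_small_subdivision_finite[of F S \<kappa>] \<kappa>(1) by blast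
 let ?s = "\<lambda>k c. (singular_subdivision k ^^ J) c"
 have sm_iota: "small_chain S \<kappa> (deg l) (?s (deg l) (iota l))" and sm_\<theta>: "small_chain S \<kappa> (deg l) (?s (deg l) (\<theta> l))"
  and sm_H: "small_chain S \<kappa> (Suc (deg l)) (?s (Suc (deg l)) (H l))" if "l \<in> flags" for l
  using J that unfolding F_def by blast+
 have sm_Z: "small_chain S \<kappa> k (?s k z)" if "k \<le> R" "z \<in> Z k" for k z using J that unfolding F_def by blast
 define E where "E l = nmap (deg l) (?s (deg l) (iota l))" for l
 define G where "G l = nmap (deg l) (?s (deg l) (\<theta> l))" for l
 define h where "h l = nmap (Suc (deg l)) (?s (Suc (deg l)) (H l))" for l
 have kE: "Poly_Mapping.keys (E l) \<subseteq> {l' \<in> flags. deg l' = deg l}" and kh: "Poly_Mapping.keys (h l) \<subseteq> {l' \<in> flags. deg l' = Suc (deg l)}" if "l \<in> flags" for l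
  using keys_nmap_small[OF sm_iota[OF that]] keys_nmap_small[OF sm_H[OF that]] by (auto simp: E_def h_def)
 have nlin: "nmap k (?s k (frag_extend f x)) = frag_extend (\<lambda>l. nmap k (?s k (f l))) x" for k f and x :: "'c \<Rightarrow>\<^sub>0 int"
  unfolding singular_subdivision_power_extend by (rule frag_induction[of x UNIV]) (auto simp: frag_extend_diff)
 have Eb: "frag_extend E (bdry l) = frag_extend bdry (E l)" if fl: "l \<in> flags" for l
 proof (cases "deg l")
  case 0
  hence "bdry l = 0" using deg_length[OF fl] by (simp add: bdry_def)
  moreover have "frag_extend bdry (E l) = 0"
   using kE[OF fl] 0 deg_length by (intro frag_extend_eq_0) (fastforce simp: bdry_def)
  ultimately show ?thesis by simp
 next
  case (Suc k)
  have "frag_extend bdry (E l) = nmap k (chain_boundary (Suc k) (?s (Suc k) (iota l)))"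
   unfolding E_def Suc using sm_iota[OF fl] Suc by (intro bdry_nmap) simp
  also have "\<dots> = nmap k (?s k (frag_extend iota (bdry l)))"
   using chain_boundary_singular_subdivision_power[OF iotaS[OF fl], of J] iota2[OF fl] Suc by simp
  also have "\<dots> = frag_extend E (bdry l)"
   unfolding nlin using kb[OF fl] Suc by (intro frag_extend_eq) (auto simp: E_def)
  finally show ?thesis by simp
 qed
 have homot: "G l - frag_cmul 2 (E l) = frag_extend bdry (h l) + frag_extend h (bdry l)" if fl: "l \<in> flags" for l
 proof -
  have "frag_extend bdry (h l) = nmap (deg l) (chain_boundary (Suc (deg l)) (?s (Suc (deg l)) (H l)))"
   unfolding h_def by (rule bdry_nmap[OF sm_H[OF fl]])
  also have "\<dots> = nmap (deg l) (?s (deg l) (\<theta> l - frag_cmul 2 (iota l) - frag_extend H (bdry l)))"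
   using chain_boundary_singular_subdivision_power[OF H1[OF fl], of J] H2[OF fl] by simp
  also have "\<dots> = G l - frag_cmul 2 (E l) - nmap (deg l) (?s (deg l) (frag_extend H (bdry l)))"
   by (simp add: singular_subdivision_power_diff singular_subdivision_power_cmul frag_extend_diff frag_extend_cmul G_def E_def)
  also have "nmap (deg l) (?s (deg l) (frag_extend H (bdry l))) = frag_extend h (bdry l)"
   unfolding nlin using keys_bdry'[OF fl] by (intro frag_extend_eq) (auto simp: h_def)
  finally show ?thesis by simp
 qed
 \<comment> \<open>A nonzero diagonal entry would put a point of the displaced chain into a cover
   member that contains \<open>pick l\<close>, at distance less than \<open>\<rho> 0 / 4\<close>.
   But the displaced chain keeps the distance \<open>\<eta> - r\<close> from \<open>pick l\<close>,
   while \<open>\<rho> 0 \<le> r \<le> \<eta>/4\<close>.\<close>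
 have diag: "Poly_Mapping.lookup (G l) l = 0" if fl: "l \<in> flags" for l
 proof (rule ccontr)
  assume "Poly_Mapping.lookup (G l) l \<noteq> 0"
  hence "l \<in> Poly_Mapping.keys (G l)" by (simp add: in_keys_iff)
  then obtain \<tau> where \<tau>: "\<tau> \<in> Poly_Mapping.keys (?s (deg l) (\<theta> l))" "l \<in> Poly_Mapping.keys (nerve_map sel (deg l) \<tau>)"
   unfolding G_def using keys_frag_extend by fastforce
  have "small_simplex S \<kappa> (deg l) \<tau>" using \<tau>(1) sm_\<theta>[OF fl] by auto
  from keys_nerve_map_small(3)[OF this \<tau>(2)] have hs: "hd l \<subseteq> sel (deg l) \<tau>" .
  obtain i where i: "i \<in> hd l" "i \<in> I" using hd_flag_nonempty[OF fl] by blast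
  obtain y where y: "y \<in> A i" "y \<in> \<tau> ` standard_simplex (deg l)" using i hs unfolding sel_def by blast
  have "singular_simplex (deg l) (top_of_set (S \<inter> ball (pick l) (r + m/8) \<inter> {y. \<eta> - r \<le> dist (pick l) y})) \<tau>"
   using singular_chain_singular_subdivision_power[OF \<theta>1[OF fl], of J] \<tau>(1) by (auto simp: singular_chain_def)
  hence "\<tau> ` standard_simplex (deg l) \<subseteq> {y. \<eta> - r \<le> dist (pick l) y}" by (auto simp: singular_simplex_def continuous_map_def)
  hence "\<eta> - r \<le> dist (pick l) y" using y(2) by blast
  moreover have "dist (pick l) y < \<rho> 0 / 4" by (rule mesh[OF i(2)]) (use pick[OF fl] i y in auto)
  ultimately show False using r \<eta> by linarith
 qed
 let ?str = "\<lambda>f. (\<Sum>l\<in>flags. (-1) ^ deg l * Poly_Mapping.lookup (f l) l)"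
 have "?str (\<lambda>l. frag_extend bdry (h l)) = - ?str (\<lambda>l. frag_extend h (bdry l))"
  by (rule supertrace_commutator[OF finite_flags]) (use kh keys_bdry' in auto)
 hence "?str (\<lambda>l. frag_extend bdry (h l) + frag_extend h (bdry l)) = 0"
  by (simp add: lookup_add distrib_left sum.distrib)
 hence "?str (\<lambda>l. G l - frag_cmul 2 (E l)) = 0" using homot by (simp cong: sum.cong)
 moreover have "?str (\<lambda>l. G l - frag_cmul 2 (E l)) = - 2 * ?str E"
  using diag by (simp add: lookup_minus sum_distrib_left sum_negf[symmetric] algebra_simps cong: sum.cong)
 ultimately have strE: "?str E = 0" by simp
 \<comment> \<open>Beyond degree \<open>R\<close> the index sets are made empty and the coordinates
   0, so that the hypotheses of \<open>Hopf_trace\<close> about all degrees hold there too.\<close>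
 define Z' where "Z' k = (if k \<le> R then Z k else {})" for k
 define l' where "l' k z x = (if k \<le> R \<and> z \<in> Z k then l k z (frag_extend iota x) else 0)" for k z x
 have cycX: "singular_relcycle k ?X {} (frag_extend iota x)" if "Poly_Mapping.keys x \<subseteq> {l \<in> flags. deg l = k}" "frag_extend bdry x = 0" for k x
  using iotaN[OF that(1)] iota_bdry[OF that(1)] that(2) by (simp add: singular_cycle)
 have "?str E = (\<Sum>k\<le>R. (-1) ^ k * int (card (Z' k)))"
 proof (rule Hopf_trace[of flags bdry deg E R Z' "\<lambda>k z. nmap k (?s k z)" l'])
  show "finite (Z' k)" for k using Zf by (simp add: Z'_def)
  have zc: "chain_boundary k (?s k z) = 0" if "k \<le> R" "z \<in> Z k" for k z
   using Zc[OF that] chain_boundary_singular_subdivision_power[of k ?X z J] by (auto simp: singular_cycle)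
  show "Poly_Mapping.keys (nmap k (?s k z)) \<subseteq> {l \<in> flags. deg l = k} \<and> frag_extend bdry (nmap k (?s k z)) = 0"
   if "k \<le> R" "z \<in> Z' k" for k z
   using that keys_nmap_small[OF sm_Z] bdry_nmap_cycle[OF sm_Z zc] by (simp add: Z'_def)
  show "l' k z (x + y) = l' k z x + l' k z y"
   if "Poly_Mapping.keys x \<subseteq> {l \<in> flags. deg l = k} \<and> frag_extend bdry x = 0" "Poly_Mapping.keys y \<subseteq> {l \<in> flags. deg l = k} \<and> frag_extend bdry y = 0" for k z x y
   using that cycX[of x k] cycX[of y k] ladd by (simp add: l'_def frag_extend_add)
  show "l' k z (frag_cmul n x) = of_int n * l' k z x" if "Poly_Mapping.keys x \<subseteq> {l \<in> flags. deg l = k} \<and> frag_extend bdry x = 0" for k z x n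
   using that cycX[of x k] lcmul by (simp add: l'_def frag_extend_cmul)
  show "l' k z (frag_extend bdry y) = 0" if y: "Poly_Mapping.keys y \<subseteq> {l \<in> flags. deg l = Suc k}" for k z y
  proof -
   have "singular_relboundary k ?X {} (frag_extend iota (frag_extend bdry y))"
   using iotaN[OF y] iota_bdry[OF y] by (auto simp: singular_boundary)
   thus ?thesis using lbd by (simp add: l'_def)
  qed
  show "l' k z (nmap k (?s k z')) = (if z = z' then 1 else 0)" if k: "k \<le> R" "z \<in> Z' k" "z' \<in> Z' k" for k z z'
  proof -
   have zz: "z \<in> Z k" "z' \<in> Z k" using k by (auto simp: Z'_def)
   let ?y = "frag_extend iota (nmap k (?s k z'))"
   have "singular_relboundary k ?X {} ((?y - ?s k z') + (?s k z' - z'))"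
   by (intro singular_relboundary_add IP singular_subdivision_power_homologous) (use k zz sm_Z zc Zc in auto)
   hence b: "singular_relboundary k ?X {} (?y - z')" by simp
   have "l k z (z' + (?y - z')) = l k z z' + l k z (?y - z')"
   by (rule ladd[OF k(1) zz(1) Zc[OF k(1) zz(2)] singular_relboundary_imp_relcycle[OF b]])
   thus ?thesis using ldelta[OF k(1) zz] lbd[OF k(1) zz(1) b] k(1) zz by (simp add: l'_def)
  qed
  show "\<exists>n a y. n \<noteq> 0 \<and> (\<forall>z\<in>Z' k. of_int (a z) = of_int n * l' k z x) \<and> Poly_Mapping.keys y \<subseteq> {l \<in> flags. deg l = Suc k}
   \<and> frag_cmul n (frag_extend E x) = (\<Sum>z\<in>Z' k. frag_cmul (a z) (nmap k (?s k z))) + frag_extend bdry y"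
   if k: "k \<le> R" and x: "Poly_Mapping.keys x \<subseteq> {l \<in> flags. deg l = k} \<and> frag_extend bdry x = 0" for k x
  proof -
   let ?y = "frag_extend iota x"
   have cy: "singular_relcycle k ?X {} ?y" using cycX x by blast
   obtain n a where na: "n \<noteq> 0" "\<forall>z\<in>Z k. of_int (a z) = of_int n * l k z ?y"
   and b: "singular_relboundary k ?X {} (frag_cmul n ?y - (\<Sum>z\<in>Z k. frag_cmul (a z) z))"
   using lrep[OF k cy] by blast
   \<comment> \<open>\<open>?u\<close> is a boundary. Its subdivision is small and therefore bounds
     a small chain, whose nerve image is the required \<open>y\<close>.\<close>
   let ?u = "frag_cmul n ?y - (\<Sum>z\<in>Z k. frag_cmul (a z) z)"
   have "singular_relboundary k ?X {} ((?s k ?u - ?u) + ?u)"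
   by (intro singular_relboundary_add b singular_subdivision_power_homologous singular_relboundary_imp_relcycle)
   hence bu: "singular_relboundary k ?X {} (?s k ?u)" by simp
   have se: "?s k ?y = frag_extend (\<lambda>l. ?s k (iota l)) x" by (rule singular_subdivision_power_extend)
   have sZ: "?s k (\<Sum>z\<in>B. frag_cmul (a z) z) = (\<Sum>z\<in>B. frag_cmul (a z) (?s k z))" if "finite B" for B
   using that by (induction B) (auto simp: singular_subdivision_power_add singular_subdivision_power_cmul)
   have su: "?s k ?u = frag_cmul n (frag_extend (\<lambda>l. ?s k (iota l)) x) - (\<Sum>z\<in>Z k. frag_cmul (a z) (?s k z))"
   by (simp add: singular_subdivision_power_diff singular_subdivision_power_cmul se sZ[OF Zf[OF k]])
   have "small_chain S \<kappa> k (frag_extend (\<lambda>l. ?s k (iota l)) x)"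
   by (rule keys_frag_extendI[of _ "{l \<in> flags. deg l = k}"]) (use x sm_iota in auto)
   moreover have "small_chain S \<kappa> k (\<Sum>z\<in>Z k. frag_cmul (a z) (?s k z))"
   by (rule keys_frag_sumI) (use sm_Z[OF k] keys_cmul in blast)
   ultimately have "small_chain S \<kappa> k (?s k ?u)" unfolding su
   using keys_diff[of "frag_cmul n (frag_extend (\<lambda>l. ?s k (iota l)) x)" "\<Sum>z\<in>Z k. frag_cmul (a z) (?s k z)"]
   keys_cmul[of n "frag_extend (\<lambda>l. ?s k (iota l)) x"] by blast
   from small_cycle_bounds_small[OF this bu \<kappa>(1)] obtain v where v: "small_chain S \<kappa> (Suc k) v" "chain_boundary (Suc k) v = ?s k ?u" by blast
   have "nmap k (?s k ?u) = frag_extend bdry (nmap (Suc k) v)" using bdry_nmap[OF v(1)] v(2) by simp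
   moreover have "nmap k (?s k ?u) = frag_cmul n (frag_extend E x) - (\<Sum>z\<in>Z k. frag_cmul (a z) (nmap k (?s k z)))"
   proof -
   have "nmap k (frag_extend (\<lambda>l. ?s k (iota l)) x) = frag_extend (\<lambda>l. nmap k (?s k (iota l))) x"
   using nlin[of k iota x] unfolding se .
   also have "\<dots> = frag_extend E x" using x by (intro frag_extend_eq) (auto simp: E_def)
   finally show ?thesis unfolding su by (simp add: frag_extend_diff frag_extend_cmul frag_extend_sum[OF Zf[OF k]] o_def)
   qed
   ultimately have "frag_cmul n (frag_extend E x) = (\<Sum>z\<in>Z k. frag_cmul (a z) (nmap k (?s k z))) + frag_extend bdry (nmap (Suc k) v)"
   by (simp add: diff_eq_eq add.commute)
   thus ?thesis using na keys_nmap_small[OF v(1)] k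
   by (intro exI[of _ n] exI[of _ a] exI[of _ "nmap (Suc k) v"]) (simp add: Z'_def l'_def)
  qed
 qed (use finite_flags keys_bdry' kE Eb bdry_bdry degR in auto)
 moreover have "\<dots> = (\<Sum>k\<le>R. (-1) ^ k * int (betti_number k ?X))"
  using l by (intro sum.cong) (auto simp: Z'_def)
 moreover have "\<dots> = euler_characteristic ?X"
 proof -
  have "{k. betti_number k ?X \<noteq> 0} \<subseteq> {..R}" using R0 by (auto simp: R_def le_max_iff_disj)
  thus ?thesis unfolding euler_characteristic_def by (intro sum.mono_neutral_right) auto
 qed
 ultimately show ?thesis using strE by simp
qed

section \<open>Flow boxes\<close>

type_synonym 'a box = "'a set \<times> ('a => real) \<times> (real => 'a => 'a)"

text \<open>A box \<open>(U, u, F)\<close> stands for a product chart on \<open>U\<close>: \<open>u\<close> is the coordinate along the plaques,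
 and \<open>F s q\<close> is the point with coordinate \<open>s\<close> on the plaque of \<open>q\<close>.\<close>

definition flow_box :: "'a topology => 'a box => bool" where
 "flow_box X = (\<lambda>(U, u, F). openin X U \<and> continuous_map (subtopology X U) euclideanreal u \<and>
  continuous_map (prod_topology (top_of_set {0<..<1}) (subtopology X U)) X (\<lambda>(s, q). F s q) \<and>
  (\<forall>q\<in>U. 0 < u q \<and> u q < 1 \<and> F (u q) q = q \<and>
   (\<forall>s\<in>{0<..<1}. F s q \<in> U \<and> u (F s q) = s \<and> (\<forall>t\<in>{0<..<1}. F t (F s q) = F t q))))"

text \<open>The middle condition holds on the whole overlap of two boxes, also where the overlap is
  disconnected: a common plaque in one box is a common plaque in the other. It expresses that the
  transverse part \<open>h\<close> of a coordinate change depends on \<open>y\<close> alone.\<close>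

definition flow_structure :: "'a topology => 'a box set => bool" where
 "flow_structure X B \<longleftrightarrow> (\<forall>b\<in>B. flow_box X b) \<and>
  (\<forall>U u F V v G p q. (U, u, F) \<in> B --> (V, v, G) \<in> B --> p \<in> U \<inter> V --> q \<in> U \<inter> V --> F (u q) p = q --> G (v q) p = q) \<and>
  (\<forall>p W. openin X W --> p \<in> W --> (\<exists>U u F. (U, u, F) \<in> B \<and> p \<in> U \<and> U \<subseteq> W))"

text \<open>A Lebesgue number together with one parameter for all members, namely the minimum over a
  finite subcover; \<open>anti\<close> allows decreasing it.\<close>

lemma compact_uniform_cover_antimono:
 fixes S :: "'b::metric_space set"
 assumes "compact S" and cov: "\<And>p. p \<in> S ==> \<exists>V t. openin (top_of_set S) V \<and> p \<in> V \<and> (0::real) < t \<and> P V t"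
  and anti: "\<And>V t t'. P V t ==> 0 < t' ==> t' \<le> t ==> P V t'"
 obtains \<delta> t where "\<delta> > 0" "t > 0" "\<And>x. x \<in> S ==> \<exists>V. P V t \<and> V \<subseteq> S \<and> S \<inter> ball x \<delta> \<subseteq> V"
proof -
 have "\<forall>p\<in>S. \<exists>T t. open T \<and> p \<in> T \<and> 0 < t \<and> P (S \<inter> T) t"
  using cov unfolding openin_open by (metis IntD2)
 from bchoice[OF this] obtain T where "\<forall>p\<in>S. \<exists>t. open (T p) \<and> p \<in> T p \<and> 0 < t \<and> P (S \<inter> T p) t" ..
 from bchoice[OF this] obtain t where T': "\<forall>p\<in>S. open (T p) \<and> p \<in> T p \<and> 0 < t p \<and> P (S \<inter> T p) (t p)" ..
 hence T: "open (T p) \<and> p \<in> T p \<and> 0 < t p \<and> P (S \<inter> T p) (t p)" if "p \<in> S" for p using that by blast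
 have "S \<subseteq> (\<Union>p\<in>S. T p)" using T by auto
 have "\<exists>C\<subseteq>S. finite C \<and> S \<subseteq> (\<Union>p\<in>C. T p)"
 proof (rule compactE_image[OF assms(1)])
  show "open (T p)" if "p \<in> S" for p using T that by blast
  show "S \<subseteq> (\<Union>p\<in>S. T p)" by fact
  show "\<exists>C\<subseteq>S. finite C \<and> S \<subseteq> (\<Union>p\<in>C. T p)" if "C' \<subseteq> S" "finite C'" "S \<subseteq> (\<Union>c\<in>C'. T c)" for C'
   using that by blast
 qed
 then obtain C where C: "C \<subseteq> S" "finite C" "S \<subseteq> (\<Union>p\<in>C. T p)" by blast
 define t0 where "t0 = Min (insert 1 (t ` C))"
 have t0: "t0 > 0" unfolding t0_def using C T by (subst Min_gr_iff) auto
 have t0le: "t0 \<le> t p" if "p \<in> C" for p unfolding t0_def using C that by (intro Min_le) auto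
 have P: "P (S \<inter> T p) t0" if "p \<in> C" for p using anti[OF _ t0 t0le[OF that]] T C that by blast
 have opn: "\<And>G. G \<in> T ` C ==> open G" using T C by blast
 obtain \<delta> where "\<delta> > 0" "\<forall>x\<in>S. \<exists>B\<in>T ` C. ball x \<delta> \<subseteq> B"
  by (rule Heine_Borel_lemma[OF assms(1), of "T ` C"]) (use C(3) in simp, rule opn, assumption, rule that, assumption, simp)
 thus thesis using that[of \<delta> t0] t0 P by (metis Int_lower1 Int_mono imageE order_refl)
qed

text \<open>Continuity in \<open>p\<close> is uniform over the compact second factor, and uniformly
  close functions have close suprema.\<close>

lemma continuous_on_Sup_compact:
 fixes h :: "'p::metric_space \<times> real => real"
 assumes h: "continuous_on (P \<times> {0..1}) h"
 shows "continuous_on P (\<lambda>p. Sup ((\<lambda>\<theta>. h (p, \<theta>)) ` {0..1}))"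
proof -
 have bdd: "bdd_above ((\<lambda>\<theta>. h (p, \<theta>)) ` {0..1})" if "p \<in> P" for p
 proof -
  have "continuous_on {0..1} (\<lambda>\<theta>. h (p, \<theta>))"
   by (rule continuous_on_compose2[OF h]) (use that in \<open>auto intro!: continuous_intros\<close>)
  hence "compact ((\<lambda>\<theta>. h (p, \<theta>)) ` {0..1})" by (rule compact_continuous_image) auto
  thus ?thesis by (simp add: bounded_imp_bdd_above compact_imp_bounded)
 qed
 show ?thesis unfolding continuous_on_iff
 proof (intro ballI allI impI)
  fix p and e :: real assume p: "p \<in> P" and e: "0 < e"
  obtain X0 where X0: "p \<in> X0" "open X0" "\<forall>x\<in>X0 \<inter> P. \<forall>t\<in>{0..1}. dist (h (x, t)) (h (p, t)) \<le> e/2"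
   by (rule continuous_on_prod_compactE[OF h compact_Icc p half_gt_zero[OF e]]) (rule that)
  obtain d where d: "d > 0" "ball p d \<subseteq> X0" using X0(1,2) openE by blast
  have le: "Sup ((\<lambda>\<theta>. h (x, \<theta>)) ` {0..1}) \<le> Sup ((\<lambda>\<theta>. h (y, \<theta>)) ` {0..1}) + e/2"
   if xy: "x \<in> P" "y \<in> P" and c: "\<And>t. t \<in> {0..1} ==> dist (h (x, t)) (h (y, t)) \<le> e/2" for x y
  proof (rule cSup_least)
   fix z assume "z \<in> (\<lambda>\<theta>. h (x, \<theta>)) ` {0..1}"
   then obtain t where t: "t \<in> {0..1}" "z = h (x, t)" by blast
   have "h (y, t) \<le> Sup ((\<lambda>\<theta>. h (y, \<theta>)) ` {0..1})" by (rule cSup_upper) (use t bdd[OF xy(2)] in auto)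
   thus "z \<le> Sup ((\<lambda>\<theta>. h (y, \<theta>)) ` {0..1}) + e/2" using c[OF t(1)] t(2) unfolding dist_real_def by linarith
  qed auto
  show "\<exists>d>0. \<forall>x'\<in>P. dist x' p < d --> dist (Sup ((\<lambda>\<theta>. h (x', \<theta>)) ` {0..1})) (Sup ((\<lambda>\<theta>. h (p, \<theta>)) ` {0..1})) < e"
  proof (intro exI[of _ d] conjI ballI impI d(1))
   fix x assume x: "x \<in> P" "dist x p < d"
   hence "x \<in> X0 \<inter> P" using d(2) by (auto simp: dist_commute)
   hence c1: "dist (h (x, t)) (h (p, t)) \<le> e/2" if "t \<in> {0..1}" for t using X0(3) that by blast
   have c2: "dist (h (p, t)) (h (x, t)) \<le> e/2" if "t \<in> {0..1}" for t using c1[OF that] by (subst dist_commute)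
   have "Sup ((\<lambda>\<theta>. h (x, \<theta>)) ` {0..1}) \<le> Sup ((\<lambda>\<theta>. h (p, \<theta>)) ` {0..1}) + e/2"
   "Sup ((\<lambda>\<theta>. h (p, \<theta>)) ` {0..1}) \<le> Sup ((\<lambda>\<theta>. h (x, \<theta>)) ` {0..1}) + e/2"
   using le[OF x(1) p c1] le[OF p x(1) c2] by blast+
   thus "dist (Sup ((\<lambda>\<theta>. h (x, \<theta>)) ` {0..1})) (Sup ((\<lambda>\<theta>. h (p, \<theta>)) ` {0..1})) < e"
   using e by (simp add: dist_real_def)
  qed
 qed
qed

text \<open>Each \<open>\<Omega> y\<close> stretches distances, so it attains \<open>t\<close> at
  exactly one place, and that place varies no more than the values of \<open>\<Omega>\<close>
  do.\<close>

lemma expanding_level: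
 fixes \<Omega> :: "'b::metric_space => real => real"
 assumes t: "0 < t" and cw: "\<And>y. y \<in> V ==> continuous_on {0..t} (\<Omega> y)"
  and cy: "\<And>w. w \<in> {0..t} ==> continuous_on V (\<lambda>y. \<Omega> y w)"
  and zero: "\<And>y. y \<in> V ==> \<Omega> y 0 = 0"
  and ex: "\<And>y w w'. y \<in> V ==> 0 \<le> w ==> w \<le> w' ==> w' \<le> t ==> w' - w \<le> \<Omega> y w' - \<Omega> y w"
 obtains W where "continuous_on V W" "\<And>y. y \<in> V ==> 0 < W y \<and> W y \<le> t \<and> \<Omega> y (W y) = t"
  "\<And>y w. y \<in> V ==> 0 \<le> w ==> w \<le> t ==> \<Omega> y w = t ==> w = W y"
proof -
 have "\<exists>w. 0 \<le> w \<and> w \<le> t \<and> \<Omega> y w = t" if "y \<in> V" for y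
  using IVT'[of "\<Omega> y" 0 t t] cw[OF that] zero[OF that] ex[OF that, of 0 t] t by auto
 then obtain W where W: "\<And>y. y \<in> V ==> 0 \<le> W y \<and> W y \<le> t \<and> \<Omega> y (W y) = t" by metis
 have dif: "\<bar>w - w'\<bar> \<le> \<bar>\<Omega> y w - \<Omega> y w'\<bar>" if "y \<in> V" "0 \<le> w" "w \<le> t" "0 \<le> w'" "w' \<le> t" for y w w'
  using ex[of y w w'] ex[of y w' w] that by (cases "w \<le> w'") auto
 have uniq: "w = W y" if "y \<in> V" "0 \<le> w" "w \<le> t" "\<Omega> y w = t" for y w
  using dif[OF that(1-3), of "W y"] W[OF that(1)] that(4) by simp
 have "continuous_on V W" unfolding continuous_on_iff
 proof (intro ballI allI impI)
  fix y and e :: real assume y: "y \<in> V" "0 < e"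
  have "W y \<in> {0..t}" using W[OF y(1)] by simp
  then obtain d where d: "d > 0" "\<forall>x'\<in>V. dist x' y < d --> dist (\<Omega> x' (W y)) (\<Omega> y (W y)) < e"
   using cy[of "W y"] y unfolding continuous_on_iff by blast
  have "dist (W x) (W y) < e" if x: "x \<in> V" "dist x y < d" for x
  proof -
   have "\<bar>W y - W x\<bar> \<le> \<bar>\<Omega> x (W y) - \<Omega> x (W x)\<bar>" by (rule dif) (use x W y in auto)
   also have "\<dots> = dist (\<Omega> x (W y)) (\<Omega> y (W y))" using W x y by (simp add: dist_real_def)
   also have "\<dots> < e" using d x by blast
   finally show ?thesis by (simp add: dist_real_def abs_minus_commute)
  qed
  thus "\<exists>d>0. \<forall>x'\<in>V. dist x' y < d --> dist (W x') (W y) < e" using d(1) by blast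
 qed
 moreover have "0 < W y" if "y \<in> V" for y
  using W[OF that] zero[OF that] t by (metis less_le)
 ultimately show thesis using that[of W] W uniq by blast
qed

lemma closed_segment_shift: "closed_segment a (a + w) = (\<lambda>\<theta>. a + \<theta> * w) ` {0..1::real}"
 by (auto simp: closed_segment_def algebra_simps image_iff)

text \<open>The distance to move along plaques has to be the same in all boxes and for both
  directions. The size \<open>om\<close> of an arc sums the oscillations of finitely many functions
  \<open>g j\<close> on it, hence depends only on the arc as a set. One of the \<open>g j\<close> is
  the coordinate of the arc's own box, so \<open>om\<close> grows at least as fast as that
  coordinate, and the size \<open>t\<close> is reached exactly once on each side.\<close>

theorem flow_structure_displacement:
 fixes S :: "(nat => real) set"
 assumes S: "compact S" and B: "flow_structure (top_of_set S) B" and \<epsilon>: "\<epsilon> > 0"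
 shows "\<exists>\<eta>>0. \<exists>\<delta>>0. \<exists>\<Phi>. two_valued_displacement S \<delta> \<Phi> \<eta> \<epsilon>"
proof -
 have "\<forall>p\<in>S. \<exists>b. b \<in> B \<and> p \<in> fst b"
 proof
  fix p assume "p \<in> S"
  then obtain U u F where "(U, u, F) \<in> B" "p \<in> U"
   using B unfolding flow_structure_def by (metis openin_topspace topspace_euclidean_subtopology)
  thus "\<exists>b. b \<in> B \<and> p \<in> fst b" by (intro exI[of _ "(U, u, F)"]) simp
 qed
 from bchoice[OF this] obtain bx where bx: "\<forall>p\<in>S. bx p \<in> B \<and> p \<in> fst (bx p)" ..
 define U where "U p = fst (bx p)" for p
 define u where "u p = fst (snd (bx p))" for p
 define F where "F p = snd (snd (bx p))" for p
 have bxB: "(U p, u p, F p) \<in> B" "p \<in> U p" if "p \<in> S" for p using bx that by (auto simp: U_def u_def F_def)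
 have fb: "flow_box (top_of_set S) (U p, u p, F p)" if "p \<in> S" for p using B bxB[OF that] unfolding flow_structure_def by blast
 have US: "openin (top_of_set S) (U p)" "U p \<subseteq> S" if "p \<in> S" for p
  using fb[OF that] openin_imp_subset unfolding flow_box_def by auto
 have ucont: "continuous_on (U p) (u p)" if "p \<in> S" for p
  using fb[OF that] US(2)[OF that] unfolding flow_box_def by (simp add: subtopology_subtopology Int_absorb1)
 have Fcont: "continuous_on ({0<..<1} \<times> U p) (\<lambda>(s, q). F p s q)" if "p \<in> S" for p
  using fb[OF that] US(2)[OF that] unfolding flow_box_def
  by (simp add: subtopology_subtopology Int_absorb1 prod_topology_subtopology_eu continuous_map_in_subtopology)
 have box: "0 < u p q" "u p q < 1" "F p (u p q) q = q" if "p \<in> S" "q \<in> U p" for p q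
  using fb[OF that(1)] that(2) unfolding flow_box_def by auto
 have boxF: "F p s q \<in> U p" "u p (F p s q) = s" "0 < t ==> t < 1 ==> F p t (F p s q) = F p t q" if "p \<in> S" "q \<in> U p" "0 < s" "s < 1" for p q s t
  using fb[OF that(1)] that(2-) unfolding flow_box_def by auto
 have compat: "F j (u j q) y = q" if "i \<in> S" "j \<in> S" "y \<in> U i \<inter> U j" "q \<in> U i \<inter> U j" "F i (u i q) y = q" for i j y q
  using B bxB(1)[OF that(1)] bxB(1)[OF that(2)] that(3-) unfolding flow_structure_def by blast
 have "\<forall>p\<in>S. \<exists>r. 0 < r \<and> S \<inter> cball p r \<subseteq> U p"
 proof
  fix p assume p: "p \<in> S"
  obtain T where T: "open T" "U p = S \<inter> T" using US(1)[OF p] by (auto simp: openin_open)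
  obtain r where "r > 0" "cball p r \<subseteq> T" using T bxB(2)[OF p] open_contains_cball by blast
  thus "\<exists>r. 0 < r \<and> S \<inter> cball p r \<subseteq> U p" using T by blast
 qed
 from bchoice[OF this] obtain r where r: "\<forall>p\<in>S. 0 < r p \<and> S \<inter> cball p (r p) \<subseteq> U p" ..
 \<comment> \<open>Tietze extension of the coordinates from closed balls to all of \<open>S\<close>,
   so that each of them can be evaluated on arcs outside its own box.\<close>
 have "\<forall>p\<in>S. \<exists>g. continuous_on S g \<and> (\<forall>x\<in>S \<inter> cball p (r p). g x = u p x)"
 proof
  fix p assume p: "p \<in> S"
  have "continuous_on (S \<inter> cball p (r p)) (u p)" using ucont[OF p] r p continuous_on_subset by blast
  moreover have "closedin (top_of_set S) (S \<inter> cball p (r p))" by (simp add: closedin_closed_Int)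
  ultimately show "\<exists>g. continuous_on S g \<and> (\<forall>x\<in>S \<inter> cball p (r p). g x = u p x)"
   using Tietze_unbounded by metis
 qed
 from bchoice[OF this] obtain g where g: "\<forall>p\<in>S. continuous_on S (g p) \<and> (\<forall>x\<in>S \<inter> cball p (r p). g p x = u p x)" ..
 have "S \<subseteq> (\<Union>p\<in>S. ball p (r p))" using r by auto
 then obtain J where J: "J \<subseteq> S" "finite J" "S \<subseteq> (\<Union>p\<in>J. ball p (r p))"
  by (rule compactE_image[OF S, rotated]) (rule that, assumption+, rule open_ball)
 obtain e where e: "e > 0" "\<forall>x\<in>S. \<exists>G\<in>(\<lambda>p. ball p (r p)) ` J. ball x e \<subseteq> G"
  by (rule Heine_Borel_lemma[OF S, of "(\<lambda>p. ball p (r p)) ` J"]) (use J(3) in simp, force, rule that, assumption, simp)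
 define \<delta> where "\<delta> = min (e/2) \<epsilon>"
 have \<delta>: "\<delta> > 0" "2 * \<delta> \<le> e" "\<delta> \<le> \<epsilon>" using e(1) \<epsilon> by (auto simp: \<delta>_def)
 \<comment> \<open>A box that is good at \<open>y\<close> contains every arc from \<open>y\<close>
   that stays within \<open>\<delta>\<close>, which makes arcs comparable between boxes.\<close>
 define good where "good i y \<longleftrightarrow> i \<in> J \<and> y \<in> S \<and> S \<inter> ball y \<delta> \<subseteq> ball i (r i)" for i y
 have goodU: "S \<inter> ball y \<delta> \<subseteq> U i \<and> y \<in> U i \<and> i \<in> S" if "good i y" for i y
 proof -
  have i: "i \<in> S" using that J unfolding good_def by blast
  have "S \<inter> ball y \<delta> \<subseteq> U i" using that r i unfolding good_def by fastforce
  thus ?thesis using i that \<delta>(1) unfolding good_def by auto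
 qed
 have goodg: "g i x = u i x" if "good i y" "x \<in> S \<inter> ball y \<delta>" for i y x
  using that g goodU[OF that(1)] unfolding good_def by (auto simp: subset_iff less_imp_le)
 define arc where "arc i y w = (\<lambda>t. F i t y) ` closed_segment (u i y) (u i y + w)" for i y w
 define valid where "valid i y w \<longleftrightarrow> good i y \<and> closed_segment (u i y) (u i y + w) \<subseteq> {0<..<1} \<and> arc i y w \<subseteq> ball y \<delta>" for i y w
 \<comment> \<open>The suprema for \<open>e = 1\<close> and \<open>e = -1\<close> add up to the
   maximum minus the minimum of \<open>g j\<close> on \<open>K\<close>.\<close>
 define om where "om K = (\<Sum>j\<in>J. \<Sum>e\<in>{1,-1}. Sup ((\<lambda>x. e * g j x) ` K))" for K
 have arcS: "arc i y w \<subseteq> U i" if "valid i y w" for i y w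
  using that goodU[of i y] boxF(1) unfolding valid_def arc_def by (fastforce simp: subset_iff)
 have Fline: "continuous_on K (\<lambda>t. F i t y)" if "i \<in> S" "y \<in> U i" "K \<subseteq> {0<..<1}" for i y K
 proof -
  have "continuous_on K (\<lambda>t. (t, y))" by (intro continuous_on_Pair continuous_on_id continuous_on_const)
  moreover have "(\<lambda>t. (t, y)) ` K \<subseteq> {0<..<1} \<times> U i" using that by auto
  ultimately show ?thesis using continuous_on_compose2[OF Fcont[OF that(1)]] by fastforce
 qed
 have arc_compact: "compact (arc i y w)" if "valid i y w" for i y w
  unfolding arc_def
 proof (rule compact_continuous_image)
  have "(\<lambda>t. (t, y)) ` closed_segment (u i y) (u i y + w) \<subseteq> {0<..<1} \<times> U i" "i \<in> S"
   using goodU[of i y] that unfolding valid_def by auto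
  moreover have "continuous_on (closed_segment (u i y) (u i y + w)) (\<lambda>t. (t, y))" by (intro continuous_intros)
  ultimately show "continuous_on (closed_segment (u i y) (u i y + w)) (\<lambda>t. F i t y)"
   using continuous_on_compose2[OF Fcont[of i]] by fastforce
 qed simp
 have bdd: "bdd_above ((\<lambda>x. e * g j x) ` arc i y w)" if "valid i y w" "j \<in> J" for e i j y w
 proof -
  have "continuous_on (arc i y w) (g j)"
   using g J that arcS[OF that(1)] goodU[of i y] US(2)[of i] unfolding valid_def by (meson continuous_on_subset subset_iff)
  hence "compact ((\<lambda>x. e * g j x) ` arc i y w)"
   by (intro compact_continuous_image continuous_intros arc_compact[OF that(1)])
  thus ?thesis by (simp add: bounded_imp_bdd_above compact_imp_bounded)
 qed
 have arc_ne: "arc i y w \<noteq> {}" for i y w by (simp add: arc_def)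
 \<comment> \<open>For the arc's own box and the sign of its direction, the supremum grows exactly
   with \<open>w\<close>; the other terms of \<open>om\<close> are monotone because arcs in one
   direction are nested.\<close>
 have Sup_own: "Sup ((\<lambda>x. s * g i x) ` arc i y (s * w)) = s * u i y + w" if v: "valid i y (s * w)" and s: "s = 1 \<or> s = -1" and w: "0 \<le> w" for i y s w
 proof -
  have ss: "s * s = 1" using s by auto
  have eq: "s * g i (F i t y) = s * t" if "t \<in> closed_segment (u i y) (u i y + s * w)" for t
  proof -
   have "F i t y \<in> S \<inter> ball y \<delta>" using v that arcS[OF v] US(2)[of i] goodU[of i y] unfolding valid_def arc_def by blast
   hence "g i (F i t y) = u i (F i t y)" using v goodg unfolding valid_def by blast
   also have "\<dots> = t" using v that goodU[of i y] boxF(2)[of i y t] unfolding valid_def by auto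
   finally show ?thesis by simp
  qed
  have "(\<lambda>x. s * g i x) ` arc i y (s * w) = (\<lambda>t. s * t) ` closed_segment (u i y) (u i y + s * w)"
   unfolding arc_def image_image by (rule image_cong[OF refl eq])
  also have "\<dots> = closed_segment (s * u i y) (s * u i y + w)"
  proof -
   have "s * (u i y + \<theta> * (s * w)) = s * u i y + \<theta> * w" for \<theta>
   proof -
   have "s * (u i y + \<theta> * (s * w)) = s * u i y + (s * s) * (\<theta> * w)" by (simp add: algebra_simps)
   thus ?thesis using ss by simp
   qed
   thus ?thesis unfolding closed_segment_shift image_image by simp
  qed
  also have "\<dots> = {s * u i y..s * u i y + w}" using w by (simp add: closed_segment_eq_real_ivl)
  finally show ?thesis using w by simp
 qed
 have om_mono: "w' - w \<le> om (arc i y (s * w')) - om (arc i y (s * w))"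
  if v: "valid i y (s * w)" "valid i y (s * w')" and s: "s = 1 \<or> s = -1" and w: "0 \<le> w" "w \<le> w'" for i y s w w'
 proof -
  have sub: "arc i y (s * w) \<subseteq> arc i y (s * w')"
   unfolding arc_def using s w by (intro image_mono) (auto simp: closed_segment_eq_real_ivl)
  let ?d = "\<lambda>j e. Sup ((\<lambda>x. e * g j x) ` arc i y (s * w')) - Sup ((\<lambda>x. e * g j x) ` arc i y (s * w))"
  have nn: "0 \<le> ?d j e" if "j \<in> J" for j e
   using cSup_subset_mono[OF _ bdd[OF v(2) that], of "(\<lambda>x. e * g j x) ` arc i y (s * w)" e] sub arc_ne by (simp add: image_mono)
  have iJ: "i \<in> J" using v(1) by (simp add: valid_def good_def)
  have "w' - w = ?d i s" using Sup_own[OF v(1) s w(1)] Sup_own[OF v(2) s] w by simp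
  also have "\<dots> \<le> (\<Sum>e\<in>{1,-1}. ?d i e)" by (rule member_le_sum) (use s nn[OF iJ] in auto)
  also have "\<dots> \<le> (\<Sum>j\<in>J. \<Sum>e\<in>{1,-1}. ?d j e)"
  proof (rule member_le_sum[OF iJ])
   show "0 \<le> (\<Sum>e\<in>{1,-1}. ?d j e)" if "j \<in> J - {i}" for j using nn[of j] that by (intro sum_nonneg) auto
  qed (rule J(2))
  also have "\<dots> = om (arc i y (s * w')) - om (arc i y (s * w))"
   by (simp add: om_def sum_subtractf)
  finally show ?thesis .
 qed
 have om_0: "om (arc i y 0) = 0" if "good i y" for i y
  using goodU[OF that] box(3)[of i y] by (simp add: om_def arc_def sum.neutral)
 \<comment> \<open>A valid arc is a valid arc in every other good box as well: the coordinate
   \<open>?\<theta>\<close> of box \<open>j\<close> is continuous and injective along it, so it runs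
   through a segment. This is what makes \<open>\<Phi>\<close> independent of the box.\<close>
 have transfer: "\<exists>w'. valid j y w' \<and> arc j y w' = arc i y w \<and> F j (u j y + w') y = F i (u i y + w) y" if v: "valid i y w" and gj: "good j y" for i j y w
 proof -
  let ?I = "closed_segment (u i y) (u i y + w)" and ?\<theta> = "\<lambda>t. u j (F i t y)"
  have i: "i \<in> S" "y \<in> U i" and j: "j \<in> S" "y \<in> U j" using goodU[of i y] goodU[OF gj] v unfolding valid_def by auto
  have I01: "0 < t" "t < 1" if "t \<in> ?I" for t using v that unfolding valid_def by auto
  have inU: "F i t y \<in> U i" "F i t y \<in> U j" if "t \<in> ?I" for t
  proof -
   show "F i t y \<in> U i" using boxF(1)[OF i I01[OF that]] .
   hence "F i t y \<in> S \<inter> ball y \<delta>" using v that US(2)[OF i(1)] unfolding valid_def arc_def by blast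
   thus "F i t y \<in> U j" using goodU[OF gj] by blast
  qed
  have Fj: "F j (?\<theta> t) y = F i t y" if "t \<in> ?I" for t
  proof (rule compat[OF i(1) j(1)])
   show "F i (u i (F i t y)) y = F i t y" using boxF(2)[OF i I01[OF that]] by simp
  qed (use i j inU[OF that] in auto)
  have cont: "continuous_on ?I ?\<theta>"
  proof (rule continuous_on_compose2[OF ucont[OF j(1)]])
   show "continuous_on ?I (\<lambda>t. F i t y)"
   by (rule Fline[OF i]) (use I01 in auto)
  qed (use inU in auto)
  have inj: "inj_on ?\<theta> ?I"
  proof (rule inj_onI)
   fix s t assume st: "s \<in> ?I" "t \<in> ?I" "?\<theta> s = ?\<theta> t"
   have "F j (?\<theta> s) y = F j (?\<theta> t) y" using st(3) by (rule arg_cong)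
   hence "F i s y = F i t y" unfolding Fj[OF st(1)] Fj[OF st(2)] .
   hence "u i (F i s y) = u i (F i t y)" by (rule arg_cong)
   thus "s = t" unfolding boxF(2)[OF i I01[OF st(1)]] boxF(2)[OF i I01[OF st(2)]] .
  qed
  have ends: "?\<theta> (u i y) = u j y" using box(3)[OF i] by simp
  have im: "?\<theta> ` ?I = closed_segment (u j y) (?\<theta> (u i y + w))"
   using continuous_injective_image_segment_1[OF cont inj] ends by simp
  define w' where "w' = ?\<theta> (u i y + w) - u j y"
  have e': "u j y + w' = ?\<theta> (u i y + w)" by (simp add: w'_def)
  have arc_eq: "arc j y w' = arc i y w"
  proof -
   have "arc j y w' = (\<lambda>t. F j (?\<theta> t) y) ` ?I" unfolding arc_def e' im[symmetric] image_image ..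
   also have "\<dots> = arc i y w" unfolding arc_def using Fj by (intro image_cong) auto
   finally show ?thesis .
  qed
  have "closed_segment (u j y) (u j y + w') \<subseteq> {0<..<1}"
   unfolding e' im[symmetric] using box(1,2)[OF j(1)] inU(2) by fastforce
  hence "valid j y w'" using gj arc_eq v unfolding valid_def by simp
  moreover have "F j (u j y + w') y = F i (u i y + w) y" unfolding e' by (rule Fj) simp
  ultimately show ?thesis using arc_eq by blast
 qed
 \<comment> \<open>All arcs of coordinate length up to some \<open>t\<close> are valid near
   \<open>p\<close>; the constants keep the coordinates in the open unit interval and the points
   within \<open>\<delta>\<close>.\<close>
 have step1: "\<exists>V t. openin (top_of_set S) V \<and> p \<in> V \<and> 0 < t \<and> (\<exists>i\<in>J. \<forall>y\<in>V. \<forall>w. \<bar>w\<bar> \<le> t --> valid i y w)" if p: "p \<in> S" for p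
 proof -
  obtain i where i: "i \<in> J" "ball p e \<subseteq> ball i (r i)" using e(2) p by blast
  have iS: "i \<in> S" using i J by blast
  have gd: "good i y" if "y \<in> S" "dist p y < \<delta>" for y
  proof -
   have "ball y \<delta> \<subseteq> ball p e"
   proof
   fix x assume "x \<in> ball y \<delta>"
   thus "x \<in> ball p e" using that(2) \<delta>(2) dist_triangle[of p x y] by simp
   qed
   thus ?thesis using i that(1) unfolding good_def by blast
  qed
  have pU: "p \<in> U i" using goodU[OF gd[OF p]] \<delta>(1) by simp
  let ?s0 = "u i p"
  have s0: "0 < ?s0" "?s0 < 1" "F i ?s0 p = p" using box[OF iS pU] by auto
  have "(?s0, p) \<in> {0<..<1} \<times> U i" using s0 pU by simp
  then obtain d where d: "d > 0" "\<And>s y. s \<in> {0<..<1} ==> y \<in> U i ==> dist (s, y) (?s0, p) < d ==> dist (F i s y) p < \<delta>/2"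
  proof -
   obtain d where "d > 0" "\<forall>x'\<in>{0<..<1} \<times> U i. dist x' (?s0, p) < d --> dist ((\<lambda>(s, q). F i s q) x') ((\<lambda>(s, q). F i s q) (?s0, p)) < \<delta>/2"
   using Fcont[OF iS] \<open>(?s0, p) \<in> {0<..<1} \<times> U i\<close> \<delta>(1) unfolding continuous_on_iff by (metis half_gt_zero)
   thus thesis using that[of d] s0(3) by auto
  qed
  define m where "m = min (d/4) (min (?s0/2) ((1 - ?s0)/2))"
  have m: "0 < m" "m \<le> d/4" "m \<le> ?s0/2" "m \<le> (1 - ?s0)/2" using d(1) s0 unfolding m_def by (simp, linarith, linarith, linarith)
  define t where "t = m / 2"
  have t: "0 < t" "t \<le> d/8" "2 * t \<le> ?s0/2" "2 * t \<le> (1 - ?s0)/2" using m by (auto simp: t_def)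
  obtain d' where d': "d' > 0" "\<forall>y\<in>U i. dist y p < d' --> dist (u i y) ?s0 < t"
   using ucont[OF iS] pU t(1) unfolding continuous_on_iff by blast
  define V where "V = U i \<inter> ball p (min d' (min (d/2) (\<delta>/2)))"
  have V1: "openin (top_of_set S) V" unfolding V_def using US(1)[OF iS] by (simp add: openin_Int_open)
  have V2: "p \<in> V" using pU d' d(1) \<delta>(1) by (simp add: V_def)
  have "valid i y w" if y: "y \<in> V" and w: "\<bar>w\<bar> \<le> t" for y w
  proof -
   have yU: "y \<in> U i" "dist p y < d'" "dist p y < d/2" "dist p y < \<delta>/2" using y by (auto simp: V_def)
   have yS: "y \<in> S" using US(2)[OF iS] yU(1) by blast
   have uy: "\<bar>u i y - ?s0\<bar> < t" using d'(2) yU(1,2) by (auto simp: dist_commute dist_real_def)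
   have seg: "\<bar>s - ?s0\<bar> < 2 * t" if "s \<in> closed_segment (u i y) (u i y + w)" for s
   using that uy w by (auto simp: closed_segment_eq_real_ivl split: if_splits)
   have seg01: "s \<in> {0<..<1}" if "s \<in> closed_segment (u i y) (u i y + w)" for s
   using seg[OF that] t s0 by auto
   have "dist y (F i s y) < \<delta>" if s: "s \<in> closed_segment (u i y) (u i y + w)" for s
   proof -
   have "dist (s, y) (?s0, p) \<le> dist s ?s0 + dist y p" unfolding dist_Pair_Pair by (rule sqrt_sum_squares_le_sum) auto
   also have "\<dots> < d" using seg[OF s] t(2) d(1) yU(3) by (simp add: dist_real_def dist_commute)
   finally have "dist (F i s y) p < \<delta>/2" using d(2) seg01[OF s] yU(1) by blast
   thus ?thesis using yU(4) dist_triangle[of y "F i s y" p] by (simp add: dist_commute)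
   qed
   thus ?thesis unfolding valid_def arc_def using gd[OF yS] yU(4) \<delta>(1) seg01 by auto
  qed
  thus ?thesis using V1 V2 t(1) i(1) by blast
 qed
 have anti1: "\<exists>i\<in>J. \<forall>y\<in>V. \<forall>w. \<bar>w\<bar> \<le> t' --> valid i y w"
  if "\<exists>i\<in>J. \<forall>y\<in>V. \<forall>w. \<bar>w\<bar> \<le> t --> valid i y w" "0 < t'" "t' \<le> t" for V and t t' :: real
  using that by (meson order_trans)
 obtain \<rho> t where t: "\<rho> > 0" "t > 0" and cov1: "\<And>x. x \<in> S ==> \<exists>V. (\<exists>i\<in>J. \<forall>y\<in>V. \<forall>w. \<bar>w\<bar> \<le> t --> valid i y w) \<and> V \<subseteq> S \<and> S \<inter> ball x \<rho> \<subseteq> V"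
  by (rule compact_uniform_cover_antimono[OF S step1 anti1]) (assumption+, rule that)
 \<comment> \<open>No box is singled out: every valid arc of size \<open>t\<close>, in whichever
   box, contributes its end point.\<close>
 define \<Phi> where "\<Phi> y = {F i (u i y + w) y | i w. valid i y w \<and> om (arc i y w) = t}" for y
 define Q where "Q f g \<eta> y \<longleftrightarrow> \<Phi> y = {f y, g y} \<and> f y \<noteq> g y \<and> \<eta> \<le> dist y (f y) \<and> dist y (f y) \<le> \<epsilon> \<and> \<eta> \<le> dist y (g y) \<and> dist y (g y) \<le> \<epsilon>" for f g \<eta> y
 define PP where "PP V \<eta> \<longleftrightarrow> (\<exists>f g. continuous_on V f \<and> f ` V \<subseteq> S \<and> continuous_on V g \<and> g ` V \<subseteq> S \<and> (\<forall>y\<in>V. Q f g \<eta> y))" for V \<eta>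
 have step2: "\<exists>V \<eta>. openin (top_of_set S) V \<and> p \<in> V \<and> 0 < \<eta> \<and> PP V \<eta>" if p: "p \<in> S" for p
 proof -
  obtain V0 i where V0: "i \<in> J" "V0 \<subseteq> S" "S \<inter> ball p \<rho> \<subseteq> V0" and val0: "\<And>y w. y \<in> V0 ==> \<bar>w\<bar> \<le> t ==> valid i y w"
   using cov1[OF p] by blast
  define V where "V = S \<inter> ball p \<rho>"
  have val: "valid i y w" if "y \<in> V" "\<bar>w\<bar> \<le> t" for y w using val0 that V0(3) unfolding V_def by blast
  have VS: "V \<subseteq> S" "p \<in> V" "openin (top_of_set S) V" using p t(1) by (auto simp: V_def openin_open_Int)
  have iS: "i \<in> S" using V0(1) J(1) by blast
  have gy: "good i y" "y \<in> U i" if "y \<in> V" for y using val[OF that, of 0] t(2) goodU unfolding valid_def by auto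
  have uV: "continuous_on V (u i)" using ucont[OF iS] gy continuous_on_subset by blast
  have in01: "0 < u i y + w" "u i y + w < 1" if "y \<in> V" "\<bar>w\<bar> \<le> t" for y w
   using val[OF that] unfolding valid_def by auto
  have Fin: "F i (u i y + w) y \<in> S" "dist y (F i (u i y + w) y) < \<delta>" if "y \<in> V" "\<bar>w\<bar> \<le> t" for y w
  proof -
   show "F i (u i y + w) y \<in> S" using boxF(1)[OF iS gy(2)[OF that(1)] in01[OF that]] US(2)[OF iS] by blast
   show "dist y (F i (u i y + w) y) < \<delta>" using val[OF that] unfolding valid_def arc_def by auto
  qed
  have contF: "continuous_on D (\<lambda>z. F i (u i (a z) + c z) (a z))"
   if "continuous_on D a" "continuous_on D c" "a ` D \<subseteq> V" "\<And>z. z \<in> D ==> \<bar>c z\<bar> \<le> t" for D :: "'d::metric_space set" and a c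
  proof -
   have "continuous_on D (\<lambda>z. (u i (a z) + c z, a z))"
   using that(1-3) by (intro continuous_on_Pair continuous_on_add continuous_on_compose2[OF uV]) auto
   moreover have "(\<lambda>z. (u i (a z) + c z, a z)) ` D \<subseteq> {0<..<1} \<times> U i" using that(3,4) in01 gy by fastforce
   ultimately show ?thesis using continuous_on_compose2[OF Fcont[OF iS]] by fastforce
  qed
  have om_cont: "continuous_on (V \<times> {-t..t}) (\<lambda>(y, w). om (arc i y w))"
  proof -
   have arc_eq: "arc i y w = (\<lambda>\<theta>. F i (u i y + \<theta> * w) y) ` {0..1}" for y w
   by (simp add: arc_def closed_segment_shift image_image)
   have "continuous_on (V \<times> {-t..t}) (\<lambda>z. Sup ((\<lambda>\<theta>. e * g j (F i (u i (fst z) + \<theta> * snd z) (fst z))) ` {0..1}))" if j: "j \<in> J" for j and e :: real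
   proof -
   have c: "\<bar>\<theta> * w\<bar> \<le> t" if "\<theta> \<in> {0..1}" "w \<in> {-t..t}" for \<theta> w :: real
   proof -
   have "\<bar>\<theta> * w\<bar> \<le> 1 * t" unfolding abs_mult using that by (intro mult_mono) auto
   thus ?thesis by simp
   qed
   let ?D = "(V \<times> {-t..t}) \<times> {0..1} :: (((nat => real) \<times> real) \<times> real) set"
   have c1: "continuous_on ?D (\<lambda>z. F i (u i (fst (fst z)) + snd z * snd (fst z)) (fst (fst z)))"
   proof (rule contF)
   show "continuous_on ?D (\<lambda>z. fst (fst z))" by (intro continuous_on_fst continuous_on_id)
   show "continuous_on ?D (\<lambda>z. snd z * snd (fst z))" by (intro continuous_on_mult continuous_on_fst continuous_on_snd continuous_on_id)
   show "\<bar>snd z * snd (fst z)\<bar> \<le> t" if "z \<in> ?D" for z using c that by auto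
   qed auto
   have c2: "(\<lambda>z. F i (u i (fst (fst z)) + snd z * snd (fst z)) (fst (fst z))) ` ?D \<subseteq> S"
   proof
   fix x assume "x \<in> (\<lambda>z. F i (u i (fst (fst z)) + snd z * snd (fst z)) (fst (fst z))) ` ?D"
   then obtain y w \<theta> where "x = F i (u i y + \<theta> * w) y" "y \<in> V" "w \<in> {-t..t}" "\<theta> \<in> {0..1}" by auto
   thus "x \<in> S" using Fin(1)[of y "\<theta> * w"] c[of \<theta> w] by simp
   qed
   have "continuous_on S (g j)" using g j J by blast
   from continuous_on_mult_left[OF continuous_on_compose2[OF this c1 c2], of e]
   have "continuous_on ?D (\<lambda>z. e * g j (F i (u i (fst (fst z)) + snd z * snd (fst z)) (fst (fst z))))" .
   from continuous_on_Sup_compact[OF this] show ?thesis by simp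
   qed
   thus ?thesis unfolding om_def arc_eq image_image case_prod_beta by (intro continuous_on_sum) auto
  qed
  have lev: "\<exists>W. continuous_on V W \<and> (\<forall>y\<in>V. 0 < W y \<and> W y \<le> t \<and> om (arc i y (s * W y)) = t) \<and>
   (\<forall>y\<in>V. \<forall>w. 0 \<le> w --> w \<le> t --> om (arc i y (s * w)) = t --> w = W y)" if s: "s = 1 \<or> s = -1" for s
  proof (rule expanding_level[of t V "\<lambda>y w. om (arc i y (s * w))"])
   show "continuous_on {0..t} (\<lambda>w. om (arc i y (s * w)))" if "y \<in> V" for y
   proof -
   have "continuous_on {0..t} (\<lambda>w. (y, s * w))" by (intro continuous_on_Pair continuous_on_const continuous_on_mult_left continuous_on_id)
   moreover have "(\<lambda>w. (y, s * w)) ` {0..t} \<subseteq> V \<times> {-t..t}" using that s by auto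
   ultimately show ?thesis using continuous_on_compose2[OF om_cont] by fastforce
   qed
   show "continuous_on V (\<lambda>y. om (arc i y (s * w)))" if "w \<in> {0..t}" for w
   proof -
   have "continuous_on V (\<lambda>y. (y, s * w))" by (intro continuous_on_Pair continuous_on_const continuous_on_id)
   moreover have "(\<lambda>y. (y, s * w)) ` V \<subseteq> V \<times> {-t..t}" using that s by auto
   ultimately show ?thesis using continuous_on_compose2[OF om_cont] by fastforce
   qed
   show "om (arc i y (s * 0)) = 0" if "y \<in> V" for y using om_0[OF gy(1)[OF that]] by simp
   show "w' - w \<le> om (arc i y (s * w')) - om (arc i y (s * w))" if "y \<in> V" "0 \<le> w" "w \<le> w'" "w' \<le> t" for y w w'
   by (rule om_mono[OF _ _ s]) (use that s val in auto)
  qed (use t(2) in blast)+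
  obtain W where W: "continuous_on V W" "\<And>y. y \<in> V ==> 0 < W y \<and> W y \<le> t \<and> om (arc i y (W y)) = t"
   "\<And>y w. y \<in> V ==> 0 \<le> w ==> w \<le> t ==> om (arc i y w) = t ==> w = W y" using lev[of 1] by auto
  obtain W' where W': "continuous_on V W'" "\<And>y. y \<in> V ==> 0 < W' y \<and> W' y \<le> t \<and> om (arc i y (- W' y)) = t"
   "\<And>y w. y \<in> V ==> 0 \<le> w ==> w \<le> t ==> om (arc i y (- w)) = t ==> w = W' y" using lev[of "-1"] by auto
  define f where "f y = F i (u i y + W y) y" for y
  define f' where "f' y = F i (u i y + - W' y) y" for y
  have abs: "\<bar>W y\<bar> \<le> t" "\<bar>- W' y\<bar> \<le> t" if "y \<in> V" for y using W(2)[OF that] W'(2)[OF that] by auto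
  have fc: "continuous_on V f" "continuous_on V f'" unfolding f_def f'_def
   by (rule contF[OF continuous_on_id]; use W(1) W'(1) abs in \<open>auto intro!: continuous_on_minus\<close>)+
  have fS: "f y \<in> S" "f' y \<in> S" "dist y (f y) \<le> \<epsilon>" "dist y (f' y) \<le> \<epsilon>" if "y \<in> V" for y
   using Fin[OF that abs(1)[OF that]] Fin[OF that abs(2)[OF that]] \<delta>(3) by (auto simp: f_def f'_def)
  have uf: "u i (f y) = u i y + W y" "u i (f' y) = u i y - W' y" if "y \<in> V" for y
   using boxF(2)[OF iS gy(2)[OF that] in01[OF that abs(1)[OF that]]] boxF(2)[OF iS gy(2)[OF that] in01[OF that abs(2)[OF that]]]
   by (auto simp: f_def f'_def)
  have ne: "f y \<noteq> f' y" "f y \<noteq> y" "f' y \<noteq> y" if "y \<in> V" for y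
   using uf[OF that] W(2)[OF that] W'(2)[OF that] by auto
  have \<Phi>V: "\<Phi> y = {f y, f' y}" if y: "y \<in> V" for y
  proof
   show "{f y, f' y} \<subseteq> \<Phi> y"
   using val[OF y abs(1)[OF y]] val[OF y abs(2)[OF y]] W(2)[OF y] W'(2)[OF y] unfolding \<Phi>_def f_def f'_def by blast
   \<comment> \<open>An arc from another box is transferred to box \<open>i\<close>. There the sign
     of \<open>w\<close> decides the side, and uniqueness of the level decides the length.\<close>
   show "\<Phi> y \<subseteq> {f y, f' y}"
   proof
   fix z assume "z \<in> \<Phi> y"
   then obtain j w0 where j: "valid j y w0" "om (arc j y w0) = t" "z = F j (u j y + w0) y" unfolding \<Phi>_def by blast
   obtain w where w: "valid i y w" "arc i y w = arc j y w0" "F i (u i y + w) y = F j (u j y + w0) y"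
   using transfer[OF j(1) gy(1)[OF y]] by blast
   have o: "om (arc i y w) = t" using j w by simp
   have v0: "valid i y (s * 0)" for s using val[OF y, of 0] t(2) by simp
   show "z \<in> {f y, f' y}"
   proof (cases "0 \<le> w")
   case True
   have "w \<le> t" using om_mono[of i y 1 0 w] v0[of 1] w(1) True o om_0[OF gy(1)[OF y]] by simp
   thus ?thesis using W(3)[OF y True _ o] j(3) w(3) by (simp add: f_def)
   next
   case False
   have "- w \<le> t" using om_mono[of i y "-1" 0 "-w"] v0[of "-1"] w(1) False o om_0[OF gy(1)[OF y]] by simp
   hence "- w = W' y" using W'(3)[OF y, of "- w"] False o by simp
   hence "w = - W' y" by simp
   thus ?thesis using j(3) w(3) by (simp add: f'_def)
   qed
   qed
  qed
  \<comment> \<open>Half of the smaller displacement at \<open>p\<close>; by continuity both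
    branches move all points of a neighbourhood by more than this.\<close>
  define \<eta> where "\<eta> = min (dist p (f p)) (dist p (f' p)) / 2"
  have "0 < dist p (f p)" "0 < dist p (f' p)" using ne[OF VS(2)] by auto
  hence \<eta>: "0 < \<eta>" "\<eta> < dist p (f p)" "\<eta> < dist p (f' p)" unfolding \<eta>_def by (simp, linarith, linarith)
  define V' where "V' = {y \<in> V. dist y (f y) \<in> {\<eta><..}} \<inter> {y \<in> V. dist y (f' y) \<in> {\<eta><..}}"
  have "openin (top_of_set V) {y \<in> V. dist y (h y) \<in> {\<eta><..}}" if h: "continuous_on V h" for h
  proof -
   have "continuous_on V (\<lambda>y. dist y (h y))" by (intro continuous_on_dist continuous_on_id h)
   hence "openin (top_of_set V) (V \<inter> (\<lambda>y. dist y (h y)) -` {\<eta><..})"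
   by (rule continuous_openin_preimage_gen) simp
   moreover have "V \<inter> (\<lambda>y. dist y (h y)) -` {\<eta><..} = {y \<in> V. dist y (h y) \<in> {\<eta><..}}" by auto
   ultimately show ?thesis by simp
  qed
  hence "openin (top_of_set V) V'" unfolding V'_def using fc by (intro openin_Int) auto
  hence "openin (top_of_set S) V'" using VS(3) openin_trans by blast
  moreover have "p \<in> V'" using VS(2) \<eta> by (simp add: V'_def)
  moreover have "PP V' \<eta>"
  proof -
   have "V' \<subseteq> V" by (auto simp: V'_def)
   hence "continuous_on V' f" "continuous_on V' f'" using fc by (auto intro: continuous_on_subset)
   moreover have "f ` V' \<subseteq> S" "f' ` V' \<subseteq> S" using fS(1,2) \<open>V' \<subseteq> V\<close> by blast+
   moreover have "Q f f' \<eta> y" if "y \<in> V'" for y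
   using that \<Phi>V[of y] ne[of y] fS(3,4)[of y] unfolding V'_def Q_def by auto
   ultimately show ?thesis unfolding PP_def by blast
  qed
  ultimately show ?thesis using \<eta>(1) by blast
 qed
 have anti: "PP V \<eta>'" if P: "PP V \<eta>" and le: "0 < \<eta>'" "\<eta>' \<le> \<eta>" for V \<eta> \<eta>'
 proof -
  from P[unfolded PP_def] obtain f g where fg: "continuous_on V f" "f ` V \<subseteq> S" "continuous_on V g" "g ` V \<subseteq> S" "\<forall>y\<in>V. Q f g \<eta> y"
   by (elim exE conjE) (rule that)
  have "Q f g \<eta>' y" if "y \<in> V" for y using bspec[OF fg(5) that] le(2) unfolding Q_def by auto
  thus ?thesis unfolding PP_def using fg(1-4) by blast
 qed
 obtain \<delta>' \<eta> where d: "\<delta>' > 0" "\<eta> > 0" and cov2: "\<And>x. x \<in> S ==> \<exists>V. PP V \<eta> \<and> V \<subseteq> S \<and> S \<inter> ball x \<delta>' \<subseteq> V"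
  by (rule compact_uniform_cover_antimono[OF S step2 anti]) (assumption+, rule that)
 have "two_valued_displacement S \<delta>' \<Phi> \<eta> \<epsilon>"
  unfolding two_valued_displacement_def
 proof
  fix x assume "x \<in> S"
  from cov2[OF this] obtain V where V: "S \<inter> ball x \<delta>' \<subseteq> V" and "PP V \<eta>" by blast
  from this(2)[unfolded PP_def] obtain f f' where P: "continuous_on V f" "f ` V \<subseteq> S" "continuous_on V f'" "f' ` V \<subseteq> S" "\<forall>y\<in>V. Q f f' \<eta> y"
   by (elim exE conjE) (rule that)
  have "continuous_on (S \<inter> ball x \<delta>') f" "continuous_on (S \<inter> ball x \<delta>') f'" using P(1,3) V continuous_on_subset by blast+
  moreover have "f ` (S \<inter> ball x \<delta>') \<subseteq> S" "f' ` (S \<inter> ball x \<delta>') \<subseteq> S" using P(2,4) V by blast+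
  moreover have "\<forall>y\<in>S \<inter> ball x \<delta>'. Q f f' \<eta> y" using P(5) V by blast
  ultimately have "\<exists>f g. continuous_on (S \<inter> ball x \<delta>') f \<and> f ` (S \<inter> ball x \<delta>') \<subseteq> S \<and>
   continuous_on (S \<inter> ball x \<delta>') g \<and> g ` (S \<inter> ball x \<delta>') \<subseteq> S \<and> (\<forall>y\<in>S \<inter> ball x \<delta>'. Q f g \<eta> y)" by blast
  thus "\<exists>f g. continuous_on (S \<inter> ball x \<delta>') f \<and> f ` (S \<inter> ball x \<delta>') \<subseteq> S \<and>
   continuous_on (S \<inter> ball x \<delta>') g \<and> g ` (S \<inter> ball x \<delta>') \<subseteq> S \<and>
   (\<forall>y\<in>S \<inter> ball x \<delta>'. \<Phi> y = {f y, g y} \<and> f y \<noteq> g y \<and> \<eta> \<le> dist y (f y) \<and> dist y (f y) \<le> \<epsilon> \<and> \<eta> \<le> dist y (g y) \<and> dist y (g y) \<le> \<epsilon>)"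
   unfolding Q_def .
 qed
 thus ?thesis using d by blast
qed

section \<open>The long ray\<close>

definition olt :: "nat set => nat set => bool" where
 "olt a b \<longleftrightarrow> (a, b) \<in> omega1 \<and> a \<noteq> b"

lemma omega1_order:
 shows "wo_rel omega1" "trans omega1" "antisym omega1" "total_on (Field omega1) omega1" "wf (omega1 - Id)" "refl_on (Field omega1) omega1"
 using Well_order_omega1
 by (auto simp: wo_rel_def well_order_on_def linear_order_on_def partial_order_on_def preorder_on_def)

lemma olt_irrefl: "\<not> olt a a" by (simp add: olt_def)

lemma olt_total: "a \<in> Field omega1 ==> b \<in> Field omega1 ==> a \<noteq> b ==> olt a b \<or> olt b a"
 using omega1_order(4) unfolding total_on_def olt_def by blast

lemma olt_trans: "olt a b ==> olt b c ==> olt a c"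
 using omega1_order(2,3) unfolding trans_def antisym_def olt_def by blast

lemma olt_Field: "olt a b ==> a \<in> Field omega1 \<and> b \<in> Field omega1"
 by (auto simp: olt_def Field_def)

lemma underS_olt: "underS omega1 a = {b. olt b a}"
 unfolding underS_def olt_def by blast

lemma olt_minimal:
 assumes "Q a"
 obtains m where "Q m" "\<And>c. olt c m ==> \<not> Q c"
proof -
 obtain m where "m \<in> Collect Q" "\<And>c. (c, m) \<in> omega1 - Id ==> c \<notin> Collect Q"
  by (rule wfE_min[OF omega1_order(5), of a "Collect Q"]) (use assms in simp, rule that)
 thus thesis using that by (simp add: olt_def)
qed

lemma long_less_iff: "((a, s), (b, t)) \<in> long_less \<longleftrightarrow> olt a b \<or> a = b \<and> s < t"
 unfolding long_less_def olt_def by auto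

lemma long_less_irrefl: "(x, x) \<notin> long_less"
 by (cases x) (simp add: long_less_iff olt_irrefl)

lemma long_less_trans: "(x, y) \<in> long_less ==> (y, z) \<in> long_less ==> (x, z) \<in> long_less"
 by (cases x; cases y; cases z) (auto simp: long_less_iff dest: olt_trans)

lemma long_less_total:
 assumes "x \<in> closed_long_ray" "y \<in> closed_long_ray" "x \<noteq> y"
 shows "(x, y) \<in> long_less \<or> (y, x) \<in> long_less"
 using assms olt_total[of "fst x" "fst y"] by (cases x; cases y) (auto simp: long_less_iff closed_long_ray_def)

lemma topspace_order_topology_on: "topspace (order_topology_on S r) = S"
 unfolding order_topology_on_def by (auto simp: topology_generated_by_topspace)

lemma topspace_long_ray: "topspace long_ray = closed_long_ray - {long_zero}"
 unfolding long_ray_def by (auto simp: topspace_order_topology_on)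

lemma long_zero_in: "long_zero \<in> closed_long_ray" and long_zero_least: "x \<in> closed_long_ray - {long_zero} ==> (long_zero, x) \<in> long_less"
proof -
 have ne: "Field omega1 \<noteq> {}" using uncountable_Field_omega1 by auto
 have 1: "wo_rel.minim omega1 (Field omega1) \<in> Field omega1" using wo_rel.minim_in[OF omega1_order(1) subset_refl ne] .
 have 2: "(wo_rel.minim omega1 (Field omega1), a) \<in> omega1" if "a \<in> Field omega1" for a using wo_rel.minim_least[OF omega1_order(1) subset_refl that] .
 show "long_zero \<in> closed_long_ray" using 1 by (simp add: closed_long_ray_def long_zero_def)
 show "(long_zero, x) \<in> long_less" if "x \<in> closed_long_ray - {long_zero}"
 proof (cases x)
  case (Pair a s)
  hence "a \<in> Field omega1" "0 \<le> s" "wo_rel.minim omega1 (Field omega1) = a ==> s \<noteq> 0"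
   using that by (auto simp: closed_long_ray_def long_zero_def)
  thus ?thesis using 2[of a] Pair by (cases "wo_rel.minim omega1 (Field omega1) = a") (auto simp: long_zero_def long_less_iff olt_def)
 qed
qed

text \<open>Otherwise \<open>Field omega1\<close> would be a countable union of countable initial
  segments.\<close>

lemma countable_omega1_bounded:
 assumes "countable A" "A \<subseteq> Field omega1"
 shows "\<exists>b\<in>Field omega1. \<forall>a\<in>A. olt a b"
proof (rule ccontr)
 assume neg: "\<not> ?thesis"
 have "Field omega1 \<subseteq> (\<Union>a\<in>A. insert a (underS omega1 a))"
 proof
  fix b assume b: "b \<in> Field omega1"
  then obtain a where a: "a \<in> A" "\<not> olt a b" using neg by blast
  thus "b \<in> (\<Union>a\<in>A. insert a (underS omega1 a))"
   using olt_total[of a b] b assms(2) unfolding underS_olt by blast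
 qed
 moreover have "countable (\<Union>a\<in>A. insert a (underS omega1 a))"
  using assms countable_underS_omega1 by (intro countable_UN) auto
 ultimately show False using uncountable_Field_omega1 countable_subset by blast
qed

lemma long_ray_countable_bounded:
 assumes "countable C" "C \<subseteq> topspace long_ray"
 shows "\<exists>b\<in>topspace long_ray. \<forall>c\<in>C. (c, b) \<in> long_less"
proof -
 have "countable (fst ` C)" "fst ` C \<subseteq> Field omega1" using assms by (auto simp: topspace_long_ray closed_long_ray_def)
 from countable_omega1_bounded[OF this] obtain b where b: "b \<in> Field omega1" "\<forall>a\<in>fst ` C. olt a b" by (elim bexE)
 \<comment> \<open>The second coordinate \<open>1/2\<close> keeps the point away from
   \<open>long_zero\<close>.\<close>
 have "(b, 1/2) \<in> topspace long_ray" using b(1) by (auto simp: topspace_long_ray closed_long_ray_def long_zero_def)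
 moreover have "(c, (b, 1/2)) \<in> long_less" if "c \<in> C" for c using bspec[OF b(2) imageI[OF that]] by (cases c) (simp add: long_less_iff)
 ultimately show ?thesis by blast
qed

text \<open>The countably many \<open>a\<close> below \<open>b0\<close> get weights
  \<open>w a\<close> from an enumeration, with finite sum \<open>W\<close>. The copy of the
  half-open unit interval at \<open>a\<close> is scaled to length \<open>w a\<close> and placed
  after the total weight \<open>s a\<close> of its predecessors. The pieces leave no gap because
  \<open>omega1\<close> is a well-order.\<close>

lemma long_ray_segment_order_iso:
 assumes b0: "b0 \<in> Field omega1"
 defines "D \<equiv> {x \<in> closed_long_ray. fst x \<in> underS omega1 b0}"
 shows "\<exists>f W. (\<forall>x\<in>D. \<forall>y\<in>D. (x, y) \<in> long_less --> f x < f y) \<and> f ` D = {0..<W::real}"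
proof -
 let ?A = "underS omega1 b0"
 have cA: "countable ?A" using countable_underS_omega1[OF b0] .
 define w where "w a = (1/2::real) ^ to_nat_on ?A a" for a
 have wpos: "w a > 0" for a by (simp add: w_def)
 have wsum: "w summable_on ?A"
 proof -
  have "(\<lambda>n. (1/2::real)^n) summable_on UNIV"
   by (subst summable_on_UNIV_nonneg_real_iff) (auto intro: summable_geometric)
  hence "(\<lambda>n. (1/2::real)^n) summable_on (to_nat_on ?A ` ?A)" by (rule summable_on_subset_banach) auto
  thus ?thesis using inj_on_to_nat_on[OF cA] by (subst (asm) summable_on_reindex) (auto simp: o_def w_def[abs_def])
 qed
 have ws: "w summable_on B" if "B \<subseteq> ?A" for B using summable_on_subset_banach[OF wsum that] .
 have mono: "infsum w B \<le> infsum w C" if "B \<subseteq> C" "C \<subseteq> ?A" for B C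
  by (rule infsum_mono_neutral) (use that ws[OF that(2)] ws[OF order_trans[OF that]] wpos in \<open>auto simp: less_imp_le\<close>)
 have dn: "underS omega1 a \<subseteq> ?A \<and> insert a (underS omega1 a) \<subseteq> ?A" if "a \<in> ?A" for a
  using that olt_trans unfolding underS_olt by blast
 define s where "s a = infsum w (underS omega1 a)" for a
 have s_ins: "infsum w (insert a (underS omega1 a)) = s a + w a" if "a \<in> ?A" for a
  unfolding s_def by (subst infsum_insert) (use dn[OF that] ws olt_irrefl in \<open>auto simp: underS_olt\<close>)
 have s_nonneg: "0 \<le> s a" for a unfolding s_def by (rule infsum_nonneg) (simp add: wpos less_imp_le)
 have s_less: "s a + w a \<le> s a'" if "olt a a'" "a' \<in> ?A" for a a'
 proof -
  have aA: "a \<in> ?A" using dn[OF that(2)] that(1) unfolding underS_olt by blast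
  have "insert a (underS omega1 a) \<subseteq> underS omega1 a'" using that(1) olt_trans unfolding underS_olt by blast
  thus ?thesis using mono[of "insert a (underS omega1 a)" "underS omega1 a'"] dn[OF that(2)] s_ins[OF aA] by (simp add: s_def)
 qed
 define f where "f x = s (fst x) + snd x * w (fst x)" for x :: "nat set \<times> real"
 define W where "W = infsum w ?A"
 have bound: "0 \<le> f x \<and> f x < s (fst x) + w (fst x) \<and> s (fst x) \<le> f x" if "x \<in> D" for x
 proof -
  have "0 \<le> snd x" "snd x < 1" using that by (auto simp: D_def closed_long_ray_def)
  hence "0 \<le> snd x * w (fst x)" "snd x * w (fst x) < 1 * w (fst x)"
   using wpos[of "fst x"] mult_strict_right_mono[of "snd x" 1 "w (fst x)"] by auto
  thus ?thesis using s_nonneg[of "fst x"] by (simp add: f_def)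
 qed
 have 1: "f x < f y" if "x \<in> D" "y \<in> D" "(x, y) \<in> long_less" for x y
 proof (cases "fst x = fst y")
  case True
  hence "snd x < snd y" using that(3) by (cases x; cases y) (auto simp: long_less_iff olt_irrefl)
  thus ?thesis using True wpos by (simp add: f_def)
 next
  case False
  hence "olt (fst x) (fst y)" using that(3) by (cases x; cases y) (auto simp: long_less_iff)
  hence "s (fst x) + w (fst x) \<le> s (fst y)" using that(2) by (intro s_less) (auto simp: D_def)
  thus ?thesis using bound[OF that(1)] bound[OF that(2)] by linarith
 qed
 have 2: "f x < W" if "x \<in> D" for x
 proof -
  have "fst x \<in> ?A" using that by (simp add: D_def)
  hence "s (fst x) + w (fst x) \<le> W" unfolding W_def s_ins[symmetric, OF \<open>fst x \<in> ?A\<close>] using dn by (intro mono) auto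
  thus ?thesis using bound[OF that] by linarith
 qed
 \<comment> \<open>A finite subset has a largest element, so its weight is at most that of the
   initial segment ending there; and an infinite sum of positive weights is bounded by its finite
   parts.\<close>
 have fin: "infsum w B \<le> r" if B: "B \<subseteq> ?A" and r: "0 \<le> r" and le: "\<And>a. a \<in> B ==> infsum w (insert a (underS omega1 a)) \<le> r" for B r
 proof (rule infsum_le_finite_sums[OF ws[OF B]])
  fix F assume F: "finite F" "F \<subseteq> B"
  show "sum w F \<le> r"
  proof (cases "F = {}")
   case False
   have "\<exists>m\<in>F. \<forall>a\<in>F. a = m \<or> olt a m"
   using F(1) False F(2)
   proof (induction F rule: finite_ne_induct)
   case (insert x G)
   then obtain m where m: "m \<in> G" "\<forall>a\<in>G. a = m \<or> olt a m" by auto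
   have "x \<in> ?A" "m \<in> ?A" using insert.prems B m(1) by blast+
   hence xm: "x \<in> Field omega1" "m \<in> Field omega1" using olt_Field[of x b0] olt_Field[of m b0] unfolding underS_olt by simp_all
   consider "x = m" | "olt x m" | "olt m x" using olt_total[OF xm] by blast
   thus ?case
   proof cases
   case 3
   have "a = x \<or> olt a x" if "a \<in> Set.insert x G" for a
   using that m(2)[rule_format, of a] olt_trans[of a m x] 3 by auto
   thus ?thesis by (intro bexI[of _ x]) simp_all
   qed (use m in blast)+
   qed simp
   then obtain m where m: "m \<in> F" "\<forall>a\<in>F. a = m \<or> olt a m" by blast
   have mA: "m \<in> ?A" using m F B by blast
   have "sum w F = infsum w F" using F(1) by simp
   also have "\<dots> \<le> infsum w (insert m (underS omega1 m))"
   by (rule mono) (use m dn[OF mA] in \<open>auto simp: underS_olt\<close>)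
   also have "\<dots> \<le> r" by (rule le) (use m F in auto)
   finally show ?thesis .
  qed (use r in simp)
 qed
 have 3: "\<exists>x\<in>D. f x = r" if r: "0 \<le> r" "r < W" for r
 proof -
  have "\<exists>a\<in>?A. r < infsum w (insert a (underS omega1 a))"
  proof (rule ccontr)
   assume "\<not> ?thesis"
   hence "W \<le> r" unfolding W_def by (intro fin[OF subset_refl r(1)]) (auto simp: not_less)
   thus False using r by simp
  qed
  then obtain a0 where "a0 \<in> ?A \<and> r < infsum w (insert a0 (underS omega1 a0))" by blast
  \<comment> \<open>The least \<open>a\<close> whose initial segment, with \<open>a\<close>
    included, weighs more than \<open>r\<close>. By minimality the weight \<open>s a\<close> before
    it is at most \<open>r\<close>, so \<open>r\<close> falls into the piece of
    \<open>a\<close>.\<close>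
  then obtain a where a: "a \<in> ?A" "r < infsum w (insert a (underS omega1 a))"
   and amin: "\<And>c. olt c a ==> \<not> (c \<in> ?A \<and> r < infsum w (insert c (underS omega1 c)))"
   using olt_minimal[of "\<lambda>a. a \<in> ?A \<and> r < infsum w (insert a (underS omega1 a))"] by blast
  have aA: "a \<in> ?A" and rlt: "r < s a + w a" using a s_ins by auto
  have "s a \<le> r" unfolding s_def
  proof (rule fin[OF _ r(1)])
   show "underS omega1 a \<subseteq> ?A" using dn[OF aA] by blast
   show "infsum w (insert c (underS omega1 c)) \<le> r" if "c \<in> underS omega1 a" for c
   using amin[of c] that dn[OF aA] unfolding underS_olt by (auto simp: not_less)
  qed
  define x where "x = (a, (r - s a) / w a)"
  have "0 \<le> (r - s a) / w a" "(r - s a) / w a < 1" using \<open>s a \<le> r\<close> rlt wpos[of a] by (auto simp: field_simps)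
  hence "x \<in> D" using aA olt_Field by (auto simp: x_def D_def closed_long_ray_def underS_olt)
  moreover have "f x = r" using wpos[of a] by (simp add: f_def x_def)
  ultimately show ?thesis by blast
 qed
 have "f ` D = {0..<W}"
 proof
  show "f ` D \<subseteq> {0..<W}" using bound 2 by force
  show "{0..<W} \<subseteq> f ` D" using 3 by force
 qed
 thus ?thesis using 1 by blast
qed

text \<open>As \<open>f\<close> preserves and reflects the order, rays correspond to real
  half-lines; a ray whose end point lies outside \<open>D\<close> meets \<open>E\<close> in
  everything or nothing, since \<open>D\<close> is closed downwards. The least point
  \<open>z\<close> corresponds to 0 and is removed.\<close>

lemma order_segment_homeomorphic:
 fixes C D :: "'p set" and r :: "'p rel" and f :: "'p => real"
 assumes total: "\<And>x y. x \<in> C ==> y \<in> C ==> x \<noteq> y ==> (x, y) \<in> r \<or> (y, x) \<in> r"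
  and DC: "D \<subseteq> C" and down: "\<And>x y. y \<in> D ==> x \<in> C ==> (x, y) \<in> r ==> x \<in> D"
  and fm: "\<And>x y. x \<in> D ==> y \<in> D ==> (x, y) \<in> r ==> f x < f y" and fD: "f ` D = {0..<W}"
  and z: "z \<in> D" "\<And>x. x \<in> C - {z} ==> (z, x) \<in> r"
 defines "E \<equiv> D - {z}" and "T \<equiv> subtopology (order_topology_on C r) (C - {z})"
 shows "\<exists>g. homeomorphic_maps (subtopology T E) (top_of_set {0<..<W}) f g \<and> (\<forall>x\<in>E. \<forall>y\<in>E. (x, y) \<in> r \<longleftrightarrow> f x < f y)"
proof -
 have fiff: "(x, y) \<in> r \<longleftrightarrow> f x < f y" if "x \<in> D" "y \<in> D" for x y
  using fm[OF that] fm[OF that(2,1)] total[of x y] that DC by (cases "x = y") (auto, fastforce)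
 have inj: "x = y" if "x \<in> D" "y \<in> D" "f x = f y" for x y
  using total[of x y] fm[of x y] fm[of y x] that DC by fastforce
 have z0: "f z = 0"
 proof -
  have fz: "f z \<in> {0..<W}" using fD z(1) by blast
  hence "0 \<in> f ` D" using fD by simp
  then obtain x where x: "x \<in> D" "f x = 0" by force
  have "x = z"
  proof (rule ccontr)
   assume "x \<noteq> z"
   hence "f z < f x" using fm[OF z(1) x(1)] z(2)[of x] x(1) DC by blast
   thus False using fz x(2) by simp
  qed
  thus ?thesis using x by simp
 qed
 have tT: "topspace T = C - {z}" by (auto simp: T_def topspace_order_topology_on)
 have EL: "E \<subseteq> topspace T" using DC by (auto simp: E_def tT)
 have ED: "x \<in> D" if "x \<in> E" for x using that by (simp add: E_def)
 have fE: "f x \<in> {0<..<W}" if "x \<in> E" for x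
 proof -
  have "f x \<in> {0..<W}" using fD ED[OF that] by blast
  moreover have "f x \<noteq> 0" using inj[OF ED[OF that] z(1)] z0 that by (auto simp: E_def)
  ultimately show ?thesis by auto
 qed
 have "\<forall>t\<in>{0<..<W}. \<exists>x. x \<in> E \<and> f x = t"
 proof
  fix t assume t: "t \<in> {0<..<W}"
  hence "t \<in> f ` D" using fD by auto
  thus "\<exists>x. x \<in> E \<and> f x = t" using z0 t by (auto simp: E_def)
 qed
 from bchoice[OF this] obtain g where fg: "\<forall>t\<in>{0<..<W}. g t \<in> E \<and> f (g t) = t" ..
 have gf: "g (f x) = x" if "x \<in> E" for x using fg fE[OF that] inj[of "g (f x)" x] ED that by blast
 have tE: "topspace (subtopology T E) = E" using EL by auto
 have ray: "openin (subtopology T E) {x \<in> E. (c, x) \<in> r}" "openin (subtopology T E) {x \<in> E. (x, c) \<in> r}" if "c \<in> E" for c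
 proof -
  have c: "c \<in> C" using that ED DC by blast
  have "openin (order_topology_on C r) {x \<in> C. (c, x) \<in> r}" "openin (order_topology_on C r) {x \<in> C. (x, c) \<in> r}"
   unfolding order_topology_on_def by (rule topology_generated_by_Basis; use c in blast)+
  moreover have "{x \<in> E. P x} = {x \<in> C. P x} \<inter> (C - {z}) \<inter> E" for P using EL tT by auto
  ultimately show "openin (subtopology T E) {x \<in> E. (c, x) \<in> r}" "openin (subtopology T E) {x \<in> E. (x, c) \<in> r}"
   unfolding T_def by (metis openin_subtopology_Int)+
 qed
 have whole: "openin (subtopology T E) E" using openin_topspace[of "subtopology T E"] unfolding tE .
 have cf: "continuous_map (subtopology T E) euclideanreal f"
  unfolding continuous_map_upper_lower_semicontinuous_lt tE
 proof (intro conjI allI)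
  fix a
  consider "a \<le> 0" | "a \<in> {0<..<W}" | "a \<ge> W" by fastforce
  hence "openin (subtopology T E) {x \<in> E. a < f x} \<and> openin (subtopology T E) {x \<in> E. f x < a}"
  proof cases
   case 1
   have "{x \<in> E. a < f x} = E" using fE 1 by force
   moreover have "{x \<in> E. f x < a} = {}" using fE 1 by force
   ultimately show ?thesis using whole by (simp only: openin_empty)
  next
   case 2
   hence "f (g a) = a" "g a \<in> E" using fg by auto
   hence "{x \<in> E. a < f x} = {x \<in> E. (g a, x) \<in> r}" "{x \<in> E. f x < a} = {x \<in> E. (x, g a) \<in> r}"
   using fiff ED by auto
   thus ?thesis using ray[OF \<open>g a \<in> E\<close>] by simp
  next
   case 3
   have "{x \<in> E. a < f x} = {}" using fE 3 by force
   moreover have "{x \<in> E. f x < a} = E" using fE 3 by force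
   ultimately show ?thesis using whole by (simp only: openin_empty)
  qed
  thus "openin (subtopology T E) {x \<in> E. a < f x}" "openin (subtopology T E) {x \<in> E. f x < a}" by auto
 qed
 have gC: "g t \<in> E \<and> g t \<in> D \<and> g t \<in> C \<and> f (g t) = t" if "t \<in> {0<..<W}" for t using fg that ED DC by blast
 have "continuous_map (top_of_set {0<..<W}) (order_topology_on C r) g"
  unfolding order_topology_on_def
 proof (rule continuous_on_generated_topo)
  let ?T = "top_of_set {0<..<W}"
  fix U assume U: "U \<in> {C} \<union> {{x \<in> C. (a, x) \<in> r} |a. a \<in> C} \<union> {{x \<in> C. (x, a) \<in> r} |a. a \<in> C}"
  then consider "U = C" | a where "a \<in> C" "U = {x \<in> C. (a, x) \<in> r}" | a where "a \<in> C" "U = {x \<in> C. (x, a) \<in> r}" by blast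
  thus "openin ?T (g -` U \<inter> topspace ?T)"
  proof cases
   case 1
   hence "g -` U \<inter> topspace ?T = {0<..<W}" using gC by auto
   thus ?thesis by simp
  next
   case (2 a)
   have "g -` U \<inter> topspace ?T = {0<..<W} \<inter> (if a \<in> D then {f a<..} else {})"
   proof (cases "a \<in> D")
   case True
   have "(a, g t) \<in> r \<longleftrightarrow> f a < t" if "t \<in> {0<..<W}" for t using fiff[OF True, of "g t"] gC[OF that] by simp
   thus ?thesis using 2 gC True by auto
   next
   case False
   have "(a, g t) \<notin> r" if "t \<in> {0<..<W}" for t using down[of "g t" a] gC[OF that] 2(1) False by blast
   thus ?thesis using 2 False by auto
   qed
   thus ?thesis by (simp add: openin_open_Int)
  next
   case (3 a)
   have "g -` U \<inter> topspace ?T = {0<..<W} \<inter> (if a \<in> D then {..<f a} else UNIV)"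
   proof (cases "a \<in> D")
   case True
   have "(g t, a) \<in> r \<longleftrightarrow> t < f a" if "t \<in> {0<..<W}" for t using fiff[OF _ True, of "g t"] gC[OF that] by simp
   thus ?thesis using 3 gC True by auto
   next
   case False
   have "(g t, a) \<in> r" if "t \<in> {0<..<W}" for t
   using total[of "g t" a] gC[OF that] 3(1) down[of "g t" a] False by blast
   thus ?thesis using 3 gC False by auto
   qed
   thus ?thesis by (simp add: openin_open_Int)
  qed
 next
  show "g ` topspace (top_of_set {0<..<W}) \<subseteq> \<Union> ({C} \<union> {{x \<in> C. (a, x) \<in> r} |a. a \<in> C} \<union> {{x \<in> C. (x, a) \<in> r} |a. a \<in> C})"
   using gC by auto
 qed
 hence cg: "continuous_map (top_of_set {0<..<W}) (subtopology T E) g"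
  using gC EL unfolding T_def by (auto simp: continuous_map_in_subtopology E_def)
 have "homeomorphic_maps (subtopology T E) (top_of_set {0<..<W}) f g"
  unfolding homeomorphic_maps_def using cf cg gf fg tE fE by (auto simp: continuous_map_in_subtopology)
 thus ?thesis using fiff ED by blast
qed

section \<open>The long ray through its order properties\<close>

locale long_line =
 fixes L :: "'p topology" and lt :: "'p => 'p => bool" (infix \<open>\<lless>\<close> 50)
 assumes lt_irrefl: "\<not> x \<lless> x" and lt_trans: "x \<lless> y ==> y \<lless> w ==> x \<lless> w"
  and lt_total: "x \<in> topspace L ==> y \<in> topspace L ==> x \<noteq> y ==> x \<lless> y \<or> y \<lless> x"
  and open_above: "c \<in> topspace L ==> openin L {x \<in> topspace L. c \<lless> x}"
  and open_below: "c \<in> topspace L ==> openin L {x \<in> topspace L. x \<lless> c}"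
  and countable_bounded: "countable C ==> C \<subseteq> topspace L ==> \<exists>b\<in>topspace L. \<forall>c\<in>C. c \<lless> b"
  and segment_chart: "b \<in> topspace L ==> \<exists>E f g W. openin L E \<and> b \<in> E \<and> (\<forall>y\<in>E. \<forall>x\<in>topspace L. x \<lless> y --> x \<in> E) \<and>
   homeomorphic_maps (subtopology L E) (top_of_set {0<..<W::real}) f g \<and> (\<forall>x\<in>E. \<forall>y\<in>E. x \<lless> y \<longleftrightarrow> f x < f y)"

lemma long_line_long_ray: "long_line long_ray (\<lambda>x y. (x, y) \<in> long_less)"
proof
 fix c assume "c \<in> topspace long_ray"
 hence c: "c \<in> closed_long_ray" by (simp add: topspace_long_ray)
 have "openin (order_topology_on closed_long_ray long_less) {x \<in> closed_long_ray. (c, x) \<in> long_less}"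
  "openin (order_topology_on closed_long_ray long_less) {x \<in> closed_long_ray. (x, c) \<in> long_less}"
  unfolding order_topology_on_def using c by (intro topology_generated_by_Basis UnI1 UnI2 CollectI exI[of _ c] conjI refl; assumption)+
 moreover have "{x \<in> topspace long_ray. P x} = {x \<in> closed_long_ray. P x} \<inter> (closed_long_ray - {long_zero})" for P
  unfolding topspace_long_ray by blast
 ultimately show "openin long_ray {x \<in> topspace long_ray. (c, x) \<in> long_less}" "openin long_ray {x \<in> topspace long_ray. (x, c) \<in> long_less}"
  by (simp_all only: openin_subtopology_Int long_ray_def)
next
 fix b assume b: "b \<in> topspace long_ray"
 hence fb: "fst b \<in> Field omega1" by (cases b) (simp add: topspace_long_ray closed_long_ray_def)
 obtain b0 where b0: "b0 \<in> Field omega1" "olt (fst b) b0"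
  using countable_omega1_bounded[of "{fst b}"] fb by blast
 define D where "D = {x \<in> closed_long_ray. fst x \<in> underS omega1 b0}"
 have Diff: "x \<in> D \<longleftrightarrow> x \<in> closed_long_ray \<and> olt (fst x) b0" for x unfolding D_def underS_olt by simp
 obtain f W where fm: "\<forall>x\<in>D. \<forall>y\<in>D. (x, y) \<in> long_less --> f x < f y" and fD: "f ` D = {0..<W::real}"
  using long_ray_segment_order_iso[OF b0(1)] unfolding D_def by blast
 have down: "x \<in> D" if "y \<in> D" "x \<in> closed_long_ray" "(x, y) \<in> long_less" for x y
 proof -
  have "olt (fst x) (fst y) \<or> fst x = fst y" using that(3) by (cases x; cases y) (simp add: long_less_iff, blast)
  thus ?thesis using that(1,2) olt_trans unfolding Diff by metis
 qed
 have bC: "b \<in> closed_long_ray" "b \<noteq> long_zero" using b by (simp_all add: topspace_long_ray)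
 have bD: "b \<in> D" using bC b0 by (simp add: Diff)
 have zb: "(long_zero, b) \<in> long_less" using bC long_zero_least by blast
 have zD: "long_zero \<in> D" by (rule down[OF bD long_zero_in zb])
 have DC: "D \<subseteq> closed_long_ray" using Diff by blast
 obtain g where g: "homeomorphic_maps (subtopology long_ray (D - {long_zero})) (top_of_set {0<..<W}) f g"
   "\<forall>x\<in>D - {long_zero}. \<forall>y\<in>D - {long_zero}. (x, y) \<in> long_less \<longleftrightarrow> f x < f y"
 proof -
  have "\<exists>g. homeomorphic_maps (subtopology (subtopology (order_topology_on closed_long_ray long_less) (closed_long_ray - {long_zero})) (D - {long_zero}))
   (top_of_set {0<..<W}) f g \<and> (\<forall>x\<in>D - {long_zero}. \<forall>y\<in>D - {long_zero}. (x, y) \<in> long_less \<longleftrightarrow> f x < f y)"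
   by (rule order_segment_homeomorphic; (rule long_less_total DC fD zD long_zero_least fm[rule_format]; assumption)?) (fact down)
  thus thesis using that unfolding long_ray_def by blast
 qed
 have c0: "(b0, 0) \<in> closed_long_ray" using b0(1) by (simp add: closed_long_ray_def)
 have "x \<in> D \<longleftrightarrow> x \<in> closed_long_ray \<and> (x, (b0, 0)) \<in> long_less" for x
  by (cases x) (auto simp: Diff long_less_iff closed_long_ray_def)
 hence "D = {x \<in> closed_long_ray. (x, (b0, 0)) \<in> long_less}" by blast
 moreover have "openin (order_topology_on closed_long_ray long_less) {x \<in> closed_long_ray. (x, (b0, 0)) \<in> long_less}"
  unfolding order_topology_on_def by (rule topology_generated_by_Basis) (use c0 in blast)
 ultimately have "openin long_ray (D \<inter> (closed_long_ray - {long_zero}))"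
  unfolding long_ray_def by (metis openin_subtopology_Int)
 moreover have "D \<inter> (closed_long_ray - {long_zero}) = D - {long_zero}" using DC by blast
 ultimately have op: "openin long_ray (D - {long_zero})" by simp
 have dn: "\<forall>y\<in>D - {long_zero}. \<forall>x\<in>topspace long_ray. (x, y) \<in> long_less --> x \<in> D - {long_zero}"
  using down unfolding topspace_long_ray by blast
 have bE: "b \<in> D - {long_zero}" using bD bC by blast
 show "\<exists>E f g W. openin long_ray E \<and> b \<in> E \<and> (\<forall>y\<in>E. \<forall>x\<in>topspace long_ray. (x, y) \<in> long_less --> x \<in> E) \<and>
   homeomorphic_maps (subtopology long_ray E) (top_of_set {0<..<W::real}) f g \<and> (\<forall>x\<in>E. \<forall>y\<in>E. ((x, y) \<in> long_less) = (f x < f y))"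
  using op bE dn g by (intro exI[of _ "D - {long_zero}"] exI[of _ f] exI[of _ g] exI[of _ W] conjI)
next
 show "(x, y) \<in> long_less \<or> (y, x) \<in> long_less" if "x \<in> topspace long_ray" "y \<in> topspace long_ray" "x \<noteq> y" for x y
  using long_less_total that by (simp add: topspace_long_ray)
qed (fact long_less_irrefl, fact long_less_trans, fact long_ray_countable_bounded)

context long_line
begin

lemma connected_heights:
 assumes C: "connectedin L C" and "a \<in> C" "b \<in> C" "a \<lless> c" "c \<lless> b" "c \<in> topspace L"
 shows "c \<in> C"
proof (rule ccontr)
 assume c: "c \<notin> C"
 let ?U = "{x \<in> topspace L. x \<lless> c}" and ?V = "{x \<in> topspace L. c \<lless> x}"
 have CL: "C \<subseteq> topspace L" using C connectedin_subset_topspace by blast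
 hence "C \<subseteq> ?U \<union> ?V" using c lt_total[OF _ assms(6)] by blast
 moreover have "?U \<inter> ?V \<inter> C = {}" using lt_trans lt_irrefl by blast
 moreover have "?U \<inter> C \<noteq> {}" "?V \<inter> C \<noteq> {}" using assms CL by auto
 ultimately show False using C open_above[OF assms(6)] open_below[OF assms(6)] unfolding connectedin by blast
qed

text \<open>The sequence is bounded because it is countable, and an initial segment through an upper
  bound is an open real interval, in which the supremum can be taken.\<close>

lemma sequence_lub:
 assumes \<gamma>: "\<And>n :: nat. \<gamma> n \<in> topspace L" "\<And>n. \<gamma> n \<lless> \<gamma> (Suc n)"
 obtains l where "l \<in> topspace L" "\<And>n. \<gamma> n \<lless> l"
  "\<And>a. a \<in> topspace L ==> a \<lless> l ==> \<exists>n. \<forall>m\<ge>n. a \<lless> \<gamma> m"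
proof -
 have "\<exists>b\<in>topspace L. \<forall>c\<in>range \<gamma>. c \<lless> b" by (rule countable_bounded) (use \<gamma> in auto)
 then obtain b where b: "b \<in> topspace L" "\<And>n. \<gamma> n \<lless> b" by blast
 obtain E f g and W :: real where E: "openin L E" "b \<in> E" "\<forall>y\<in>E. \<forall>x\<in>topspace L. x \<lless> y --> x \<in> E"
  "homeomorphic_maps (subtopology L E) (top_of_set {0<..<W}) f g"
  "\<forall>x\<in>E. \<forall>y\<in>E. x \<lless> y \<longleftrightarrow> f x < f y" using segment_chart[OF b(1)] by blast
 have EL: "E \<subseteq> topspace L" using E(1) openin_subset by blast
 have tE: "topspace (subtopology L E) = E" using EL by auto
 have fE: "f x \<in> {0<..<W} \<and> g (f x) = x" if "x \<in> E" for x
  using E(4) that tE unfolding homeomorphic_maps_def continuous_map_def by auto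
 have gE: "g r \<in> E \<and> f (g r) = r" if "r \<in> {0<..<W}" for r
  using E(4) that tE unfolding homeomorphic_maps_def continuous_map_def by auto
 have \<gamma>E: "\<gamma> n \<in> E" for n using E(2,3) \<gamma>(1) b(2) by blast
 have inc: "f (\<gamma> n) < f (\<gamma> (Suc n))" for n using E(5) \<gamma>E \<gamma>(2) by blast
 have bd: "f (\<gamma> n) < f b" for n using E(2,5) \<gamma>E b(2) by blast
 define r where "r = (SUP n. f (\<gamma> n))"
 have bdd: "bdd_above (range (\<lambda>n. f (\<gamma> n)))" using bd less_imp_le by (intro bdd_aboveI2[of _ _ "f b"]) blast
 have lt: "f (\<gamma> n) < r" for n
  using inc[of n] cSUP_upper[OF UNIV_I bdd, of "Suc n"] unfolding r_def by linarith
 have "r \<le> f b" unfolding r_def using bd less_imp_le by (intro cSUP_least) auto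
 hence rW: "r \<in> {0<..<W}" using lt[of 0] fE[OF \<gamma>E[of 0]] fE[OF E(2)] by auto
 define l where "l = g r"
 have lE: "l \<in> E" "f l = r" using gE[OF rW] by (auto simp: l_def)
 show thesis
 proof (rule that[of l])
  show "l \<in> topspace L" using lE EL by blast
  show "\<gamma> n \<lless> l" for n using E(5) \<gamma>E lE(1) lt lE(2) by metis
  fix a assume a: "a \<in> topspace L" "a \<lless> l"
  hence aE: "a \<in> E" using E(3) lE(1) by blast
  hence "f a < r" using E(5) lE a(2) by metis
  then obtain n where n: "f a < f (\<gamma> n)" unfolding r_def using less_cSUP_iff[OF _ bdd] by auto
  have "f (\<gamma> n) \<le> f (\<gamma> m)" if "n \<le> m" for m using lift_Suc_mono_le[of "\<lambda>n. f (\<gamma> n)" n m] inc that less_imp_le by blast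
  hence "\<forall>m\<ge>n. f a < f (\<gamma> m)" using n by (meson order.strict_trans2)
  thus "\<exists>n. \<forall>m\<ge>n. a \<lless> \<gamma> m" using E(5) aE \<gamma>E by blast
 qed
qed

end

section \<open>Arcs in plaques\<close>

lemma flow_boxD:
 assumes "flow_box X (U, u, F)"
 shows "openin X U" "continuous_map (subtopology X U) euclideanreal u"
  and "continuous_map (prod_topology (top_of_set {0<..<1}) (subtopology X U)) X (\<lambda>(s, q). F s q)"
  and "q \<in> U ==> u q \<in> {0<..<1}" "q \<in> U ==> F (u q) q = q"
  and "q \<in> U ==> s \<in> {0<..<1} ==> F s q \<in> U"
  and "q \<in> U ==> s \<in> {0<..<1} ==> u (F s q) = s"
  and "q \<in> U ==> s \<in> {0<..<1} ==> t \<in> {0<..<1} ==> F t (F s q) = F t q"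
 using assms unfolding flow_box_def by auto

lemma unit_interval_mix:
 fixes a s t :: real
 assumes "a \<in> {0<..<1}" "s \<in> {0<..<1}" "t \<in> {0..1}"
 shows "a + t * (s - a) \<in> {0<..<1}"
 using convexD_alt[OF convex_real_interval(8), of a 0 1 s t] assms by (simp add: algebra_simps)

lemma openin_unit_interval_start:
 assumes "openin (top_of_set {0..1::real}) S" "0 \<in> S"
 obtains e where "e > 0" "\<And>t. t \<in> {0..1} ==> t < e ==> t \<in> S"
proof -
 obtain e where "e > 0" "\<forall>t\<in>{0..1}. dist t 0 < e --> t \<in> S"
  using bspec[OF conjunct2[OF assms(1)[unfolded openin_euclidean_subtopology_iff]] assms(2)] by blast
 thus thesis by (intro that[of e]) (auto simp: dist_real_def)
qed

definition plaque_arc :: "'x box set => 'x => (real => 'x) => bool" where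
 "plaque_arc A z \<alpha> \<longleftrightarrow> (\<exists>U u F s. (U, u, F) \<in> A \<and> z \<in> U \<and> s \<in> {0<..<1} \<and> s \<noteq> u z \<and> \<alpha> = (\<lambda>t. F (u z + t * (s - u z)) z))"

locale flow_space =
 fixes X :: "'x topology" and B :: "'x box set"
 assumes flow: "flow_structure X B" and hausdorff: "Hausdorff_space X"
begin

lemma box: "(U, u, F) \<in> B ==> flow_box X (U, u, F)"
 using flow unfolding flow_structure_def by blast

lemma same_plaque:
 assumes "(U, u, F) \<in> B" "(V, v, G) \<in> B" "p \<in> U \<inter> V" "q \<in> U \<inter> V" "F (u q) p = q"
 shows "G (v q) p = q"
 using flow assms unfolding flow_structure_def by blast

lemma small_box:
 assumes "openin X W" "p \<in> W"
 obtains U u F where "(U, u, F) \<in> B" "p \<in> U" "U \<subseteq> W"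
proof -
 have "\<exists>U u F. (U, u, F) \<in> B \<and> p \<in> U \<and> U \<subseteq> W"
  using flow assms unfolding flow_structure_def by blast
 thus thesis using that by blast
qed

lemma plaque_curve_continuous:
 assumes "(U, u, F) \<in> B" "q \<in> U"
 shows "continuous_map (top_of_set {0<..<1}) X (\<lambda>s. F s q)"
proof -
 note b = flow_boxD[OF box[OF assms(1)]]
 have "q \<in> topspace (subtopology X U)" using assms(2) b(1) openin_subset by fastforce
 hence "continuous_map (top_of_set {0<..<1}) (prod_topology (top_of_set {0<..<1}) (subtopology X U)) (\<lambda>s. (s, q))"
  by (simp add: continuous_map_pairwise o_def continuous_map_const)
 from continuous_map_compose[OF this b(3)] show ?thesis by (simp add: o_def)
qed

lemma plaque_transport_continuous:
 assumes "(U, u, F) \<in> B" "s \<in> {0<..<1}"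
 shows "continuous_map (subtopology X U) X (F s)"
proof -
 note b = flow_boxD[OF box[OF assms(1)]]
 have "continuous_map (subtopology X U) (prod_topology (top_of_set {0<..<1}) (subtopology X U)) (\<lambda>q. (s, q))"
  using assms(2) by (simp add: continuous_map_pairwise o_def continuous_map_const)
 from continuous_map_compose[OF this b(3)] show ?thesis by (simp add: o_def)
qed

lemma plaque_arcE:
 assumes "plaque_arc A z \<alpha>" "A \<subseteq> B"
 obtains U u F s where "(U, u, F) \<in> A" "(U, u, F) \<in> B" "z \<in> U" "s \<in> {0<..<1}" "s \<noteq> u z"
  "\<forall>t\<in>{0..1}. \<alpha> t = F (u z + t * (s - u z)) z"
  "\<forall>t\<in>{0..1}. \<alpha> t \<in> U" "\<forall>t\<in>{0..1}. u (\<alpha> t) = u z + t * (s - u z)"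
  "\<forall>t\<in>{0..1}. F (u (\<alpha> t)) z = \<alpha> t"
proof -
 obtain U u F s where 1: "(U, u, F) \<in> A" "z \<in> U" "s \<in> {0<..<1}" "s \<noteq> u z" "\<alpha> = (\<lambda>t. F (u z + t * (s - u z)) z)"
  using assms(1) unfolding plaque_arc_def by blast
 hence UB: "(U, u, F) \<in> B" using assms(2) by blast
 note b = flow_boxD[OF box[OF UB]]
 have m: "u z + t * (s - u z) \<in> {0<..<1}" if "t \<in> {0..1}" for t
  using unit_interval_mix[OF b(4)[OF 1(2)] 1(3) that] .
 have e: "\<alpha> t = F (u z + t * (s - u z)) z \<and> \<alpha> t \<in> U \<and> u (\<alpha> t) = u z + t * (s - u z) \<and> F (u (\<alpha> t)) z = \<alpha> t" if "t \<in> {0..1}" for t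
  using b(6,7)[OF 1(2) m[OF that]] unfolding 1(5) by simp
 show thesis by (rule that[OF 1(1) UB 1(2,3,4)]) (use e in blast)+
qed

context
 fixes A z \<alpha> assumes arc: "plaque_arc A z \<alpha>" and AB: "A \<subseteq> B"
begin

lemma arc_start: "\<alpha> 0 = z"
proof -
 obtain U u F s where a0: "(U, u, F) \<in> B" "z \<in> U" "\<forall>t\<in>{0..1}. \<alpha> t = F (u z + t * (s - u z)) z"
  by (rule plaque_arcE[OF arc AB]) (rule that; assumption)
 note a = a0[rule_format]
 show ?thesis using a(3)[of 0] flow_boxD(5)[OF box[OF a(1)] a(2)] by simp
qed

lemma arc_continuous: "continuous_map (top_of_set {0..1}) X \<alpha>"
proof -
 obtain U u F s where a0: "(U, u, F) \<in> B" "z \<in> U" "s \<in> {0<..<1}" "\<forall>t\<in>{0..1}. \<alpha> t = F (u z + t * (s - u z)) z"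
  by (rule plaque_arcE[OF arc AB]) (rule that; assumption)
 note a = a0[rule_format]
 have "continuous_map (top_of_set {0..1}) (top_of_set {0<..<1}) (\<lambda>t. u z + t * (s - u z))"
  using unit_interval_mix[OF flow_boxD(4)[OF box[OF a(1)] a(2)] a(3)]
  by (auto simp: continuous_map_in_subtopology image_subset_iff intro!: continuous_intros)
 from continuous_map_compose[OF this plaque_curve_continuous[OF a(1,2)]]
 show ?thesis by (rule continuous_map_eq) (simp add: a(4))
qed

lemma arc_inj: "inj_on \<alpha> {0..1}"
proof -
 obtain u s where a0: "s \<noteq> u z" "\<forall>t\<in>{0..1}. u (\<alpha> t) = u z + t * (s - u z)"
  by (rule plaque_arcE[OF arc AB]) (rule that; assumption)
 note a = a0[rule_format]
 show ?thesis
 proof (rule inj_onI)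
  fix t t' assume t: "t \<in> {0..1::real}" "t' \<in> {0..1}" "\<alpha> t = \<alpha> t'"
  have "u (\<alpha> t) = u (\<alpha> t')" using t(3) by simp
  hence "u z + t * (s - u z) = u z + t' * (s - u z)" by (simp only: a(2)[OF t(1)] a(2)[OF t(2)])
  thus "t = t'" using a(1) by simp
 qed
qed

text \<open>Points of the arc in \<open>V\<close> lie on one plaque of \<open>V\<close>, even if the
  arc leaves \<open>V\<close> in between, because compatibility in \<open>flow_structure\<close> is
  not restricted to components of the overlap.\<close>

lemma arc_plaque:
 assumes "(V, v, G) \<in> B" "t \<in> {0..1}" "t' \<in> {0..1}" "\<alpha> t \<in> V" "\<alpha> t' \<in> V"
 shows "G (v (\<alpha> t')) (\<alpha> t) = \<alpha> t'"
proof -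
 obtain U u F s where a0: "(U, u, F) \<in> B" "z \<in> U" "\<forall>t\<in>{0..1}. \<alpha> t \<in> U" "\<forall>t\<in>{0..1}. F (u (\<alpha> t)) z = \<alpha> t"
  by (rule plaque_arcE[OF arc AB]) (rule that; assumption)
 note a = a0[rule_format]
 note b = flow_boxD[OF box[OF a(1)]]
 have "F (u (\<alpha> t')) (\<alpha> t) = F (u (\<alpha> t')) (F (u (\<alpha> t)) z)" using a(4)[OF assms(2)] by simp
 also have "\<dots> = F (u (\<alpha> t')) z" by (rule b(8)[OF a(2) b(4)[OF a(3)[OF assms(2)]] b(4)[OF a(3)[OF assms(3)]]])
 also have "\<dots> = \<alpha> t'" by (rule a(4)[OF assms(3)])
 finally show ?thesis by (intro same_plaque[OF a(1) assms(1)]) (use a(3) assms in auto)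
qed

lemma arc_image_closed: "closedin X (\<alpha> ` {0..1})"
proof -
 have "compactin (top_of_set {0..1::real}) {0..1}" by (simp add: compactin_subtopology)
 from image_compactin[OF this arc_continuous] show ?thesis by (rule compactin_imp_closedin[OF hausdorff])
qed

lemma arc_coordinate_open:
 assumes "(V, v, G) \<in> B" "open T"
 shows "openin (top_of_set {0..1}) {t \<in> {0..1}. \<alpha> t \<in> V \<and> v (\<alpha> t) \<in> T}"
proof -
 note b = flow_boxD[OF box[OF assms(1)]]
 have "openin (subtopology X V) {q \<in> topspace (subtopology X V). v q \<in> T}"
  by (rule openin_continuous_map_preimage[OF b(2)]) (use assms(2) in simp)
 hence "openin X {q \<in> topspace (subtopology X V). v q \<in> T}" using b(1) openin_trans_full by blast
 from openin_continuous_map_preimage[OF arc_continuous this]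
 have "openin (top_of_set {0..1}) {t \<in> {0..1}. \<alpha> t \<in> {q \<in> topspace (subtopology X V). v q \<in> T}}" by simp
 moreover have "{t \<in> {0..1}. \<alpha> t \<in> {q \<in> topspace (subtopology X V). v q \<in> T}} = {t \<in> {0..1}. \<alpha> t \<in> V \<and> v (\<alpha> t) \<in> T}"
  using openin_subset[OF b(1)] by auto
 ultimately show ?thesis by simp
qed

lemma arc_coordinate_continuous:
 assumes "(V, v, G) \<in> B" "T \<subseteq> {0..1}" "\<alpha> ` T \<subseteq> V"
 shows "continuous_on T (v \<circ> \<alpha>)"
proof -
 note b = flow_boxD[OF box[OF assms(1)]]
 have "continuous_map (top_of_set T) X \<alpha>"
  using continuous_map_from_subtopology[OF arc_continuous, of T] assms(2) by (simp add: subtopology_subtopology inf.absorb2)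
 hence "continuous_map (top_of_set T) (subtopology X V) \<alpha>" using assms(3) by (auto simp: continuous_map_in_subtopology)
 from continuous_map_compose[OF this b(2)] show ?thesis by simp
qed

text \<open>Near its start the arc lies in \<open>V\<close> and cannot return to the coordinate of
  \<open>z\<close>, as it would then return to \<open>z\<close> itself. By connectedness the
  coordinate stays on one side, and \<open>\<sigma>\<close> records which.\<close>

lemma arc_direction:
 assumes "(V, v, G) \<in> B" "z \<in> V"
 obtains \<sigma> \<epsilon> where "\<sigma> = 1 \<or> \<sigma> = (-1::real)" "\<epsilon> \<in> {0<..1}" "\<And>t. t \<in> {0<..\<epsilon>} ==> \<alpha> t \<in> V \<and> 0 < \<sigma> * (v (\<alpha> t) - v z)"
proof -
 have "openin (top_of_set {0..1}) {t \<in> {0..1}. \<alpha> t \<in> V \<and> v (\<alpha> t) \<in> UNIV}" by (rule arc_coordinate_open[OF assms(1)]) simp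
 moreover have "0 \<in> {t \<in> {0..1}. \<alpha> t \<in> V \<and> v (\<alpha> t) \<in> UNIV}" using arc_start assms(2) by simp
 ultimately obtain e where e: "e > 0" "\<And>t. t \<in> {0..1} ==> t < e ==> \<alpha> t \<in> V"
  by (rule openin_unit_interval_start) (rule that, assumption, simp)
 define \<epsilon> where "\<epsilon> = min 1 (e / 2)"
 have \<epsilon>: "\<epsilon> \<in> {0<..1}" "\<And>t. t \<in> {0<..\<epsilon>} ==> \<alpha> t \<in> V"
  using e by (auto simp: \<epsilon>_def)
 have ne: "v (\<alpha> t) \<noteq> v z" if t: "t \<in> {0<..\<epsilon>}" for t
 proof
  assume eq: "v (\<alpha> t) = v z"
  have "G (v (\<alpha> t)) (\<alpha> 0) = \<alpha> t" by (rule arc_plaque[OF assms(1)]) (use t \<epsilon> arc_start assms(2) in auto)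
  hence "\<alpha> t = \<alpha> 0" using eq arc_start flow_boxD(5)[OF box[OF assms(1)] assms(2)] by simp
  thus False using inj_onD[OF arc_inj, of t 0] t \<epsilon> by auto
 qed
 have "continuous_on {0<..\<epsilon>} (v \<circ> \<alpha>)" by (rule arc_coordinate_continuous[OF assms(1)]) (use \<epsilon> in auto)
 hence con: "connected ((v \<circ> \<alpha>) ` {0<..\<epsilon>})" by (rule connected_continuous_image) simp
 have "(\<forall>t\<in>{0<..\<epsilon>}. v z < v (\<alpha> t)) \<or> (\<forall>t\<in>{0<..\<epsilon>}. v (\<alpha> t) < v z)"
 proof (rule ccontr)
  assume "\<not> ?thesis"
  then obtain t t' where t: "t \<in> {0<..\<epsilon>}" "t' \<in> {0<..\<epsilon>}" "v (\<alpha> t) \<le> v z" "v z \<le> v (\<alpha> t')" by (meson not_le)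
  have "v z \<in> (v \<circ> \<alpha>) ` {0<..\<epsilon>}" by (rule connectedD_interval[OF con _ _ t(3,4)]) (use t(1,2) in auto)
  thus False using ne by (metis comp_apply imageE)
 qed
 thus thesis
 proof
  assume "\<forall>t\<in>{0<..\<epsilon>}. v z < v (\<alpha> t)"
  thus thesis by (intro that[of 1 \<epsilon>]) (use \<epsilon> in auto)
 next
  assume "\<forall>t\<in>{0<..\<epsilon>}. v (\<alpha> t) < v z"
  thus thesis by (intro that[of "-1" \<epsilon>]) (use \<epsilon> in auto)
 qed
qed

end

text \<open>In the reference box the coordinate of \<open>\<beta>\<close> takes every value between
  that of \<open>z\<close> and that of \<open>\<beta> \<epsilon>'\<close>. Early points of
  \<open>\<alpha>\<close> have such values, and on the plaque of \<open>z\<close> a point is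
  determined by its coordinate.\<close>

lemma arcs_same_direction:
 assumes arcs: "plaque_arc A z \<alpha>" "plaque_arc A z \<beta>" "A \<subseteq> B" and V: "(V, v, G) \<in> B" "z \<in> V"
  and \<alpha>: "\<epsilon> \<in> {0<..1}" "\<And>t. t \<in> {0<..\<epsilon>} ==> \<alpha> t \<in> V \<and> 0 < \<sigma> * (v (\<alpha> t) - v z)"
  and \<beta>: "\<epsilon>' \<in> {0<..1}" "\<And>t. t \<in> {0<..\<epsilon>'} ==> \<beta> t \<in> V \<and> 0 < \<sigma> * (v (\<beta> t) - v z)"
 obtains e where "e > 0" "\<And>t. t \<in> {0..1} ==> t < e ==> \<alpha> t \<in> \<beta> ` {0..1}"
proof -
 define c where "c = \<sigma> * (v (\<beta> \<epsilon>') - v z)"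
 have c: "c > 0" unfolding c_def using \<beta>(1) \<beta>(2)[of \<epsilon>'] by auto
 have \<beta>0: "\<beta> 0 = z" and \<alpha>0: "\<alpha> 0 = z" using arc_start[OF arcs(2,3)] arc_start[OF arcs(1,3)] .
 have sub: "\<beta> t \<in> V" if "t \<in> {0..\<epsilon>'}" for t
  using \<beta>(2)[of t] \<beta>0 V(2) that by (cases "t = 0") auto
 have "continuous_on {0..\<epsilon>'} (v \<circ> \<beta>)" by (rule arc_coordinate_continuous[OF arcs(2,3) V(1)]) (use \<beta>(1) sub in auto)
 hence cont: "continuous_on {0..\<epsilon>'} (\<lambda>t. \<sigma> * (v (\<beta> t) - v z))" by (auto intro!: continuous_intros simp: o_def)
 have "openin (top_of_set {0..1}) {t \<in> {0..1}. \<alpha> t \<in> V \<and> v (\<alpha> t) \<in> {y. \<sigma> * (y - v z) < c}}"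
  by (rule arc_coordinate_open[OF arcs(1,3) V(1)]) (intro open_Collect_less continuous_intros)
 moreover have "0 \<in> {t \<in> {0..1}. \<alpha> t \<in> V \<and> v (\<alpha> t) \<in> {y. \<sigma> * (y - v z) < c}}" using \<alpha>0 V(2) c by simp
 ultimately obtain e where e: "e > 0" "\<And>t. t \<in> {0..1} ==> t < e ==> \<alpha> t \<in> V \<and> \<sigma> * (v (\<alpha> t) - v z) < c"
  by (rule openin_unit_interval_start) (rule that, assumption, simp)
 show thesis
 proof (rule that[of "min e \<epsilon>"])
  show "min e \<epsilon> > 0" using e \<alpha>(1) by auto
  fix t :: real assume t: "t \<in> {0..1}" "t < min e \<epsilon>"
  hence \<alpha>t: "\<alpha> t \<in> V" "\<sigma> * (v (\<alpha> t) - v z) < c" using e(2)[of t] by auto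
  have "0 \<le> \<sigma> * (v (\<alpha> t) - v z)" using \<alpha>(2)[of t] t \<alpha>0 by (cases "t = 0") auto
  hence "\<exists>\<tau>\<ge>0. \<tau> \<le> \<epsilon>' \<and> \<sigma> * (v (\<beta> \<tau>) - v z) = \<sigma> * (v (\<alpha> t) - v z)"
   using \<alpha>t(2) \<beta>(1) \<beta>0 by (intro IVT'[OF _ _ _ cont]) (auto simp: c_def)
  then obtain \<tau> where \<tau>: "0 \<le> \<tau>" "\<tau> \<le> \<epsilon>'" "\<sigma> * (v (\<beta> \<tau>) - v z) = \<sigma> * (v (\<alpha> t) - v z)" by blast
  have "\<sigma> \<noteq> 0" using c by (auto simp: c_def)
  hence v: "v (\<beta> \<tau>) = v (\<alpha> t)" using \<tau>(3) by simp
  have "\<tau> \<in> {0..1}" using \<tau> \<beta>(1) by auto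
  have "\<alpha> t = G (v (\<alpha> t)) (\<alpha> 0)" using arc_plaque[OF arcs(1,3) V(1), of 0 t] t \<alpha>t \<alpha>0 V(2) by simp
  also have "\<dots> = \<beta> \<tau>" using arc_plaque[OF arcs(2,3) V(1), of 0 \<tau>] \<open>\<tau> \<in> {0..1}\<close> sub[of \<tau>] \<tau> \<beta>0 \<alpha>0 V(2) v by simp
  finally show "\<alpha> t \<in> \<beta> ` {0..1}" using \<open>\<tau> \<in> {0..1}\<close> by blast
 qed
qed

text \<open>The parameters at which \<open>\<alpha>\<close> lies on \<open>\<beta>\<close> form a
  closed set \<open>K\<close>, which is open as long as \<open>\<alpha>\<close> stays away from the
  end point \<open>\<beta> 1\<close>. So either \<open>\<alpha>\<close> never leaves
  \<open>\<beta>\<close>, or it reaches \<open>\<beta> 1\<close> and has by then covered all of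
  \<open>\<beta>\<close>.\<close>

lemma arcs_nested:
 assumes arcs: "plaque_arc A z \<alpha>" "plaque_arc A z \<beta>" "A \<subseteq> B"
  and e: "e > 0" "\<And>t. t \<in> {0..1} ==> t < e ==> \<alpha> t \<in> \<beta> ` {0..1}"
 shows "\<alpha> ` {0..1} \<subseteq> \<beta> ` {0..1} \<or> \<beta> ` {0..1} \<subseteq> \<alpha> ` {0..1}"
proof -
 obtain V v G r where b0: "(V, v, G) \<in> B" "z \<in> V" "r \<in> {0<..<1}" "r \<noteq> v z"
  "\<forall>t\<in>{0..1}. \<beta> t = G (v z + t * (r - v z)) z" "\<forall>t\<in>{0..1}. \<beta> t \<in> V"
  "\<forall>t\<in>{0..1}. v (\<beta> t) = v z + t * (r - v z)" "\<forall>t\<in>{0..1}. G (v (\<beta> t)) z = \<beta> t"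
  by (rule plaque_arcE[OF arcs(2,3)]) (rule that; assumption)
 note b = b0[rule_format]
 have \<beta>0: "\<beta> 0 = z" and \<alpha>0: "\<alpha> 0 = z" using arc_start[OF arcs(2,3)] arc_start[OF arcs(1,3)] .
 define K where "K = {t \<in> {0..1}. \<alpha> t \<in> \<beta> ` {0..1}}"
 have Kc: "closedin (top_of_set {0..1}) K"
  using closedin_continuous_map_preimage[OF arc_continuous[OF arcs(1,3)] arc_image_closed[OF arcs(2,3)]] by (simp add: K_def)
 \<comment> \<open>The coordinates strictly between those of the two ends of \<open>\<beta>\<close>,
   whichever of them is larger.\<close>
 define T where "T = {y. 0 < (y - v z) / (r - v z) \<and> (y - v z) / (r - v z) < 1}"
 have "open T" unfolding T_def using b(4) by (intro open_Collect_conj open_Collect_less continuous_intros) auto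
 define N where "N = {t \<in> {0..1}. \<alpha> t \<in> V \<and> v (\<alpha> t) \<in> T}"
 have No: "openin (top_of_set {0..1}) N" unfolding N_def by (rule arc_coordinate_open[OF arcs(1,3) b(1) \<open>open T\<close>])
 have NK: "N \<subseteq> K"
 proof
  fix t assume t: "t \<in> N"
  define \<tau> where "\<tau> = (v (\<alpha> t) - v z) / (r - v z)"
  have t': "t \<in> {0..1}" "\<alpha> t \<in> V" "\<tau> \<in> {0..1}" using t by (auto simp: N_def T_def \<tau>_def)
  have "\<alpha> t = G (v (\<alpha> t)) (\<alpha> 0)" using arc_plaque[OF arcs(1,3) b(1), of 0 t] t' \<alpha>0 b(2) by simp
  also have "v (\<alpha> t) = v z + \<tau> * (r - v z)" using b(4) by (simp add: \<tau>_def)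
  finally have "\<alpha> t = \<beta> \<tau>" using b(5)[OF t'(3)] \<alpha>0 by simp
  thus "t \<in> K" using t' by (auto simp: K_def)
 qed
 have KN: "t \<in> N \<union> {t. t < e}" if tK: "t \<in> K" "\<alpha> t \<noteq> \<beta> 1" for t
 proof (cases "t < e")
  case False
  obtain \<tau> where \<tau>: "\<tau> \<in> {0..1}" "\<alpha> t = \<beta> \<tau>" and t: "t \<in> {0..1}" using tK(1) unfolding K_def by blast
  have "\<tau> \<noteq> 1" using \<tau> tK(2) by auto
  have "\<tau> \<noteq> 0"
  proof
   assume "\<tau> = 0"
   hence "\<alpha> t = \<alpha> 0" using \<tau> \<beta>0 \<alpha>0 by simp
   thus False using inj_onD[OF arc_inj[OF arcs(1,3)], of t 0] t False e(1) by auto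
  qed
  hence "0 < \<tau>" "\<tau> < 1" using \<tau>(1) \<open>\<tau> \<noteq> 1\<close> by auto
  hence "t \<in> N" using t \<tau> b(4) b(6)[OF \<tau>(1)] b(7)[OF \<tau>(1)] by (simp add: N_def T_def)
  thus ?thesis by simp
 qed simp
 have clopen: "J \<subseteq> K" if J: "connected J" "J \<subseteq> {0..1}" "0 \<in> J" and nb: "\<And>t. t \<in> J ==> \<alpha> t \<noteq> \<beta> 1" for J
 proof -
  have "K \<inter> J = (N \<union> {0..1} \<inter> {..<e}) \<inter> J"
  proof (intro equalityI subsetI)
   fix t assume "t \<in> K \<inter> J"
   thus "t \<in> (N \<union> {0..1} \<inter> {..<e}) \<inter> J" using KN[of t] nb[of t] J(2) by auto
  next
   fix t assume "t \<in> (N \<union> {0..1} \<inter> {..<e}) \<inter> J"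
   thus "t \<in> K \<inter> J" using NK e(2)[of t] by (auto simp: K_def)
  qed
  moreover have "openin (top_of_set {0..1}) (N \<union> {0..1} \<inter> {..<e})" using No by (intro openin_Un) (auto simp: openin_open_Int)
  ultimately have "openin (top_of_set J) (K \<inter> J)"
   using J(2) by (metis openin_subtopology_Int inf.absorb2 subtopology_subtopology)
  moreover have "closedin (top_of_set J) (K \<inter> J)"
   using Kc J(2) by (metis closedin_subtopology_Int_closed inf.absorb2 inf_commute subtopology_subtopology)
  moreover have "K \<inter> J \<noteq> {}" using e J(3) by (auto simp: K_def)
  ultimately have "K \<inter> J = J" using J(1) unfolding connected_clopen by blast
  thus ?thesis by blast
 qed
 show ?thesis
 proof (cases "\<beta> 1 \<in> \<alpha> ` {0..1}")
  case False
  have "{0..1} \<subseteq> K"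
  proof (rule clopen)
   show "\<alpha> t \<noteq> \<beta> 1" if "t \<in> {0..1}" for t using False imageI[OF that, of \<alpha>] by auto
  qed auto
  thus ?thesis by (auto simp: K_def)
 next
  case True
  then obtain t1 where t1: "t1 \<in> {0..1}" "\<alpha> t1 = \<beta> 1" by auto
  have "\<beta> 1 \<noteq> z" using b(4) b(7)[of 1] by auto
  hence "t1 \<noteq> 0" using t1 \<alpha>0 by auto
  hence t1': "0 < t1" "t1 \<le> 1" using t1 by auto
  have "{0..<t1} \<subseteq> K"
  proof (rule clopen)
   fix t assume "t \<in> {0..<t1}"
   thus "\<alpha> t \<noteq> \<beta> 1" using inj_onD[OF arc_inj[OF arcs(1,3)], of t t1] t1 t1' by auto
  qed (use t1' in auto)
  moreover have "t1 \<in> K" using t1 by (auto simp: K_def)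
  ultimately have sub: "{0..t1} \<subseteq> K" using t1' by (auto simp: less_le)
  hence inV: "\<alpha> ` {0..t1} \<subseteq> V" using b(6) by (auto simp: K_def)
  have "continuous_on {0..t1} (v \<circ> \<alpha>)" by (rule arc_coordinate_continuous[OF arcs(1,3) b(1)]) (use t1' inV in auto)
  hence con: "connected ((v \<circ> \<alpha>) ` {0..t1})" by (rule connected_continuous_image) simp
  have "v (\<beta> 1) = r" using b(7)[of 1] by simp
  hence mem: "v z \<in> (v \<circ> \<alpha>) ` {0..t1}" "r \<in> (v \<circ> \<alpha>) ` {0..t1}"
   using \<alpha>0 t1' t1(2) imageI[of 0 "{0..t1}" "v \<circ> \<alpha>"] imageI[of t1 "{0..t1}" "v \<circ> \<alpha>"] by auto
  \<comment> \<open>Up to \<open>t1\<close> the coordinate along \<open>\<alpha>\<close> goes from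
    \<open>v z\<close> to \<open>r\<close>, so it takes every value that it has on
    \<open>\<beta>\<close>.\<close>
  have "\<beta> \<tau> \<in> \<alpha> ` {0..1}" if \<tau>: "\<tau> \<in> {0..1}" for \<tau>
  proof -
   have "v (\<beta> \<tau>) \<in> (v \<circ> \<alpha>) ` {0..t1}"
   proof (cases "v z \<le> r")
   case True
   hence "v z \<le> v (\<beta> \<tau>)" "v (\<beta> \<tau>) \<le> r" using b(7)[OF \<tau>] \<tau> mult_left_le_one_le[of "r - v z" \<tau>] by auto
   thus ?thesis using connectedD_interval[OF con mem] by blast
   next
   case False
   hence "r \<le> v (\<beta> \<tau>)" "v (\<beta> \<tau>) \<le> v z" using b(7)[OF \<tau>] \<tau> mult_left_le_one_le[of "v z - r" \<tau>] mult_nonneg_nonneg[of \<tau> "v z - r"]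
   by (auto simp: algebra_simps)
   thus ?thesis using connectedD_interval[OF con mem(2,1)] by blast
   qed
   then obtain t where t: "t \<in> {0..t1}" "v (\<beta> \<tau>) = v (\<alpha> t)" by auto
   have t01: "t \<in> {0..1}" using t t1' by auto
   have "\<alpha> t \<in> V" using inV t(1) by blast
   hence "G (v (\<alpha> t)) (\<alpha> 0) = \<alpha> t" using arc_plaque[OF arcs(1,3) b(1), of 0 t] t01 \<alpha>0 b(2) by simp
   hence "\<alpha> t = \<beta> \<tau>" using b(8)[OF \<tau>] t(2) \<alpha>0 by simp
   thus ?thesis using t01 by (metis imageI)
  qed
  thus ?thesis by blast
 qed
qed

text \<open>In the parameter of \<open>\<alpha>\<close> the arc \<open>\<beta>\<close> is a
  connected set containing 0, so with \<open>t\<close> it contains everything before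
  \<open>t\<close>.\<close>

lemma arc_initial_segment:
 assumes arcs: "plaque_arc A z \<alpha>" "plaque_arc A z \<beta>" "A \<subseteq> B" and sub: "\<beta> ` {0..1} \<subseteq> \<alpha> ` {0..1}"
  and t: "0 \<le> t'" "t' \<le> t" "t \<le> 1" "\<alpha> t \<in> \<beta> ` {0..1}"
 shows "\<alpha> t' \<in> \<beta> ` {0..1}"
proof -
 obtain U u F s where a0: "(U, u, F) \<in> B" "z \<in> U" "s \<in> {0<..<1}" "s \<noteq> u z" "\<forall>t\<in>{0..1}. \<alpha> t \<in> U"
  "\<forall>t\<in>{0..1}. u (\<alpha> t) = u z + t * (s - u z)"
  by (rule plaque_arcE[OF arcs(1,3)]) (rule that; assumption)
 note a = a0[rule_format]
 have "\<alpha> ` {0..1} \<subseteq> U" using a(5) by (rule image_subsetI)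
 hence inU: "\<beta> ` {0..1} \<subseteq> U" using sub by (rule order_trans[rotated])
 have "continuous_on {0..1} (u \<circ> \<beta>)" by (rule arc_coordinate_continuous[OF arcs(2,3) a(1)]) (use inU in auto)
 hence "continuous_on {0..1} (\<lambda>\<tau>. (u (\<beta> \<tau>) - u z) / (s - u z))" using a(4) by (auto intro!: continuous_intros simp: o_def)
 hence con: "connected ((\<lambda>\<tau>. (u (\<beta> \<tau>) - u z) / (s - u z)) ` {0..1})" by (rule connected_continuous_image) simp
 obtain \<tau>1 where \<tau>1: "\<tau>1 \<in> {0..1}" "\<alpha> t = \<beta> \<tau>1" using t(4) by auto
 have 0: "0 \<in> (\<lambda>\<tau>. (u (\<beta> \<tau>) - u z) / (s - u z)) ` {0..1}" using arc_start[OF arcs(2,3)] by (auto intro!: image_eqI[of _ _ 0])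
 have 1: "t \<in> (\<lambda>\<tau>. (u (\<beta> \<tau>) - u z) / (s - u z)) ` {0..1}"
  using \<tau>1 a(4) a(6)[of t] t by (auto intro!: image_eqI[of _ _ \<tau>1])
 have "t' \<in> (\<lambda>\<tau>. (u (\<beta> \<tau>) - u z) / (s - u z)) ` {0..1}" by (rule connectedD_interval[OF con 0 1 t(1,2)])
 then obtain \<tau> where \<tau>: "\<tau> \<in> {0..1}" "t' = (u (\<beta> \<tau>) - u z) / (s - u z)" by auto
 obtain t'' where t'': "t'' \<in> {0..1}" "\<beta> \<tau> = \<alpha> t''" using sub \<tau>(1) by blast
 have "t' = t''" using \<tau>(2) a(4) a(6)[OF t''(1)] t''(2) by simp
 thus ?thesis using t''(2) \<tau>(1) by (metis imageI)
qed

end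

section \<open>Intervals, connectedness and compact sets on a long line\<close>

context long_line
begin

lemma unbounded:
 assumes "a \<in> topspace L"
 obtains b where "b \<in> topspace L" "a \<lless> b"
proof -
 have "\<exists>b\<in>topspace L. \<forall>c\<in>{a}. c \<lless> b" by (rule countable_bounded) (use assms in auto)
 thus thesis using that by blast
qed

lemma segmentE:
 assumes "b \<in> topspace L"
 obtains E f g W where "openin L E" "E \<subseteq> topspace L" "b \<in> E" "\<forall>y\<in>E. \<forall>x\<in>topspace L. x \<lless> y --> x \<in> E"
  "homeomorphic_maps (subtopology L E) (top_of_set {0<..<W::real}) f g" "\<forall>x\<in>E. \<forall>y\<in>E. x \<lless> y \<longleftrightarrow> f x < f y"
  "\<forall>x\<in>E. f x \<in> {0<..<W} \<and> g (f x) = x" "\<forall>r\<in>{0<..<W}. g r \<in> E \<and> f (g r) = r"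
proof -
 obtain E f g and W :: real where E: "openin L E" "b \<in> E" "\<forall>y\<in>E. \<forall>x\<in>topspace L. x \<lless> y --> x \<in> E"
  "homeomorphic_maps (subtopology L E) (top_of_set {0<..<W}) f g"
  "\<forall>x\<in>E. \<forall>y\<in>E. x \<lless> y \<longleftrightarrow> f x < f y" using segment_chart[OF assms] by blast
 have EL: "E \<subseteq> topspace L" using E(1) openin_subset by blast
 have tE: "topspace (subtopology L E) = E" using EL by auto
 have fE: "\<forall>x\<in>E. f x \<in> {0<..<W} \<and> g (f x) = x"
  using E(4) tE unfolding homeomorphic_maps_def continuous_map_def by auto
 have gE: "\<forall>r\<in>{0<..<W}. g r \<in> E \<and> f (g r) = r"
  using E(4) tE unfolding homeomorphic_maps_def continuous_map_def by auto
 show thesis by (rule that[OF E(1) EL E(2,3,4,5) fE gE])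
qed

lemma interval_base:
 assumes "openin L W" "t \<in> W"
 obtains a b where "a \<in> topspace L" "b \<in> topspace L" "a \<lless> t" "t \<lless> b" "\<And>c. c \<in> topspace L ==> a \<lless> c ==> c \<lless> b ==> c \<in> W"
proof -
 have tL: "t \<in> topspace L" using assms openin_subset by blast
 obtain E f g R where E: "openin L E" "E \<subseteq> topspace L" "t \<in> E" "\<forall>y\<in>E. \<forall>x\<in>topspace L. x \<lless> y --> x \<in> E"
  "homeomorphic_maps (subtopology L E) (top_of_set {0<..<R::real}) f g" "\<forall>x\<in>E. \<forall>y\<in>E. x \<lless> y \<longleftrightarrow> f x < f y"
  "\<forall>x\<in>E. f x \<in> {0<..<R} \<and> g (f x) = x" "\<forall>r\<in>{0<..<R}. g r \<in> E \<and> f (g r) = r"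
  by (rule segmentE[OF tL])
 have "continuous_map (top_of_set {0<..<R}) L g" using E(5) by (auto simp: homeomorphic_maps_def continuous_map_in_subtopology)
 from openin_continuous_map_preimage[OF this assms(1)] have op: "openin (top_of_set {0<..<R}) {r \<in> {0<..<R}. g r \<in> W}" by simp
 have ft: "f t \<in> {0<..<R}" "g (f t) = t" using E(3,7) by blast+
 have "open {r \<in> {0<..<R}. g r \<in> W}" using op openin_open_trans open_greaterThanLessThan by blast
 moreover have "f t \<in> {r \<in> {0<..<R}. g r \<in> W}" using ft assms(2) by simp
 ultimately obtain e where e: "e > 0" "cball (f t) e \<subseteq> {r \<in> {0<..<R}. g r \<in> W}" using open_contains_cball by blast
 have m: "r \<in> {0<..<R} \<and> g r \<in> W" if "f t - e \<le> r" "r \<le> f t + e" for r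
  using subsetD[OF e(2), of r] that by (auto simp: cball_def dist_real_def)
 have g: "f t - e \<in> {0<..<R}" "f t + e \<in> {0<..<R}" using m[of "f t - e"] m[of "f t + e"] e(1) by auto
 have gg: "g (f t - e) \<in> E" "g (f t + e) \<in> E" "f (g (f t - e)) = f t - e" "f (g (f t + e)) = f t + e" using E(8) g by blast+
 show thesis
 proof (rule that[of "g (f t - e)" "g (f t + e)"])
  show "g (f t - e) \<lless> t" "t \<lless> g (f t + e)" using E(3,6) gg e(1) by simp_all
  fix c assume c: "c \<in> topspace L" "g (f t - e) \<lless> c" "c \<lless> g (f t + e)"
  hence cE: "c \<in> E" using E(4) gg(2) by blast
  have "f t - e < f c" "f c < f t + e" using c(2,3) E(6) cE gg by metis+
  thus "c \<in> W" using m[of "f c"] E(7) cE by auto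
 qed (use gg E(2) in auto)
qed

lemma order_dense:
 assumes "a \<in> topspace L" "b \<in> topspace L" "a \<lless> b"
 obtains c where "c \<in> topspace L" "a \<lless> c" "c \<lless> b"
proof -
 obtain E f g R where E: "openin L E" "E \<subseteq> topspace L" "b \<in> E" "\<forall>y\<in>E. \<forall>x\<in>topspace L. x \<lless> y --> x \<in> E"
  "homeomorphic_maps (subtopology L E) (top_of_set {0<..<R::real}) f g" "\<forall>x\<in>E. \<forall>y\<in>E. x \<lless> y \<longleftrightarrow> f x < f y"
  "\<forall>x\<in>E. f x \<in> {0<..<R} \<and> g (f x) = x" "\<forall>r\<in>{0<..<R}. g r \<in> E \<and> f (g r) = r"
  by (rule segmentE[OF assms(2)])
 have aE: "a \<in> E" using E(3,4) assms by blast
 have "f a < f b" using E(6) aE E(3) assms(3) by blast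
 hence r: "(f a + f b) / 2 \<in> {0<..<R}" "f a < (f a + f b) / 2" "(f a + f b) / 2 < f b" using E(7) aE E(3) by auto
 define c where "c = g ((f a + f b) / 2)"
 have c: "c \<in> E" "f c = (f a + f b) / 2" unfolding c_def using E(8) r(1) by blast+
 show thesis
 proof (rule that[of c])
  show "a \<lless> c" "c \<lless> b" using E(6) aE E(3) c r by simp_all
 qed (use c E(2) in blast)
qed

lemma Hausdorff_space_long_line: "Hausdorff_space L"
proof -
 have less: "\<exists>U V. openin L U \<and> openin L V \<and> x \<in> U \<and> y \<in> V \<and> disjnt U V"
  if xy: "x \<in> topspace L" "y \<in> topspace L" "x \<lless> y" for x y
 proof -
  obtain c where c: "c \<in> topspace L" "x \<lless> c" "c \<lless> y" by (rule order_dense[OF xy])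
  have "disjnt {x \<in> topspace L. x \<lless> c} {x \<in> topspace L. c \<lless> x}" unfolding disjnt_iff using lt_trans lt_irrefl by blast
  thus ?thesis using open_above[OF c(1)] open_below[OF c(1)] xy c(2,3)
   by (intro exI[of _ "{x \<in> topspace L. x \<lless> c}"] exI[of _ "{x \<in> topspace L. c \<lless> x}"]) auto
 qed
 show ?thesis unfolding Hausdorff_space_def
 proof (intro allI impI)
  fix x y assume "x \<in> topspace L \<and> y \<in> topspace L \<and> x \<noteq> y"
  hence xy: "x \<in> topspace L" "y \<in> topspace L" "x \<lless> y \<or> y \<lless> x" using lt_total by auto
  from xy(3) show "\<exists>U V. openin L U \<and> openin L V \<and> x \<in> U \<and> y \<in> V \<and> disjnt U V"
  proof
   assume "y \<lless> x"
   then obtain U V where "openin L U" "openin L V" "y \<in> U" "x \<in> V" "disjnt U V" using less xy by blast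
   thus ?thesis by (intro exI[of _ V] exI[of _ U]) (simp add: disjnt_sym)
  qed (use less xy in blast)
 qed
qed

text \<open>An order segment as an injective real curve, read off from the chart of an initial
  segment; it serves both for paths in leaves and for the intermediate value theorem.\<close>

lemma interval_path:
 assumes "a \<in> topspace L" "b \<in> topspace L" "a \<lless> b"
 obtains g p q where "p \<le> q" "continuous_map (top_of_set {p..q::real}) L g" "g p = a" "g q = b"
  "\<And>r. r \<in> {p..q} ==> g r = a \<or> a \<lless> g r" "\<And>c. c \<in> topspace L ==> a \<lless> c ==> c \<lless> b ==> \<exists>r\<in>{p<..<q}. g r = c"
  "\<And>r. r \<in> {p<..<q} ==> a \<lless> g r \<and> g r \<lless> b" "inj_on g {p..q}"
proof -
 obtain E f g R where E: "openin L E" "E \<subseteq> topspace L" "b \<in> E" "\<forall>y\<in>E. \<forall>x\<in>topspace L. x \<lless> y --> x \<in> E"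
  "homeomorphic_maps (subtopology L E) (top_of_set {0<..<R::real}) f g" "\<forall>x\<in>E. \<forall>y\<in>E. x \<lless> y \<longleftrightarrow> f x < f y"
  "\<forall>x\<in>E. f x \<in> {0<..<R} \<and> g (f x) = x" "\<forall>r\<in>{0<..<R}. g r \<in> E \<and> f (g r) = r"
  by (rule segmentE[OF assms(2)])
 have aE: "a \<in> E" using E(3,4) assms by blast
 have fab: "f a < f b" using E(6) aE E(3) assms(3) by blast
 have fR: "f a \<in> {0<..<R}" "f b \<in> {0<..<R}" "g (f a) = a" "g (f b) = b" using E(7) aE E(3) by blast+
 have sub: "r \<in> {0<..<R}" if "r \<in> {f a..f b}" for r using that fR by auto
 have gr: "g r \<in> E" "f (g r) = r" if "r \<in> {f a..f b}" for r using E(8) sub[OF that] by blast+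
 have "continuous_map (top_of_set {0<..<R}) L g" using E(5) by (auto simp: homeomorphic_maps_def continuous_map_in_subtopology)
 moreover have "{0<..<R} \<inter> {f a..f b} = {f a..f b}" using sub by blast
 ultimately have cont: "continuous_map (top_of_set {f a..f b}) L g"
  using continuous_map_from_subtopology[of "top_of_set {0<..<R}" L g "{f a..f b}"] by (simp add: subtopology_subtopology)
 show thesis
 proof (rule that[of "f a" "f b" g])
  show "inj_on g {f a..f b}" by (rule inj_on_inverseI[of _ f]) (use gr in blast)
  show "g r = a \<or> a \<lless> g r" if r: "r \<in> {f a..f b}" for r
  proof (cases "r = f a")
   case False
   hence "f a < f (g r)" using r gr(2)[OF r] by auto
   thus ?thesis using E(6) aE gr(1)[OF r] by blast
  qed (use fR in auto)
  show "\<exists>r\<in>{f a<..<f b}. g r = c" if c: "c \<in> topspace L" "a \<lless> c" "c \<lless> b" for c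
  proof -
   have cE: "c \<in> E" using E(3,4) c by blast
   hence "f a < f c" "f c < f b" using E(3,6) aE c by blast+
   thus ?thesis using E(7) cE by (intro bexI[of _ "f c"]) auto
  qed
  show "a \<lless> g r \<and> g r \<lless> b" if r: "r \<in> {f a<..<f b}" for r
  proof -
   have r': "r \<in> {f a..f b}" using r by auto
   hence "f a < f (g r)" "f (g r) < f b" using gr(2)[OF r'] r by auto
   thus ?thesis using E(3,6) aE gr(1)[OF r'] by blast
  qed
 qed (use fab fR cont in auto)
qed

lemma connectedin_interval:
 assumes "a \<in> topspace L" "b \<in> topspace L"
 shows "connectedin L {c \<in> topspace L. a \<lless> c \<and> c \<lless> b}"
proof (cases "a \<lless> b")
 case True
 obtain g p q where g: "p \<le> q" "continuous_map (top_of_set {p..q::real}) L g" "g p = a" "g q = b"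
  "\<And>r. r \<in> {p..q} ==> g r = a \<or> a \<lless> g r" "\<And>c. c \<in> topspace L ==> a \<lless> c ==> c \<lless> b ==> \<exists>r\<in>{p<..<q}. g r = c"
  "\<And>r. r \<in> {p<..<q} ==> a \<lless> g r \<and> g r \<lless> b" "inj_on g {p..q}"
  by (rule interval_path[OF assms True]) (rule that)
 have "connectedin (top_of_set {p..q}) {p<..<q}" by (auto simp: connectedin_subtopology)
 from connectedin_continuous_map_image[OF g(2) this] have "connectedin L (g ` {p<..<q})" .
 moreover have "g ` {p<..<q} = {c \<in> topspace L. a \<lless> c \<and> c \<lless> b}"
 proof (intro equalityI subsetI)
  fix x assume "x \<in> g ` {p<..<q}"
  then obtain r where r: "r \<in> {p<..<q}" "x = g r" by blast
  hence "r \<in> topspace (top_of_set {p..q})" by auto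
  hence "x \<in> topspace L" using g(2) r(2) unfolding continuous_map_def by auto
  thus "x \<in> {c \<in> topspace L. a \<lless> c \<and> c \<lless> b}" using g(7)[OF r(1)] r(2) by simp
 next
  fix x assume "x \<in> {c \<in> topspace L. a \<lless> c \<and> c \<lless> b}"
  thus "x \<in> g ` {p<..<q}" using g(6)[of x] by auto
 qed
 ultimately show ?thesis by simp
next
 case False
 hence "{c \<in> topspace L. a \<lless> c \<and> c \<lless> b} = {}" using lt_trans by blast
 thus ?thesis by (simp only: connectedin_empty)
qed

lemma compactin_bounded:
 assumes "compactin L K"
 obtains b where "b \<in> topspace L" "\<And>c. c \<in> K ==> c \<lless> b"
proof -
 let ?C = "(\<lambda>b. {x \<in> topspace L. x \<lless> b}) ` topspace L"
 have KL: "K \<subseteq> topspace L" using assms compactin_subset_topspace by blast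
 have "K \<subseteq> \<Union>?C"
 proof
  fix c assume "c \<in> K"
  hence c: "c \<in> topspace L" using KL by blast
  obtain b where "b \<in> topspace L" "c \<lless> b" by (rule unbounded[OF c])
  thus "c \<in> \<Union>?C" using c by blast
 qed
 then obtain D where D: "finite D" "D \<subseteq> ?C" "K \<subseteq> \<Union>D"
  using compactinD[OF assms, of ?C] open_below by blast
 from finite_subset_image[OF D(1,2)] obtain F where F: "F \<subseteq> topspace L" "finite F" "D = (\<lambda>b. {x \<in> topspace L. x \<lless> b}) ` F" by blast
 have "\<exists>b\<in>topspace L. \<forall>c\<in>F. c \<lless> b" by (rule countable_bounded) (use F in \<open>auto intro: countable_finite\<close>)
 then obtain b where b: "b \<in> topspace L" "\<forall>c\<in>F. c \<lless> b" by blast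
 show thesis
 proof (rule that[OF b(1)])
  fix c assume "c \<in> K"
  then obtain d where "d \<in> F" "c \<lless> d" using D(3) F(3) by blast
  thus "c \<lless> b" using b(2) lt_trans by blast
 qed
qed

lemma openin_interval: "a \<in> topspace L ==> b \<in> topspace L ==> openin L {c \<in> topspace L. a \<lless> c \<and> c \<lless> b}"
 using openin_Int[OF open_above[of a] open_below[of b]] by (simp add: Collect_conj_eq Int_ac)

text \<open>Both the part of the interval where \<open>P\<close> holds and its complement are open,
  and the interval is connected.\<close>

lemma interval_propagate:
 assumes ab: "a \<in> topspace L" "b \<in> topspace L" and t: "t \<in> topspace L" "a \<lless> t" "t \<lless> b" "P t"
  and local: "\<And>c. c \<in> topspace L ==> a \<lless> c ==> c \<lless> b ==> \<exists>T. openin L T \<and> c \<in> T \<and>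
   (\<forall>c'\<in>T. a \<lless> c' \<and> c' \<lless> b --> P c' = P c)"
  and c: "c \<in> topspace L" "a \<lless> c" "c \<lless> b"
 shows "P c"
proof (rule ccontr)
 assume nP: "\<not> P c"
 let ?J = "{c \<in> topspace L. a \<lless> c \<and> c \<lless> b}"
 have op: "openin L {c \<in> ?J. P c = k}" for k
 proof (subst openin_subopen, intro ballI)
  fix d assume d: "d \<in> {c \<in> ?J. P c = k}"
  then obtain T where T: "openin L T" "d \<in> T" "\<forall>c'\<in>T. a \<lless> c' \<and> c' \<lless> b --> P c' = P d" using local[of d] by blast
  have "T \<inter> ?J \<subseteq> {c \<in> ?J. P c = k}" using T(3) d by blast
  thus "\<exists>T. openin L T \<and> d \<in> T \<and> T \<subseteq> {c \<in> ?J. P c = k}"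
   using T(1,2) d openin_interval[OF ab] by (intro exI[of _ "T \<inter> ?J"]) auto
 qed
 have con: "connectedin L ?J" by (rule connectedin_interval[OF ab])
 have "?J \<subseteq> {c \<in> ?J. P c = True} \<union> {c \<in> ?J. P c = False}" by blast
 moreover have "{c \<in> ?J. P c = True} \<inter> {c \<in> ?J. P c = False} \<inter> ?J = {}" by blast
 moreover have "{c \<in> ?J. P c = True} \<inter> ?J \<noteq> {}" "{c \<in> ?J. P c = False} \<inter> ?J \<noteq> {}" using t c nP by blast+
 ultimately have "\<exists>E1 E2. openin L E1 \<and> openin L E2 \<and> ?J \<subseteq> E1 \<union> E2 \<and> E1 \<inter> E2 \<inter> ?J = {} \<and> E1 \<inter> ?J \<noteq> {} \<and> E2 \<inter> ?J \<noteq> {}"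
  using op[of True] op[of False] by (intro exI[of _ "{c \<in> ?J. P c = True}"] exI[of _ "{c \<in> ?J. P c = False}"] conjI)
 thus False using con unfolding connectedin by (elim conjE) (rule notE)
qed

text \<open>If every height \<open>\<gamma>\<close> failed at some greater height, iterating countably often would lead to a
 limit height at which all terms of a sequence increasing to it fail.\<close>

lemma closing_off:
 assumes \<delta>: "\<delta> \<in> topspace L" and \<B>: "countable \<B>"
  and anti: "\<And>\<gamma> Q \<mu> \<mu>'. R \<gamma> Q \<mu> ==> \<mu>' \<in> topspace L ==> \<mu>' \<lless> \<mu> ==> R \<gamma> Q \<mu>'"
  and step: "\<And>\<gamma> \<mu>. (\<And>n::nat. \<gamma> n \<in> topspace L \<and> \<delta> \<lless> \<gamma> n \<and> \<gamma> n \<lless> \<mu>) ==> \<mu> \<in> topspace L ==>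
   (\<And>a. a \<in> topspace L ==> a \<lless> \<mu> ==> \<exists>n. \<forall>m\<ge>n. a \<lless> \<gamma> m) ==> \<exists>n. \<exists>Q\<in>\<B>. R (\<gamma> n) Q \<mu>"
 obtains \<gamma> Q where "\<gamma> \<in> topspace L" "\<delta> \<lless> \<gamma>" "Q \<in> \<B>" "\<And>\<mu>. \<mu> \<in> topspace L ==> R \<gamma> Q \<mu>"
proof (rule ccontr)
 assume "\<not> thesis"
 hence "\<forall>\<gamma> Q. \<exists>\<mu>. \<gamma> \<in> topspace L \<and> \<delta> \<lless> \<gamma> \<and> Q \<in> \<B> --> \<mu> \<in> topspace L \<and> \<not> R \<gamma> Q \<mu>" using that by blast
 then obtain h where h: "\<And>\<gamma> Q. \<gamma> \<in> topspace L ==> \<delta> \<lless> \<gamma> ==> Q \<in> \<B> ==> h \<gamma> Q \<in> topspace L \<and> \<not> R \<gamma> Q (h \<gamma> Q)" by metis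
 have "\<exists>b. \<gamma> \<in> topspace L \<and> \<delta> \<lless> \<gamma> --> b \<in> topspace L \<and> \<gamma> \<lless> b \<and> (\<forall>Q\<in>\<B>. h \<gamma> Q \<lless> b)" for \<gamma>
 proof (cases "\<gamma> \<in> topspace L \<and> \<delta> \<lless> \<gamma>")
  case True
  have "\<exists>b\<in>topspace L. \<forall>c\<in>insert \<gamma> (h \<gamma> ` \<B>). c \<lless> b"
   by (rule countable_bounded) (use \<B> True h in auto)
  thus ?thesis by blast
 qed blast
 then obtain nx where nx: "\<And>\<gamma>. \<gamma> \<in> topspace L ==> \<delta> \<lless> \<gamma> ==> nx \<gamma> \<in> topspace L \<and> \<gamma> \<lless> nx \<gamma> \<and> (\<forall>Q\<in>\<B>. h \<gamma> Q \<lless> nx \<gamma>)" by metis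
 obtain \<gamma>0 where \<gamma>0: "\<gamma>0 \<in> topspace L" "\<delta> \<lless> \<gamma>0" by (rule unbounded[OF \<delta>])
 define \<gamma> where "\<gamma> n = (nx ^^ n) \<gamma>0" for n
 have \<gamma>S: "\<gamma> (Suc n) = nx (\<gamma> n)" for n by (simp add: \<gamma>_def)
 have \<gamma>: "\<gamma> n \<in> topspace L \<and> \<delta> \<lless> \<gamma> n" for n
 proof (induction n)
  case 0 thus ?case using \<gamma>0 by (simp add: \<gamma>_def)
 next
  case (Suc n) thus ?case unfolding \<gamma>S using nx[of "\<gamma> n"] lt_trans[of \<delta> "\<gamma> n" "nx (\<gamma> n)"] by blast
 qed
 have inc: "\<gamma> n \<lless> \<gamma> (Suc n)" for n unfolding \<gamma>S using nx \<gamma> by blast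
 obtain l where l: "l \<in> topspace L" "\<And>n. \<gamma> n \<lless> l" "\<And>a. a \<in> topspace L ==> a \<lless> l ==> \<exists>n. \<forall>m\<ge>n. a \<lless> \<gamma> m"
  by (rule sequence_lub[of \<gamma>]) (use \<gamma> inc in auto)
 \<comment> \<open>At the limit \<open>l\<close> some pair succeeds, although its chosen height of
   failure was placed below the next term of the sequence; \<open>anti\<close> brings the success
   down to that height.\<close>
 have "\<exists>n. \<exists>Q\<in>\<B>. R (\<gamma> n) Q l" by (rule step) (use \<gamma> l in auto)
 then obtain n Q where Q: "Q \<in> \<B>" "R (\<gamma> n) Q l" by blast
 have hq: "h (\<gamma> n) Q \<in> topspace L" "\<not> R (\<gamma> n) Q (h (\<gamma> n) Q)" using h \<gamma> Q(1) by blast+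
 have "h (\<gamma> n) Q \<lless> \<gamma> (Suc n)" unfolding \<gamma>S using nx \<gamma> Q(1) by blast
 hence "h (\<gamma> n) Q \<lless> l" using l(2) lt_trans by blast
 thus False using anti[OF Q(2) hq(1)] hq(2) by blast
qed

end

section \<open>Foliations on products with the long ray\<close>

text \<open>The Euler characteristic enters this part only through \<open>crossing\<close>.\<close>

locale long_flow = long_line L lt
 for L :: "'p topology" and lt :: "'p => 'p => bool" (infix \<open>\<lless>\<close> 50) +
 fixes S :: "'b::{metric_space,second_countable_topology} set" and B :: "('b \<times> 'p) box set"
 assumes compact: "compact S" and connected: "connected S" and nonempty: "S \<noteq> {}"
  and flow_structure: "flow_structure (prod_topology (top_of_set S) L) B"
  and crossing: "\<And>\<mu>. \<mu> \<in> topspace L ==>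
   \<exists>U u F q s. (U, u, F) \<in> B \<and> q \<in> U \<and> s \<in> {0<..<1} \<and> snd q = \<mu> \<and> snd (F s q) \<noteq> \<mu>"
begin

abbreviation X where "X \<equiv> prod_topology (top_of_set S) L"

sublocale flow_space X B
proof
 show "flow_structure X B" by (fact flow_structure)
 show "Hausdorff_space X"
  using Hausdorff_space_long_line by (simp add: Hausdorff_space_prod_topology Hausdorff_space_subtopology)
qed

lemma box_subset: "(U, u, F) \<in> B ==> q \<in> U ==> fst q \<in> S \<and> snd q \<in> topspace L"
 using openin_subset[OF flow_boxD(1)[OF box]] by fastforce

lemma box_nbhd:
 assumes "openin X W" "(x, t) \<in> W"
 obtains T a b where "open T" "x \<in> T" "a \<in> topspace L" "b \<in> topspace L" "a \<lless> t" "t \<lless> b"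
  "\<And>y c. y \<in> T ==> y \<in> S ==> c \<in> topspace L ==> a \<lless> c ==> c \<lless> b ==> (y, c) \<in> W"
proof -
 obtain U V where UV: "openin (top_of_set S) U" "openin L V" "x \<in> U" "t \<in> V" "U \<times> V \<subseteq> W"
  using assms unfolding openin_prod_topology_alt by meson
 obtain T where T: "open T" "U = S \<inter> T" using UV(1) by (auto simp: openin_open)
 obtain a b where ab: "a \<in> topspace L" "b \<in> topspace L" "a \<lless> t" "t \<lless> b"
  "\<And>c. c \<in> topspace L ==> a \<lless> c ==> c \<lless> b ==> c \<in> V" by (rule interval_base[OF UV(2,4)]) (rule that)
 have "(y, c) \<in> W" if "y \<in> T" "y \<in> S" "c \<in> topspace L" "a \<lless> c" "c \<lless> b" for y c
  using ab(5)[OF that(3-5)] that(1,2) UV(5) T(2) by blast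
 moreover have "x \<in> T" using UV(3) T(2) by blast
 ultimately show thesis using that[OF T(1) _ ab(1-4)] by blast
qed

lemma height_preimage_open:
 assumes "(U, u, F) \<in> B" "s \<in> {0<..<1}" "openin L T"
 shows "openin X {q \<in> U. snd (F s q) \<in> T}"
proof -
 have U: "openin X U" by (rule flow_boxD(1)[OF box[OF assms(1)]])
 have "continuous_map (subtopology X U) L (snd \<circ> F s)"
  by (rule continuous_map_compose[OF plaque_transport_continuous[OF assms(1,2)] continuous_map_snd])
 from openin_continuous_map_preimage[OF this assms(3)]
 have "openin (subtopology X U) {q \<in> topspace (subtopology X U). snd (F s q) \<in> T}" by simp
 moreover have "topspace (subtopology X U) = U" using openin_subset[OF U] by auto
 ultimately show ?thesis using U openin_trans_full by metis
qed

text \<open>Tangency of the fibre to the foliation at one point. It is witnessed by a single box;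
  \<open>vertical_in_box\<close> passes to every other box around the point.\<close>

definition vertical :: "'b \<times> 'p => bool" where
 "vertical p \<longleftrightarrow> (\<exists>U u F a b. (U, u, F) \<in> B \<and> p \<in> U \<and> a \<in> topspace L \<and> b \<in> topspace L \<and> a \<lless> snd p \<and> snd p \<lless> b \<and>
  (\<forall>c\<in>topspace L. a \<lless> c \<and> c \<lless> b --> (fst p, c) \<in> U \<and> F (u (fst p, c)) p = (fst p, c)))"

lemma vertical_in_box:
 assumes "vertical (x, t)" "(V, v, G) \<in> B" "(x, t) \<in> V"
 obtains a b where "a \<in> topspace L" "b \<in> topspace L" "a \<lless> t" "t \<lless> b"
  "\<And>c. c \<in> topspace L ==> a \<lless> c ==> c \<lless> b ==> (x, c) \<in> V \<and> G (v (x, c)) (x, t) = (x, c)"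
proof -
 obtain U u F a0 b0 where U: "(U, u, F) \<in> B" "(x, t) \<in> U" "a0 \<in> topspace L" "b0 \<in> topspace L" "a0 \<lless> t" "t \<lless> b0"
  and Uv: "\<forall>c\<in>topspace L. a0 \<lless> c \<and> c \<lless> b0 --> (x, c) \<in> U \<and> F (u (x, c)) (x, t) = (x, c)"
  using assms(1) unfolding vertical_def fst_conv snd_conv by (elim exE conjE) (rule that)
 have xt: "x \<in> S" "t \<in> topspace L" using box_subset[OF U(1,2)] by auto
 have "openin X V" by (rule flow_boxD(1)[OF box[OF assms(2)]])
 then obtain T a1 b1 where T: "open T" "x \<in> T" "a1 \<in> topspace L" "b1 \<in> topspace L" "a1 \<lless> t" "t \<lless> b1"
  "\<And>y c. y \<in> T ==> y \<in> S ==> c \<in> topspace L ==> a1 \<lless> c ==> c \<lless> b1 ==> (y, c) \<in> V" by (rule box_nbhd[OF _ assms(3)]) (rule that)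
 let ?W = "{c \<in> topspace L. a0 \<lless> c \<and> c \<lless> b0} \<inter> {c \<in> topspace L. a1 \<lless> c \<and> c \<lless> b1}"
 have W: "openin L ?W" "t \<in> ?W" using openin_interval U(3-6) T(3-6) xt(2) by auto
 obtain a b where ab: "a \<in> topspace L" "b \<in> topspace L" "a \<lless> t" "t \<lless> b"
  "\<And>c. c \<in> topspace L ==> a \<lless> c ==> c \<lless> b ==> c \<in> ?W" by (rule interval_base[OF W]) (rule that)
 show thesis
 proof (rule that[OF ab(1-4)])
  fix c assume c: "c \<in> topspace L" "a \<lless> c" "c \<lless> b"
  have cW: "a0 \<lless> c" "c \<lless> b0" "a1 \<lless> c" "c \<lless> b1" using ab(5)[OF c] by auto
  have cV: "(x, c) \<in> V" using T(7)[OF T(2) xt(1) c(1) cW(3,4)] .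
  have cU: "(x, c) \<in> U" "F (u (x, c)) (x, t) = (x, c)" using Uv c(1) cW(1,2) by blast+
  have "G (v (x, c)) (x, t) = (x, c)" by (rule same_plaque[OF U(1) assms(2) _ _ cU(2)]) (use U(2) assms(3) cV cU in auto)
  thus "(x, c) \<in> V \<and> G (v (x, c)) (x, t) = (x, c)" using cV by blast
 qed
qed

text \<open>Along a segment of the fibre the box coordinate is continuous and injective, so its
  values cover a neighbourhood of \<open>v (x, t)\<close>; hence the plaque near
  \<open>(x, t)\<close> contains nothing but fibre points.\<close>

lemma vertical_plaque:
 assumes "vertical (x, t)" "(V, v, G) \<in> B" "(x, t) \<in> V"
 obtains e where "e > 0" "\<And>s. s \<in> {0<..<1} ==> \<bar>s - v (x, t)\<bar> < e ==> fst (G s (x, t)) = x"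
proof -
 obtain a b where ab: "a \<in> topspace L" "b \<in> topspace L" "a \<lless> t" "t \<lless> b"
  "\<And>c. c \<in> topspace L ==> a \<lless> c ==> c \<lless> b ==> (x, c) \<in> V \<and> G (v (x, c)) (x, t) = (x, c)"
  by (rule vertical_in_box[OF assms]) (rule that)
 have xt: "x \<in> S" "t \<in> topspace L" using box_subset[OF assms(2,3)] by auto
 obtain a' where a': "a' \<in> topspace L" "a \<lless> a'" "a' \<lless> t" by (rule order_dense[OF ab(1) xt(2) ab(3)])
 obtain b' where b': "b' \<in> topspace L" "t \<lless> b'" "b' \<lless> b" by (rule order_dense[OF xt(2) ab(2) ab(4)])
 obtain g p q where g: "p \<le> q" "continuous_map (top_of_set {p..q::real}) L g" "g p = a'" "g q = b'"
  "\<And>r. r \<in> {p..q} ==> g r = a' \<or> a' \<lless> g r" "\<And>c. c \<in> topspace L ==> a' \<lless> c ==> c \<lless> b' ==> \<exists>r\<in>{p<..<q}. g r = c"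
  "\<And>r. r \<in> {p<..<q} ==> a' \<lless> g r \<and> g r \<lless> b'" "inj_on g {p..q}"
  by (rule interval_path[OF a'(1) b'(1) lt_trans[OF a'(3) b'(2)]]) (rule that)
 have gL: "g r \<in> topspace L" if "r \<in> {p..q}" for r using g(2) that unfolding continuous_map_def by auto
 have gab: "a \<lless> g r \<and> g r \<lless> b" if r: "r \<in> {p..q}" for r
 proof -
  consider "r = p" | "r = q" | "r \<in> {p<..<q}" using r by fastforce
  thus ?thesis
  proof cases
   case 1 thus ?thesis using g(3) a' ab(4) lt_trans by metis
  next
   case 2 thus ?thesis using g(4) b' ab(3) lt_trans by metis
  next
   case 3 thus ?thesis using g(7) a' b' lt_trans by metis
  qed
 qed
 have gV: "(x, g r) \<in> V" "G (v (x, g r)) (x, t) = (x, g r)" if "r \<in> {p..q}" for r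
  using ab(5)[OF gL[OF that]] gab[OF that] by blast+
 define h where "h r = v (x, g r)" for r
 note bV = flow_boxD[OF box[OF assms(2)]]
 have "continuous_map (top_of_set {p..q}) X (\<lambda>r. (x, g r))" using g(2) xt(1) by (simp add: continuous_map_pairwise o_def)
 hence "continuous_map (top_of_set {p..q}) (subtopology X V) (\<lambda>r. (x, g r))" using gV(1) by (auto simp: continuous_map_in_subtopology)
 from continuous_map_compose[OF this bV(2)] have hc: "continuous_on {p..q} h" by (simp add: o_def h_def[abs_def])
 have hi: "inj_on h {p..q}"
 proof (rule inj_onI)
  fix r r' assume r: "r \<in> {p..q}" "r' \<in> {p..q}" "h r = h r'"
  from r(3) have "G (v (x, g r)) (x, t) = G (v (x, g r')) (x, t)" by (simp only: h_def)
  hence "(x, g r) = (x, g r')" by (simp only: gV(2)[OF r(1)] gV(2)[OF r(2)])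
  thus "r = r'" using inj_onD[OF g(8) _ r(1,2)] by simp
 qed
 obtain r0 where r0: "r0 \<in> {p<..<q}" "g r0 = t" using g(6)[OF xt(2) a'(3) b'(2)] by blast
 have mono: "(h p < h r0 \<and> h r0 < h q) \<or> (h q < h r0 \<and> h r0 < h p)"
  by (rule continuous_inj_imp_mono[OF _ _ hc hi]) (use r0 in auto)
 have con: "connected (h ` {p..q})" by (rule connected_continuous_image[OF hc]) simp
 define e where "e = min \<bar>h p - h r0\<bar> \<bar>h q - h r0\<bar>"
 show thesis
 proof (rule that[of e])
  show "e > 0" using mono by (auto simp: e_def)
  fix s assume s: "s \<in> {0<..<1}" "\<bar>s - v (x, t)\<bar> < e"
  hence sh: "\<bar>s - h r0\<bar> < \<bar>h p - h r0\<bar>" "\<bar>s - h r0\<bar> < \<bar>h q - h r0\<bar>" by (auto simp: e_def h_def r0(2))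
  have "h p \<in> h ` {p..q}" "h q \<in> h ` {p..q}" using g(1) by auto
  moreover have "(h p \<le> s \<and> s \<le> h q) \<or> (h q \<le> s \<and> s \<le> h p)" using mono sh by (auto simp: abs_if split: if_splits)
  ultimately have "s \<in> h ` {p..q}" using connectedD_interval[OF con, of "h p" "h q" s] connectedD_interval[OF con, of "h q" "h p" s] by blast
  then obtain r where r: "r \<in> {p..q}" "s = v (x, g r)" by (auto simp: h_def)
  thus "fst (G s (x, t)) = x" using gV(2)[OF r(1)] by simp
 qed
qed

text \<open>If the plaque leaves the level upwards, points slightly below the level follow it. If it
  leaves downwards, a nearby plaque starts at a height \<open>d\<close> above the level and ends
  below it; it passes every height \<open>\<gamma>\<close> in between, and from there it leads back
  up to \<open>d\<close>.\<close>

lemma crossing_level: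
 assumes \<mu>: "\<mu> \<in> topspace L"
 obtains a where "a \<in> topspace L" "a \<lless> \<mu>" "\<And>\<gamma>. \<gamma> \<in> topspace L ==> a \<lless> \<gamma> ==> \<gamma> \<lless> \<mu> ==>
  \<exists>U u F y s. (U, u, F) \<in> B \<and> (y, \<gamma>) \<in> U \<and> s \<in> {0<..<1} \<and> \<mu> \<lless> snd (F s (y, \<gamma>))"
proof -
 obtain U u F q s where q: "(U, u, F) \<in> B" "q \<in> U" "s \<in> {0<..<1}" "snd q = \<mu>" "snd (F s q) \<noteq> \<mu>" using crossing[OF \<mu>] by blast
 note b = flow_boxD[OF box[OF q(1)]]
 have FL: "snd (F s q) \<in> topspace L" using box_subset[OF q(1) b(6)[OF q(2,3)]] by blast
 have q': "(fst q, \<mu>) = q" using q(4) by auto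
 have qS: "fst q \<in> S" using box_subset[OF q(1,2)] by blast
 from lt_total[OF \<mu> FL] q(5) have "\<mu> \<lless> snd (F s q) \<or> snd (F s q) \<lless> \<mu>" by auto
 thus thesis
 proof
  assume "\<mu> \<lless> snd (F s q)"
  hence "(fst q, \<mu>) \<in> {q' \<in> U. snd (F s q') \<in> {c \<in> topspace L. \<mu> \<lless> c}}" unfolding q' using q FL by simp
  then obtain T a c where T: "open T" "fst q \<in> T" "a \<in> topspace L" "c \<in> topspace L" "a \<lless> \<mu>" "\<mu> \<lless> c"
   "\<And>y d. y \<in> T ==> y \<in> S ==> d \<in> topspace L ==> a \<lless> d ==> d \<lless> c ==> (y, d) \<in> {q' \<in> U. snd (F s q') \<in> {c \<in> topspace L. \<mu> \<lless> c}}"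
   by (rule box_nbhd[OF height_preimage_open[OF q(1,3) open_above[OF \<mu>]]]) (rule that)
  show thesis
  proof (rule that[OF T(3,5)])
   fix \<gamma> assume \<gamma>: "\<gamma> \<in> topspace L" "a \<lless> \<gamma>" "\<gamma> \<lless> \<mu>"
   have "(fst q, \<gamma>) \<in> {q' \<in> U. snd (F s q') \<in> {c \<in> topspace L. \<mu> \<lless> c}}"
   by (rule T(7)[OF T(2) qS \<gamma>(1,2) lt_trans[OF \<gamma>(3) T(6)]])
   thus "\<exists>U u F y s. (U, u, F) \<in> B \<and> (y, \<gamma>) \<in> U \<and> s \<in> {0<..<1} \<and> \<mu> \<lless> snd (F s (y, \<gamma>))"
   using q(1,3) by blast
  qed
 next
  assume "snd (F s q) \<lless> \<mu>"
  hence "(fst q, \<mu>) \<in> {q' \<in> U. snd (F s q') \<in> {c \<in> topspace L. c \<lless> \<mu>}}" unfolding q' using q FL by simp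
  then obtain T a c where T: "open T" "fst q \<in> T" "a \<in> topspace L" "c \<in> topspace L" "a \<lless> \<mu>" "\<mu> \<lless> c"
   "\<And>y d. y \<in> T ==> y \<in> S ==> d \<in> topspace L ==> a \<lless> d ==> d \<lless> c ==> (y, d) \<in> {q' \<in> U. snd (F s q') \<in> {c \<in> topspace L. c \<lless> \<mu>}}"
   by (rule box_nbhd[OF height_preimage_open[OF q(1,3) open_below[OF \<mu>]]]) (rule that)
  obtain d where d: "d \<in> topspace L" "\<mu> \<lless> d" "d \<lless> c" by (rule order_dense[OF \<mu> T(4,6)])
  define p where "p = (fst q, d)"
  have "p \<in> {q' \<in> U. snd (F s q') \<in> {c \<in> topspace L. c \<lless> \<mu>}}"
   unfolding p_def by (rule T(7)[OF T(2) qS d(1) lt_trans[OF T(5) d(2)] d(3)])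
  hence p: "p \<in> U" "snd (F s p) \<in> topspace L" "snd (F s p) \<lless> \<mu>" "snd p = d" by (auto simp: p_def)
  show thesis
  proof (rule that[OF p(2,3)])
   fix \<gamma> assume \<gamma>: "\<gamma> \<in> topspace L" "snd (F s p) \<lless> \<gamma>" "\<gamma> \<lless> \<mu>"
   have "connectedin (top_of_set {0<..<1::real}) {0<..<1}" by (simp add: connectedin_subtopology)
   moreover have "continuous_map (top_of_set {0<..<1}) L (snd \<circ> (\<lambda>r. F r p))"
   by (rule continuous_map_compose[OF plaque_curve_continuous[OF q(1) p(1)] continuous_map_snd])
   ultimately have con: "connectedin L ((snd \<circ> (\<lambda>r. F r p)) ` {0<..<1})" by (rule connectedin_continuous_map_image[rotated])
   have i1: "snd (F s p) \<in> (snd \<circ> (\<lambda>r. F r p)) ` {0<..<1}" using q(3) by auto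
   have "snd (F (u p) p) \<in> (snd \<circ> (\<lambda>r. F r p)) ` {0<..<1}" using b(4)[OF p(1)] by (intro image_eqI[of _ _ "u p"]) simp_all
   hence i2: "d \<in> (snd \<circ> (\<lambda>r. F r p)) ` {0<..<1}" using b(5)[OF p(1)] p(4) by simp
   have "\<gamma> \<in> (snd \<circ> (\<lambda>r. F r p)) ` {0<..<1}" by (rule connected_heights[OF con i1 i2 \<gamma>(2) lt_trans[OF \<gamma>(3) d(2)] \<gamma>(1)])
   then obtain r where r: "r \<in> {0<..<1}" "\<gamma> = snd (F r p)" by auto
   hence e: "(fst (F r p), \<gamma>) = F r p" by simp
   have "F (u p) (F r p) = p" using b(8)[OF p(1) r(1) b(4)[OF p(1)]] b(5)[OF p(1)] by simp
   hence "\<mu> \<lless> snd (F (u p) (F r p))" using p(4) d(2) by simp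
   thus "\<exists>U u F y s. (U, u, F) \<in> B \<and> (y, \<gamma>) \<in> U \<and> s \<in> {0<..<1} \<and> \<mu> \<lless> snd (F s (y, \<gamma>))"
   using q(1) b(6)[OF p(1) r(1)] b(4)[OF p(1)] e by metis
  qed
 qed
qed

text \<open>Reaching above \<open>\<mu>\<close> inside one box is stable under moving the base
  point, so closing off over pairs of a height and a set of a countable base applies. It is used for
  all boxes with \<open>Y = S\<close>, and for the boxes above \<open>\<delta>\<close> with
  \<open>Y = {x}\<close>.\<close>

lemma tall_point:
 assumes \<delta>: "\<delta> \<in> topspace L" and A: "A \<subseteq> B"
  and step: "\<And>\<mu>. \<mu> \<in> topspace L ==> \<delta> \<lless> \<mu> ==> \<exists>a\<in>topspace L. a \<lless> \<mu> \<and> (\<forall>\<gamma>\<in>topspace L. \<delta> \<lless> \<gamma> \<and> a \<lless> \<gamma> \<and> \<gamma> \<lless> \<mu> -->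
   (\<exists>U u F y s. (U, u, F) \<in> A \<and> y \<in> Y \<and> (y, \<gamma>) \<in> U \<and> s \<in> {0<..<1} \<and> \<mu> \<lless> snd (F s (y, \<gamma>))))"
 obtains \<gamma> T where "\<gamma> \<in> topspace L" "\<delta> \<lless> \<gamma>" "open T" "T \<inter> Y \<noteq> {}"
  "\<And>y \<mu>. y \<in> T ==> y \<in> S ==> \<mu> \<in> topspace L ==> \<exists>U u F s. (U, u, F) \<in> A \<and> (y, \<gamma>) \<in> U \<and> s \<in> {0<..<1} \<and> \<mu> \<lless> snd (F s (y, \<gamma>))"
proof -
 obtain \<B> :: "'b set set" where \<B>: "countable \<B>" "topological_basis \<B>" using ex_countable_basis by blast
 define R where "R = (\<lambda>\<gamma> Q \<mu>. Q \<inter> Y \<noteq> {} \<and> (\<forall>y\<in>Q \<inter> S. \<exists>U u F s. (U, u, F) \<in> A \<and> (y, \<gamma>) \<in> U \<and> s \<in> {0<..<1} \<and> \<mu> \<lless> snd (F s (y, \<gamma>))))"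
 obtain \<gamma> Q where Q: "\<gamma> \<in> topspace L" "\<delta> \<lless> \<gamma>" "Q \<in> \<B>" "\<And>\<mu>. \<mu> \<in> topspace L ==> R \<gamma> Q \<mu>"
 proof (rule closing_off[OF \<delta> \<B>(1), of R])
  fix \<gamma> Q \<mu> \<mu>' assume "R \<gamma> Q \<mu>" "\<mu>' \<in> topspace L" "\<mu>' \<lless> \<mu>"
  thus "R \<gamma> Q \<mu>'" unfolding R_def using lt_trans by blast
 next
  fix \<gamma> :: "nat => 'p" and \<mu>
  assume \<gamma>: "\<And>n. \<gamma> n \<in> topspace L \<and> \<delta> \<lless> \<gamma> n \<and> \<gamma> n \<lless> \<mu>" and \<mu>: "\<mu> \<in> topspace L"
   and lim: "\<And>a. a \<in> topspace L ==> a \<lless> \<mu> ==> \<exists>n. \<forall>m\<ge>n. a \<lless> \<gamma> m"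
  have "\<delta> \<lless> \<mu>" using \<gamma>[of 0] lt_trans by blast
  from step[OF \<mu> this] obtain a where a: "a \<in> topspace L" "a \<lless> \<mu>"
   "\<forall>\<gamma>\<in>topspace L. \<delta> \<lless> \<gamma> \<and> a \<lless> \<gamma> \<and> \<gamma> \<lless> \<mu> -->
   (\<exists>U u F y s. (U, u, F) \<in> A \<and> y \<in> Y \<and> (y, \<gamma>) \<in> U \<and> s \<in> {0<..<1} \<and> \<mu> \<lless> snd (F s (y, \<gamma>)))" by blast
  obtain n where n: "a \<lless> \<gamma> n" using lim[OF a(1,2)] by blast
  have "\<exists>U u F y s. (U, u, F) \<in> A \<and> y \<in> Y \<and> (y, \<gamma> n) \<in> U \<and> s \<in> {0<..<1} \<and> \<mu> \<lless> snd (F s (y, \<gamma> n))" using a(3) \<gamma>[of n] n by blast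
  then obtain U u F y s where y: "(U, u, F) \<in> A" "y \<in> Y" "(y, \<gamma> n) \<in> U" "s \<in> {0<..<1}" "\<mu> \<lless> snd (F s (y, \<gamma> n))" by (elim exE conjE) (rule that)
  have UB: "(U, u, F) \<in> B" using y(1) A by blast
  have "snd (F s (y, \<gamma> n)) \<in> topspace L" using box_subset[OF UB flow_boxD(6)[OF box[OF UB] y(3,4)]] by blast
  hence "(y, \<gamma> n) \<in> {q \<in> U. snd (F s q) \<in> {c \<in> topspace L. \<mu> \<lless> c}}" using y(3,5) by simp
  then obtain T a' b' where T: "open T" "y \<in> T" "a' \<in> topspace L" "b' \<in> topspace L" "a' \<lless> \<gamma> n" "\<gamma> n \<lless> b'"
   "\<And>y' c. y' \<in> T ==> y' \<in> S ==> c \<in> topspace L ==> a' \<lless> c ==> c \<lless> b' ==> (y', c) \<in> {q \<in> U. snd (F s q) \<in> {c \<in> topspace L. \<mu> \<lless> c}}"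
   by (rule box_nbhd[OF height_preimage_open[OF UB y(4) open_above[OF \<mu>]]]) (rule that)
  obtain Q where Q: "Q \<in> \<B>" "y \<in> Q" "Q \<subseteq> T" by (rule topological_basisE[OF \<B>(2) T(1,2)])
  have "\<exists>U u F s. (U, u, F) \<in> A \<and> (y', \<gamma> n) \<in> U \<and> s \<in> {0<..<1} \<and> \<mu> \<lless> snd (F s (y', \<gamma> n))" if y': "y' \<in> Q \<inter> S" for y'
  proof -
   have "(y', \<gamma> n) \<in> {q \<in> U. snd (F s q) \<in> {c \<in> topspace L. \<mu> \<lless> c}}" by (rule T(7)[OF _ _ _ T(5,6)]) (use y' Q(3) \<gamma> in auto)
   thus ?thesis using y(1,4) by blast
  qed
  hence "R (\<gamma> n) Q \<mu>" unfolding R_def using Q(2) y(2) by blast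
  thus "\<exists>n. \<exists>Q\<in>\<B>. R (\<gamma> n) Q \<mu>" using Q(1) by blast
 qed (rule that)
 have "open Q" by (rule topological_basis_open[OF \<B>(2) Q(3)])
 moreover have "Q \<inter> Y \<noteq> {}" using Q(4)[OF \<delta>] by (simp add: R_def)
 ultimately show thesis
  by (rule that[OF Q(1,2)]) (use Q(4) in \<open>simp add: R_def\<close>)
qed

end

context long_flow
begin

text \<open>The arcs are ordered by inclusion, and an arc that reaches above the bound
  \<open>bd \<alpha>\<close> of another one contains it. Hence countably many arcs always lie in a
  single one, which serves both for the contradiction at a fixed \<open>\<epsilon>\<close> and for
  combining the values \<open>1/n\<close> of \<open>\<epsilon>\<close>.\<close>

lemma unbounded_arcs_converge:
 assumes A: "A \<subseteq> B" and arc: "\<And>\<alpha>. \<alpha> \<in> \<A> ==> plaque_arc A z \<alpha>"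
  and nested: "\<And>\<alpha> \<beta>. \<alpha> \<in> \<A> ==> \<beta> \<in> \<A> ==> \<alpha> ` {0..1} \<subseteq> \<beta> ` {0..1} \<or> \<beta> ` {0..1} \<subseteq> \<alpha> ` {0..1}"
  and high: "\<And>\<mu>. \<mu> \<in> topspace L ==> \<exists>\<alpha>\<in>\<A>. \<mu> \<lless> snd (\<alpha> 1)"
 obtains x' \<delta>' where "\<delta>' \<in> topspace L" "snd z \<lless> \<delta>'"
  "\<And>\<alpha> t. \<alpha> \<in> \<A> ==> t \<in> {0..1} ==> \<delta>' \<lless> snd (\<alpha> t) ==> fst (\<alpha> t) = x'"
proof -
 have "\<exists>b. \<alpha> \<in> \<A> --> b \<in> topspace L \<and> (\<forall>t\<in>{0..1}. snd (\<alpha> t) \<lless> b)" for \<alpha>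
 proof (cases "\<alpha> \<in> \<A>")
  case True
  have "continuous_map (top_of_set {0..1}) L (snd \<circ> \<alpha>)"
   by (rule continuous_map_compose[OF arc_continuous[OF arc[OF True] A] continuous_map_snd])
  moreover have "compactin (top_of_set {0..1::real}) {0..1}" by (simp add: compactin_subtopology)
  ultimately have "compactin L ((snd \<circ> \<alpha>) ` {0..1})" by (rule image_compactin[rotated])
  then obtain b where "b \<in> topspace L" "\<And>c. c \<in> (snd \<circ> \<alpha>) ` {0..1} ==> c \<lless> b" by (rule compactin_bounded) (rule that)
  thus ?thesis by (intro exI[of _ b]) auto
 qed simp
 then obtain bd where bd: "\<And>\<alpha>. \<alpha> \<in> \<A> ==> bd \<alpha> \<in> topspace L" "\<And>\<alpha> t. \<alpha> \<in> \<A> ==> t \<in> {0..1} ==> snd (\<alpha> t) \<lless> bd \<alpha>" by metis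
 have sub: "\<alpha> ` {0..1} \<subseteq> \<beta> ` {0..1}" if \<alpha>\<beta>: "\<alpha> \<in> \<A>" "\<beta> \<in> \<A>" "t \<in> {0..1}" "\<beta> t \<notin> \<alpha> ` {0..1}" for \<alpha> \<beta> t
  using nested[OF \<alpha>\<beta>(1,2)] \<alpha>\<beta>(3,4) by blast
 have high_sub: "\<alpha> ` {0..1} \<subseteq> \<beta> ` {0..1}" if \<alpha>\<beta>: "\<alpha> \<in> \<A>" "\<beta> \<in> \<A>" "bd \<alpha> \<lless> snd (\<beta> 1)" for \<alpha> \<beta>
 proof (rule sub[OF \<alpha>\<beta>(1,2), of 1])
  show "\<beta> 1 \<notin> \<alpha> ` {0..1}"
  proof
   assume "\<beta> 1 \<in> \<alpha> ` {0..1}"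
   hence "snd (\<beta> 1) \<lless> bd \<alpha>" using bd(2)[OF \<alpha>\<beta>(1)] by auto
   thus False using \<alpha>\<beta>(3) lt_trans lt_irrefl by blast
  qed
 qed simp
 have small: "\<exists>\<alpha>\<in>\<A>. \<forall>\<beta>\<in>\<A>. \<forall>t\<in>{0..1}. \<forall>t'\<in>{0..1}. \<beta> t \<notin> \<alpha> ` {0..1} --> \<beta> t' \<notin> \<alpha> ` {0..1} --> dist (fst (\<beta> t)) (fst (\<beta> t')) < \<epsilon>"
  if \<epsilon>: "\<epsilon> > 0" for \<epsilon> :: real
 proof (rule ccontr)
  assume neg: "\<not> ?thesis"
  have "\<exists>\<beta> t t'. \<alpha> \<in> \<A> --> \<beta> \<in> \<A> \<and> t \<in> {0..1} \<and> t' \<in> {0..1} \<and> \<beta> t \<notin> \<alpha> ` {0..1} \<and> \<beta> t' \<notin> \<alpha> ` {0..1} \<and> \<not> dist (fst (\<beta> t)) (fst (\<beta> t')) < \<epsilon>" for \<alpha>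
   using neg by blast
  then obtain nb tt tt' where nb: "\<And>\<alpha>. \<alpha> \<in> \<A> ==> nb \<alpha> \<in> \<A> \<and> tt \<alpha> \<in> {0..1} \<and> tt' \<alpha> \<in> {0..1} \<and> nb \<alpha> (tt \<alpha>) \<notin> \<alpha> ` {0..1} \<and> nb \<alpha> (tt' \<alpha>) \<notin> \<alpha> ` {0..1}
   \<and> \<not> dist (fst (nb \<alpha> (tt \<alpha>))) (fst (nb \<alpha> (tt' \<alpha>))) < \<epsilon>" by metis
  obtain b0 where "b0 \<in> topspace L" using countable_bounded[of "{}"] by auto
  then obtain \<alpha>0 where \<alpha>0: "\<alpha>0 \<in> \<A>" using high by blast
  define \<alpha> where "\<alpha> n = (nb ^^ n) \<alpha>0" for n
  have \<alpha>S: "\<alpha> (Suc n) = nb (\<alpha> n)" for n by (simp add: \<alpha>_def)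
  have \<alpha>: "\<alpha> n \<in> \<A>" for n by (induction n) (use \<alpha>0 nb \<alpha>S in \<open>auto simp: \<alpha>_def\<close>)
  define p q where "p n = nb (\<alpha> n) (tt (\<alpha> n))" and "q n = nb (\<alpha> n) (tt' (\<alpha> n))" for n
  have pq: "p n \<in> \<alpha> (Suc n) ` {0..1}" "q n \<in> \<alpha> (Suc n) ` {0..1}" "p n \<notin> \<alpha> n ` {0..1}" "q n \<notin> \<alpha> n ` {0..1}" "\<not> dist (fst (p n)) (fst (q n)) < \<epsilon>" for n
   using nb[OF \<alpha>[of n]] unfolding \<alpha>S p_def q_def by blast+
  have inc: "\<alpha> n ` {0..1} \<subseteq> \<alpha> (Suc n) ` {0..1}" for n
   using sub[OF \<alpha>[of n] \<alpha>[of "Suc n"], of "tt (\<alpha> n)"] nb[OF \<alpha>[of n]] unfolding \<alpha>S by blast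
  have incs: "\<alpha> n ` {0..1} \<subseteq> \<alpha> m ` {0..1}" if "n \<le> m" for n m by (rule lift_Suc_mono_le[of "\<lambda>n. \<alpha> n ` {0..1}", OF inc that])
  have "\<exists>b\<in>topspace L. \<forall>c\<in>range (\<lambda>n. bd (\<alpha> n)). c \<lless> b" by (rule countable_bounded) (use bd \<alpha> in auto)
  then obtain c where c: "c \<in> topspace L" "\<And>n. bd (\<alpha> n) \<lless> c" by blast
  obtain \<beta> where \<beta>: "\<beta> \<in> \<A>" "c \<lless> snd (\<beta> 1)" using high[OF c(1)] by blast
  have \<alpha>\<beta>: "\<alpha> n ` {0..1} \<subseteq> \<beta> ` {0..1}" for n by (rule high_sub[OF \<alpha> \<beta>(1) lt_trans[OF c(2) \<beta>(2)]])
  have "\<exists>s. s \<in> {0..1} \<and> \<beta> s = p n" "\<exists>s. s \<in> {0..1} \<and> \<beta> s = q n" for n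
   using subsetD[OF \<alpha>\<beta>[of "Suc n"] pq(1)[of n]] subsetD[OF \<alpha>\<beta>[of "Suc n"] pq(2)[of n]] by (metis imageE)+
  then obtain \<tau> \<tau>' where \<tau>: "\<And>n. \<tau> n \<in> {0..1}" "\<And>n. \<beta> (\<tau> n) = p n" "\<And>n. \<tau>' n \<in> {0..1}" "\<And>n. \<beta> (\<tau>' n) = q n" by metis
  \<comment> \<open>The part of \<open>\<beta>\<close> up to a point found at stage \<open>n\<close>
    lies in \<open>\<alpha> m\<close> for every later \<open>m\<close>, while the points found at
    stage \<open>m\<close> avoid \<open>\<alpha> m\<close>; so these come later on
    \<open>\<beta>\<close>.\<close>
  have order: "r < r'" if r: "n < m" "r \<in> {\<tau> n, \<tau>' n}" "r' \<in> {\<tau> m, \<tau>' m}" for n m r r'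
  proof (rule ccontr)
   assume "\<not> r < r'"
   hence le: "r' \<le> r" by simp
   have r01: "0 \<le> r'" "r \<le> 1" using r(2,3) \<tau>(1,3)[of n] \<tau>(1,3)[of m] by auto
   have "\<beta> r \<in> \<alpha> (Suc n) ` {0..1}" using r(2) \<tau>(2,4) pq(1,2)[of n] by auto
   hence "\<beta> r \<in> \<alpha> m ` {0..1}" using incs[of "Suc n" m] r(1) by auto
   from arc_initial_segment[OF arc[OF \<beta>(1)] arc[OF \<alpha>] A \<alpha>\<beta> r01(1) le r01(2) this]
   show False using r(3) \<tau>(2,4) pq(3,4)[of m] by auto
  qed
  have "\<tau> n \<le> \<tau> (Suc n)" for n using order[of n "Suc n" "\<tau> n" "\<tau> (Suc n)"] by simp
  hence "incseq \<tau>" by (rule incseq_SucI)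
  then obtain l where l: "\<tau> \<longlonglongrightarrow> l" "\<forall>i. \<tau> i \<le> l" by (rule incseq_convergent[of \<tau> 1]) (use \<tau>(1) in auto)
  have l01: "l \<in> {0..1}" using LIMSEQ_le_const2[OF l(1), of 1] l(2) \<tau>(1) by (meson atLeastAtMost_iff order_trans)
  have l1: "(\<lambda>n. \<tau> (Suc n)) \<longlonglongrightarrow> l" by (rule LIMSEQ_Suc[OF l(1)])
  \<comment> \<open>The parameters of the points \<open>p n\<close> and \<open>q n\<close>
    interlace, so the two sequences have the same limit.\<close>
  have l2: "(\<lambda>n. \<tau>' (Suc n)) \<longlonglongrightarrow> l"
  proof (rule tendsto_sandwich[OF _ _ l(1) LIMSEQ_Suc[OF l1]])
   show "\<forall>\<^sub>F n in sequentially. \<tau> n \<le> \<tau>' (Suc n)" using order by (intro always_eventually allI less_imp_le) auto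
   show "\<forall>\<^sub>F n in sequentially. \<tau>' (Suc n) \<le> \<tau> (Suc (Suc n))" using order by (intro always_eventually allI less_imp_le) auto
  qed
  have "continuous_map (top_of_set {0..1}) (top_of_set S) (fst \<circ> \<beta>)"
   by (rule continuous_map_compose[OF arc_continuous[OF arc[OF \<beta>(1)] A] continuous_map_fst])
  hence cont: "continuous_on {0..1} (\<lambda>r. fst (\<beta> r))" by (simp add: o_def)
  have "(\<lambda>n. dist (fst (\<beta> (\<tau> (Suc n)))) (fst (\<beta> (\<tau>' (Suc n))))) \<longlonglongrightarrow> dist (fst (\<beta> l)) (fst (\<beta> l))"
   by (intro tendsto_dist continuous_on_tendsto_compose[OF cont] l1 l2 l01) (use \<tau> in auto)
  hence "(\<lambda>n. dist (fst (p (Suc n))) (fst (q (Suc n)))) \<longlonglongrightarrow> 0" by (simp add: \<tau>)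
  hence "\<epsilon> \<le> 0" by (rule LIMSEQ_le_const) (use pq(5) in \<open>auto simp: not_less\<close>)
  thus False using \<epsilon> by simp
 qed
 have "\<exists>\<alpha>. \<alpha> \<in> \<A> \<and> (\<forall>\<beta>\<in>\<A>. \<forall>t\<in>{0..1}. \<forall>t'\<in>{0..1}. \<beta> t \<notin> \<alpha> ` {0..1} --> \<beta> t' \<notin> \<alpha> ` {0..1} --> dist (fst (\<beta> t)) (fst (\<beta> t')) < inverse (real (Suc n)))" for n
  using small[of "inverse (real (Suc n))"] by auto
 then obtain as where as: "\<And>n. as n \<in> \<A>"
  "\<And>n \<beta> t t'. \<beta> \<in> \<A> ==> t \<in> {0..1} ==> t' \<in> {0..1} ==> \<beta> t \<notin> as n ` {0..1} ==> \<beta> t' \<notin> as n ` {0..1} ==> dist (fst (\<beta> t)) (fst (\<beta> t')) < inverse (real (Suc n))" by metis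
 have "\<exists>b\<in>topspace L. \<forall>c\<in>range (\<lambda>n. bd (as n)). c \<lless> b" by (rule countable_bounded) (use bd as in auto)
 then obtain c where c: "c \<in> topspace L" "\<And>n. bd (as n) \<lless> c" by blast
 obtain \<beta> where \<beta>: "\<beta> \<in> \<A>" "c \<lless> snd (\<beta> 1)" using high[OF c(1)] by blast
 have as\<beta>: "as n ` {0..1} \<subseteq> \<beta> ` {0..1}" for n by (rule high_sub[OF as(1) \<beta>(1) lt_trans[OF c(2) \<beta>(2)]])
 \<comment> \<open>The end point of one arc beyond \<open>\<beta>\<close> fixes the limit component:
   every other arc point above \<open>bd \<beta>\<close> has its first component within
   \<open>inverse (real (Suc n))\<close> of it, for each \<open>n\<close>.\<close>
 obtain \<gamma> where \<gamma>: "\<gamma> \<in> \<A>" "bd \<beta> \<lless> snd (\<gamma> 1)" using high[OF bd(1)[OF \<beta>(1)]] by blast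
 have out: "\<alpha> t \<notin> as n ` {0..1}" if \<alpha>: "\<alpha> \<in> \<A>" "bd \<beta> \<lless> snd (\<alpha> t)" for \<alpha> t n
 proof
  assume "\<alpha> t \<in> as n ` {0..1}"
  hence "\<alpha> t \<in> \<beta> ` {0..1}" using as\<beta> by blast
  hence "snd (\<alpha> t) \<lless> bd \<beta>" using bd(2)[OF \<beta>(1)] by auto
  thus False using \<alpha>(2) lt_trans lt_irrefl by blast
 qed
 show thesis
 proof (rule that[of "bd \<beta>" "fst (\<gamma> 1)"])
  show "snd z \<lless> bd \<beta>" using bd(2)[OF \<beta>(1), of 0] arc_start[OF arc[OF \<beta>(1)] A] by simp
  fix \<alpha> t assume \<alpha>: "\<alpha> \<in> \<A>" "t \<in> {0..1::real}" "bd \<beta> \<lless> snd (\<alpha> t)"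
  have "dist (fst (\<alpha> t)) (fst (\<gamma> 1)) < inverse (real (Suc n))" for n
   using nested[OF \<alpha>(1) \<gamma>(1)]
  proof
   assume "\<alpha> ` {0..1} \<subseteq> \<gamma> ` {0..1}"
   then obtain t' where t': "t' \<in> {0..1}" "\<alpha> t = \<gamma> t'" using \<alpha>(2) by blast
   show ?thesis unfolding t'(2)
   by (rule as(2)[OF \<gamma>(1) t'(1)]) (use out[OF \<alpha>(1,3)] out[OF \<gamma>] t'(2) in auto)
  next
   assume "\<gamma> ` {0..1} \<subseteq> \<alpha> ` {0..1}"
   moreover have "\<gamma> 1 \<in> \<gamma> ` {0..1}" by simp
   ultimately obtain t' where t': "t' \<in> {0..1}" "\<gamma> 1 = \<alpha> t'" by blast
   show ?thesis unfolding t'(2)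
   by (rule as(2)[OF \<alpha>(1,2) t'(1)]) (use out[OF \<alpha>(1,3)] out[OF \<gamma>] t'(2) in auto)
  qed
  hence "\<not> 0 < dist (fst (\<alpha> t)) (fst (\<gamma> 1))" using reals_Archimedean by (meson not_less_iff_gr_or_eq order_less_trans)
  thus "fst (\<alpha> t) = fst (\<gamma> 1)" by simp
 qed (rule bd(1)[OF \<beta>(1)])
qed

lemma verticalI:
 assumes "(U, u, F) \<in> B" "(x, t) \<in> U" "a \<in> topspace L" "b \<in> topspace L" "a \<lless> t" "t \<lless> b"
  "\<And>c. c \<in> topspace L ==> a \<lless> c ==> c \<lless> b ==> (x, c) \<in> U \<and> F (u (x, c)) (x, t) = (x, c)"
 shows "vertical (x, t)"
 unfolding vertical_def
 by (rule exI[of _ U], rule exI[of _ u], rule exI[of _ F], rule exI[of _ a], rule exI[of _ b]) (simp add: assms)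

text \<open>Arcs from \<open>z\<close> are sorted by their direction in one reference box; if both
  classes had bounded heights, so would all arcs. In the unbounded class the arcs pass every height
  above \<open>\<delta>'\<close> with constant first component, and a box of one of them witnesses
  verticality.\<close>

lemma tall_imp_vertical:
 assumes A: "A \<subseteq> B" and z: "z \<in> topspace X"
  and tall: "\<And>\<mu>. \<mu> \<in> topspace L ==> \<exists>U u F s. (U, u, F) \<in> A \<and> z \<in> U \<and> s \<in> {0<..<1} \<and> \<mu> \<lless> snd (F s z)"
 obtains x' \<delta>' where "x' \<in> S" "\<delta>' \<in> topspace L" "\<And>t. t \<in> topspace L ==> \<delta>' \<lless> t ==> vertical (x', t)"
  "\<exists>U u F s. (U, u, F) \<in> A \<and> z \<in> U \<and> s \<in> {0<..<1} \<and> fst (F s z) = x'"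
proof -
 obtain U0 u0 F0 where U0: "(U0, u0, F0) \<in> B" "z \<in> U0" by (rule small_box[OF openin_topspace z])
 have zL: "snd z \<in> topspace L" using z by auto
 define \<A> where "\<A> \<sigma> = {\<alpha>. plaque_arc A z \<alpha> \<and> (\<exists>\<epsilon>\<in>{0<..1}. \<forall>t\<in>{0<..\<epsilon>}. \<alpha> t \<in> U0 \<and> 0 < \<sigma> * (u0 (\<alpha> t) - u0 z))}" for \<sigma> :: real
 have arcs: "\<exists>\<alpha>\<in>\<A> 1 \<union> \<A> (-1). \<mu> \<lless> snd (\<alpha> 1)" if \<mu>: "\<mu> \<in> topspace L" for \<mu>
 proof -
  have "\<exists>b\<in>topspace L. \<forall>c\<in>{\<mu>, snd z}. c \<lless> b" by (rule countable_bounded) (use \<mu> zL in auto)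
  then obtain b where b: "b \<in> topspace L" "\<mu> \<lless> b" "snd z \<lless> b" by blast
  obtain U u F s where U: "(U, u, F) \<in> A" "z \<in> U" "s \<in> {0<..<1}" "b \<lless> snd (F s z)" using tall[OF b(1)] by (elim exE conjE) (rule that)
  have UB: "(U, u, F) \<in> B" using U(1) A by blast
  have "s \<noteq> u z"
  proof
   assume "s = u z"
   hence "snd (F s z) = snd z" using flow_boxD(5)[OF box[OF UB] U(2)] by simp
   thus False using U(4) b(3) lt_trans lt_irrefl by metis
  qed
  define \<alpha> where "\<alpha> = (\<lambda>t. F (u z + t * (s - u z)) z)"
  have arc: "plaque_arc A z \<alpha>" unfolding plaque_arc_def using U \<open>s \<noteq> u z\<close> \<alpha>_def by blast
  obtain \<sigma> \<epsilon> where \<sigma>: "\<sigma> = 1 \<or> \<sigma> = (-1::real)" "\<epsilon> \<in> {0<..1}" "\<And>t. t \<in> {0<..\<epsilon>} ==> \<alpha> t \<in> U0 \<and> 0 < \<sigma> * (u0 (\<alpha> t) - u0 z)"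
   by (rule arc_direction[OF arc A U0]) (rule that)
  hence "\<alpha> \<in> \<A> \<sigma>" unfolding \<A>_def using arc by blast
  hence "\<alpha> \<in> \<A> 1 \<union> \<A> (-1)" using \<sigma>(1) by auto
  moreover have "\<alpha> 1 = F s z" by (simp add: \<alpha>_def)
  ultimately show ?thesis using U(4) b(2) lt_trans by metis
 qed
 have "\<exists>\<sigma>\<in>{1, -1}. \<forall>\<mu>\<in>topspace L. \<exists>\<alpha>\<in>\<A> \<sigma>. \<mu> \<lless> snd (\<alpha> 1)"
 proof (rule ccontr)
  assume "\<not> ?thesis"
  then obtain \<mu> \<nu> where \<mu>: "\<mu> \<in> topspace L" "\<forall>\<alpha>\<in>\<A> 1. \<not> \<mu> \<lless> snd (\<alpha> 1)" and \<nu>: "\<nu> \<in> topspace L" "\<forall>\<alpha>\<in>\<A> (-1). \<not> \<nu> \<lless> snd (\<alpha> 1)" by blast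
  have "\<exists>b\<in>topspace L. \<forall>c\<in>{\<mu>, \<nu>}. c \<lless> b" by (rule countable_bounded) (use \<mu> \<nu> in auto)
  then obtain b where b: "b \<in> topspace L" "\<mu> \<lless> b" "\<nu> \<lless> b" by blast
  show False using arcs[OF b(1)] \<mu>(2) \<nu>(2) lt_trans[OF b(2)] lt_trans[OF b(3)] by blast
 qed
 then obtain \<sigma> where high: "\<And>\<mu>. \<mu> \<in> topspace L ==> \<exists>\<alpha>\<in>\<A> \<sigma>. \<mu> \<lless> snd (\<alpha> 1)" by blast
 have arc: "plaque_arc A z \<alpha>" if "\<alpha> \<in> \<A> \<sigma>" for \<alpha> using that by (simp add: \<A>_def)
 have nested: "\<alpha> ` {0..1} \<subseteq> \<beta> ` {0..1} \<or> \<beta> ` {0..1} \<subseteq> \<alpha> ` {0..1}" if \<alpha>\<beta>: "\<alpha> \<in> \<A> \<sigma>" "\<beta> \<in> \<A> \<sigma>" for \<alpha> \<beta>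
 proof -
  obtain \<epsilon> where \<epsilon>: "\<epsilon> \<in> {0<..1}" "\<And>t. t \<in> {0<..\<epsilon>} ==> \<alpha> t \<in> U0 \<and> 0 < \<sigma> * (u0 (\<alpha> t) - u0 z)" using \<alpha>\<beta>(1) unfolding \<A>_def by blast
  obtain \<epsilon>' where \<epsilon>': "\<epsilon>' \<in> {0<..1}" "\<And>t. t \<in> {0<..\<epsilon>'} ==> \<beta> t \<in> U0 \<and> 0 < \<sigma> * (u0 (\<beta> t) - u0 z)" using \<alpha>\<beta>(2) unfolding \<A>_def by blast
  obtain e where e: "e > 0" "\<And>t. t \<in> {0..1} ==> t < e ==> \<alpha> t \<in> \<beta> ` {0..1}"
   by (rule arcs_same_direction[OF arc[OF \<alpha>\<beta>(1)] arc[OF \<alpha>\<beta>(2)] A U0 \<epsilon> \<epsilon>']) (assumption | rule that)+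
  show ?thesis by (rule arcs_nested[OF arc[OF \<alpha>\<beta>(1)] arc[OF \<alpha>\<beta>(2)] A e])
 qed
 obtain x' \<delta>' where x': "\<delta>' \<in> topspace L" "snd z \<lless> \<delta>'" "\<And>\<alpha> t. \<alpha> \<in> \<A> \<sigma> ==> t \<in> {0..1} ==> \<delta>' \<lless> snd (\<alpha> t) ==> fst (\<alpha> t) = x'"
  by (rule unbounded_arcs_converge[OF A arc nested high]) (assumption | rule that)+
 have reach: "\<exists>\<tau>\<in>{0..1}. \<alpha> \<tau> = (x', t)" if \<alpha>: "\<alpha> \<in> \<A> \<sigma>" "t \<in> topspace L" "\<delta>' \<lless> t" "t \<lless> snd (\<alpha> 1)" for \<alpha> t
 proof -
  have "connectedin (top_of_set {0..1::real}) {0..1}" by (simp add: connectedin_subtopology)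
  moreover have "continuous_map (top_of_set {0..1}) L (snd \<circ> \<alpha>)"
   by (rule continuous_map_compose[OF arc_continuous[OF arc[OF \<alpha>(1)] A] continuous_map_snd])
  ultimately have con: "connectedin L ((snd \<circ> \<alpha>) ` {0..1})" by (rule connectedin_continuous_map_image[rotated])
  have "snd (\<alpha> 0) \<in> (snd \<circ> \<alpha>) ` {0..1}" "snd (\<alpha> 1) \<in> (snd \<circ> \<alpha>) ` {0..1}" by auto
  hence i: "snd z \<in> (snd \<circ> \<alpha>) ` {0..1}" "snd (\<alpha> 1) \<in> (snd \<circ> \<alpha>) ` {0..1}" using arc_start[OF arc[OF \<alpha>(1)] A] by simp_all
  have "t \<in> (snd \<circ> \<alpha>) ` {0..1}" by (rule connected_heights[OF con i lt_trans[OF x'(2) \<alpha>(3)] \<alpha>(4,2)])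
  then obtain \<tau> where \<tau>: "\<tau> \<in> {0..1}" "snd (\<alpha> \<tau>) = t" by auto
  hence "fst (\<alpha> \<tau>) = x'" using x'(3)[OF \<alpha>(1) \<tau>(1)] \<alpha>(3) by simp
  thus ?thesis using \<tau> by (intro bexI[of _ \<tau>] prod_eqI) auto
 qed
 obtain d where d: "d \<in> topspace L" "\<delta>' \<lless> d" by (rule unbounded[OF x'(1)])
 obtain \<alpha> where \<alpha>: "\<alpha> \<in> \<A> \<sigma>" "d \<lless> snd (\<alpha> 1)" using high[OF d(1)] by blast
 obtain \<tau> where \<tau>: "\<tau> \<in> {0..1}" "\<alpha> \<tau> = (x', d)" using reach[OF \<alpha>(1) d \<alpha>(2)] by blast
 obtain U u F s where a: "(U, u, F) \<in> A" "(U, u, F) \<in> B" "z \<in> U" "s \<in> {0<..<1}" "s \<noteq> u z"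
  "\<forall>t\<in>{0..1}. \<alpha> t = F (u z + t * (s - u z)) z" "\<forall>t\<in>{0..1}. \<alpha> t \<in> U"
  "\<forall>t\<in>{0..1}. u (\<alpha> t) = u z + t * (s - u z)" "\<forall>t\<in>{0..1}. F (u (\<alpha> t)) z = \<alpha> t" by (rule plaque_arcE[OF arc[OF \<alpha>(1)] A])
 have F\<tau>: "F (u (\<alpha> \<tau>)) z = \<alpha> \<tau>" "\<alpha> \<tau> \<in> U" using a(7,9) \<tau>(1) by blast+
 show thesis
 proof (rule that[OF _ x'(1)])
  show "x' \<in> S" using box_subset[OF a(2) F\<tau>(2)] \<tau>(2) by simp
  show "\<exists>U u F s. (U, u, F) \<in> A \<and> z \<in> U \<and> s \<in> {0<..<1} \<and> fst (F s z) = x'"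
   by (rule exI[of _ U], rule exI[of _ u], rule exI[of _ F], rule exI[of _ "u (\<alpha> \<tau>)"])
   (use a(1,3) F\<tau> \<tau>(2) flow_boxD(4)[OF box[OF a(2)] F\<tau>(2)] in simp)
  fix t assume t: "t \<in> topspace L" "\<delta>' \<lless> t"
  \<comment> \<open>An arc that ends above \<open>t\<close> contains a whole fibre interval around
    \<open>t\<close>, and its box serves as the witness.\<close>
  obtain \<beta> where \<beta>: "\<beta> \<in> \<A> \<sigma>" "t \<lless> snd (\<beta> 1)" using high[OF t(1)] by blast
  obtain V v G r where b: "(V, v, G) \<in> A" "(V, v, G) \<in> B" "z \<in> V" "r \<in> {0<..<1}" "r \<noteq> v z"
   "\<forall>t\<in>{0..1}. \<beta> t = G (v z + t * (r - v z)) z" "\<forall>t\<in>{0..1}. \<beta> t \<in> V"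
   "\<forall>t\<in>{0..1}. v (\<beta> t) = v z + t * (r - v z)" "\<forall>t\<in>{0..1}. G (v (\<beta> t)) z = \<beta> t" by (rule plaque_arcE[OF arc[OF \<beta>(1)] A])
  have b1: "snd (\<beta> 1) \<in> topspace L" using box_subset[OF b(2)] b(7) by auto
  obtain \<tau>0 where \<tau>0: "\<tau>0 \<in> {0..1}" "\<beta> \<tau>0 = (x', t)" using reach[OF \<beta>(1) t \<beta>(2)] by blast
  have "(x', c) \<in> V \<and> G (v (x', c)) (x', t) = (x', c)" if c: "c \<in> topspace L" "\<delta>' \<lless> c" "c \<lless> snd (\<beta> 1)" for c
  proof -
   obtain \<tau>1 where \<tau>1: "\<tau>1 \<in> {0..1}" "\<beta> \<tau>1 = (x', c)" using reach[OF \<beta>(1) c] by blast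
   have V: "\<beta> \<tau>0 \<in> V" "\<beta> \<tau>1 \<in> V" using b(7) \<tau>0(1) \<tau>1(1) by blast+
   show ?thesis using arc_plaque[OF arc[OF \<beta>(1)] A b(2) \<tau>0(1) \<tau>1(1) V] V(2) \<tau>0(2) \<tau>1(2) by simp
  qed
  moreover have "(x', t) \<in> V" using b(7) \<tau>0 by force
  ultimately show "vertical (x', t)" by (intro verticalI[OF b(2) _ x'(1) b1 t(2) \<beta>(2)])
 qed
qed

section \<open>The set of base points of vertical rays\<close>

definition verticals :: "'p => 'b set" where
 "verticals \<delta> = {x \<in> S. \<forall>t\<in>topspace L. \<delta> \<lless> t --> vertical (x, t)}"

text \<open>Verticality is local in the height. Within one box it propagates along an interval,
  because fibre points near \<open>(x, d)\<close> lie on the plaque of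
  \<open>(x, d)\<close>.\<close>

lemma fiber_plaque:
 assumes x: "x \<in> verticals \<delta>" and V: "(V, v, G) \<in> B" and ab: "a \<in> topspace L" "b \<in> topspace L"
  and sub: "\<And>c. c \<in> topspace L ==> a \<lless> c ==> c \<lless> b ==> \<delta> \<lless> c \<and> (x, c) \<in> V"
  and t: "t \<in> topspace L" "a \<lless> t" "t \<lless> b" and c: "c \<in> topspace L" "a \<lless> c" "c \<lless> b"
 shows "G (v (x, c)) (x, t) = (x, c)"
proof (rule interval_propagate[OF ab t _ _ c, of "\<lambda>c. G (v (x, c)) (x, t) = (x, c)"])
 note bV = flow_boxD[OF box[OF V]]
 have tV: "(x, t) \<in> V" using sub[OF t] by blast
 show "G (v (x, t)) (x, t) = (x, t)" by (rule bV(5)[OF tV])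
 fix d assume d: "d \<in> topspace L" "a \<lless> d" "d \<lless> b"
 have dV: "(x, d) \<in> V" "\<delta> \<lless> d" using sub[OF d] by blast+
 have "vertical (x, d)" using x d(1) dV(2) by (simp add: verticals_def)
 then obtain a' b' where ab': "a' \<in> topspace L" "b' \<in> topspace L" "a' \<lless> d" "d \<lless> b'"
  "\<And>c. c \<in> topspace L ==> a' \<lless> c ==> c \<lless> b' ==> (x, c) \<in> V \<and> G (v (x, c)) (x, d) = (x, c)"
  by (rule vertical_in_box[OF _ V dV(1)]) (rule that)
 have key: "(G (v (x, e)) (x, t) = (x, e)) = (G (v (x, d)) (x, t) = (x, d))" if e: "e \<in> topspace L" "a' \<lless> e" "e \<lless> b'" for e
 proof -
  have eV: "(x, e) \<in> V" "G (v (x, e)) (x, d) = (x, e)" using ab'(5)[OF e] by blast+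
  note m = bV(4)[OF eV(1)] bV(4)[OF dV(1)]
  have "G (v (x, d)) (x, e) = (x, d)" using bV(8)[OF dV(1) m(1,2)] eV(2) bV(5)[OF dV(1)] by simp
  thus ?thesis using bV(8)[OF tV m(1) m(2)] bV(8)[OF tV m(2) m(1)] eV(2) by metis
 qed
 show "\<exists>T. openin L T \<and> d \<in> T \<and> (\<forall>e\<in>T. a \<lless> e \<and> e \<lless> b --> (G (v (x, e)) (x, t) = (x, e)) = (G (v (x, d)) (x, t) = (x, d)))"
 proof (intro exI conjI ballI impI)
  show "openin L {c \<in> topspace L. a' \<lless> c \<and> c \<lless> b'}" by (rule openin_interval[OF ab'(1,2)])
  show "d \<in> {c \<in> topspace L. a' \<lless> c \<and> c \<lless> b'}" using d(1) ab'(3,4) by blast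
 qed (rule key; blast)
qed

text \<open>In one box, that \<open>(x, c)\<close> lies on the plaque of \<open>(x, t)\<close>
  equates two continuous maps of \<open>x\<close> into a Hausdorff space, so it passes to limits.
  \<open>fiber_plaque\<close> provides it for all \<open>c\<close> in an interval that does not
  depend on \<open>x\<close>.\<close>

lemma verticals_closed:
 assumes \<delta>: "\<delta> \<in> topspace L" and y: "y \<in> closure (verticals \<delta>)" "y \<in> S"
 shows "y \<in> verticals \<delta>"
 unfolding verticals_def
proof (intro CollectI conjI ballI impI y(2))
 fix t assume t: "t \<in> topspace L" "\<delta> \<lless> t"
 have "(y, t) \<in> topspace X" using y(2) t(1) by simp
 then obtain V v G where V: "(V, v, G) \<in> B" "(y, t) \<in> V" by (rule small_box[OF openin_topspace])
 note bV = flow_boxD[OF box[OF V(1)]]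
 obtain T a0 b0 where T: "open T" "y \<in> T" "a0 \<in> topspace L" "b0 \<in> topspace L" "a0 \<lless> t" "t \<lless> b0"
  "\<And>y c. y \<in> T ==> y \<in> S ==> c \<in> topspace L ==> a0 \<lless> c ==> c \<lless> b0 ==> (y, c) \<in> V"
  by (rule box_nbhd[OF bV(1) V(2)]) (rule that)
 have W: "openin L ({c \<in> topspace L. a0 \<lless> c \<and> c \<lless> b0} \<inter> {c \<in> topspace L. \<delta> \<lless> c})"
  "t \<in> {c \<in> topspace L. a0 \<lless> c \<and> c \<lless> b0} \<inter> {c \<in> topspace L. \<delta> \<lless> c}"
  using openin_interval[OF T(3,4)] open_above[OF \<delta>] t T(5,6) by auto
 obtain a b where ab: "a \<in> topspace L" "b \<in> topspace L" "a \<lless> t" "t \<lless> b"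
  "\<And>c. c \<in> topspace L ==> a \<lless> c ==> c \<lless> b ==> c \<in> {c \<in> topspace L. a0 \<lless> c \<and> c \<lless> b0} \<inter> {c \<in> topspace L. \<delta> \<lless> c}"
  by (rule interval_base[OF W]) (rule that)
 have inV: "(x, c) \<in> V" "\<delta> \<lless> c" if "x \<in> T" "x \<in> S" "c \<in> topspace L" "a \<lless> c" "c \<lless> b" for x c
  using ab(5)[OF that(3-5)] T(7)[OF that(1-3)] by blast+
 have "G (v (y, c)) (y, t) = (y, c)" if c: "c \<in> topspace L" "a \<lless> c" "c \<lless> b" for c
 proof -
  let ?Z = "top_of_set (T \<inter> S)"
  have id: "continuous_map ?Z (top_of_set S) (\<lambda>x. x)" by (auto simp: continuous_map_in_subtopology)
  have cc: "continuous_map ?Z (subtopology X V) (\<lambda>x. (x, d))" if d: "d \<in> topspace L" "a \<lless> d" "d \<lless> b" for d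
   using id inV(1)[OF _ _ d] d(1) by (auto simp: continuous_map_in_subtopology continuous_map_pairwise o_def)
  have vc: "continuous_map ?Z (top_of_set {0<..<1}) (\<lambda>x. v (x, c))"
   using continuous_map_compose[OF cc[OF c] bV(2)] bV(4) inV(1)[OF _ _ c] by (auto simp: continuous_map_in_subtopology o_def)
  have "continuous_map ?Z (prod_topology (top_of_set {0<..<1}) (subtopology X V)) (\<lambda>x. (v (x, c), (x, t)))"
   using vc cc[OF t(1) ab(3,4)] by (simp add: continuous_map_pairwise o_def)
  from continuous_map_compose[OF this bV(3)] have c1: "continuous_map ?Z X (\<lambda>x. G (v (x, c)) (x, t))" by (simp add: o_def)
  have c2: "continuous_map ?Z X (\<lambda>x. (x, c))" using cc[OF c] by (simp add: continuous_map_in_subtopology)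
  from closedin_continuous_maps_eq[OF hausdorff c1 c2]
  obtain C where C: "closed C" "{x \<in> T \<inter> S. G (v (x, c)) (x, t) = (x, c)} = T \<inter> S \<inter> C"
   by (auto simp: closedin_closed)
  have "T \<inter> verticals \<delta> \<subseteq> C"
  proof
   fix x assume x: "x \<in> T \<inter> verticals \<delta>"
   hence xS: "x \<in> T" "x \<in> S" "x \<in> verticals \<delta>" by (auto simp: verticals_def)
   have "G (v (x, c)) (x, t) = (x, c)"
   by (rule fiber_plaque[OF xS(3) V(1) ab(1,2) _ t(1) ab(3,4) c]) (use inV xS in blast)
   hence "x \<in> {x \<in> T \<inter> S. G (v (x, c)) (x, t) = (x, c)}" using xS by simp
   thus "x \<in> C" unfolding C(2) by blast
  qed
  hence "closure (T \<inter> verticals \<delta>) \<subseteq> C" using C(1) by (rule closure_minimal)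
  hence "y \<in> C" using open_Int_closure_subset[OF T(1), of "verticals \<delta>"] y(1) T(2) by blast
  hence "y \<in> {x \<in> T \<inter> S. G (v (x, c)) (x, t) = (x, c)}" unfolding C(2) using T(2) y(2) by blast
  thus ?thesis by simp
 qed
 thus "vertical (y, t)" using inV(1)[OF T(2) y(2)] by (intro verticalI[OF V ab(1-4)] conjI)
qed

text \<open>Each vertical ray has its own lower end. A countable dense set of base points has a
  common one, and closedness extends it to all base points.\<close>

lemma verticals_uniform:
 obtains \<delta> where "\<delta> \<in> topspace L" "\<And>\<delta>'. \<delta>' \<in> topspace L ==> verticals \<delta>' \<subseteq> verticals \<delta>"
proof -
 let ?V = "\<Union>\<delta>\<in>topspace L. verticals \<delta>"
 obtain D where D: "countable D" "D \<subseteq> ?V" "?V \<subseteq> closure D" by (rule separable)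
 have "\<forall>d\<in>D. \<exists>\<delta>. \<delta> \<in> topspace L \<and> d \<in> verticals \<delta>" using D(2) by blast
 from bchoice[OF this] obtain e where e: "\<forall>d\<in>D. e d \<in> topspace L \<and> d \<in> verticals (e d)" ..
 have "\<exists>b\<in>topspace L. \<forall>c\<in>e ` D. c \<lless> b" by (rule countable_bounded) (use D(1) e in auto)
 then obtain \<delta> where \<delta>: "\<delta> \<in> topspace L" "\<forall>d\<in>D. e d \<lless> \<delta>" by blast
 have "D \<subseteq> verticals \<delta>"
 proof
  fix d assume d: "d \<in> D"
  hence "d \<in> verticals (e d)" "e d \<lless> \<delta>" using e \<delta>(2) by blast+
  thus "d \<in> verticals \<delta>" unfolding verticals_def using lt_trans by blast
 qed
 hence "?V \<subseteq> closure (verticals \<delta>)" using D(3) closure_mono by blast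
 moreover have "?V \<subseteq> S" by (auto simp: verticals_def)
 ultimately have "?V \<subseteq> verticals \<delta>" using verticals_closed[OF \<delta>(1)] by blast
 thus thesis using that[OF \<delta>(1)] by blast
qed

text \<open>For \<open>y\<close> near \<open>x\<close> the tall plaques from
  \<open>(y, \<gamma>)\<close> are taken in boxes above \<open>\<delta>\<close>. The fibre over
  \<open>x'\<close> to which they lead belongs to \<open>verticals \<delta>\<close> by the
  maximality \<open>max\<close>, so it is vertical at every height such a plaque can have. The
  plaque therefore never leaves this fibre, and \<open>y = x'\<close>.\<close>

lemma verticals_open:
 assumes \<delta>: "\<delta> \<in> topspace L" and max: "\<And>\<delta>'. \<delta>' \<in> topspace L ==> verticals \<delta>' \<subseteq> verticals \<delta>" and x: "x \<in> verticals \<delta>"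
 obtains T where "open T" "x \<in> T" "T \<inter> S \<subseteq> verticals \<delta>"
proof -
 define A where "A = {(U, u, F) \<in> B. \<forall>q\<in>U. \<delta> \<lless> snd q}"
 have AB: "A \<subseteq> B" by (auto simp: A_def)
 have xS: "x \<in> S" using x by (simp add: verticals_def)
 have high: "openin X (S \<times> {c \<in> topspace L. \<delta> \<lless> c})" using open_above[OF \<delta>] by (simp add: openin_prod_Times_iff)
 have step: "\<exists>a\<in>topspace L. a \<lless> \<mu> \<and> (\<forall>\<gamma>\<in>topspace L. \<delta> \<lless> \<gamma> \<and> a \<lless> \<gamma> \<and> \<gamma> \<lless> \<mu> -->
   (\<exists>U u F y s. (U, u, F) \<in> A \<and> y \<in> {x} \<and> (y, \<gamma>) \<in> U \<and> s \<in> {0<..<1} \<and> \<mu> \<lless> snd (F s (y, \<gamma>))))"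
  if \<mu>: "\<mu> \<in> topspace L" "\<delta> \<lless> \<mu>" for \<mu>
 proof -
  have "(x, \<mu>) \<in> S \<times> {c \<in> topspace L. \<delta> \<lless> c}" using xS \<mu> by simp
  then obtain U u F where U: "(U, u, F) \<in> B" "(x, \<mu>) \<in> U" "U \<subseteq> S \<times> {c \<in> topspace L. \<delta> \<lless> c}" by (rule small_box[OF high])
  have UA: "(U, u, F) \<in> A" using U(1,3) by (auto simp: A_def)
  note b = flow_boxD[OF box[OF U(1)]]
  have "vertical (x, \<mu>)" using x \<mu> by (simp add: verticals_def)
  then obtain a c where ac: "a \<in> topspace L" "c \<in> topspace L" "a \<lless> \<mu>" "\<mu> \<lless> c"
   "\<And>d. d \<in> topspace L ==> a \<lless> d ==> d \<lless> c ==> (x, d) \<in> U \<and> F (u (x, d)) (x, \<mu>) = (x, d)"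
   by (rule vertical_in_box[OF _ U(1,2)]) (rule that)
  obtain d where d: "d \<in> topspace L" "\<mu> \<lless> d" "d \<lless> c" by (rule order_dense[OF \<mu>(1) ac(2,4)])
  have dU: "(x, d) \<in> U" "F (u (x, d)) (x, \<mu>) = (x, d)" using ac(5)[OF d(1) lt_trans[OF ac(3) d(2)] d(3)] by blast+
  show ?thesis
  proof (intro bexI[OF _ ac(1)] conjI ac(3) ballI impI)
   fix \<gamma> assume \<gamma>: "\<gamma> \<in> topspace L" "\<delta> \<lless> \<gamma> \<and> a \<lless> \<gamma> \<and> \<gamma> \<lless> \<mu>"
   hence \<gamma>U: "(x, \<gamma>) \<in> U" "F (u (x, \<gamma>)) (x, \<mu>) = (x, \<gamma>)" using ac(5)[of \<gamma>] ac(4) lt_trans by blast+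
   have "F (u (x, d)) (x, \<gamma>) = (x, d)" using b(8)[OF U(2) b(4)[OF \<gamma>U(1)] b(4)[OF dU(1)]] \<gamma>U(2) dU(2) by simp
   hence "\<mu> \<lless> snd (F (u (x, d)) (x, \<gamma>))" using d(2) by simp
   thus "\<exists>U u F y s. (U, u, F) \<in> A \<and> y \<in> {x} \<and> (y, \<gamma>) \<in> U \<and> s \<in> {0<..<1} \<and> \<mu> \<lless> snd (F s (y, \<gamma>))"
   using UA \<gamma>U(1) b(4)[OF dU(1)] by blast
  qed
 qed
 obtain \<gamma> T where T: "\<gamma> \<in> topspace L" "\<delta> \<lless> \<gamma>" "open T" "T \<inter> {x} \<noteq> {}"
  "\<And>y \<mu>. y \<in> T ==> y \<in> S ==> \<mu> \<in> topspace L ==> \<exists>U u F s. (U, u, F) \<in> A \<and> (y, \<gamma>) \<in> U \<and> s \<in> {0<..<1} \<and> \<mu> \<lless> snd (F s (y, \<gamma>))"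
  by (rule tall_point[OF \<delta> AB step]) (assumption, assumption, rule that)
 have "y \<in> verticals \<delta>" if y: "y \<in> T" "y \<in> S" for y
 proof -
  have zX: "(y, \<gamma>) \<in> topspace X" using y(2) T(1) by simp
  obtain x' \<delta>' where x': "x' \<in> S" "\<delta>' \<in> topspace L" "\<And>t. t \<in> topspace L ==> \<delta>' \<lless> t ==> vertical (x', t)"
   "\<exists>U u F s. (U, u, F) \<in> A \<and> (y, \<gamma>) \<in> U \<and> s \<in> {0<..<1} \<and> fst (F s (y, \<gamma>)) = x'"
   by (rule tall_imp_vertical[OF AB zX T(5)[OF y]]) (assumption, rule that)
  have x'V: "x' \<in> verticals \<delta>" using max[OF x'(2)] x'(1,3) by (auto simp: verticals_def)
  obtain U u F s where U: "(U, u, F) \<in> A" "(y, \<gamma>) \<in> U" "s \<in> {0<..<1}" "fst (F s (y, \<gamma>)) = x'" using x'(4) by (elim exE conjE) (rule that)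
  have UB: "(U, u, F) \<in> B" and Uh: "\<And>q. q \<in> U ==> \<delta> \<lless> snd q" using U(1) by (auto simp: A_def)
  note b = flow_boxD[OF box[OF UB]]
  let ?z = "(y, \<gamma>)"
  \<comment> \<open>The parameters at which the plaque is in the fibre over \<open>x'\<close>:
    closed by continuity, and open by \<open>vertical_plaque\<close>, as the whole box lies above
    \<open>\<delta>\<close>.\<close>
  define D where "D = {r \<in> {0<..<1}. fst (F r ?z) = x'}"
  have "continuous_map (top_of_set {0<..<1}) (top_of_set S) (fst \<circ> (\<lambda>r. F r ?z))"
   by (rule continuous_map_compose[OF plaque_curve_continuous[OF UB U(2)] continuous_map_fst])
  hence "continuous_on {0<..<1} (\<lambda>r. fst (F r ?z))" by (simp add: o_def)
  hence "closedin (top_of_set {0<..<1}) D" unfolding D_def by (rule continuous_closedin_preimage_constant)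
  moreover have "openin (top_of_set {0<..<1}) D"
   unfolding openin_euclidean_subtopology_iff
  proof (intro conjI ballI)
   fix r assume r: "r \<in> D"
   hence r': "r \<in> {0<..<1}" "fst (F r ?z) = x'" by (auto simp: D_def)
   define t where "t = snd (F r ?z)"
   have Fr: "F r ?z = (x', t)" using r'(2) by (simp add: t_def prod_eq_iff)
   have FU: "(x', t) \<in> U" "u (x', t) = r" using b(6,7)[OF U(2) r'(1)] Fr by simp_all
   have "vertical (x', t)" using x'V box_subset[OF UB FU(1)] Uh[OF FU(1)] by (simp add: verticals_def)
   then obtain e where e: "e > 0" "\<And>s. s \<in> {0<..<1} ==> \<bar>s - u (x', t)\<bar> < e ==> fst (F s (x', t)) = x'"
   by (rule vertical_plaque[OF _ UB FU(1)]) (rule that)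
   have "r1 \<in> D" if r1: "r1 \<in> {0<..<1}" "dist r1 r < e" for r1
   using e(2)[OF r1(1)] r1 FU(2) b(8)[OF U(2) r'(1) r1(1)] Fr by (simp add: D_def dist_real_def)
   thus "\<exists>e>0. \<forall>x\<in>{0<..<1}. dist x r < e --> x \<in> D" using e(1) by blast
  qed (auto simp: D_def)
  moreover have "D \<noteq> {}" using U(3,4) by (auto simp: D_def)
  ultimately have "D = {0<..<1}" using connected_Ioo[of 0 "1::real"] unfolding connected_clopen by blast
  hence "u ?z \<in> D" using b(4)[OF U(2)] by blast
  hence "fst (F (u ?z) ?z) = x'" unfolding D_def by blast
  hence "y = x'" using b(5)[OF U(2)] by simp
  thus ?thesis using x'V by simp
 qed
 thus thesis using that[of T] T(3,4) by auto
qed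

theorem ultimately_vertical: "\<exists>\<delta>\<in>topspace L. \<forall>x\<in>S. \<forall>t\<in>topspace L. \<delta> \<lless> t --> vertical (x, t)"
proof -
 obtain \<delta> where \<delta>: "\<delta> \<in> topspace L" "\<And>\<delta>'. \<delta>' \<in> topspace L ==> verticals \<delta>' \<subseteq> verticals \<delta>" by (rule verticals_uniform) (rule that)
 have step: "\<exists>a\<in>topspace L. a \<lless> \<mu> \<and> (\<forall>\<gamma>\<in>topspace L. \<delta> \<lless> \<gamma> \<and> a \<lless> \<gamma> \<and> \<gamma> \<lless> \<mu> -->
   (\<exists>U u F y s. (U, u, F) \<in> B \<and> y \<in> S \<and> (y, \<gamma>) \<in> U \<and> s \<in> {0<..<1} \<and> \<mu> \<lless> snd (F s (y, \<gamma>))))"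
  if \<mu>: "\<mu> \<in> topspace L" for \<mu>
 proof -
  obtain a where a: "a \<in> topspace L" "a \<lless> \<mu>" "\<And>\<gamma>. \<gamma> \<in> topspace L ==> a \<lless> \<gamma> ==> \<gamma> \<lless> \<mu> ==>
   \<exists>U u F y s. (U, u, F) \<in> B \<and> (y, \<gamma>) \<in> U \<and> s \<in> {0<..<1} \<and> \<mu> \<lless> snd (F s (y, \<gamma>))" by (rule crossing_level[OF \<mu>]) (rule that)
  show ?thesis
  proof (intro bexI[OF _ a(1)] conjI a(2) ballI impI)
   fix \<gamma> assume \<gamma>: "\<gamma> \<in> topspace L" "\<delta> \<lless> \<gamma> \<and> a \<lless> \<gamma> \<and> \<gamma> \<lless> \<mu>"
   obtain U u F y s where y: "(U, u, F) \<in> B" "(y, \<gamma>) \<in> U" "s \<in> {0<..<1}" "\<mu> \<lless> snd (F s (y, \<gamma>))"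
   using a(3)[OF \<gamma>(1)] \<gamma>(2) by (elim conjE) blast
   thus "\<exists>U u F y s. (U, u, F) \<in> B \<and> y \<in> S \<and> (y, \<gamma>) \<in> U \<and> s \<in> {0<..<1} \<and> \<mu> \<lless> snd (F s (y, \<gamma>))"
   using box_subset[OF y(1,2)] unfolding fst_conv by blast
  qed
 qed
 obtain \<gamma> T where T: "\<gamma> \<in> topspace L" "\<delta> \<lless> \<gamma>" "open T" "T \<inter> S \<noteq> {}"
  "\<And>y \<mu>. y \<in> T ==> y \<in> S ==> \<mu> \<in> topspace L ==> \<exists>U u F s. (U, u, F) \<in> B \<and> (y, \<gamma>) \<in> U \<and> s \<in> {0<..<1} \<and> \<mu> \<lless> snd (F s (y, \<gamma>))"
  by (rule tall_point[OF \<delta>(1) subset_refl step]) (assumption, rule that)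
 obtain y where y: "y \<in> T" "y \<in> S" using T(4) by blast
 have zX: "(y, \<gamma>) \<in> topspace X" using y(2) T(1) by simp
 obtain x' \<delta>' where x': "x' \<in> S" "\<delta>' \<in> topspace L" "\<And>t. t \<in> topspace L ==> \<delta>' \<lless> t ==> vertical (x', t)"
  by (rule tall_imp_vertical[OF subset_refl zX T(5)[OF y]]) (assumption, rule that)
 have ne: "verticals \<delta> \<noteq> {}" using \<delta>(2)[OF x'(2)] x'(1,3) by (auto simp: verticals_def)
 have "closedin (top_of_set S) (verticals \<delta>)"
 proof -
  have "verticals \<delta> = S \<inter> closure (verticals \<delta>)"
   using verticals_closed[OF \<delta>(1)] closure_subset[of "verticals \<delta>"] unfolding verticals_def by blast
  thus ?thesis using closedin_closed_Int[OF closed_closure] by metis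
 qed
 moreover have "openin (top_of_set S) (verticals \<delta>)"
 proof (subst openin_subopen, intro ballI)
  fix x assume x: "x \<in> verticals \<delta>"
  obtain T where T: "open T" "x \<in> T" "T \<inter> S \<subseteq> verticals \<delta>" by (rule verticals_open[OF \<delta> x])
  have "x \<in> S" using x by (simp add: verticals_def)
  thus "\<exists>T. openin (top_of_set S) T \<and> x \<in> T \<and> T \<subseteq> verticals \<delta>"
   using T openin_open_Int[OF T(1), of S] by (intro exI[of _ "S \<inter> T"]) auto
 qed
 ultimately have "verticals \<delta> = S" using connected ne unfolding connected_clopen by blast
 thus ?thesis using \<delta>(1) unfolding verticals_def by blast
qed

end

section \<open>From charts to flow boxes\<close>

lemma embedding_map_restrict:
 assumes "embedding_map (subtopology X T) Y f" "T' \<subseteq> T"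
 shows "embedding_map (subtopology X T') Y f"
proof -
 have fY: "f ` topspace (subtopology X T) \<subseteq> topspace Y"
  using homeomorphic_imp_surjective_map[OF assms(1)[unfolded embedding_map_def]] unfolding topspace_subtopology[of Y] by blast
 have "homeomorphic_map (subtopology (subtopology X T) T') (subtopology (subtopology Y (f ` topspace (subtopology X T))) (f ` topspace (subtopology X T'))) f"
  using assms(1) unfolding embedding_map_def
  by (rule homeomorphic_map_subtopologies) (use assms(2) fY in auto)
 moreover have "f ` topspace (subtopology X T) \<inter> f ` topspace (subtopology X T') = f ` topspace (subtopology X T')" using assms(2) by auto
 ultimately show ?thesis using assms(2) unfolding embedding_map_def by (simp add: subtopology_subtopology Int_absorb1)
qed

lemma chart_inverse:
 assumes "is_chart p n X (U, \<phi>)"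
 obtains \<psi> where "homeomorphic_maps (subtopology X U) (subtopology (model_space p n) (\<phi> ` U)) \<phi> \<psi>"
  "\<And>q. q \<in> U ==> \<psi> (\<phi> q) = q" "inj_on \<phi> U" "openin X U" "openin (model_space p n) (\<phi> ` U)"
proof -
 have c: "openin X U" "openin (model_space p n) (\<phi> ` U)" "embedding_map (subtopology X U) (model_space p n) \<phi>"
  using assms by (auto simp: is_chart_def)
 have tU: "topspace (subtopology X U) = U" using openin_subset[OF c(1)] by auto
 obtain \<psi> where \<psi>: "homeomorphic_maps (subtopology X U) (subtopology (model_space p n) (\<phi> ` U)) \<phi> \<psi>"
  using c(3) unfolding embedding_map_def tU homeomorphic_map_maps by blast
 have inv: "\<psi> (\<phi> q) = q" if "q \<in> U" for q using \<psi> that unfolding homeomorphic_maps_def tU by blast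
 show thesis by (rule that[OF \<psi> inv _ c(1,2)]) (use inv in \<open>auto intro: inj_on_inverseI\<close>)
qed

lemma chart_restrict:
 assumes "is_chart p n X (U, \<phi>)" "openin X W"
 shows "is_chart p n X (U \<inter> W, \<phi>)"
proof -
 obtain \<psi> where \<psi>: "homeomorphic_maps (subtopology X U) (subtopology (model_space p n) (\<phi> ` U)) \<phi> \<psi>"
  "openin X U" "openin (model_space p n) (\<phi> ` U)" using chart_inverse[OF assms(1)] by metis
 have "homeomorphic_map (subtopology X U) (subtopology (model_space p n) (\<phi> ` U)) \<phi>" using \<psi>(1) homeomorphic_maps_map by blast
 moreover have "openin (subtopology X U) (U \<inter> W)" using assms(2) by (simp add: openin_subtopology_Int2)
 ultimately have "openin (subtopology (model_space p n) (\<phi> ` U)) (\<phi> ` (U \<inter> W))" using homeomorphic_map_openness_eq by blast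
 hence "openin (model_space p n) (\<phi> ` (U \<inter> W))" using \<psi>(3) openin_trans_full by blast
 moreover have "embedding_map (subtopology X (U \<inter> W)) (model_space p n) \<phi>"
  by (rule embedding_map_restrict[of X U]) (use assms(1) in \<open>auto simp: is_chart_def\<close>)
 ultimately show ?thesis using \<psi>(2) assms(2) by (simp add: is_chart_def openin_Int)
qed

text \<open>Coordinate changes are written with \<open>inv_into\<close> of the chart domain;
  injectivity makes the inverses for the smaller and the larger domain agree.\<close>

lemma foliated_change_restrict:
 assumes fc: "foliated_change p n (U, \<phi>) (V, \<psi>)" and inj: "inj_on \<phi> U" and sub: "U' \<subseteq> U" "V' \<subseteq> V"
 shows "foliated_change p n (U', \<phi>) (V', \<psi>)"
proof -
 obtain g h where gh: "embedding_map (subtopology (Euclidean_space (n - p)) (snd ` \<phi> ` (U \<inter> V))) (Euclidean_space (n - p)) h"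
  "\<forall>(x, y)\<in>\<phi> ` (U \<inter> V). \<psi> (inv_into U \<phi> (x, y)) = (g x y, h y)"
  using fc unfolding foliated_change_def by auto
 have "embedding_map (subtopology (Euclidean_space (n - p)) (snd ` \<phi> ` (U' \<inter> V'))) (Euclidean_space (n - p)) h"
  by (rule embedding_map_restrict[OF gh(1)]) (use sub in blast)
 moreover have "\<psi> (inv_into U' \<phi> z) = (g (fst z) (snd z), h (snd z))" if z: "z \<in> \<phi> ` (U' \<inter> V')" for z
 proof -
  obtain q where q: "q \<in> U'" "q \<in> V'" "z = \<phi> q" using z by blast
  have "inv_into U' \<phi> z = q" "inv_into U \<phi> z = q" using q sub inj inj_on_subset[OF inj sub(1)] by (auto simp: inv_into_f_f)
  moreover have "z \<in> \<phi> ` (U \<inter> V)" using q sub by blast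
  ultimately show ?thesis using bspec[OF gh(2), of z] by (auto simp: case_prod_beta)
 qed
 ultimately show ?thesis unfolding foliated_change_def case_prod_conv
  by (intro exI[of _ g] exI[of _ h]) (simp add: case_prod_beta)
qed

text \<open>The transverse coordinate of the second chart is \<open>h\<close> of that of the first,
  with one \<open>h\<close> for the whole overlap. The converse exchanges the two charts.\<close>

lemma same_slice:
 assumes A: "foliated_atlas p n X A" and c: "(U, \<phi>) \<in> A" "(V, \<psi>) \<in> A" and q: "q \<in> U \<inter> V" "q' \<in> U \<inter> V"
 shows "snd (\<phi> q) = snd (\<phi> q') \<longleftrightarrow> snd (\<psi> q) = snd (\<psi> q')"
proof -
 have dir: "snd (\<psi> q) = snd (\<psi> q')" if cc: "(U, \<phi>) \<in> A" "(V, \<psi>) \<in> A" "q \<in> U \<inter> V" "q' \<in> U \<inter> V" and e: "snd (\<phi> q) = snd (\<phi> q')" for U V \<phi> \<psi>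
 proof -
  have fc: "foliated_change p n (U, \<phi>) (V, \<psi>)" and ch: "is_chart p n X (U, \<phi>)" using A cc by (auto simp: foliated_atlas_def)
  have inj: "inj_on \<phi> U" using chart_inverse[OF ch] by metis
  obtain g h where gh: "\<forall>z\<in>\<phi> ` (U \<inter> V). \<psi> (inv_into U \<phi> z) = (g (fst z) (snd z), h (snd z))"
   using fc unfolding foliated_change_def by (auto simp: case_prod_beta)
  have "\<psi> r = (g (fst (\<phi> r)) (snd (\<phi> r)), h (snd (\<phi> r)))" if "r \<in> U \<inter> V" for r
   using bspec[OF gh imageI[OF that]] inj that by (simp add: inv_into_f_f)
  thus ?thesis using cc(3,4) e by simp
 qed
 show ?thesis using dir[OF c q] dir[OF c(2,1)] q by auto
qed

text \<open>The atlas remains foliated when the restricted chart is added, so by maximality the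
  chart is already there.\<close>

lemma foliation_restrict_chart:
 assumes F: "foliation p n X A" and c: "(U, \<phi>) \<in> A" and W: "openin X W"
 shows "(U \<inter> W, \<phi>) \<in> A"
proof -
 let ?c = "(U \<inter> W, \<phi>)"
 have A: "foliated_atlas p n X A" using F by (simp add: foliation_def)
 have ch: "is_chart p n X d" if "d \<in> A" for d using A that by (simp add: foliated_atlas_def)
 have fc: "foliated_change p n d e" if "d \<in> A" "e \<in> A" for d e using A that by (simp add: foliated_atlas_def)
 have inj: "inj_on \<psi> V" if "(V, \<psi>) \<in> A" for V \<psi> using chart_inverse[OF ch[OF that]] by metis
 have 1: "foliated_change p n ?c d" if d: "d \<in> A" for d
 proof (cases d)
  case (Pair V \<psi>)
  show ?thesis unfolding Pair by (rule foliated_change_restrict[OF _ inj[OF c]]) (use fc[OF c] d Pair in auto)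
 qed
 have 2: "foliated_change p n d ?c" if d: "d \<in> A" for d
 proof (cases d)
  case (Pair V \<psi>)
  have "(V, \<psi>) \<in> A" using d Pair by simp
  thus ?thesis unfolding Pair by (intro foliated_change_restrict[OF fc[OF _ c] inj]) auto
 qed
 have 3: "foliated_change p n ?c ?c" by (rule foliated_change_restrict[OF fc[OF c c] inj[OF c]]) auto
 have "U \<subseteq> topspace X" using A c by (force simp: foliated_atlas_def)
 hence "foliated_atlas p n X (insert ?c A)"
  using A chart_restrict[OF ch[OF c] W] 1 2 3 unfolding foliated_atlas_def by auto
 thus ?thesis using F unfolding foliation_def by (metis insertI1 subset_insertI)
qed

text \<open>Inside the chart image a product \<open>QQ \<times> C\<close> of an interval and a
  transverse open set is chosen, and the interval of radius \<open>r\<close> around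
  \<open>x0\<close> is rescaled to the unit interval. In such a product a slice is connected, so
  lying on a common plaque is equality of transverse coordinates.\<close>

lemma chart_flow_box:
 assumes ch: "is_chart 1 (m + 1) X (U, \<phi>)" and W: "openin X W" and p: "p \<in> U" "p \<in> W"
 obtains V v G where "flow_box X (V, v, G)" "p \<in> V" "V \<subseteq> U \<inter> W"
  "\<And>q q'. q \<in> V ==> q' \<in> V ==> G (v q') q = q' \<longleftrightarrow> snd (\<phi> q) = snd (\<phi> q')"
proof -
 define E where "E = model_space 1 (m + 1)"
 have E: "E = prod_topology (top_of_set (coord_space 1)) (top_of_set (coord_space m))"
  by (simp add: E_def model_space_def Euclidean_space_eq)
 obtain \<psi> where \<psi>0: "homeomorphic_maps (subtopology X U) (subtopology (model_space 1 (m + 1)) (\<phi> ` U)) \<phi> \<psi>"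
  "\<And>q. q \<in> U ==> \<psi> (\<phi> q) = q" "inj_on \<phi> U" "openin X U" "openin (model_space 1 (m + 1)) (\<phi> ` U)"
  by (rule chart_inverse[OF ch]) (rule that)
 note \<psi> = \<psi>0[folded E_def]
 have tU: "topspace (subtopology X U) = U" and tE: "topspace (subtopology E (\<phi> ` U)) = \<phi> ` U"
  using openin_subset[OF \<psi>(4)] openin_subset[OF \<psi>(5)] by auto
 have c\<phi>: "continuous_map (subtopology X U) E \<phi>" and c\<psi>: "continuous_map (subtopology E (\<phi> ` U)) (subtopology X U) \<psi>"
  and \<phi>\<psi>: "\<And>z. z \<in> \<phi> ` U ==> \<phi> (\<psi> z) = z"
  using \<psi>(1) unfolding homeomorphic_maps_def tU tE by (auto simp: continuous_map_in_subtopology)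
 have \<psi>U: "\<psi> z \<in> U" if "z \<in> \<phi> ` U" for z using \<psi>(2) that by auto
 define N where "N = {z \<in> \<phi> ` U. \<psi> z \<in> W}"
 have "openin (subtopology E (\<phi> ` U)) N"
  using openin_continuous_map_preimage[OF continuous_map_into_fulltopology[OF c\<psi>] W] unfolding tE N_def .
 hence No: "openin E N" using \<psi>(5) openin_trans_full by blast
 define x0 y0 where "x0 = fst (\<phi> p)" and "y0 = snd (\<phi> p)"
 have "(x0, y0) \<in> N" using p \<psi>(2) by (simp add: N_def x0_def y0_def)
 then obtain D C where DC: "openin (top_of_set (coord_space 1)) D" "openin (top_of_set (coord_space m)) C" "x0 \<in> D" "y0 \<in> C" "D \<times> C \<subseteq> N"
  using No unfolding E openin_prod_topology_alt by meson
 obtain r where r0: "r > 0" "coord_cube 1 x0 r \<subseteq> D" by (rule coord_cube_inside[OF DC(1,3)])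
 define QQ where "QQ = coord_cube 1 x0 r"
 note r = r0[folded QQ_def]
 have Qo: "openin (top_of_set (coord_space 1)) QQ" unfolding QQ_def by (rule openin_coord_cube)
 have QN: "QQ \<times> C \<subseteq> N" using r(2) DC(5) by blast
 define V where "V = {q \<in> U. \<phi> q \<in> QQ \<times> C}"
 define v where "v q = (fst (\<phi> q) 0 - x0 0 + r) / (2 * r)" for q
 define e where "e s = (\<lambda>i::nat. if i = 0 then x0 0 - r + 2 * r * s else 0)" for s :: real
 define G where "G s q = \<psi> (e s, snd (\<phi> q))" for s q
 have cube: "x \<in> QQ \<longleftrightarrow> x \<in> coord_space 1 \<and> \<bar>x 0 - x0 0\<bar> < r" for x unfolding QQ_def coord_cube_def by auto
 have es: "e s \<in> QQ" if "s \<in> {0<..<1}" for s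
 proof -
  have "2 * r * s < 2 * r * 1" "0 < 2 * r * s" using r(1) that by (auto intro!: mult_strict_left_mono)
  thus ?thesis unfolding cube by (auto simp: e_def abs_if)
 qed
 have ev: "e (v q) = fst (\<phi> q)" if "q \<in> V" for q
 proof
  fix i show "e (v q) i = fst (\<phi> q) i" using that r(1) by (cases "i = 0") (auto simp: e_def v_def V_def cube mem_Times_iff)
 qed
 have ve: "(e s 0 - x0 0 + r) / (2 * r) = s" for s using r(1) by (simp add: e_def)
 have e_inj: "s = t" if "e s = e t" for s t using fun_cong[OF that, of 0] r(1) by (simp add: e_def)
 have GN: "(e s, snd (\<phi> q)) \<in> QQ \<times> C" if "s \<in> {0<..<1}" "q \<in> V" for s q using es that by (auto simp: V_def)
 have NU: "z \<in> \<phi> ` U" if "z \<in> QQ \<times> C" for z using QN that by (auto simp: N_def)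
 have \<phi>G: "\<phi> (G s q) = (e s, snd (\<phi> q))" "G s q \<in> V" if "s \<in> {0<..<1}" "q \<in> V" for s q
  using \<phi>\<psi>[OF NU[OF GN[OF that]]] \<psi>U[OF NU[OF GN[OF that]]] GN[OF that] by (simp_all add: G_def V_def)
 have v01: "v q \<in> {0<..<1}" if "q \<in> V" for q
 proof -
  have "\<bar>fst (\<phi> q) 0 - x0 0\<bar> < r" using that by (auto simp: V_def cube mem_Times_iff)
  thus ?thesis using r(1) by (auto simp: v_def field_simps abs_if split: if_splits)
 qed
 have Vo: "openin X V"
 proof -
  have "openin E (QQ \<times> C)" unfolding E openin_prod_Times_iff using Qo DC(2) by blast
  from openin_continuous_map_preimage[OF c\<phi> this] have "openin (subtopology X U) V" unfolding tU V_def .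
  thus ?thesis using \<psi>(4) openin_trans_full by blast
 qed
 have VU: "V \<subseteq> U" by (auto simp: V_def)
 have c\<phi>V: "continuous_map (subtopology X V) E \<phi>"
  using continuous_map_from_subtopology[OF c\<phi>, of V] VU by (simp add: subtopology_subtopology Int_absorb1)
 have c1: "continuous_map (subtopology X V) (top_of_set (coord_space 1)) (fst \<circ> \<phi>)"
  using continuous_map_compose[OF c\<phi>V[unfolded E] continuous_map_fst] .
 have c2: "continuous_map (subtopology X V) (top_of_set (coord_space m)) (snd \<circ> \<phi>)"
  using continuous_map_compose[OF c\<phi>V[unfolded E] continuous_map_snd] .
 have "continuous_map (top_of_set (coord_space 1)) euclideanreal (\<lambda>x. (x 0 - x0 0 + r) / (2 * r))"
  using r(1) by (auto intro!: continuous_intros continuous_on_product_coordinates continuous_on_subset[OF continuous_on_product_coordinates])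
 from continuous_map_compose[OF c1 this] have vc: "continuous_map (subtopology X V) euclideanreal v" by (simp add: o_def v_def[abs_def])
 let ?Z = "prod_topology (top_of_set {0<..<1::real}) (subtopology X V)"
 have "continuous_on {0<..<1} e"
 proof (rule continuous_on_coordinatewise_then_product)
  fix i show "continuous_on {0<..<1} (\<lambda>s. e s i)" by (cases "i = 0") (auto simp: e_def intro!: continuous_intros)
 qed
 hence ec: "continuous_map (top_of_set {0<..<1}) (top_of_set (coord_space 1)) e"
  using es by (auto simp: continuous_map_in_subtopology cube)
 have "continuous_map ?Z E (\<lambda>z. (e (fst z), snd (\<phi> (snd z))))"
  unfolding E continuous_map_pairwise
  using continuous_map_compose[OF continuous_map_fst ec, of "subtopology X V"] continuous_map_compose[OF continuous_map_snd c2, of "top_of_set {0<..<1}"]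
  by (simp add: o_def)
 moreover have "(e (fst z), snd (\<phi> (snd z))) \<in> \<phi> ` U" if "z \<in> topspace ?Z" for z using NU[OF GN] that by auto
 ultimately have "continuous_map ?Z (subtopology E (\<phi> ` U)) (\<lambda>z. (e (fst z), snd (\<phi> (snd z))))"
  by (auto simp: continuous_map_in_subtopology)
 from continuous_map_compose[OF this continuous_map_into_fulltopology[OF c\<psi>]]
 have Gc: "continuous_map ?Z X (\<lambda>(s, q). G s q)" by (simp add: o_def G_def case_prod_unfold)
 show thesis
 proof (rule that)
  have "G (v q) q = q" if "q \<in> V" for q using ev[OF that] \<psi>(2)[OF subsetD[OF VU that]] by (simp add: G_def)
  moreover have "G t (G s q) = G t q" if "q \<in> V" "s \<in> {0<..<1}" for s t q using \<phi>G[OF that(2,1)] by (simp add: G_def)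
  moreover have "v (G s q) = s" if "q \<in> V" "s \<in> {0<..<1}" for s q using \<phi>G[OF that(2,1)] ve by (simp add: v_def)
  ultimately show "flow_box X (V, v, G)"
   unfolding flow_box_def using Vo vc Gc \<phi>G(2) v01 by auto
  show "p \<in> V" using p(1) r(1) DC(4) openin_subset[OF DC(1)] DC(3) by (auto simp: V_def cube mem_Times_iff x0_def y0_def)
  show "V \<subseteq> U \<inter> W"
  proof
   fix q assume q: "q \<in> V"
   hence "\<phi> q \<in> N" using QN by (auto simp: V_def)
   hence "\<psi> (\<phi> q) \<in> W" unfolding N_def by blast
   thus "q \<in> U \<inter> W" using \<psi>(2)[of q] q VU by auto
  qed
  fix q q' assume q: "q \<in> V" "q' \<in> V"
  have "G (v q') q = q' \<longleftrightarrow> \<phi> (G (v q') q) = \<phi> q'"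
   using inj_on_eq_iff[OF \<psi>(3), of "G (v q') q" q'] \<phi>G(2)[OF v01[OF q(2)] q(1)] q(2) VU by blast
  also have "\<dots> \<longleftrightarrow> snd (\<phi> q) = snd (\<phi> q')" unfolding \<phi>G(1)[OF v01[OF q(2)] q(1)] by (simp add: prod_eq_iff ev[OF q(2)])
  finally show "G (v q') q = q' \<longleftrightarrow> snd (\<phi> q) = snd (\<phi> q')" .
 qed
qed

text \<open>Each box is tied to a chart that sees its plaques as slices, so compatibility of boxes
  reduces to compatibility of charts.\<close>

definition chart_boxes :: "'a topology => 'a fchart set => 'a box set" where
 "chart_boxes X A = {(V, v, G). flow_box X (V, v, G) \<and>
  (\<exists>U \<phi>. (U, \<phi>) \<in> A \<and> V \<subseteq> U \<and> (\<forall>q\<in>V. \<forall>q'\<in>V. G (v q') q = q' \<longleftrightarrow> snd (\<phi> q) = snd (\<phi> q')))}"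

lemma chart_boxes_slice:
 assumes A: "foliated_atlas p n X A" and b: "(V, v, G) \<in> chart_boxes X A" and c: "(U, \<phi>) \<in> A" and q: "q \<in> U \<inter> V" "q' \<in> U \<inter> V"
 shows "G (v q') q = q' \<longleftrightarrow> snd (\<phi> q) = snd (\<phi> q')"
proof -
 obtain U' \<phi>' where c': "(U', \<phi>') \<in> A" "V \<subseteq> U'" "\<forall>q\<in>V. \<forall>q'\<in>V. G (v q') q = q' \<longleftrightarrow> snd (\<phi>' q) = snd (\<phi>' q')"
  using b unfolding chart_boxes_def by blast
 show ?thesis using c'(3) same_slice[OF A c'(1) c, of q q'] q c'(2) by blast
qed

lemma flow_structure_chart_boxes:
 assumes A: "foliated_atlas 1 (m + 1) X A"
 shows "flow_structure X (chart_boxes X A)"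
 unfolding flow_structure_def
proof (intro conjI allI impI ballI)
 show "flow_box X b" if "b \<in> chart_boxes X A" for b using that by (auto simp: chart_boxes_def)
next
 fix U u F V v G p q
 assume a: "(U, u, F) \<in> chart_boxes X A" "(V, v, G) \<in> chart_boxes X A" "p \<in> U \<inter> V" "q \<in> U \<inter> V" "F (u q) p = q"
 obtain U' \<phi> where c: "(U', \<phi>) \<in> A" "U \<subseteq> U'" using a(1) unfolding chart_boxes_def by blast
 have m: "p \<in> U' \<inter> U" "q \<in> U' \<inter> U" "p \<in> U' \<inter> V" "q \<in> U' \<inter> V" using a(3,4) c(2) by blast+
 show "G (v q) p = q" using chart_boxes_slice[OF A a(1) c(1) m(1,2)] chart_boxes_slice[OF A a(2) c(1) m(3,4)] a(5) by blast
next
 fix p W assume W: "openin X W" "p \<in> W"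
 have "p \<in> topspace X" using W openin_subset by blast
 hence "p \<in> (\<Union>c\<in>A. fst c)" using A by (simp add: foliated_atlas_def)
 then obtain U \<phi> where c: "(U, \<phi>) \<in> A" "p \<in> U" by force
 have ch: "is_chart 1 (m + 1) X (U, \<phi>)" using A c(1) by (simp add: foliated_atlas_def)
 obtain V v G where V: "flow_box X (V, v, G)" "p \<in> V" "V \<subseteq> U \<inter> W"
  "\<And>q q'. q \<in> V ==> q' \<in> V ==> G (v q') q = q' \<longleftrightarrow> snd (\<phi> q) = snd (\<phi> q')"
  by (rule chart_flow_box[OF ch W(1) c(2) W(2)]) (rule that)
 hence "(V, v, G) \<in> chart_boxes X A" unfolding chart_boxes_def using c(1) by blast
 thus "\<exists>U u F. (U, u, F) \<in> chart_boxes X A \<and> p \<in> U \<and> U \<subseteq> W" using V by blast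
qed

definition push_box :: "('a => 'b) => ('b => 'a) => 'a box => 'b box" where
 "push_box h k = (\<lambda>(U, u, F). (h ` U, u \<circ> k, \<lambda>s q. h (F s (k q))))"

lemma flow_structure_push:
 assumes hk: "homeomorphic_maps X Y h k" and B: "flow_structure X B"
 shows "flow_structure Y (push_box h k ` B)"
proof -
 have h: "homeomorphic_map X Y h" and ch: "continuous_map X Y h" and ck: "continuous_map Y X k"
  and kh: "\<And>x. x \<in> topspace X ==> k (h x) = x" and hk': "\<And>y. y \<in> topspace Y ==> h (k y) = y"
  using hk homeomorphic_maps_map unfolding homeomorphic_maps_def by blast+
 have box: "flow_box X b" if "b \<in> B" for b using B that by (auto simp: flow_structure_def)
 have sub: "q \<in> topspace X" if "(U, u, F) \<in> B" "q \<in> U" for U u F q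
  using openin_subset[OF flow_boxD(1)[OF box[OF that(1)]]] that(2) by blast
 have fb: "flow_box Y (h ` U, u \<circ> k, \<lambda>s q. h (F s (k q)))" if b: "(U, u, F) \<in> B" for U u F
 proof -
  note f = flow_boxD[OF box[OF b]]
  have hU: "openin Y (h ` U)" using f(1) h homeomorphic_map_openness_eq by blast
  have kU: "k (h q) = q" if "q \<in> U" for q using kh sub[OF b that] .
  have ckU: "continuous_map (subtopology Y (h ` U)) (subtopology X U) k"
   using continuous_map_from_subtopology[OF ck] kU by (auto simp: continuous_map_in_subtopology)
  have "continuous_map (prod_topology (top_of_set {0<..<1::real}) (subtopology Y (h ` U))) (prod_topology (top_of_set {0<..<1}) (subtopology X U)) (\<lambda>z. (fst z, k (snd z)))"
   using continuous_map_compose[OF continuous_map_snd ckU, of "top_of_set {0<..<1::real}"] continuous_map_fst[of "top_of_set {0<..<1::real}" "subtopology Y (h ` U)"]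
   by (simp add: continuous_map_pairwise o_def)
  from continuous_map_compose[OF continuous_map_compose[OF this f(3)] ch]
  have Fc: "continuous_map (prod_topology (top_of_set {0<..<1}) (subtopology Y (h ` U))) Y (\<lambda>(s, q). h (F s (k q)))"
   by (simp add: o_def case_prod_unfold)
  have uc: "continuous_map (subtopology Y (h ` U)) euclideanreal (u \<circ> k)" by (rule continuous_map_compose[OF ckU f(2)])
  show ?thesis unfolding flow_box_def using hU Fc uc f(4-8) kU by auto
 qed
 show ?thesis unfolding flow_structure_def
 proof (intro conjI allI impI ballI)
  show "flow_box Y b" if "b \<in> push_box h k ` B" for b using that fb by (auto simp: push_box_def)
 next
  fix U u F V v G p q
  assume a: "(U, u, F) \<in> push_box h k ` B" "(V, v, G) \<in> push_box h k ` B" "p \<in> U \<inter> V" "q \<in> U \<inter> V" "F (u q) p = q"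
  obtain U' u' F' where b1: "(U', u', F') \<in> B" "U = h ` U'" "u = u' \<circ> k" "F = (\<lambda>s q. h (F' s (k q)))" using a(1) by (auto simp: push_box_def)
  obtain V' v' G' where b2: "(V', v', G') \<in> B" "V = h ` V'" "v = v' \<circ> k" "G = (\<lambda>s q. h (G' s (k q)))" using a(2) by (auto simp: push_box_def)
  have pull: "k x \<in> U \<and> h (k x) = x" if b: "(U, u, F) \<in> B" and x: "x \<in> h ` U" for U u F x
   using x kh[OF sub[OF b]] by auto
  have m: "k p \<in> U' \<inter> V'" "k q \<in> U' \<inter> V'" "h (k q) = q"
   using pull[OF b1(1)] pull[OF b2(1)] a(3,4) unfolding b1(2) b2(2) by blast+
  have FU: "F' (u' (k q)) (k p) \<in> U'" using flow_boxD(4,6)[OF box[OF b1(1)]] m by blast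
  have "h (F' (u' (k q)) (k p)) = q" using a(5) by (simp add: b1(3,4))
  hence "F' (u' (k q)) (k p) = k q" using kh[OF sub[OF b1(1) FU]] by simp
  hence "G' (v' (k q)) (k p) = k q"
   using B b1(1) b2(1) m(1,2) unfolding flow_structure_def by blast
  thus "G (v q) p = q" using m(3) by (simp add: b2(3,4))
 next
  fix p W assume W: "openin Y W" "p \<in> W"
  have p: "p \<in> topspace Y" using W openin_subset by blast
  have "openin X {x \<in> topspace X. h x \<in> W}" by (rule openin_continuous_map_preimage[OF ch W(1)])
  moreover have "k p \<in> {x \<in> topspace X. h x \<in> W}" using ck p W(2) hk'[OF p] unfolding continuous_map_def by auto
  ultimately obtain U u F where U: "(U, u, F) \<in> B" "k p \<in> U" "U \<subseteq> {x \<in> topspace X. h x \<in> W}"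
   using B unfolding flow_structure_def by meson
  have "(h ` U, u \<circ> k, \<lambda>s q. h (F s (k q))) \<in> push_box h k ` B" using imageI[OF U(1), of "push_box h k"] by (simp add: push_box_def)
  moreover have "p \<in> h ` U" using hk'[OF p] U(2) by (metis imageI)
  moreover have "h ` U \<subseteq> W" using U(3) by blast
  ultimately show "\<exists>U u F. (U, u, F) \<in> push_box h k ` B \<and> p \<in> U \<and> U \<subseteq> W" by blast
 qed
qed

text \<open>If no plaque leaves the level, then \<open>F s\<close> maps it into itself and the boxes
  restrict to it. This produces the foliation of the compact factor in the indirect argument for
  \<open>crossing\<close>.\<close>

lemma flow_structure_level:
 assumes B: "flow_structure (prod_topology Y L) B" and \<mu>: "\<mu> \<in> topspace L"
  and sat: "\<And>U u F q s. (U, u, F) \<in> B ==> q \<in> U ==> s \<in> {0<..<1} ==> snd q = \<mu> ==> snd (F s q) = \<mu>"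
 shows "flow_structure Y ((\<lambda>(U, u, F). ({x \<in> topspace Y. (x, \<mu>) \<in> U}, \<lambda>x. u (x, \<mu>), \<lambda>s x. fst (F s (x, \<mu>)))) ` B)"
  (is "flow_structure Y (?f ` B)")
proof -
 let ?X = "prod_topology Y L"
 have box: "flow_box ?X b" if "b \<in> B" for b using B that by (auto simp: flow_structure_def)
 have inc: "continuous_map Y ?X (\<lambda>x. (x, \<mu>))" using \<mu> by (simp add: continuous_map_pairwise o_def)
 have Fe: "(fst (F s (x, \<mu>)), \<mu>) = F s (x, \<mu>)" if "(U, u, F) \<in> B" "(x, \<mu>) \<in> U" "s \<in> {0<..<1}" for U u F x s
  using sat[OF that] by (simp add: prod_eq_iff)
 have FY: "fst (F s (x, \<mu>)) \<in> topspace Y" if "(U, u, F) \<in> B" "(x, \<mu>) \<in> U" "s \<in> {0<..<1}" for U u F x s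
  using openin_subset[OF flow_boxD(1)[OF box[OF that(1)]]] flow_boxD(6)[OF box[OF that(1)] that(2,3)] by fastforce
 have fb: "flow_box Y (?f (U, u, F))" if b: "(U, u, F) \<in> B" for U u F
 proof -
  note f = flow_boxD[OF box[OF b]]
  let ?V = "{x \<in> topspace Y. (x, \<mu>) \<in> U}"
  have Vo: "openin Y ?V" by (rule openin_continuous_map_preimage[OF inc f(1)])
  have iV: "continuous_map (subtopology Y ?V) (subtopology ?X U) (\<lambda>x. (x, \<mu>))"
   using continuous_map_from_subtopology[OF inc, of ?V] by (auto simp: continuous_map_in_subtopology)
  have uc: "continuous_map (subtopology Y ?V) euclideanreal (\<lambda>x. u (x, \<mu>))"
   using continuous_map_compose[OF iV f(2)] by (simp add: o_def)
  have "continuous_map (prod_topology (top_of_set {0<..<1::real}) (subtopology Y ?V)) (prod_topology (top_of_set {0<..<1}) (subtopology ?X U)) (\<lambda>z. (fst z, (snd z, \<mu>)))"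
   unfolding continuous_map_pairwise[of _ "top_of_set {0<..<1::real}"]
   using continuous_map_compose[OF continuous_map_snd iV, of "top_of_set {0<..<1::real}"] continuous_map_fst[of "top_of_set {0<..<1::real}" "subtopology Y ?V"]
   by (simp add: o_def)
  from continuous_map_compose[OF continuous_map_compose[OF this f(3)] continuous_map_fst]
  have Fc: "continuous_map (prod_topology (top_of_set {0<..<1}) (subtopology Y ?V)) Y (\<lambda>(s, x). fst (F s (x, \<mu>)))"
   by (simp add: o_def case_prod_unfold)
  show ?thesis unfolding flow_box_def case_prod_conv
  proof (intro conjI ballI Vo uc Fc)
   fix x assume x: "x \<in> ?V"
   hence xU: "(x, \<mu>) \<in> U" by blast
   show "0 < u (x, \<mu>)" "u (x, \<mu>) < 1" "fst (F (u (x, \<mu>)) (x, \<mu>)) = x" using f(4,5)[OF xU] by auto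
   fix s :: real assume s: "s \<in> {0<..<1}"
   show "fst (F s (x, \<mu>)) \<in> ?V" using FY[OF b xU s] Fe[OF b xU s] f(6)[OF xU s] by simp
   show "u (fst (F s (x, \<mu>)), \<mu>) = s" using Fe[OF b xU s] f(7)[OF xU s] by simp
   fix t :: real assume t: "t \<in> {0<..<1}"
   show "fst (F t (fst (F s (x, \<mu>)), \<mu>)) = fst (F t (x, \<mu>))" using Fe[OF b xU s] f(8)[OF xU s t] by simp
  qed
 qed
 show ?thesis unfolding flow_structure_def
 proof (intro conjI allI impI ballI)
  show "flow_box Y b" if b: "b \<in> ?f ` B" for b
  proof -
   obtain c where "c \<in> B" "b = ?f c" using b by blast
   thus ?thesis using fb[of "fst c" "fst (snd c)" "snd (snd c)"] by simp
  qed
 next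
  fix U u F V v G p q
  assume a: "(U, u, F) \<in> ?f ` B" "(V, v, G) \<in> ?f ` B" "p \<in> U \<inter> V" "q \<in> U \<inter> V" "F (u q) p = q"
  obtain U' u' F' where b1: "(U', u', F') \<in> B" "U = {x \<in> topspace Y. (x, \<mu>) \<in> U'}" "u = (\<lambda>x. u' (x, \<mu>))" "F = (\<lambda>s x. fst (F' s (x, \<mu>)))" using a(1) by auto
  obtain V' v' G' where b2: "(V', v', G') \<in> B" "V = {x \<in> topspace Y. (x, \<mu>) \<in> V'}" "v = (\<lambda>x. v' (x, \<mu>))" "G = (\<lambda>s x. fst (G' s (x, \<mu>)))" using a(2) by auto
  have m: "(p, \<mu>) \<in> U' \<inter> V'" "(q, \<mu>) \<in> U' \<inter> V'" using a(3,4) b1(2) b2(2) by auto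
  have "F' (u' (q, \<mu>)) (p, \<mu>) = (q, \<mu>)"
   using Fe[OF b1(1) _ flow_boxD(4)[OF box[OF b1(1)]], of p "(q, \<mu>)"] a(5) m unfolding b1(3,4) by auto
  hence "G' (v' (q, \<mu>)) (p, \<mu>) = (q, \<mu>)" using B b1(1) b2(1) m unfolding flow_structure_def by blast
  thus "G (v q) p = q" by (simp add: b2(3,4))
 next
  fix p W assume W: "openin Y W" "p \<in> W"
  have "openin ?X (W \<times> topspace L)" using W(1) by (simp add: openin_prod_Times_iff)
  moreover have "(p, \<mu>) \<in> W \<times> topspace L" using W(2) \<mu> by simp
  ultimately obtain U u F where U: "(U, u, F) \<in> B" "(p, \<mu>) \<in> U" "U \<subseteq> W \<times> topspace L"
   using B unfolding flow_structure_def by meson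
  have "p \<in> topspace Y" using W openin_subset by blast
  hence "p \<in> {x \<in> topspace Y. (x, \<mu>) \<in> U}" "{x \<in> topspace Y. (x, \<mu>) \<in> U} \<subseteq> W" using U by auto
  thus "\<exists>U u F. (U, u, F) \<in> ?f ` B \<and> p \<in> U \<and> U \<subseteq> W" using imageI[OF U(1), of ?f] unfolding case_prod_conv by blast
 qed
qed

section \<open>Leaves\<close>

context long_line
begin

text \<open>\<open>across\<close> makes the first component locally constant, hence constant, on a
  plaque; so every \<open>{x} \<times> T\<close> is a union of plaques and is open and closed for
  the leaf topology. \<open>along\<close> makes the curve up the fibre continuous for the leaf
  topology, so the set is path connected.\<close>

lemma leaves_of_vertical_charts:
 fixes M :: "'m topology" and A :: "('m \<times> 'p) fchart set" and \<delta> :: 'p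
 defines "T \<equiv> {t \<in> topspace L. \<delta> \<lless> t}"
 assumes \<delta>: "\<delta> \<in> topspace L"
  and cover: "\<And>p. p \<in> topspace M \<times> T ==> \<exists>U \<phi>. (U, \<phi>) \<in> A \<and> p \<in> U"
  and sub: "\<And>U \<phi>. (U, \<phi>) \<in> A ==> U \<subseteq> topspace M \<times> T"
  and along: "\<And>U \<phi> x t. (U, \<phi>) \<in> A ==> (x, t) \<in> U ==> \<exists>a\<in>topspace L. \<exists>b\<in>topspace L. a \<lless> t \<and> t \<lless> b \<and>
   (\<forall>c\<in>topspace L. a \<lless> c \<and> c \<lless> b --> (x, c) \<in> U \<and> snd (\<phi> (x, c)) = snd (\<phi> (x, t)))"
  and across: "\<And>U \<phi> p. (U, \<phi>) \<in> A ==> p \<in> U ==> \<exists>N. openin (prod_topology M L) N \<and> p \<in> N \<and>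
   (\<forall>q\<in>N \<inter> U. snd (\<phi> q) = snd (\<phi> p) --> fst q = fst p)"
 shows "leaves (subtopology (prod_topology M L) (topspace M \<times> T)) A = {{x} \<times> T | x. x \<in> topspace M}"
proof -
 let ?X = "prod_topology M L" and ?W = "topspace M \<times> T"
 let ?LT = "leaf_topology (subtopology ?X ?W) A" and ?P = "plaques (subtopology ?X ?W) A"
 have TL: "T \<subseteq> topspace L" by (auto simp: T_def)
 have plaqueE: "\<exists>U \<phi> y. (U, \<phi>) \<in> A \<and> P \<in> connected_components_of (subtopology ?X {u \<in> U. snd (\<phi> u) = y})" if P: "P \<in> ?P" for P
 proof -
  obtain U \<phi> y where U: "(U, \<phi>) \<in> A" "P \<in> connected_components_of (subtopology (subtopology ?X ?W) {u \<in> U. snd (\<phi> u) = y})"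
   using P unfolding plaques_def by blast
  have "?W \<inter> {u \<in> U. snd (\<phi> u) = y} = {u \<in> U. snd (\<phi> u) = y}" using sub[OF U(1)] by blast
  hence "P \<in> connected_components_of (subtopology ?X {u \<in> U. snd (\<phi> u) = y})" using U(2) by (simp only: subtopology_subtopology)
  thus ?thesis using U(1) by blast
 qed
 have plaqueI: "P \<in> ?P" if "(U, \<phi>) \<in> A" "P \<in> connected_components_of (subtopology ?X {u \<in> U. snd (\<phi> u) = y})" for U \<phi> y P
 proof -
  have "?W \<inter> {u \<in> U. snd (\<phi> u) = y} = {u \<in> U. snd (\<phi> u) = y}" using sub[OF that(1)] by blast
  hence "P \<in> connected_components_of (subtopology (subtopology ?X ?W) {u \<in> U. snd (\<phi> u) = y})"
   using that(2) by (simp add: subtopology_subtopology)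
  thus ?thesis using that(1) unfolding plaques_def by blast
 qed
 have fiber: "P \<subseteq> {fst p} \<times> T" if P: "P \<in> ?P" and p: "p \<in> P" for P p
 proof -
  obtain U \<phi> y where U: "(U, \<phi>) \<in> A" and C: "P \<in> connected_components_of (subtopology ?X {u \<in> U. snd (\<phi> u) = y})" using plaqueE[OF P] by blast
  have PU: "P \<subseteq> {u \<in> U. snd (\<phi> u) = y}" using connected_components_of_subset[OF C] by auto
  have con: "connectedin ?X P" using connectedin_connected_components_of[OF C] by (simp add: connectedin_subtopology)
  have PX: "P \<subseteq> topspace ?X" using con connectedin_subset_topspace by blast
  have tP: "topspace (subtopology ?X P) = P" using PX by auto
  have op: "openin (subtopology ?X P) {q \<in> P. (fst q = fst p) = k}" for k
  proof (subst openin_subopen, intro ballI)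
   fix q assume q: "q \<in> {q \<in> P. (fst q = fst p) = k}"
   hence qU: "q \<in> U" using PU by blast
   obtain N where N: "openin ?X N" "q \<in> N" "\<forall>q'\<in>N \<inter> U. snd (\<phi> q') = snd (\<phi> q) --> fst q' = fst q" using across[OF U qU] by blast
   have "fst q' = fst q" if "q' \<in> P \<inter> N" for q' using N(3) that PU q by blast
   hence "P \<inter> N \<subseteq> {q \<in> P. (fst q = fst p) = k}" using q by auto
   thus "\<exists>T. openin (subtopology ?X P) T \<and> q \<in> T \<and> T \<subseteq> {q \<in> P. (fst q = fst p) = k}"
   using N(1,2) q openin_subtopology_Int2[OF N(1), of P] by (intro exI[of _ "P \<inter> N"]) auto
  qed
  have "P - {q \<in> P. (fst q = fst p) = True} = {q \<in> P. (fst q = fst p) = False}" by blast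
  hence "closedin (subtopology ?X P) {q \<in> P. (fst q = fst p) = True}" using op[of False] unfolding closedin_def tP by auto
  moreover have "connected_space (subtopology ?X P)" using con by (simp add: connectedin_def)
  ultimately have "{q \<in> P. (fst q = fst p) = True} = {} \<or> {q \<in> P. (fst q = fst p) = True} = P"
   using op[of True] unfolding connected_space_clopen_in tP by blast
  hence eq: "fst q = fst p" if "q \<in> P" for q using p that by blast
  have PW: "P \<subseteq> ?W" using PU sub[OF U] by blast
  show ?thesis
  proof
   fix q assume q: "q \<in> P"
   hence "q \<in> topspace M \<times> T" using PW by (rule subsetD[rotated])
   hence "snd q \<in> T" by (simp only: mem_Times_iff)
   thus "q \<in> {fst p} \<times> T" using eq[OF q] by (simp add: mem_Times_iff)
  qed
 qed
 have exP: "\<exists>P. P \<in> ?P \<and> p \<in> P" if p: "p \<in> ?W" for p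
 proof -
  obtain U \<phi> where U: "(U, \<phi>) \<in> A" "p \<in> U" using cover[OF p] by blast
  have "p \<in> topspace (subtopology ?X {u \<in> U. snd (\<phi> u) = snd (\<phi> p)})" using U(2) p TL by (auto simp: mem_Times_iff)
  hence "p \<in> \<Union>(connected_components_of (subtopology ?X {u \<in> U. snd (\<phi> u) = snd (\<phi> p)}))"
   by (simp only: Union_connected_components_of)
  then obtain P where "P \<in> connected_components_of (subtopology ?X {u \<in> U. snd (\<phi> u) = snd (\<phi> p)})" "p \<in> P" by blast
  thus ?thesis using plaqueI[OF U(1)] by blast
 qed
 have PW: "P \<subseteq> ?W" if P: "P \<in> ?P" for P
 proof
  fix p assume p: "p \<in> P"
  obtain U \<phi> y where U: "(U, \<phi>) \<in> A" "P \<in> connected_components_of (subtopology ?X {u \<in> U. snd (\<phi> u) = y})" using plaqueE[OF P] by blast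
  thus "p \<in> ?W" using connected_components_of_subset[OF U(2)] sub[OF U(1)] p by auto
 qed
 have tLT: "topspace ?LT = ?W" unfolding leaf_topology_def topology_generated_by_topspace using exP PW by blast
 have fo: "openin ?LT ({x} \<times> T)" if x: "x \<in> topspace M" for x
 proof (subst openin_subopen, intro ballI)
  fix p assume p: "p \<in> {x} \<times> T"
  hence "p \<in> ?W" "fst p = x" using x by auto
  then obtain P where P: "P \<in> ?P" "p \<in> P" using exP by blast
  have "openin ?LT P" unfolding leaf_topology_def by (rule topology_generated_by_Basis[OF P(1)])
  thus "\<exists>S. openin ?LT S \<and> p \<in> S \<and> S \<subseteq> {x} \<times> T" using P fiber[OF P] \<open>fst p = x\<close> by blast
 qed
 have fc: "closedin ?LT ({x} \<times> T)" if x: "x \<in> topspace M" for x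
 proof -
  have "openin ?LT (\<Union>x'\<in>topspace M - {x}. {x'} \<times> T)" using fo by (intro openin_Union) auto
  moreover have "?W - {x} \<times> T = (\<Union>x'\<in>topspace M - {x}. {x'} \<times> T)" by auto
  ultimately show ?thesis unfolding closedin_def tLT using x by auto
 qed
 have path: "path_component_of ?LT (x, s) (x, t)" if x: "x \<in> topspace M" and st: "s \<in> T" "t \<in> T" "s \<lless> t" for x s t
 proof -
  have stL: "s \<in> topspace L" "t \<in> topspace L" "\<delta> \<lless> s" using st by (auto simp: T_def)
  obtain g p q where g: "p \<le> q" "continuous_map (top_of_set {p..q::real}) L g" "g p = s" "g q = t"
   "\<And>r. r \<in> {p..q} ==> g r = s \<or> s \<lless> g r" "\<And>c. c \<in> topspace L ==> s \<lless> c ==> c \<lless> t ==> \<exists>r\<in>{p<..<q}. g r = c"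
   "\<And>r. r \<in> {p<..<q} ==> s \<lless> g r \<and> g r \<lless> t" "inj_on g {p..q}"
   by (rule interval_path[OF stL(1,2) st(3)]) (rule that)
  have gT: "g r \<in> T" if r: "r \<in> {p..q}" for r
  proof -
   have "g r \<in> topspace L" using g(2) r unfolding continuous_map_def by auto
   thus ?thesis unfolding T_def using g(5)[OF r] stL(3) lt_trans by auto
  qed
  \<comment> \<open>It is enough to check the generating plaques: around each point the fibre
    interval from \<open>along\<close> is connected and lies in one slice, hence in the plaque of
    that point.\<close>
  have cont: "continuous_map (top_of_set {p..q}) ?LT (\<lambda>r. (x, g r))"
   unfolding leaf_topology_def
  proof (rule continuous_on_generated_topo)
   show "(\<lambda>r. (x, g r)) ` topspace (top_of_set {p..q}) \<subseteq> \<Union> ?P"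
   proof (rule image_subsetI)
   fix r assume "r \<in> topspace (top_of_set {p..q})"
   hence "(x, g r) \<in> ?W" using gT x by simp
   from exP[OF this] show "(x, g r) \<in> \<Union> ?P" by blast
   qed
   fix P assume P: "P \<in> ?P"
   obtain U \<phi> y where U: "(U, \<phi>) \<in> A" and C: "P \<in> connected_components_of (subtopology ?X {u \<in> U. snd (\<phi> u) = y})" using plaqueE[OF P] by blast
   have PU: "P \<subseteq> {u \<in> U. snd (\<phi> u) = y}" using connected_components_of_subset[OF C] by auto
   show "openin (top_of_set {p..q}) ((\<lambda>r. (x, g r)) -` P \<inter> topspace (top_of_set {p..q}))"
   proof (subst openin_subopen, intro ballI)
   fix r assume r: "r \<in> (\<lambda>r. (x, g r)) -` P \<inter> topspace (top_of_set {p..q})"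
   hence rP: "(x, g r) \<in> P" "r \<in> {p..q}" by auto
   hence rU: "(x, g r) \<in> U" "snd (\<phi> (x, g r)) = y" using PU by auto
   obtain a b where ab: "a \<in> topspace L" "b \<in> topspace L" "a \<lless> g r" "g r \<lless> b"
   "\<forall>c\<in>topspace L. a \<lless> c \<and> c \<lless> b --> (x, c) \<in> U \<and> snd (\<phi> (x, c)) = snd (\<phi> (x, g r))" using along[OF U rU(1)] by blast
   let ?J = "{c \<in> topspace L. a \<lless> c \<and> c \<lless> b}"
   have "continuous_map L ?X (\<lambda>c. (x, c))" using x by (simp add: continuous_map_pairwise o_def)
   from connectedin_continuous_map_image[OF this connectedin_interval[OF ab(1,2)]]
   have "connectedin (subtopology ?X {u \<in> U. snd (\<phi> u) = y}) ((\<lambda>c. (x, c)) ` ?J)"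
   unfolding connectedin_subtopology using ab(5) rU(2) by auto
   moreover have "(x, g r) \<in> (\<lambda>c. (x, c)) ` ?J" using ab(3,4) gT[OF rP(2)] TL by auto
   hence "\<not> disjnt P ((\<lambda>c. (x, c)) ` ?J)" using rP(1) unfolding disjnt_iff by blast
   ultimately have JP: "(\<lambda>c. (x, c)) ` ?J \<subseteq> P" by (rule connected_components_of_maximal[OF C])
   have "openin (top_of_set {p..q}) {r \<in> topspace (top_of_set {p..q}). g r \<in> ?J}"
   by (rule openin_continuous_map_preimage[OF g(2) openin_interval[OF ab(1,2)]])
   moreover have "r \<in> {r \<in> topspace (top_of_set {p..q}). g r \<in> ?J}" using rP(2) ab(3,4) gT[OF rP(2)] TL by auto
   ultimately show "\<exists>S. openin (top_of_set {p..q}) S \<and> r \<in> S \<and> S \<subseteq> (\<lambda>r. (x, g r)) -` P \<inter> topspace (top_of_set {p..q})"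
   using JP by (intro exI[of _ "{r \<in> topspace (top_of_set {p..q}). g r \<in> ?J}"]) blast
   qed
  qed
  have "continuous_map (top_of_set {0..1}) (top_of_set {p..q}) (\<lambda>r. (1 - r) * p + r * q)"
   using g(1) convexD_alt[OF convex_real_interval(5)[of p q], of p q] by (auto simp: continuous_map_in_subtopology intro!: continuous_intros)
  from continuous_map_compose[OF this cont]
  have "pathin ?LT (\<lambda>r. (x, g ((1 - r) * p + r * q)))" unfolding pathin_def by (simp add: o_def)
  thus ?thesis unfolding path_component_of_def
   by (rule exI[of _ "\<lambda>r. (x, g ((1 - r) * p + r * q))", OF conjI]) (simp add: g(3,4))
 qed
 have comp: "path_component_of_set ?LT (x, t) = {x} \<times> T" if x: "x \<in> topspace M" and t: "t \<in> T" for x t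
 proof (intro equalityI subsetI)
  fix q assume "q \<in> path_component_of_set ?LT (x, t)"
  then obtain g where g: "pathin ?LT g" "g 0 = (x, t)" "g 1 = q" unfolding path_component_of_def by blast
  have cases: "g ` {0..1} \<subseteq> {x} \<times> T \<or> disjnt (g ` {0..1}) ({x} \<times> T)"
   by (rule connectedin_clopen_cases[OF connectedin_path_image[OF g(1)] fc[OF x] fo[OF x]])
  have i: "g 0 \<in> g ` {0..1}" "g 1 \<in> g ` {0..1}" by auto
  have g0: "g 0 \<in> {x} \<times> T" using g(2) t by simp
  have "\<not> disjnt (g ` {0..1}) ({x} \<times> T)" by (rule notI, drule disjnt_iff[THEN iffD1, rule_format, of _ _ "g 0"]) (use i g0 in simp)
  hence "g ` {0..1} \<subseteq> {x} \<times> T" using cases by (elim disjE) simp_all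
  thus "q \<in> {x} \<times> T" using subsetD[OF _ i(2)] g(3) by blast
 next
  fix q assume q: "q \<in> {x} \<times> T"
  then obtain s where s: "s \<in> T" "q = (x, s)" by blast
  have "s = t \<or> s \<lless> t \<or> t \<lless> s" using lt_total[of s t] s(1) t TL by blast
  hence "path_component_of ?LT (x, t) (x, s)"
  proof (elim disjE)
   assume "s = t"
   thus ?thesis using x t tLT by (simp add: path_component_of_refl)
  next
   assume "s \<lless> t"
   from path[OF x s(1) t this] show ?thesis by (simp add: path_component_of_sym)
  next
   assume "t \<lless> s"
   from path[OF x t s(1) this] show ?thesis .
  qed
  thus "q \<in> path_component_of_set ?LT (x, t)" using s(2) by simp
 qed
 obtain t0 where "t0 \<in> topspace L" "\<delta> \<lless> t0" by (rule unbounded[OF \<delta>])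
 hence t0: "t0 \<in> T" by (simp add: T_def)
 show ?thesis unfolding leaves_def path_components_of_def tLT
 proof (intro equalityI subsetI)
  fix Q assume "Q \<in> path_component_of_set ?LT ` ?W"
  then obtain x t where xt: "x \<in> topspace M" "t \<in> T" "Q = path_component_of_set ?LT (x, t)" by blast
  thus "Q \<in> {{x} \<times> T |x. x \<in> topspace M}" using comp[OF xt(1,2)] by blast
 next
  fix Q assume "Q \<in> {{x} \<times> T |x. x \<in> topspace M}"
  then obtain x where x: "x \<in> topspace M" "Q = {x} \<times> T" by blast
  hence "Q = path_component_of_set ?LT (x, t0)" using comp[OF x(1) t0] by simp
  thus "Q \<in> path_component_of_set ?LT ` ?W" using x(1) t0 by blast
 qed
qed

end

lemma foliated_atlas_subset:
 assumes "foliated_atlas p n X A" "(U, \<phi>) \<in> A"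
 shows "U \<subseteq> topspace X"
 using UN_upper[OF assms(2), of fst] assms(1) by (simp add: foliated_atlas_def)

lemma foliated_atlas_cover:
 assumes "foliated_atlas p n X A" "q \<in> topspace X"
 obtains U \<phi> where "(U, \<phi>) \<in> A" "q \<in> U"
proof -
 have "q \<in> (\<Union>c\<in>A. fst c)" using assms by (simp add: foliated_atlas_def)
 then obtain c where "c \<in> A" "q \<in> fst c" by blast
 thus thesis using that[of "fst c" "snd c"] by simp
qed

theorem corollary6p3:
  fixes M :: "'a topology" and m :: nat
    and \<F> :: "('a \<times> (nat set \<times> real)) fchart set"
  assumes "closed_manifold m M"
    and "euler_characteristic M \<noteq> 0"
    and "foliation 1 (m + 1) (prod_topology M long_ray) \<F>"
  shows "\<exists>\<alpha> \<in> topspace long_ray.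
    leaves (subtopology (prod_topology M long_ray) (topspace M \<times> long_tail \<alpha>))
           (restrict_foliation \<F> (topspace M \<times> long_tail \<alpha>))
      = {{x} \<times> long_tail \<alpha> | x. x \<in> topspace M}"
proof -
 let ?X = "prod_topology M long_ray"
 interpret long_line long_ray "\<lambda>x y. (x, y) \<in> long_less" by (rule long_line_long_ray)
 obtain f :: "'a => nat => real" and d where f: "homeomorphic_map M (top_of_set (f ` topspace M)) f" "compact (f ` topspace M)"
  "f ` topspace M \<subseteq> coord_space d" "locally_euclidean_set m (f ` topspace M)" by (rule closed_manifold_embedding[OF assms(1)])
 define S where "S = f ` topspace M"
 obtain g where fg: "homeomorphic_maps M (top_of_set S) f g" using f(1) unfolding homeomorphic_map_maps S_def by blast
 have gf: "\<And>x. x \<in> topspace M ==> g (f x) = x" using fg unfolding homeomorphic_maps_def by blast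
 have at: "foliated_atlas 1 (m + 1) ?X \<F>" using assms(3) by (simp add: foliation_def)
 define B where "B = chart_boxes ?X \<F>"
 have B: "flow_structure ?X B" unfolding B_def by (rule flow_structure_chart_boxes[OF at])
 define h k where "h = (\<lambda>(x, t). (f x, t :: nat set \<times> real))" and "k = (\<lambda>(y, t). (g y, t :: nat set \<times> real))"
 let ?Y = "prod_topology (top_of_set S) long_ray"
 have hk: "homeomorphic_maps ?X ?Y h k"
  unfolding h_def k_def using homeomorphic_maps_prod[of M long_ray "top_of_set S" long_ray f "\<lambda>t. t" g "\<lambda>t. t"] fg
  by (auto simp: homeomorphic_maps_def)
 define B' where "B' = push_box h k ` B"
 have B': "flow_structure ?Y B'" unfolding B'_def by (rule flow_structure_push[OF hk B])
 have connS: "connected S"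
 proof -
  have "connected_space M" using assms(1) by (simp add: closed_manifold_def manifold_def)
  moreover have "M homeomorphic_space top_of_set S" using fg unfolding homeomorphic_space_def by blast
  ultimately have "connected_space (top_of_set S)" using homeomorphic_connected_space by blast
  hence "connectedin euclidean S" unfolding connectedin_def by simp
  thus ?thesis by simp
 qed
 have neS: "S \<noteq> {}" using assms(1) by (auto simp: S_def closed_manifold_def manifold_def)
 \<comment> \<open>If no plaque left the level \<open>\<mu>\<close>, the level would be a foliated
   copy of \<open>S\<close>; displacing along its plaques would force the Euler characteristic to be
   0.\<close>
 have cross: "\<exists>U u F q s. (U, u, F) \<in> B' \<and> q \<in> U \<and> s \<in> {0<..<1} \<and> snd q = \<mu> \<and> snd (F s q) \<noteq> \<mu>" if \<mu>: "\<mu> \<in> topspace long_ray" for \<mu>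
 proof (rule ccontr)
  assume "\<not> ?thesis"
  hence sat: "\<And>U u F q s. (U, u, F) \<in> B' ==> q \<in> U ==> s \<in> {0<..<1} ==> snd q = \<mu> ==> snd (F s q) = \<mu>" by blast
  have fl: "flow_structure (top_of_set S) ((\<lambda>(U, u, F). ({x \<in> topspace (top_of_set S). (x, \<mu>) \<in> U}, \<lambda>x. u (x, \<mu>), \<lambda>s x. fst (F s (x, \<mu>)))) ` B')"
   by (rule flow_structure_level[OF B' \<mu>]) (rule sat)
  have "euler_characteristic (top_of_set S) = 0"
   by (rule Lefschetz_two_valued_displacement[OF f(2-4)[folded S_def]])
   (rule flow_structure_displacement[OF f(2)[folded S_def] fl], assumption+)
  moreover have "euler_characteristic M = euler_characteristic (top_of_set S)"
   by (rule homeomorphic_space_euler_characteristic) (use fg in \<open>auto simp: homeomorphic_space_def\<close>)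
  ultimately show False using assms(2) by simp
 qed
 interpret lf: long_flow long_ray "\<lambda>x y. (x, y) \<in> long_less" S B'
  by unfold_locales (use f(2) connS neS B' cross in \<open>simp_all add: S_def\<close>)
 obtain \<delta> where \<delta>: "\<delta> \<in> topspace long_ray" "\<And>x t. x \<in> S ==> t \<in> topspace long_ray ==> (\<delta>, t) \<in> long_less ==> lf.vertical (x, t)"
  using lf.ultimately_vertical by blast
 let ?W = "topspace M \<times> long_tail \<delta>"
 have Wo: "openin ?X ?W" using open_above[OF \<delta>(1)] by (simp add: openin_prod_Times_iff long_tail_def)
 have XU: "x \<in> topspace M \<and> t \<in> topspace long_ray" if "(U, \<phi>) \<in> \<F>" "(x, t) \<in> U" for U \<phi> x t
  using subsetD[OF foliated_atlas_subset[OF at that(1)] that(2)] by simp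
 have boxat: "\<exists>V v G. (V, v, G) \<in> B \<and> (h ` V, v \<circ> k, \<lambda>s q. h (G s (k q))) \<in> B' \<and> p \<in> V \<and> V \<subseteq> U" if U: "(U, \<phi>) \<in> \<F>" "p \<in> U" for U \<phi> p
 proof -
  have "openin ?X U" using at U(1) by (force simp: foliated_atlas_def is_chart_def)
  then obtain V v G where V: "(V, v, G) \<in> B" "p \<in> V" "V \<subseteq> U" using B U(2) unfolding flow_structure_def by meson
  have "(h ` V, v \<circ> k, \<lambda>s q. h (G s (k q))) \<in> B'" using imageI[OF V(1), of "push_box h k"] unfolding B'_def push_box_def case_prod_conv .
  with V show ?thesis by (intro exI conjI)
 qed
 have kh: "k (h (x, t)) = (x, t)" if "x \<in> topspace M" for x t using gf[OF that] by (simp add: h_def k_def)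
 have BX: "(V, v, G) \<in> B ==> flow_box ?X (V, v, G)" for V v G using B by (simp add: flow_structure_def)
 have "leaves (subtopology ?X ?W) (restrict_foliation \<F> ?W) = {{x} \<times> long_tail \<delta> | x. x \<in> topspace M}"
  unfolding long_tail_def
 proof (rule leaves_of_vertical_charts[OF \<delta>(1)], unfold long_tail_def[symmetric])
  fix p assume p: "p \<in> ?W"
  hence "p \<in> topspace ?X" by (auto simp: long_tail_def)
  then obtain U \<phi> where U: "(U, \<phi>) \<in> \<F>" "p \<in> U" by (rule foliated_atlas_cover[OF at])
  have "(U \<inter> ?W, \<phi>) \<in> restrict_foliation \<F> ?W"
   using foliation_restrict_chart[OF assms(3) U(1) Wo] by (simp add: restrict_foliation_def)
  thus "\<exists>U \<phi>. (U, \<phi>) \<in> restrict_foliation \<F> ?W \<and> p \<in> U" using U(2) p by blast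
 next
  show "U \<subseteq> ?W" if "(U, \<phi>) \<in> restrict_foliation \<F> ?W" for U \<phi> using that by (simp add: restrict_foliation_def)
 next
  fix U \<phi> x t assume U0: "(U, \<phi>) \<in> restrict_foliation \<F> ?W" and xt: "(x, t) \<in> U"
  have U: "(U, \<phi>) \<in> \<F>" "U \<subseteq> ?W" using U0 by (auto simp: restrict_foliation_def)
  have x: "x \<in> topspace M" "t \<in> topspace long_ray" "(\<delta>, t) \<in> long_less" using xt U(2) by (auto simp: long_tail_def)
  obtain V v G where V: "(V, v, G) \<in> B" "(h ` V, v \<circ> k, \<lambda>s q. h (G s (k q))) \<in> B'" "(x, t) \<in> V" "V \<subseteq> U" using boxat[OF U(1) xt] by blast
  have vert: "lf.vertical (f x, t)" using \<delta>(2) x by (simp add: S_def)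
  have hV: "(f x, t) \<in> h ` V" using imageI[OF V(3), of h] by (simp add: h_def)
  obtain a b where ab: "a \<in> topspace long_ray" "b \<in> topspace long_ray" "(a, t) \<in> long_less" "(t, b) \<in> long_less"
   "\<And>c. c \<in> topspace long_ray ==> (a, c) \<in> long_less ==> (c, b) \<in> long_less ==>
   (f x, c) \<in> h ` V \<and> h (G ((v \<circ> k) (f x, c)) (k (f x, t))) = (f x, c)"
   by (rule lf.vertical_in_box[OF vert V(2) hV]) (rule that)
  show "\<exists>a\<in>topspace long_ray. \<exists>b\<in>topspace long_ray. (a, t) \<in> long_less \<and> (t, b) \<in> long_less \<and>
   (\<forall>c\<in>topspace long_ray. (a, c) \<in> long_less \<and> (c, b) \<in> long_less --> (x, c) \<in> U \<and> snd (\<phi> (x, c)) = snd (\<phi> (x, t)))"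
  proof (intro bexI[OF _ ab(1)] bexI[OF _ ab(2)] conjI ab(3,4) ballI impI; elim conjE)
   fix c assume c: "c \<in> topspace long_ray" "(a, c) \<in> long_less" "(c, b) \<in> long_less"
   obtain q where q: "q \<in> V" "h q = (f x, c)" using ab(5)[OF c] by (metis imageE)
   have "fst q \<in> topspace M" "snd q = c" "f (fst q) = f x" using q V(4) XU[OF U(1), of "fst q" "snd q"] by (auto simp: h_def case_prod_beta)
   hence "fst q = x" using gf x(1) by metis
   hence cV: "(x, c) \<in> V" using q(1) \<open>snd q = c\<close> by (metis prod.collapse)
   have k: "k (f x, c) = (x, c)" "k (f x, t) = (x, t)" using kh[OF x(1)] by (simp_all add: h_def)
   have GV: "G (v (x, c)) (x, t) \<in> V" using flow_boxD(4,6)[OF BX[OF V(1)]] cV V(3) by blast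
   have e: "h (G (v (x, c)) (x, t)) = h (x, c)" using ab(5)[OF c] k by (simp add: h_def)
   have "k (h (G (v (x, c)) (x, t))) = G (v (x, c)) (x, t)"
   using kh[of "fst (G (v (x, c)) (x, t))" "snd (G (v (x, c)) (x, t))"] XU[OF U(1), of "fst (G (v (x, c)) (x, t))" "snd (G (v (x, c)) (x, t))"] GV V(4) by auto
   hence "G (v (x, c)) (x, t) = (x, c)" using e kh[OF x(1)] by simp
   hence "snd (\<phi> (x, t)) = snd (\<phi> (x, c))"
   using chart_boxes_slice[OF at V(1)[unfolded B_def] U(1), of "(x, t)" "(x, c)"] cV V(3,4) by blast
   thus "(x, c) \<in> U" "snd (\<phi> (x, c)) = snd (\<phi> (x, t))" using cV V(4) by auto
  qed
 next
  fix U \<phi> p assume U0: "(U, \<phi>) \<in> restrict_foliation \<F> ?W" and pU: "p \<in> U"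
  obtain x t where p: "p = (x, t)" by (cases p)
  have U: "(U, \<phi>) \<in> \<F>" "U \<subseteq> ?W" using U0 by (auto simp: restrict_foliation_def)
  have x: "x \<in> topspace M" "t \<in> topspace long_ray" "(\<delta>, t) \<in> long_less" using pU U(2) p by (auto simp: long_tail_def)
  obtain V v G where V: "(V, v, G) \<in> B" "(h ` V, v \<circ> k, \<lambda>s q. h (G s (k q))) \<in> B'" "p \<in> V" "V \<subseteq> U" using boxat[OF U(1) pU] by blast
  note b = flow_boxD[OF BX[OF V(1)]]
  have vert: "lf.vertical (f x, t)" using \<delta>(2) x by (simp add: S_def)
  have hV: "(f x, t) \<in> h ` V" using imageI[OF V(3), of h] by (simp add: h_def p)
  have k: "k (f x, t) = p" using kh[OF x(1)] by (simp add: h_def p)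
  obtain e where e: "e > 0" "\<And>s. s \<in> {0<..<1} ==> \<bar>s - (v \<circ> k) (f x, t)\<bar> < e ==> fst (h (G s (k (f x, t)))) = f x"
   by (rule lf.vertical_plaque[OF vert V(2) hV]) (rule that)
  \<comment> \<open>Points of the box within \<open>e\<close> of \<open>p\<close> in the plaque
    coordinate. Among them, equal transverse coordinates mean a common plaque with \<open>p\<close>,
    and that part of the plaque lies in the fibre.\<close>
  define N where "N = {q \<in> V. v q \<in> {v p - e<..<v p + e}}"
  have tV: "topspace (subtopology ?X V) = V" using openin_subset[OF b(1)] by (simp only: topspace_subtopology Int_absorb1)
  have "openin (subtopology ?X V) {q \<in> topspace (subtopology ?X V). v q \<in> {v p - e<..<v p + e}}"
   by (rule openin_continuous_map_preimage[OF b(2)]) simp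
  hence "openin (subtopology ?X V) N" unfolding N_def tV .
  hence "openin ?X N" using b(1) openin_trans_full by blast
  moreover have "p \<in> N" using V(3) e(1) by (simp add: N_def)
  moreover have "fst q = fst p" if q: "q \<in> N \<inter> U" "snd (\<phi> q) = snd (\<phi> p)" for q
  proof -
   have qV: "q \<in> V" "\<bar>v q - v p\<bar> < e" using q(1) by (auto simp: N_def abs_if)
   have "G (v q) p = q" using chart_boxes_slice[OF at V(1)[unfolded B_def] U(1), of p q] q V(3,4) qV(1) by auto
   hence "fst (h q) = f x" using e(2)[OF b(4)[OF qV(1)]] qV(2) k by simp
   hence "f (fst q) = f x" by (simp add: h_def case_prod_beta)
   moreover have "fst q \<in> topspace M" using XU[OF U(1), of "fst q" "snd q"] q(1) by simp
   ultimately have "fst q = x" using gf x(1) by metis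
   thus ?thesis by (simp add: p)
  qed
  ultimately show "\<exists>N. openin ?X N \<and> p \<in> N \<and> (\<forall>q\<in>N \<inter> U. snd (\<phi> q) = snd (\<phi> p) --> fst q = fst p)" by blast
 qed
 thus ?thesis using \<delta>(1) by blast
qed

end
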